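(* If $\mathsf E_0[(u^k_1)^2]<\infty$ for every $1\le k\le K$, then $$\mathcal J[\tilde{\mathcal S}]-\mathcal J[\mathcal S]\le\frac{\theta}{\Theta(\Delta)}\,\log\gamma+K\,\Theta(\Delta),$$ where $\mathcal S$ and $\tilde{\mathcal S}$ are the centralized CUSUM and the D-CUSUM rules with thresholds $\nu,\tilde\nu$ chosen so that $\mathsf E_\infty[-u_{\mathcal S}]=\gamma=\mathsf E_\infty[-u_{\tilde{\mathcal S}}]$, $\theta=\max_{1\le k\le K}\theta^k$, and $\Theta(\Delta)$ denotes positive quantities, not depending on $\gamma$, of exact order $\Delta$ as $\Delta\to\infty$.
   Context: Setting. Time is discrete, $t\in\{0,1,2,\dots\}$. $\xi_t=(\xi^1_t,\dots,\xi^K_t)$ is a $K$-dimensional process with $\xi^k_0=0$; $\mathscr F^k_t=\sigma(\xi^k_s,0\le s\le t)$, $\mathscr F_t=\vee_k\mathscr F^k_t$. $\mathsf P_0,\mathsf P_\infty$ are locally equivalent probability measures under which $\xi^1,\dots,\xi^K$ are independent, $\mathsf P_i=\mathsf P_i^1\times\dots\times\mathsf P_i^K$. Put $u^k_t=\log\frac{d\mathsf P^k_0}{d\mathsf P^k_\infty}|_{\mathscr F^k_t}$, $u_t=\sum_{k=1}^Ku^k_t$, $u_0=0$. Under both measures each $\{u^k_t\}$ is a random walk (i.i.d. increments), and $u^k_1$ is unbounded and absolutely continuous with a positive density. $I^k_0=\mathsf E_0[u^k_1]$ and $I^k_\infty=-\mathsf E_\infty[u^k_1]$ are positive and finite. For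 $\tau\ge0$, $\mathsf P_\tau$ coincides with $\mathsf P_\infty$ on $\mathscr F_t$ for $t\le\tau$ and $\log\frac{d\mathsf P_\tau}{d\mathsf P_\infty}|_{\mathscr F_t}=u_t-u_\tau$ for $t\ge\tau$. For a stopping time $\mathcal T$, $$\mathcal J[\mathcal T]=\sup_{\tau\ge0}\operatorname{ess\,sup}\mathsf E_\tau[(u_{\mathcal T}-u_\tau)\mathbf 1_{\{\mathcal T>\tau\}}|\mathscr F_\tau].$$ Centralized CUSUM: $\mathcal S=\inf\{t\ge0:y_t\ge\nu\}$, $y_t=u_t-\inf_{0\le s<t}u_s$ ($y_0=0$). Communication scheme. Given thresholds $\overline{\Delta}^k,\underline{\Delta}^k>0$: $\tau^k_0=0$, $\tau^k_n=\inf\{t>\tau^k_{n-1}:u^k_t-u^k_{\tau^k_{n-1}}\notin(-\underline{\Delta}^k,\overline{\Delta}^k)\}$, $\ell^k_n=u^k_{\tau^k_n}-u^k_{\tau^k_{n-1}}$, $m^k_t=\max\{n:\tau^k_n\le t\}$. Let $d\ge1$ be an integer, $\overline\epsilon^k_0=\underline\epsilon^k_0=0$, $\overline\epsilon^k_d=\underline\epsilon^k_d=\infty$, and let $\overline\epsilon^k_j,\underline\epsilon^k_j>0$, $1\le j\le d-1$, be determined by $$\mathsf P_0(\ell^k_1-\overline{\Delta}^k\ge\overline\epsilon^k_j\,|\,\ell^k_1\ge\overline{\Delta}^k)=1-\tfrac jd=\mathsf P_\infty(\ell^k_1+\underline{\Delta}^k\le-\underline\epsilon^k_j\,|\,\ell^k_1\le-\underline{\Delta}^k).$$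 Put $\overline{\Delta}^k_j=\overline{\Delta}^k+\overline\epsilon^k_{j-1}$, $\underline{\Delta}^k_j=\underline{\Delta}^k+\underline\epsilon^k_{j-1}$ for $1\le j\le d$ and $\overline{\Delta}^k_{d+1}=\underline{\Delta}^k_{d+1}=\infty$. The message at $\tau^k_n$ is $z^k_n=j$ if $\overline{\Delta}^k_j\le\ell^k_n<\overline{\Delta}^k_{j+1}$ and $z^k_n=-j$ if $-\underline{\Delta}^k_{j+1}<\ell^k_n\le-\underline{\Delta}^k_j$, $j=1,\dots,d$. Let $$\overline\Lambda^k_j=\log\frac{\mathsf P_0(z^k_1=j)}{\mathsf P_\infty(z^k_1=j)},\quad-\underline\Lambda^k_j=\log\frac{\mathsf P_0(z^k_1=-j)}{\mathsf P_\infty(z^k_1=-j)},\quad\tilde\ell^k_n=\sum_{j=1}^d\big[\overline\Lambda^k_j\mathbf 1_{\{z^k_n=j\}}-\underline\Lambda^k_j\mathbf 1_{\{z^k_n=-j\}}\big].$$ D-CUSUM: $\tilde u^k_t=\sum_{n=1}^{m^k_t}\tilde\ell^k_n$, $\tilde u_t=\sum_{k=1}^K\tilde u^k_t$, $\tilde y_t=\tilde u_t-\inf_{0\le s\le t}\tilde u_s$, $\tilde{\mathcal S}=\inf\{t\ge0:\tilde y_t\ge\tilde\nu\}$. Quantization quantities. $\epsilon^k=\max_{1\le j\le d-1}\{\overline\epsilon^k_j-\overline\epsilon^k_{j-1},\ \underline\epsilon^k_j-\underline\epsilon^k_{j-1}\}$ (equal to $0$ if $d=1$) and $$\theta^k=\epsilon^k+\Theta(1)\,\mathsf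 E_0[(u^k_1)^2\mathbf 1_{\{u^k_1\ge\overline\epsilon^k_{d-1}\}}]+\Theta(1)\,\mathsf E_\infty[(u^k_1)^2\mathbf 1_{\{-u^k_1\ge\underline\epsilon^k_{d-1}\}}],$$ where each $\Theta(1)$ is a (suitable) positive term not depending on $d$ and bounded from above and below (away from $0$) as $\overline{\Delta}^k,\underline{\Delta}^k\to\infty$. Asymptotic conventions. There is a quantity $\Delta$ such that $\overline{\Delta}^k,\underline{\Delta}^k=\Theta(\Delta)$ as $\Delta,\overline{\Delta}^k,\underline{\Delta}^k\to\infty$ for all $1\le k\le K$. $x=\Theta(y)$ means that $x/y$ is bounded above and bounded away from $0$. In the term $K\,\Theta(\Delta)$ the dependence on the number of sensors is only through the factor $K$; the per-sensor quantities (the numbers $I_0^k,I_\infty^k$ and the second moments of $u^k_1$) are regarded as being of order $\Theta(1)$ uniformly in $k$.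
   Formalization: "Random walk" is taken relative to each sensor's own filtration: each increment of u^k is independent of F^k_t, not merely i.i.d. among themselves; otherwise F_τ may reveal future increments and both J values can be infinite, leaving the difference undefined. *)

theory Defs
  imports "HOL-Probability.Probability"
begin

section \<open>Filtrations, log-likelihood ratios and random walks\<close>

definition gen_filtration :: "'a set \<Rightarrow> (nat \<Rightarrow> 'a \<Rightarrow> real) \<Rightarrow> nat \<Rightarrow> 'a measure" where
  "gen_filtration \<Omega> X t = sigma \<Omega> {X s -` A \<inter> \<Omega> | s A. s \<le> t \<and> A \<in> sets borel}"

definition joint_filtration :: "'a set \<Rightarrow> nat \<Rightarrow> (nat \<Rightarrow> nat \<Rightarrow> 'a \<Rightarrow> real) \<Rightarrow> nat \<Rightarrow> 'a measure" where
  "joint_filtration \<Omega> K \<xi> t = sigma \<Omega> (\<Union>k\<in>{1..K}. sets (gen_filtration \<Omega> (\<xi> k) t))"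

text \<open>
  \<open>v\<close> is a version of \<open>log (dN/dM)\<close> on the sub-\<open>\<sigma>\<close>-algebra \<open>F\<close>.  Since \<open>v\<close> is real-valued, the
  density \<open>exp v\<close> is positive and finite, so this includes that \<open>M\<close> and \<open>N\<close> are equivalent on \<open>F\<close>.
\<close>
definition is_log_density :: "'a measure \<Rightarrow> 'a measure \<Rightarrow> 'a measure \<Rightarrow> ('a \<Rightarrow> real) \<Rightarrow> bool" where
  "is_log_density F M N v \<longleftrightarrow> v \<in> borel_measurable F \<and>
     restr_to_subalg N F = density (restr_to_subalg M F) (\<lambda>\<omega>. ennreal (exp (v \<omega>)))"

text \<open>
  Random walk relative to a filtration \<open>F\<close>: each increment is independent of the past \<open>F t\<close> (for an
  adapted \<open>X\<close>, this makes the increments independent), and the increments are identically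
  distributed.
\<close>
definition random_walk :: "'a measure \<Rightarrow> (nat \<Rightarrow> 'a measure) \<Rightarrow> (nat \<Rightarrow> 'a \<Rightarrow> real) \<Rightarrow> bool" where
  "random_walk M F X \<longleftrightarrow>
     (\<forall>t. prob_space.indep_set M (sets (F t))
            (sets (vimage_algebra (space M) (\<lambda>\<omega>. X (Suc t) \<omega> - X t \<omega>) borel)) \<and>
          distr M borel (\<lambda>\<omega>. X (Suc t) \<omega> - X t \<omega>) = distr M borel (\<lambda>\<omega>. X (Suc 0) \<omega> - X 0 \<omega>))"

section \<open>The change-point model\<close>

text \<open>
  \<open>P \<tau>\<close> is the measure with change-point \<open>\<tau>\<close>; \<open>P 0\<close> and \<open>P \<infinity>\<close> are the post- and pre-change
  measures.  The sensors are \<open>k \<in> {1..K}\<close>.  \<open>u k t\<close> is the log-likelihood ratio of sensor \<open>k\<close> on its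
  own \<open>\<sigma>\<close>-algebra, i.e. that of the marginals of the \<open>k\<close>-th coordinate process; the product
  structure of \<open>P 0\<close> and \<open>P \<infinity>\<close> is the independence of the coordinate processes, viewed as random
  elements of the sequence space.  A positive density on the whole line makes \<open>u k 1\<close> unbounded.
\<close>
locale sensor_system =
  fixes K :: nat and P :: "enat \<Rightarrow> 'a measure"
    and \<xi> :: "nat \<Rightarrow> nat \<Rightarrow> 'a \<Rightarrow> real" and u :: "nat \<Rightarrow> nat \<Rightarrow> 'a \<Rightarrow> real"
  assumes K_pos: "1 \<le> K"
    and prob_P: "\<And>\<tau>. prob_space (P \<tau>)"
    and sets_P: "\<And>\<tau>. sets (P \<tau>) = sets (P \<infinity>)"
    and meas_xi: "\<And>k t. k \<in> {1..K} \<Longrightarrow> \<xi> k t \<in> borel_measurable (P \<infinity>)"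
    and xi_0: "\<And>k \<omega>. k \<in> {1..K} \<Longrightarrow> \<omega> \<in> space (P \<infinity>) \<Longrightarrow> \<xi> k 0 \<omega> = 0"
    and indep_sensors: "\<And>i. i \<in> {0, \<infinity>} \<Longrightarrow>
          prob_space.indep_vars (P i) (\<lambda>_. PiM UNIV (\<lambda>_. borel)) (\<lambda>k \<omega> t. \<xi> k t \<omega>) {1..K}"
    and llr: "\<And>k t. k \<in> {1..K} \<Longrightarrow>
          is_log_density (gen_filtration (space (P \<infinity>)) (\<xi> k) t) (P \<infinity>) (P 0) (u k t)"
    and u_0: "\<And>k \<omega>. k \<in> {1..K} \<Longrightarrow> \<omega> \<in> space (P \<infinity>) \<Longrightarrow> u k 0 \<omega> = 0"
    and walk: "\<And>k i. k \<in> {1..K} \<Longrightarrow> i \<in> {0, \<infinity>} \<Longrightarrow>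
          random_walk (P i) (gen_filtration (space (P \<infinity>)) (\<xi> k)) (u k)"
    and pos_density: "\<And>k i. k \<in> {1..K} \<Longrightarrow> i \<in> {0, \<infinity>} \<Longrightarrow>
          \<exists>f. distributed (P i) lborel (u k 1) f \<and> (\<forall>x. 0 < f x)"
    and info_0: "\<And>k. k \<in> {1..K} \<Longrightarrow> integrable (P 0) (u k 1) \<and> 0 < (\<integral>\<omega>. u k 1 \<omega> \<partial>P 0)"
    and info_inf: "\<And>k. k \<in> {1..K} \<Longrightarrow> integrable (P \<infinity>) (u k 1) \<and> 0 < - (\<integral>\<omega>. u k 1 \<omega> \<partial>P \<infinity>)"
    and change_before: "\<And>\<tau> t A. t \<le> \<tau> \<Longrightarrow> A \<in> sets (joint_filtration (space (P \<infinity>)) K \<xi> t) \<Longrightarrow>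
          emeasure (P (enat \<tau>)) A = emeasure (P \<infinity>) A"
    and change_after: "\<And>\<tau> t. \<tau> \<le> t \<Longrightarrow>
          is_log_density (joint_filtration (space (P \<infinity>)) K \<xi> t) (P \<infinity>) (P (enat \<tau>))
            (\<lambda>\<omega>. (\<Sum>k=1..K. u k t \<omega>) - (\<Sum>k=1..K. u k \<tau> \<omega>))"

section \<open>Stopped paths and the performance measure\<close>

text \<open>
  Times are extended naturals.  A path stopped at time \<open>\<infinity>\<close> gets the value \<open>0\<close>; the detection rules
  and communication times below are almost surely finite under each \<open>P \<tau>\<close>, \<open>\<tau> < \<infinity>\<close>, and under
  \<open>P \<infinity>\<close>.
\<close>
definition stopped :: "(nat \<Rightarrow> real) \<Rightarrow> enat \<Rightarrow> real" where
  "stopped v T = (case T of enat t \<Rightarrow> v t | \<infinity> \<Rightarrow> 0)"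

definition sensor_sum :: "nat \<Rightarrow> (nat \<Rightarrow> nat \<Rightarrow> 'a \<Rightarrow> real) \<Rightarrow> 'a \<Rightarrow> nat \<Rightarrow> real" where
  "sensor_sum K u \<omega> t = (\<Sum>k=1..K. u k t \<omega>)"

definition detection_delay ::
  "nat \<Rightarrow> (enat \<Rightarrow> 'a measure) \<Rightarrow> (nat \<Rightarrow> nat \<Rightarrow> 'a \<Rightarrow> real) \<Rightarrow> (nat \<Rightarrow> nat \<Rightarrow> 'a \<Rightarrow> real) \<Rightarrow> ('a \<Rightarrow> enat) \<Rightarrow> ereal" where
  "detection_delay K P \<xi> u T =
     (SUP \<tau>::nat. esssup (P (enat \<tau>)) (\<lambda>\<omega>. ereal
        (real_cond_exp (P (enat \<tau>)) (joint_filtration (space (P \<infinity>)) K \<xi> \<tau>)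
           (\<lambda>\<omega>. (stopped (sensor_sum K u \<omega>) (T \<omega>) - sensor_sum K u \<omega> \<tau>) * of_bool (enat \<tau> < T \<omega>)) \<omega>)))"

section \<open>Centralized CUSUM\<close>

text \<open>An infimum over the empty set is \<open>\<infinity>\<close> in \<^typ>\<open>enat\<close>.\<close>
definition first_time :: "(nat \<Rightarrow> bool) \<Rightarrow> enat" where
  "first_time Q = Inf (enat ` Collect Q)"

definition cusum_stat :: "(nat \<Rightarrow> real) \<Rightarrow> nat \<Rightarrow> real" where
  "cusum_stat v t = (if t = 0 then 0 else v t - Min (v ` {..<t}))"

definition cusum :: "nat \<Rightarrow> (nat \<Rightarrow> nat \<Rightarrow> 'a \<Rightarrow> real) \<Rightarrow> real \<Rightarrow> 'a \<Rightarrow> enat" where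
  "cusum K u \<nu> \<omega> = first_time (\<lambda>t. \<nu> \<le> cusum_stat (sensor_sum K u \<omega>) t)"

section \<open>Communication scheme of one sensor\<close>

text \<open>
  \<open>v\<close> is the path of the sensor's log-likelihood ratio, \<open>lo\<close> and \<open>up\<close> its two thresholds.
\<close>
fun comm_time :: "real \<Rightarrow> real \<Rightarrow> (nat \<Rightarrow> real) \<Rightarrow> nat \<Rightarrow> enat" where
  "comm_time lo up v 0 = 0"
| "comm_time lo up v (Suc n) = first_time (\<lambda>t. comm_time lo up v n < enat t \<and>
     v t - stopped v (comm_time lo up v n) \<notin> {- lo<..<up})"

definition comm_incr :: "real \<Rightarrow> real \<Rightarrow> (nat \<Rightarrow> real) \<Rightarrow> nat \<Rightarrow> real" where
  "comm_incr lo up v n = stopped v (comm_time lo up v n) - stopped v (comm_time lo up v (n - 1))"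

definition num_comm :: "real \<Rightarrow> real \<Rightarrow> (nat \<Rightarrow> real) \<Rightarrow> nat \<Rightarrow> nat" where
  "num_comm lo up v t = Max {n. comm_time lo up v n \<le> enat t}"

text \<open>
  \<open>el j\<close> and \<open>eu j\<close>, \<open>0 \<le> j \<le> d\<close>, are the lower and upper quantization levels of the overshoot, for a
  sensor with log-likelihood ratio process \<open>v\<close> under \<open>P0\<close> (post-change) and \<open>Pinf\<close> (pre-change).
\<close>
definition quantile_levels ::
  "'a measure \<Rightarrow> 'a measure \<Rightarrow> (nat \<Rightarrow> 'a \<Rightarrow> real) \<Rightarrow> real \<Rightarrow> real \<Rightarrow> nat \<Rightarrow> (nat \<Rightarrow> ereal) \<Rightarrow> (nat \<Rightarrow> ereal) \<Rightarrow> bool" where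
  "quantile_levels P0 Pinf v lo up d el eu \<longleftrightarrow>
     el 0 = 0 \<and> eu 0 = 0 \<and> el d = \<infinity> \<and> eu d = \<infinity> \<and>
     (\<forall>j\<in>{1..<d}.
        0 < el j \<and> el j < \<infinity> \<and> 0 < eu j \<and> eu j < \<infinity> \<and>
        (let l = (\<lambda>\<omega>. comm_incr lo up (\<lambda>t. v t \<omega>) 1) in
           \<P>(\<omega> in P0. eu j \<le> ereal (l \<omega> - up) \<bar> up \<le> l \<omega>) = 1 - real j / real d \<and>
           \<P>(\<omega> in Pinf. ereal (l \<omega> + lo) \<le> - el j \<bar> l \<omega> \<le> - lo) = 1 - real j / real d))"

definition level :: "real \<Rightarrow> (nat \<Rightarrow> ereal) \<Rightarrow> nat \<Rightarrow> ereal" where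
  "level D e j = ereal D + e (j - 1)"

text \<open>
  For increasing levels at most one of the indicators is nonzero, so the value is the label in
  \<open>{1..d} \<union> {-d..-1}\<close> of the bin that contains \<open>x\<close>, and \<open>0\<close> if there is none (i.e. inside the
  thresholds).
\<close>
definition quantize :: "real \<Rightarrow> real \<Rightarrow> nat \<Rightarrow> (nat \<Rightarrow> ereal) \<Rightarrow> (nat \<Rightarrow> ereal) \<Rightarrow> real \<Rightarrow> int" where
  "quantize lo up d el eu x =
     (\<Sum>j=1..d. int j * of_bool (level up eu j \<le> ereal x \<and> ereal x < level up eu (j + 1)))
   - (\<Sum>j=1..d. int j * of_bool (- level lo el (j + 1) < ereal x \<and> ereal x \<le> - level lo el j))"

definition message ::
  "real \<Rightarrow> real \<Rightarrow> nat \<Rightarrow> (nat \<Rightarrow> ereal) \<Rightarrow> (nat \<Rightarrow> ereal) \<Rightarrow> (nat \<Rightarrow> real) \<Rightarrow> nat \<Rightarrow> int" where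
  "message lo up d el eu v n = quantize lo up d el eu (comm_incr lo up v n)"

text \<open>
  For \<open>j > 0\<close> the value at \<open>i = j\<close> is \<open>\<Lambda>\<close>-bar, and the value at \<open>i = -j\<close> is minus \<open>\<Lambda>\<close>-underbar.
\<close>
definition message_llr ::
  "'a measure \<Rightarrow> 'a measure \<Rightarrow> (nat \<Rightarrow> 'a \<Rightarrow> real) \<Rightarrow> real \<Rightarrow> real \<Rightarrow> nat \<Rightarrow> (nat \<Rightarrow> ereal) \<Rightarrow> (nat \<Rightarrow> ereal) \<Rightarrow> int \<Rightarrow> real" where
  "message_llr P0 Pinf v lo up d el eu i =
     ln (\<P>(\<omega> in P0. message lo up d el eu (\<lambda>t. v t \<omega>) 1 = i) /
         \<P>(\<omega> in Pinf. message lo up d el eu (\<lambda>t. v t \<omega>) 1 = i))"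

definition quantized_incr ::
  "'a measure \<Rightarrow> 'a measure \<Rightarrow> (nat \<Rightarrow> 'a \<Rightarrow> real) \<Rightarrow> real \<Rightarrow> real \<Rightarrow> nat \<Rightarrow> (nat \<Rightarrow> ereal) \<Rightarrow> (nat \<Rightarrow> ereal) \<Rightarrow> nat \<Rightarrow> 'a \<Rightarrow> real" where
  "quantized_incr P0 Pinf v lo up d el eu n \<omega> =
     (let z = message lo up d el eu (\<lambda>t. v t \<omega>) n; \<Lambda> = message_llr P0 Pinf v lo up d el eu in
      \<Sum>j=1..d. \<Lambda> (int j) * of_bool (z = int j) + \<Lambda> (- int j) * of_bool (z = - int j))"

definition quantized_llr ::
  "'a measure \<Rightarrow> 'a measure \<Rightarrow> (nat \<Rightarrow> 'a \<Rightarrow> real) \<Rightarrow> real \<Rightarrow> real \<Rightarrow> nat \<Rightarrow> (nat \<Rightarrow> ereal) \<Rightarrow> (nat \<Rightarrow> ereal) \<Rightarrow> nat \<Rightarrow> 'a \<Rightarrow> real" where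
  "quantized_llr P0 Pinf v lo up d el eu t \<omega> =
     (\<Sum>n=1..num_comm lo up (\<lambda>t. v t \<omega>) t. quantized_incr P0 Pinf v lo up d el eu n \<omega>)"

section \<open>D-CUSUM\<close>

definition dcusum_stat :: "(nat \<Rightarrow> real) \<Rightarrow> nat \<Rightarrow> real" where
  "dcusum_stat v t = v t - Min (v ` {..t})"

definition dcusum ::
  "nat \<Rightarrow> (enat \<Rightarrow> 'a measure) \<Rightarrow> (nat \<Rightarrow> nat \<Rightarrow> 'a \<Rightarrow> real) \<Rightarrow> (nat \<Rightarrow> real) \<Rightarrow> (nat \<Rightarrow> real) \<Rightarrow> nat \<Rightarrow>
   (nat \<Rightarrow> nat \<Rightarrow> ereal) \<Rightarrow> (nat \<Rightarrow> nat \<Rightarrow> ereal) \<Rightarrow> real \<Rightarrow> 'a \<Rightarrow> enat" where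
  "dcusum K P u lo up d el eu \<nu> \<omega> = first_time (\<lambda>t. \<nu> \<le> dcusum_stat
     (sensor_sum K (\<lambda>k. quantized_llr (P 0) (P \<infinity>) (u k) (lo k) (up k) d (el k) (eu k)) \<omega>) t)"

section \<open>Quantization error\<close>

definition max_gap :: "nat \<Rightarrow> (nat \<Rightarrow> ereal) \<Rightarrow> (nat \<Rightarrow> ereal) \<Rightarrow> ereal" where
  "max_gap d el eu =
     (if d = 1 then 0 else Max (\<Union>j\<in>{1..d-1}. {eu j - eu (j - 1), el j - el (j - 1)}))"

text \<open>
  The two truncated second moments are taken in \<open>[0,\<infinity>]\<close>: the one under \<open>Pinf\<close> need not be finite.
  \<open>\<alpha>\<close> and \<open>\<beta>\<close> are the two \<open>\<Theta>(1)\<close> factors.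
\<close>
definition quantization_error ::
  "'a measure \<Rightarrow> 'a measure \<Rightarrow> ('a \<Rightarrow> real) \<Rightarrow> real \<Rightarrow> real \<Rightarrow> nat \<Rightarrow> (nat \<Rightarrow> ereal) \<Rightarrow> (nat \<Rightarrow> ereal) \<Rightarrow> ereal" where
  "quantization_error P0 Pinf x \<alpha> \<beta> d el eu = max_gap d el eu
     + ereal \<alpha> * enn2ereal (\<integral>\<^sup>+\<omega>. ennreal ((x \<omega>)\<^sup>2) * of_bool (eu (d - 1) \<le> ereal (x \<omega>)) \<partial>P0)
     + ereal \<beta> * enn2ereal (\<integral>\<^sup>+\<omega>. ennreal ((x \<omega>)\<^sup>2) * of_bool (el (d - 1) \<le> ereal (- x \<omega>)) \<partial>Pinf)"

section \<open>Exact order\<close>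

text \<open>
  \<open>f = \<Theta>(g)\<close> as the argument tends to \<open>\<infinity>\<close>, for positive \<open>f\<close> and \<open>g\<close>, with explicit implied
  constants \<open>m\<close> and \<open>M\<close>, so that these can be required to be uniform.
\<close>
definition exact_order :: "real \<Rightarrow> real \<Rightarrow> (real \<Rightarrow> real) \<Rightarrow> (real \<Rightarrow> real) \<Rightarrow> bool" where
  "exact_order m M f g \<longleftrightarrow> (\<forall>\<^sub>F x in at_top. m * g x \<le> f x \<and> f x \<le> M * g x)"

end

theory Submission
  imports Defs
begin

text \<open>
 Every bound is a statement about a random walk that is killed when it leaves a set.  Under the
 post-change measure the increments have the exponentially tilted pre-change law.  For such a walk,
 expected occupation times (\<open>green\<close>) and functionals of the exit position (\<open>exit_mean\<close>) are bounded
 by exhibiting a supersolution of the one-step equation (\<open>green_le\<close>, \<open>exit_mean_le\<close>).  Between two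
 messages the log-likelihood ratio of a sensor is a walk killed at the exit from \<open>(- lo, up)\<close>; the
 phases of all sensors together form a Markov chain, and the messages are functions of the exit
 positions.  The implied constants come out uniform because they depend on the laws of the increments
 only through bounds of their means and second moments.

 \<^bold>\<open>Threshold.\<close>  The exponential of the quantized log-likelihood ratio of a message is the likelihood
 ratio of its label.  Sum the likelihood ratios of the message streams over all starting times, each
 multiplied by the conditional mean \<open>h\<close> of the ratios of the messages in progress.  The mean of this
 sum grows by at most \<open>exp (O(K De))\<close> per step, and it is at least \<open>exp (nu' - O(K De))\<close> at an alarm.
 Hence early alarms are unlikely, and \<open>nu' <= ln gam + O(K De)\<close> (\<open>alarm_probability_le\<close>,
 \<open>dcusum_threshold_le\<close>).

 \<^bold>\<open>Delay of D-CUSUM.\<close>  The delay is the information number times the mean running time after the change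
 (Wald), which splits into three parts.  Until each sensor has sent a message, \<open>O(De)\<close> steps pass.  From
 then on, as long as the procedure runs, the log-likelihood ratio stays below \<open>nu' + O(K De)\<close> plus the
 accumulated losses of the messages (\<open>path_loss\<close>).  The time to reach \<open>nu' + O(K De)\<close> is given by
 Lorden's overshoot bound.  The time beyond it is paid for by the losses alone: a message loses on
 average \<open>O(\<theta>)\<close> and takes on average at least a multiple of \<open>De\<close> steps, so the losses amount to
 \<open>O(\<theta> / De)\<close> per step (\<open>acc_loss_mean_le\<close>, \<open>delay_sum_le\<close>).

 \<^bold>\<open>Centralized CUSUM.\<close>  Its delay is at least \<open>nu - O(1)\<close>, by a change at time zero
 (\<open>cusum_delay_ge\<close>), and \<open>ln gam <= nu + O(1)\<close>, because a walk that starts afresh at its minimum reaches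
 \<open>nu\<close> first with a probability of order \<open>exp (- nu)\<close> (\<open>cusum_threshold_ge\<close>).  The \<open>O(1)\<close> terms depend on
 the system and are absorbed by \<open>K De\<close> for large \<open>De\<close>; the two occurrences of \<open>ln gam\<close> cancel.
\<close>

section \<open>Killed random walks on the line\<close>

lemma ennreal_suminf_swap: "(\<Sum>i. \<Sum>j. f i j :: ennreal) = (\<Sum>j. \<Sum>i. f i j)"
proof -
 have "(\<Sum>j. \<Sum>i. f i j) = (\<Sum>j. nn_integral (count_space UNIV) (%i. f i j))"
  by (simp add: nn_integral_count_space_nat)
 also have "... = nn_integral (count_space UNIV) (%i. (\<Sum>j. f i j))"
  by (rule nn_integral_suminf[symmetric]) auto
 finally show ?thesis by (simp add: nn_integral_count_space_nat)
qed

definition kill :: "real measure => real set => (real => ennreal) => real => ennreal" where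
 "kill mu S f v = nn_integral mu (%x. indicator S (v + x) * f (v + x))"

definition green :: "real measure => real set => (real => ennreal) => real => ennreal" where
 "green mu S f v = (\<Sum>n. (kill mu S ^^ n) f v)"

definition exit_mean :: "real measure => real set => (real => ennreal) => real => ennreal" where
 "exit_mean mu S g = green mu S (kill mu (- S) g)"

locale real_law = prob_space mu for mu :: "real measure" +
 assumes sets_law [measurable_cong, simp]: "sets mu = sets borel"
begin

lemma space_law [simp]: "space mu = UNIV"
 using sets_eq_imp_space_eq[OF sets_law] by simp

lemma kill_measurable [measurable]:
 assumes [measurable]: "S : sets borel" "f : borel_measurable borel"
 shows "kill mu S f : borel_measurable borel"
proof -
 have "(%v. nn_integral mu (%x. indicator S (v + x) * f (v + x))) : borel_measurable borel"
  by (rule borel_measurable_nn_integral) measurable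
 then show ?thesis by (simp add: kill_def[abs_def])
qed

lemma kill_pow_measurable [measurable]:
 assumes [measurable]: "S : sets borel" "f : borel_measurable borel"
 shows "(kill mu S ^^ n) f : borel_measurable borel"
 by (induction n) (simp_all add: assms)

lemma green_measurable [measurable]:
 assumes [measurable]: "S : sets borel" "f : borel_measurable borel"
 shows "green mu S f : borel_measurable borel"
 unfolding green_def[abs_def] by measurable

lemma exit_mean_measurable [measurable]:
 assumes [measurable]: "S : sets borel" "g : borel_measurable borel"
 shows "exit_mean mu S g : borel_measurable borel"
 unfolding exit_mean_def by measurable

lemma kill_mono: "(!!w. w : S ==> f w <= g w) ==> kill mu S f v <= kill mu S g v"
 unfolding kill_def by (intro nn_integral_mono) (auto simp: indicator_def)

lemma kill_cong: "(!!w. w : S ==> f w = g w) ==> kill mu S f v = kill mu S g v"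
 by (intro antisym kill_mono) auto

lemma kill_pow_mono:
 assumes "!!w. w : D ==> f w <= g w" "S <= D" "v : D"
 shows "(kill mu S ^^ n) f v <= (kill mu S ^^ n) g v"
 using assms by (induction n arbitrary: v) (auto intro!: kill_mono)

lemma kill_add:
 assumes [measurable]: "S : sets borel" "f : borel_measurable borel" "g : borel_measurable borel"
 shows "kill mu S (%w. f w + g w) v = kill mu S f v + kill mu S g v"
 unfolding kill_def by (subst nn_integral_add[symmetric]) (auto simp: distrib_left)

lemma kill_cmult:
 assumes [measurable]: "S : sets borel" "f : borel_measurable borel"
 shows "kill mu S (%w. c * f w) v = c * kill mu S f v"
 unfolding kill_def by (subst nn_integral_cmult[symmetric]) (auto simp: ac_simps)

lemma kill_sum:
 assumes [measurable]: "S : sets borel" "!!i. f i : borel_measurable borel"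
 shows "kill mu S (%w. \<Sum>i\<in>I. f i w) v = (\<Sum>i\<in>I. kill mu S (f i) v)"
 unfolding kill_def by (subst nn_integral_sum[symmetric]) (auto simp: sum_distrib_left)

lemma kill_suminf:
 assumes [measurable]: "S : sets borel" "!!i. f i : borel_measurable borel"
 shows "kill mu S (%w. \<Sum>i. f i w) v = (\<Sum>i. kill mu S (f i) v)"
 unfolding kill_def by (subst nn_integral_suminf[symmetric]) (auto simp: ennreal_suminf_cmult)

lemma kill_pow_add:
 assumes [measurable]: "S : sets borel" "f : borel_measurable borel" "g : borel_measurable borel"
 shows "(kill mu S ^^ n) (%w. f w + g w) v = (kill mu S ^^ n) f v + (kill mu S ^^ n) g v"
proof (induction n arbitrary: v)
 case (Suc n)
 then have "(kill mu S ^^ n) (%w. f w + g w) = (%w. (kill mu S ^^ n) f w + (kill mu S ^^ n) g w)"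
  by (intro ext)
 then show ?case by (simp add: kill_add)
qed simp

lemma kill_pow_cmult:
 assumes [measurable]: "S : sets borel" "f : borel_measurable borel"
 shows "(kill mu S ^^ n) (%w. c * f w) v = c * (kill mu S ^^ n) f v"
proof (induction n arbitrary: v)
 case (Suc n)
 then have "(kill mu S ^^ n) (%w. c * f w) = (%w. c * (kill mu S ^^ n) f w)"
  by (intro ext)
 then show ?case by (simp add: kill_cmult)
qed simp

lemma kill_pow_suminf:
 assumes [measurable]: "S : sets borel" "!!i. f i : borel_measurable borel"
 shows "(kill mu S ^^ n) (%w. \<Sum>i. f i w) v = (\<Sum>i. (kill mu S ^^ n) (f i) v)"
proof (induction n arbitrary: v)
 case (Suc n)
 then have "(kill mu S ^^ n) (%w. \<Sum>i. f i w) = (%w. \<Sum>i. (kill mu S ^^ n) (f i) w)"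
  by (intro ext)
 then show ?case by (simp add: kill_suminf)
qed simp

lemma green_unfold:
 assumes [measurable]: "S : sets borel" "f : borel_measurable borel"
 shows "green mu S f v = f v + kill mu S (green mu S f) v"
proof -
 have "green mu S f v = (kill mu S ^^ 0) f v + (\<Sum>n. (kill mu S ^^ (Suc n)) f v)"
  unfolding green_def by (subst suminf_offset[where i=1]) (auto intro!: summableI)
 also have "(\<Sum>n. (kill mu S ^^ (Suc n)) f v) = kill mu S (green mu S f) v"
  unfolding green_def[abs_def] by (subst kill_suminf) simp_all
 finally show ?thesis by simp
qed

lemma green_mono:
 assumes "!!w. w : D ==> f w <= g w" "S <= D" "v : D"
 shows "green mu S f v <= green mu S g v"
 unfolding green_def
 by (intro suminf_le summableI kill_pow_mono[where D=D] assms)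

lemma green_cmult:
 assumes [measurable]: "S : sets borel" "f : borel_measurable borel"
 shows "green mu S (%w. c * f w) v = c * green mu S f v"
 unfolding green_def by (simp add: kill_pow_cmult)

lemma green_add:
 assumes [measurable]: "S : sets borel" "f : borel_measurable borel" "g : borel_measurable borel"
 shows "green mu S (%w. f w + g w) v = green mu S f v + green mu S g v"
 unfolding green_def by (simp add: kill_pow_add suminf_add summableI)

lemma green_suminf:
 assumes [measurable]: "S : sets borel" "!!i. f i : borel_measurable borel"
 shows "green mu S (%w. \<Sum>i. f i w) v = (\<Sum>i. green mu S (f i) v)"
 unfolding green_def by (simp add: kill_pow_suminf) (rule ennreal_suminf_swap)

lemma green_partial_Suc:
 assumes [measurable]: "S : sets borel" "f : borel_measurable borel"
 shows "(SUM i<Suc n. (kill mu S ^^ i) f v) = f v + kill mu S (%w. SUM i<n. (kill mu S ^^ i) f w) v"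
 by (subst sum.lessThan_Suc_shift, subst kill_sum) simp_all

text \<open>A supersolution dominates every partial sum of the series, by induction on its length.\<close>

lemma green_le:
 assumes [measurable]: "S : sets borel" "f : borel_measurable borel"
 assumes super: "!!v. v : D ==> f v + kill mu S W v <= W v" and "S <= D" "v : D"
 shows "green mu S f v <= W v"
proof -
 have "(SUM i<n. (kill mu S ^^ i) f v) <= W v" for n
  using \<open>v : D\<close>
 proof (induction n arbitrary: v)
  case (Suc n)
  have "(SUM i<Suc n. (kill mu S ^^ i) f v) = f v + kill mu S (%w. SUM i<n. (kill mu S ^^ i) f w) v"
   by (rule green_partial_Suc) fact+
  also have "... <= f v + kill mu S W v"
   using Suc.IH \<open>S <= D\<close> by (intro add_left_mono kill_mono) auto
  also have "... <= W v" using super Suc.prems by auto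
  finally show ?case .
 qed simp
 then show ?thesis unfolding green_def by (intro suminf_le_const summableI) auto
qed

text \<open>
 A bounded subsolution is dominated because the mass that survives \<open>n\<close> steps vanishes.
\<close>

lemma le_green:
 assumes [measurable]: "S : sets borel" "f : borel_measurable borel" "W : borel_measurable borel"
 assumes sub: "!!v. v : D ==> W v <= f v + kill mu S W v" and "S <= D" "v : D"
  and bnd: "!!v. v : D ==> W v <= ennreal c"
  and lim: "(%n. (kill mu S ^^ n) (%_. 1) v) \<longlonglongrightarrow> 0"
 shows "W v <= green mu S f v"
proof -
 have part: "W v <= (SUM i<n. (kill mu S ^^ i) f v) + (kill mu S ^^ n) W v" for n
  using \<open>v : D\<close>
 proof (induction n arbitrary: v)
  case (Suc n)
  have "W v <= f v + kill mu S W v" using sub Suc.prems by auto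
  also have "... <= f v + kill mu S (%w. (SUM i<n. (kill mu S ^^ i) f w) + (kill mu S ^^ n) W w) v"
   using Suc.IH \<open>S <= D\<close> by (intro add_left_mono kill_mono) auto
  also have "... = (SUM i<Suc n. (kill mu S ^^ i) f v) + (kill mu S ^^ Suc n) W v"
   by (subst kill_add) (simp_all only: green_partial_Suc assms, simp_all add: add.assoc assms)
  finally show ?case .
 qed simp
 have "W v <= green mu S f v + ennreal c * (kill mu S ^^ n) (%_. 1) v" for n
 proof -
  have "(kill mu S ^^ n) W v <= (kill mu S ^^ n) (%w. ennreal c * 1) v"
   by (rule kill_pow_mono[where D=D]) (use bnd \<open>S <= D\<close> \<open>v : D\<close> in auto)
  also have "... = ennreal c * (kill mu S ^^ n) (%_. 1) v"
   by (rule kill_pow_cmult) auto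
  finally have *: "(kill mu S ^^ n) W v <= ennreal c * (kill mu S ^^ n) (%_. 1) v" .
  have "(SUM i<n. (kill mu S ^^ i) f v) <= green mu S f v"
   unfolding green_def by (rule sum_le_suminf) (auto intro: summableI)
  then show ?thesis using part[of n] * by (meson add_mono order_trans)
 qed
 moreover have "(%n. green mu S f v + ennreal c * (kill mu S ^^ n) (%_. 1) v) \<longlonglongrightarrow> green mu S f v + ennreal c * 0"
  by (intro tendsto_add tendsto_const ennreal_tendsto_cmult lim) simp
 ultimately show ?thesis
  by (intro LIMSEQ_le_const) auto
qed

lemma exit_mean_unfold:
 assumes [measurable]: "S : sets borel" "g : borel_measurable borel"
 shows "exit_mean mu S g v = kill mu (- S) g v + kill mu S (exit_mean mu S g) v"
 unfolding exit_mean_def by (rule green_unfold) auto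

text \<open>The exit mean is the Green function of the rate at which mass leaves the set.\<close>

lemma exit_mean_le:
 assumes [measurable]: "S : sets borel" "g : borel_measurable borel"
 assumes "!!v. v : D ==> kill mu (- S) g v + kill mu S W v <= W v" and "S <= D" "v : D"
 shows "exit_mean mu S g v <= W v"
 unfolding exit_mean_def using assms by (intro green_le[where D=D]) auto

lemma exit_mean_mono:
 assumes "!!w. w \<notin> S ==> g w <= g' w"
 shows "exit_mean mu S g v <= exit_mean mu S g' v"
 unfolding exit_mean_def using assms by (intro green_mono[where D=UNIV] kill_mono) auto

lemma exit_mean_cong:
 assumes "!!w. w \<notin> S ==> g w = g' w"
 shows "exit_mean mu S g v = exit_mean mu S g' v"
 using assms by (intro antisym exit_mean_mono) auto

lemma exit_mean_add:
 assumes [measurable]: "S : sets borel" "f : borel_measurable borel" "g : borel_measurable borel"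
 shows "exit_mean mu S (%w. f w + g w) v = exit_mean mu S f v + exit_mean mu S g v"
proof -
 have "kill mu (- S) (%w. f w + g w) = (%v. kill mu (- S) f v + kill mu (- S) g v)"
  by (rule ext, rule kill_add) auto
 then show ?thesis unfolding exit_mean_def by (simp add: green_add)
qed

lemma exit_mean_cmult:
 assumes [measurable]: "S : sets borel" "f : borel_measurable borel"
 shows "exit_mean mu S (%w. c * f w) v = c * exit_mean mu S f v"
proof -
 have "kill mu (- S) (%w. c * f w) = (%v. c * kill mu (- S) f v)"
  by (rule ext, rule kill_cmult) auto
 then show ?thesis unfolding exit_mean_def by (simp add: green_cmult)
qed

lemma exit_mean_suminf:
 assumes [measurable]: "S : sets borel" "!!i. f i : borel_measurable borel"
 shows "exit_mean mu S (%w. \<Sum>i. f i w) v = (\<Sum>i. exit_mean mu S (f i) v)"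
proof -
 have "kill mu (- S) (%w. \<Sum>i. f i w) = (%v. \<Sum>i. kill mu (- S) (f i) v)"
  by (rule ext, rule kill_suminf) auto
 then show ?thesis unfolding exit_mean_def by (simp add: green_suminf)
qed

lemma exit_mean_sum:
 assumes [measurable]: "S : sets borel" "!!i. f i : borel_measurable borel" and "finite I"
 shows "exit_mean mu S (%w. \<Sum>i\<in>I. f i w) v = (\<Sum>i\<in>I. exit_mean mu S (f i) v)"
 using \<open>finite I\<close>
proof induction
 case empty
 show ?case using exit_mean_cmult[of S "%_. 0" 0 v] by simp
next
 case (insert i I)
 then show ?case by (simp add: exit_mean_add)
qed

lemma kill_pow_exit_mean_le:
 assumes [measurable]: "S : sets borel" "g : borel_measurable borel"
 shows "(kill mu S ^^ r) (exit_mean mu S g) v <= exit_mean mu S g v"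
proof (induction r arbitrary: v)
 case (Suc r)
 have "(kill mu S ^^ Suc r) (exit_mean mu S g) v <= kill mu S (exit_mean mu S g) v"
  using Suc.IH by (auto intro!: kill_mono)
 also have "... <= exit_mean mu S g v"
  using exit_mean_unfold[OF assms, of v] by (simp add: add_increasing)
 finally show ?case .
qed simp

lemma kill_compl:
 assumes [measurable]: "S : sets borel" "f : borel_measurable borel" "g : borel_measurable borel"
 shows "kill mu (- S) g v + kill mu S f v = nn_integral mu (%x. (if v + x : S then f (v + x) else g (v + x)))"
 unfolding kill_def
 by (subst nn_integral_add[symmetric]) (auto intro!: nn_integral_cong simp: indicator_def)

lemma kill_compl_one:
 assumes [measurable]: "S : sets borel"
 shows "kill mu (- S) (%_. 1) v + kill mu S (%_. 1) v = 1"
 by (subst kill_compl) (auto simp: emeasure_space_1[simplified])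

lemma kill_pow_one_le: "(kill mu S ^^ n) (%_. 1) v <= 1"
proof (induction n arbitrary: v)
 case (Suc n)
 have "(kill mu S ^^ Suc n) (%_. 1) v <= kill mu S (%_. 1) v"
  using Suc.IH by (auto intro!: kill_mono)
 also have "... <= nn_integral mu (%x. 1)" unfolding kill_def
  by (intro nn_integral_mono) (auto simp: indicator_def)
 finally show ?case by (simp add: emeasure_space_1[simplified])
qed simp

lemma exit_mean_one_le:
 assumes [measurable]: "S : sets borel"
 shows "exit_mean mu S (%_. 1) v <= 1"
 by (rule exit_mean_le[where D=UNIV and W="%_. 1"]) (auto simp: kill_compl_one)

lemma exit_mean_one:
 assumes [measurable]: "S : sets borel"
  and lim: "(%n. (kill mu S ^^ n) (%_. 1) v) \<longlonglongrightarrow> 0"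
 shows "exit_mean mu S (%_. 1) v = 1"
proof (rule antisym[OF exit_mean_one_le])
 have "(%_. 1) v <= green mu S (kill mu (- S) (%_. 1)) v"
  by (rule le_green[where D=UNIV and c=1]) (auto simp: kill_compl_one lim)
 then show "1 <= exit_mean mu S (%_. 1) v" by (simp add: exit_mean_def)
qed fact

text \<open>
 An exponential function is contracted by the step as soon as the Laplace transform is below one;
 all geometric tails come from this.
\<close>

lemma kill_exp_le:
 assumes [measurable]: "S : sets borel" and m: "nn_integral mu (%x. ennreal (exp (- lam * x))) <= ennreal \<rho>"
  and "0 <= \<rho>"
 shows "kill mu S (%w. ennreal (exp (lam * (b - w)))) v <= ennreal (\<rho> * exp (lam * (b - v)))"
proof -
 have "kill mu S (%w. ennreal (exp (lam * (b - w)))) v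
    <= nn_integral mu (%x. ennreal (exp (lam * (b - v))) * ennreal (exp (- lam * x)))"
  unfolding kill_def
  by (intro nn_integral_mono)
    (auto simp: indicator_def ennreal_mult[symmetric] exp_add[symmetric] algebra_simps)
 also have "... = ennreal (exp (lam * (b - v))) * nn_integral mu (%x. ennreal (exp (- lam * x)))"
  by (rule nn_integral_cmult) auto
 also have "... <= ennreal (exp (lam * (b - v))) * ennreal \<rho>"
  by (intro mult_left_mono m) auto
 finally show ?thesis using \<open>0 <= \<rho>\<close> by (simp add: ennreal_mult[symmetric] mult.commute)
qed

lemma kill_pow_one_exp_le:
 assumes [measurable]: "S : sets borel" and m: "nn_integral mu (%x. ennreal (exp (- lam * x))) <= ennreal \<rho>"
  and "0 <= \<rho>" and S: "!!w. w : S ==> 0 <= lam * (b - w)" and v: "0 <= lam * (b - v)"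
 shows "(kill mu S ^^ n) (%_. 1) v <= ennreal (exp (lam * (b - v)) * \<rho> ^ n)"
 using v
proof (induction n arbitrary: v)
 case 0
 then show ?case by simp
next
 case (Suc n)
 have "(kill mu S ^^ Suc n) (%_. 1) v <= kill mu S (%w. ennreal (\<rho> ^ n) * ennreal (exp (lam * (b - w)))) v"
  using Suc.IH S \<open>0 <= \<rho>\<close> by (auto intro!: kill_mono simp: ennreal_mult mult.commute)
 also have "... = ennreal (\<rho> ^ n) * kill mu S (%w. ennreal (exp (lam * (b - w)))) v"
  by (rule kill_cmult) auto
 also have "... <= ennreal (\<rho> ^ n) * ennreal (\<rho> * exp (lam * (b - v)))"
  by (intro mult_left_mono kill_exp_le m \<open>0 <= \<rho>\<close>) auto
 also have "... = ennreal (exp (lam * (b - v)) * \<rho> ^ Suc n)"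
  using \<open>0 <= \<rho>\<close> by (simp add: ennreal_mult[symmetric] ac_simps)
 finally show ?case .
qed

lemma kill_pow_one_tendsto_0:
 assumes [measurable]: "S : sets borel" and m: "nn_integral mu (%x. ennreal (exp (- lam * x))) <= ennreal \<rho>"
  and "0 <= \<rho>" "\<rho> < 1" and S: "!!w. w : S ==> 0 <= lam * (b - w)" and v: "0 <= lam * (b - v)"
 shows "(%n. (kill mu S ^^ n) (%_. 1) v) \<longlonglongrightarrow> 0"
proof (rule tendsto_sandwich[OF _ _ tendsto_const])
 show "\<forall>\<^sub>F n in sequentially. (kill mu S ^^ n) (%_. 1) v <= ennreal (exp (lam * (b - v)) * \<rho> ^ n)"
  by (intro always_eventually allI kill_pow_one_exp_le assms)
 have "(%n. exp (lam * (b - v)) * \<rho> ^ n) \<longlonglongrightarrow> exp (lam * (b - v)) * 0"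
  using assms by (intro tendsto_mult tendsto_const LIMSEQ_realpow_zero)
 then show "(%n. ennreal (exp (lam * (b - v)) * \<rho> ^ n)) \<longlonglongrightarrow> 0"
  by (metis ennreal_0 mult_zero_right tendsto_ennrealI)
qed auto

end

subsection \<open>Exponential tilting\<close>

text \<open>
 The law of a log-likelihood increment after the change, in terms of its law before the change.
\<close>

definition tilt :: "real measure => real measure" where
 "tilt mu = density mu (%x. ennreal (exp x))"

lemma sets_tilt [measurable_cong, simp]: "sets (tilt mu) = sets mu"
 by (simp add: tilt_def)

lemma (in real_law) nn_integral_tilt:
 assumes [measurable]: "f : borel_measurable borel"
 shows "nn_integral (tilt mu) (%x. f x) = nn_integral mu (%x. ennreal (exp x) * f x)"
 unfolding tilt_def by (rule nn_integral_density) auto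

lemma (in real_law) kill_tilt:
 assumes [measurable]: "S : sets borel" "f : borel_measurable borel"
 shows "kill (tilt mu) S f v = ennreal (exp (- v)) * kill mu S (%w. ennreal (exp w) * f w) v"
proof -
 have "ennreal (exp (- v)) * kill mu S (%w. ennreal (exp w) * f w) v
   = nn_integral mu (%x. ennreal (exp (-v)) * (indicator S (v + x) * (ennreal (exp (v + x)) * f (v + x))))"
  unfolding kill_def by (rule nn_integral_cmult[symmetric]) auto
 also have "... = nn_integral mu (%x. ennreal (exp x) * (indicator S (v + x) * f (v + x)))"
  by (intro nn_integral_cong)
    (auto simp: indicator_def mult.assoc[symmetric] ennreal_mult[symmetric] exp_add[symmetric])
 also have "... = kill (tilt mu) S f v"
  unfolding kill_def by (subst nn_integral_tilt) auto
 finally show ?thesis by simp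
qed

lemma (in real_law) kill_pow_tilt:
 assumes [measurable]: "S : sets borel" "f : borel_measurable borel" and "real_law (tilt mu)"
 shows "(kill (tilt mu) S ^^ n) f v = ennreal (exp (- v)) * (kill mu S ^^ n) (%w. ennreal (exp w) * f w) v"
proof (induction n arbitrary: v)
 case 0
 then show ?case by (simp add: mult.assoc[symmetric] ennreal_mult[symmetric] exp_minus)
next
 case (Suc n)
 interpret t: real_law "tilt mu" by fact
 have [measurable]: "(kill (tilt mu) S ^^ n) f : borel_measurable borel" by simp
 show ?case
  apply (simp add: kill_tilt)
  apply (intro arg_cong2[where f="(*)"] refl kill_cong)
  apply (simp add: Suc.IH mult.assoc[symmetric] ennreal_mult[symmetric] exp_minus)
  done
qed

text \<open>Stopped at the exit, the likelihood ratio is the exponential of the displacement.\<close>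

lemma (in real_law) exit_mean_tilt:
 assumes [measurable]: "S : sets borel" "g : borel_measurable borel" and "real_law (tilt mu)"
 shows "exit_mean (tilt mu) S g v = ennreal (exp (- v)) * exit_mean mu S (%w. ennreal (exp w) * g w) v"
proof -
 interpret t: real_law "tilt mu" by fact
 have "exit_mean (tilt mu) S g v
   = (\<Sum>n. ennreal (exp (- v)) * (kill mu S ^^ n) (%w. ennreal (exp w) * kill (tilt mu) (- S) g w) v)"
  unfolding exit_mean_def green_def by (simp add: kill_pow_tilt[OF _ _ assms(3)])
 also have "(%w. ennreal (exp w) * kill (tilt mu) (- S) g w) = kill mu (- S) (%w. ennreal (exp w) * g w)"
  by (rule ext) (simp add: kill_tilt mult.assoc[symmetric] ennreal_mult[symmetric] exp_minus)
 finally show ?thesis by (simp add: exit_mean_def green_def)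
qed

section \<open>Overshoot and exit probabilities of a walk with positive drift\<close>

lemma exp_upper_quadratic:
 fixes y :: real assumes "0 <= y"
 shows "exp (- y) <= 1 - y + y^2 / 2"
proof -
 have "(%y. 1 - y + y^2 / 2 - exp (- y)) 0 <= (%y. 1 - y + y^2 / 2 - exp (- y)) y"
 proof (rule DERIV_nonneg_imp_nondecreasing[OF \<open>0 <= y\<close>])
  fix x :: real assume "0 <= x"
  have "((%y. 1 - y + y^2 / 2 - exp (- y)) has_real_derivative (- 1 + x + exp (- x))) (at x)"
   by (auto intro!: derivative_eq_intros)
  moreover have "0 <= - 1 + x + exp (- x)" using exp_ge_add_one_self[of "- x"] by simp
  ultimately show "EX y. ((%y. 1 - y + y^2 / 2 - exp (- y)) has_real_derivative y) (at x) & 0 <= y" by blast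
 qed
 then show ?thesis by simp
qed

lemma square_le_8_exp_half: "0 <= s ==> s^2 <= 8 * exp (s / 2)" for s :: real
 using exp_lower_Taylor_quadratic[of "s/2"] by (simp add: power2_eq_square field_simps)

lemma exp_tilt_quadratic:
 fixes lam x :: real assumes "0 <= lam" "lam <= 1/2"
 shows "exp (- lam * x) <= 1 - lam * x + lam^2 / 2 * (x^2 + 8 * exp (- x))"
proof (cases "0 <= x")
 case True
 have "exp (- (lam * x)) <= 1 - lam * x + (lam * x)^2 / 2"
  by (rule exp_upper_quadratic) (use True assms in auto)
 also have "... <= 1 - lam * x + lam^2 / 2 * (x^2 + 8 * exp (- x))"
  by (simp add: power_mult_distrib algebra_simps)
 finally show ?thesis by simp
next
 case False
 define s where "s = - x"
 have s: "0 < s" "x = - s" using False by (auto simp: s_def)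
 obtain t where t: "\<bar>t\<bar> <= \<bar>lam * s\<bar>" "exp (lam * s) = (SUM m<2. (lam * s) ^ m / fact m) + exp t / fact 2 * (lam * s)^2"
  using Maclaurin_exp_le[of "lam * s" 2] by blast
 have "lam * s <= s / 2" using assms s mult_right_mono[of lam "1/2" s] by simp
 moreover have "0 <= lam * s" using assms s by simp
 ultimately have "t <= s / 2" using t(1) by linarith
 then have "exp t * s^2 <= exp (s / 2) * (8 * exp (s / 2))"
  using square_le_8_exp_half[of s] s by (intro mult_mono) auto
 also have "... = 8 * exp s" using exp_add[of "s/2" "s/2"] by simp
 finally have *: "exp t * s^2 <= 8 * exp s" .
 have "exp (lam * s) = 1 + lam * s + lam^2 / 2 * (exp t * s^2)"
  using t(2) by (simp add: eval_nat_numeral algebra_simps)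
 also have "... <= 1 + lam * s + lam^2 / 2 * (s^2 + 8 * exp s)"
  using * by (intro add_left_mono mult_left_mono) (auto intro: order_trans)
 finally show ?thesis using s by simp
qed

text \<open>
 A second-order expansion of the Laplace transform: a lower bound of the mean and an upper bound of
 the second moment give a geometric rate that does not depend on the law otherwise.
\<close>

lemma (in real_law) laplace_le:
 fixes a b lam :: real
 assumes mgf: "nn_integral mu (%x. ennreal (exp (- x))) <= 1"
  and int: "integrable mu (%x. x)" "integrable mu (%x. x^2)"
  and mean: "a <= (\<integral>x. x \<partial>mu)" and sq: "(\<integral>x. x^2 \<partial>mu) <= b"
  and lam: "0 <= lam" "lam <= 1/2" "lam * (b + 8) <= a"
 shows "nn_integral mu (%x. ennreal (exp (- lam * x))) <= ennreal (1 - lam * a / 2)"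
proof -
 have i1: "integrable mu (%x. exp (- x))"
  using mgf by (intro integrableI_nonneg) (auto simp: le_less_trans[OF _ ennreal_one_less_top])
 have m1: "(\<integral>x. exp (- x) \<partial>mu) <= 1"
  using mgf by (subst (asm) nn_integral_eq_integral[OF i1]) auto
 have iR: "integrable mu (%x. 1 - lam * x + lam^2 / 2 * (x^2 + 8 * exp (- x)))"
  using int i1 by simp
 have "nn_integral mu (%x. ennreal (exp (- lam * x))) <= nn_integral mu (%x. ennreal (1 - lam * x + lam^2 / 2 * (x^2 + 8 * exp (- x))))"
  by (intro nn_integral_mono ennreal_leI exp_tilt_quadratic lam)
 also have "... = ennreal (\<integral>x. 1 - lam * x + lam^2 / 2 * (x^2 + 8 * exp (- x)) \<partial>mu)"
  by (intro nn_integral_eq_integral iR AE_I2 order_trans[OF _ exp_tilt_quadratic]) (use lam in auto)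
 also have "(\<integral>x. 1 - lam * x + lam^2 / 2 * (x^2 + 8 * exp (- x)) \<partial>mu)
   = 1 - lam * (\<integral>x. x \<partial>mu) + lam^2 / 2 * ((\<integral>x. x^2 \<partial>mu) + 8 * (\<integral>x. exp (- x) \<partial>mu))"
  using int i1 by (simp add: prob_space[simplified])
 also have "... <= 1 - lam * a + lam^2 / 2 * (b + 8 * 1)"
  using mean sq m1 lam by (intro add_mono diff_mono mult_left_mono) auto
 also have "lam^2 / 2 * (b + 8 * 1) <= lam * a / 2"
  using mult_left_mono[OF lam(3,1)] by (simp add: power2_eq_square)
 finally show ?thesis by (simp add: ennreal_leI algebra_simps)
qed

text \<open>
 The mean time in a unit window has a bound that is uniform in the position of the window; cutting
 the line into such windows turns moments of the overshoot into moments of one increment.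
\<close>

lemma (in real_law) green_window_le:
 assumes [measurable]: "S : sets borel"
  and m: "nn_integral mu (%x. ennreal (exp (- lam * x))) <= ennreal \<rho>" and r: "0 <= \<rho>" "\<rho> < 1" and "0 <= lam"
 shows "green mu S (indicator {y..y+1}) v <= ennreal (exp lam / (1 - \<rho>))"
proof -
 define C where "C = exp lam / (1 - \<rho>)"
 have C: "0 < C" "C * (1 - \<rho>) = exp lam" using r by (auto simp: C_def)
 define W where "W = (%v. ennreal (C * min 1 (exp (lam * (y - v)))))"
 have W1: "kill mu S W w <= ennreal (C * 1)" for w
 proof -
  have "kill mu S W w <= nn_integral mu (%x. ennreal C)"
   unfolding kill_def W_def using C
   by (intro nn_integral_mono) (auto simp: indicator_def intro!: ennreal_leI)
  then show ?thesis by (simp add: emeasure_space_1[simplified])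
 qed
 have W2: "kill mu S W w <= ennreal (C * (\<rho> * exp (lam * (y - w))))" for w
 proof -
  have "kill mu S W w <= kill mu S (%w. ennreal C * ennreal (exp (lam * (y - w)))) w"
   unfolding W_def using C by (intro kill_mono) (auto simp: ennreal_mult[symmetric] intro!: ennreal_leI)
  also have "... = ennreal C * kill mu S (%w. ennreal (exp (lam * (y - w)))) w"
   by (rule kill_cmult) auto
  also have "... <= ennreal C * ennreal (\<rho> * exp (lam * (y - w)))"
   by (intro mult_left_mono kill_exp_le m r) auto
  finally show ?thesis using C r by (simp add: ennreal_mult)
 qed
 have "green mu S (indicator {y..y+1}) v <= W v"
 proof (rule green_le[where D=UNIV])
  fix w :: real
  consider "w < y" | "y <= w" "w <= y + 1" | "y + 1 < w" by linarith
  then show "indicator {y..y+1} w + kill mu S W w <= W w"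
  proof cases
   case 1
   then have "1 <= exp (lam * (y - w))" using \<open>0 <= lam\<close> by auto
   then show ?thesis using 1 W1[of w] by (simp add: W_def)
  next
   case 2
   then have "exp (lam * (y - w)) <= 1" using \<open>0 <= lam\<close> by (simp add: mult_nonneg_nonpos)
   moreover have "1 <= exp lam * exp (lam * (y - w))"
    using 2 mult_left_mono[of w "y + 1" lam] \<open>0 <= lam\<close> by (simp add: exp_add[symmetric] algebra_simps)
   then have "1 + C * (\<rho> * exp (lam * (y - w))) <= C * exp (lam * (y - w))"
    using C(2) by (simp add: algebra_simps) (metis C(2) distrib_left mult.assoc mult.commute right_diff_distrib diff_add_cancel add.commute le_diff_eq)
   then have "ennreal 1 + ennreal (C * (\<rho> * exp (lam * (y - w)))) <= ennreal (C * exp (lam * (y - w)))"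
    using C r ennreal_plus[of 1 "C * (\<rho> * exp (lam * (y - w)))"] ennreal_leI by fastforce
   ultimately have "1 + ennreal (C * (\<rho> * exp (lam * (y - w)))) <= W w"
    by (simp add: W_def min_absorb2)
   with add_left_mono[OF W2[of w], of 1] have "1 + kill mu S W w <= W w" by (rule order_trans)
   then show ?thesis using 2 by (simp add: indicator_def)
  next
   case 3
   then have "exp (lam * (y - w)) <= 1" using \<open>0 <= lam\<close> by (simp add: mult_nonneg_nonpos)
   moreover have "C * (\<rho> * exp (lam * (y - w))) <= C * exp (lam * (y - w))"
    using C r by (intro mult_left_mono) (auto simp: mult_le_cancel_right1)
   ultimately have "ennreal (C * (\<rho> * exp (lam * (y - w)))) <= W w"
    by (simp add: W_def min_absorb2 ennreal_leI)
   with W2[of w] show ?thesis using 3 by (simp add: indicator_def)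
  qed
 qed auto
 also have "... <= ennreal C" using C by (auto simp: W_def intro!: ennreal_leI)
 finally show ?thesis by (simp add: C_def)
qed

lemma (in real_law) green_antitone_le:
 fixes e :: "real => ennreal"
 assumes [measurable]: "S : sets borel" "e : borel_measurable borel"
  and m: "nn_integral mu (%x. ennreal (exp (- lam * x))) <= ennreal \<rho>" and r: "0 <= \<rho>" "\<rho> < 1" and "0 <= lam"
  and e: "!!s t. 0 <= s ==> s <= t ==> e t <= e s"
  and S: "S <= {..<b}" and v: "v < b"
 shows "green mu S (%w. e (b - w)) v <= ennreal (exp lam / (1 - \<rho>)) * (\<Sum>j. e (real j))"
proof -
 have "green mu S (%w. e (b - w)) v <= green mu S (%w. \<Sum>j. e (real j) * indicator {b - real j - 1..b - real j - 1 + 1} w) v"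
 proof (rule green_mono[where D="{..<b}"])
  fix w assume "w : {..<b}"
  define j where "j = nat \<lfloor>b - w\<rfloor>"
  have j: "real j <= b - w" "b - w < real j + 1" using \<open>w : {..<b}\<close> by (auto simp: j_def)
  have "e (b - w) <= e (real j)" using j by (intro e) auto
  also have "... = (\<Sum>i\<in>{j}. e (real i) * indicator {b - real i - 1..b - real i - 1 + 1} w)"
   using j by (simp add: indicator_def)
  also have "... <= (\<Sum>i. e (real i) * indicator {b - real i - 1..b - real i - 1 + 1} w)"
   by (intro sum_le_suminf summableI) auto
  finally show "e (b - w) <= (\<Sum>i. e (real i) * indicator {b - real i - 1..b - real i - 1 + 1} w)" .
 qed (use S v in auto)
 also have "... = (\<Sum>j. e (real j) * green mu S (indicator {b - real j - 1..b - real j - 1 + 1}) v)"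
  by (subst green_suminf) (auto simp: green_cmult)
 also have "... <= (\<Sum>j. e (real j) * ennreal (exp lam / (1 - \<rho>)))"
  by (intro suminf_le mult_left_mono green_window_le[OF _ m] r \<open>0 <= lam\<close> summableI) auto
 finally show ?thesis by (simp add: ennreal_suminf_multc mult.commute)
qed

lemma suminf_pos_part_le:
 fixes y :: real shows "(\<Sum>j. ennreal (y - real j)) <= ennreal (if 0 <= y then y^2 + y else 0)"
proof (cases "0 <= y")
 case False
 then have "ennreal (y - real j) = 0" for j by (intro ennreal_neg) auto
 then show ?thesis by simp
next
 case True
 have "(SUM j<n. ennreal (y - real j)) <= ennreal (y^2 + y)" for n
 proof -
  have "(SUM j<n. ennreal (y - real j)) = (SUM j<n. ennreal (max 0 (y - real j)))"
   by (intro sum.cong) (auto simp: max_def ennreal_neg)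
  also have "... = ennreal (SUM j<n. max 0 (y - real j))"
   by (intro sum_ennreal) auto
  also have "(SUM j<n. max 0 (y - real j)) <= (SUM j<n. if real j <= y then y else 0)"
   using True by (intro sum_mono) auto
  also have "... <= (SUM j<=nat \<lfloor>y\<rfloor>. y)"
  proof -
   have "(SUM j<n. if real j <= y then y else 0) = (\<Sum>j\<in>{j. j < n & real j <= y}. y)"
    by (rule sum.mono_neutral_cong_right) auto
   also have "... <= (SUM j<=nat \<lfloor>y\<rfloor>. y)"
    by (intro sum_mono2) (use True in \<open>auto simp: le_nat_floor\<close>)
   finally show ?thesis .
  qed
  also have "... <= y^2 + y"
   using True by (simp add: power2_eq_square algebra_simps mult_left_mono)
  finally show ?thesis by (simp add: ennreal_leI)
 qed
 then show ?thesis using True by (auto intro!: suminf_le_const summableI)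
qed

text \<open>
 A walk jumps over the boundary from some unit window below it, and it visits each of these windows
 for a bounded mean time.
\<close>

lemma (in real_law) exit_overshoot_le:
 fixes eps :: real
 assumes [measurable]: "S : sets borel"
  and m: "nn_integral mu (%x. ennreal (exp (- lam * x))) <= ennreal \<rho>" and r: "0 <= \<rho>" "\<rho> < 1" and "0 <= lam"
  and S: "S <= {..<b}" and v: "v < b" and eps: "0 <= eps"
 shows "exit_mean mu S (%w. ennreal (w - b - eps)) v
  <= ennreal (exp lam / (1 - \<rho>)) * nn_integral mu (%x. ennreal (x^2 + x) * indicator {eps..} x)"
proof -
 define e where "e = (%s. nn_integral mu (%x. ennreal (x - eps - s)))"
 have [measurable]: "e : borel_measurable borel" unfolding e_def by (rule borel_measurable_nn_integral) measurable
 have "exit_mean mu S (%w. ennreal (w - b - eps)) v <= green mu S (%w. e (b - w)) v"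
  unfolding exit_mean_def e_def
  by (intro green_mono[where D=UNIV])
    (auto simp: kill_def indicator_def algebra_simps intro!: nn_integral_mono)
 also have "... <= ennreal (exp lam / (1 - \<rho>)) * (\<Sum>j. e (real j))"
 proof (rule green_antitone_le[OF _ _ m r \<open>0 <= lam\<close> _ S v])
  show "e t <= e s" if "0 <= s" "s <= t" for s t
   unfolding e_def using that by (intro nn_integral_mono ennreal_leI) auto
 qed auto
 also have "(\<Sum>j. e (real j)) = nn_integral mu (%x. (\<Sum>j. ennreal (x - eps - real j)))"
  unfolding e_def by (subst nn_integral_suminf) auto
 also have "... <= nn_integral mu (%x. ennreal (x^2 + x) * indicator {eps..} x)"
 proof (rule nn_integral_mono)
  fix x
  have "(\<Sum>j. ennreal (x - eps - real j)) <= ennreal (if 0 <= x - eps then (x - eps)^2 + (x - eps) else 0)"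
   by (rule suminf_pos_part_le)
  also have "... <= ennreal (x^2 + x) * indicator {eps..} x"
   using eps by (auto simp: indicator_def intro!: ennreal_leI add_mono power_mono)
  finally show "(\<Sum>j. ennreal (x - eps - real j)) <= ennreal (x^2 + x) * indicator {eps..} x" .
 qed
 finally show ?thesis by (simp add: mult_left_mono)
qed

lemma (in real_law) truncated_mean_le:
 assumes int: "integrable mu (%x. x)" and mean: "a <= (\<integral>x. x \<partial>mu)" "0 < a" and eps: "0 <= eps"
 shows "nn_integral mu (%x. ennreal x * indicator {eps..} x)
   <= ennreal (4 / a) * nn_integral mu (%x. ennreal (x^2) * indicator {eps..} x)"
proof (cases "eps <= a / 2")
 case False
 have "nn_integral mu (%x. ennreal x * indicator {eps..} x) <= nn_integral mu (%x. ennreal (4 / a) * (ennreal (x^2) * indicator {eps..} x))"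
 proof (rule nn_integral_mono)
  fix x
  show "ennreal x * indicator {eps..} x <= ennreal (4 / a) * (ennreal (x^2) * indicator {eps..} x)"
  proof (cases "eps <= x")
   case True
   then have x: "a / 2 <= x" "0 < x" using False \<open>0 < a\<close> by auto
   then have "x * a <= 4 * x^2" using mult_left_mono[OF x(1), of x] by (simp add: power2_eq_square)
   then show ?thesis using True \<open>0 < a\<close> by (auto simp: ennreal_mult[symmetric] field_simps intro!: ennreal_leI)
  qed simp
 qed
 then show ?thesis by (simp add: nn_integral_cmult)
next
 case True
 define B where "B = nn_integral mu (%x. ennreal x * indicator {a/2..} x)"
 have "ennreal a <= ennreal (\<integral>x. max 0 x \<partial>mu)"
  using int by (intro ennreal_leI order_trans[OF mean(1)] integral_mono) auto
 also have "... = nn_integral mu (%x. ennreal (max 0 x))"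
  using int by (intro nn_integral_eq_integral[symmetric]) auto
 also have "... <= nn_integral mu (%x. ennreal (a / 2) + ennreal x * indicator {a/2..} x)"
  using \<open>0 < a\<close> by (intro nn_integral_mono)
   (auto simp: indicator_def max_def ennreal_neg intro!: ennreal_leI add_increasing)
 also have "... = ennreal (a / 2) + B"
  unfolding B_def by (subst nn_integral_add) (auto simp: emeasure_space_1[simplified])
 finally have B: "ennreal (a / 2) <= B"
 proof -
  assume *: "ennreal a <= ennreal (a / 2) + B"
  have "ennreal a = ennreal (a / 2) + ennreal (a / 2)" using \<open>0 < a\<close> by (subst ennreal_plus[symmetric]) auto
  then show ?thesis using * by (simp add: ennreal_add_left_cancel_le)
 qed
 have "nn_integral mu (%x. ennreal x * indicator {eps..} x) <= nn_integral mu (%x. ennreal (a / 2) + ennreal x * indicator {a/2..} x)"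
  using \<open>0 < a\<close> by (intro nn_integral_mono)
   (auto simp: indicator_def intro!: ennreal_leI add_increasing)
 also have "... = ennreal (a / 2) + B"
  unfolding B_def by (subst nn_integral_add) (auto simp: emeasure_space_1[simplified])
 also have "... <= 2 * B" using B by (simp add: mult_2 add_right_mono)
 also have "B <= ennreal (2 / a) * nn_integral mu (%x. ennreal (x^2) * indicator {eps..} x)"
 proof -
  have "B <= nn_integral mu (%x. ennreal (2 / a) * (ennreal (x^2) * indicator {eps..} x))"
   unfolding B_def
  proof (rule nn_integral_mono)
   fix x
   show "ennreal x * indicator {a/2..} x <= ennreal (2 / a) * (ennreal (x^2) * indicator {eps..} x)"
   proof (cases "a / 2 <= x")
    case x: True
    then have "x * a <= 2 * x^2" using mult_left_mono[OF x, of x] \<open>0 < a\<close> by (simp add: power2_eq_square)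
    then show ?thesis using x True \<open>0 < a\<close> by (auto simp: ennreal_mult[symmetric] field_simps intro!: ennreal_leI)
   qed simp
  qed
  then show ?thesis by (simp add: nn_integral_cmult)
 qed
 also have "2 * (ennreal (2 / a) * nn_integral mu (%x. ennreal (x^2) * indicator {eps..} x))
   = ennreal (4 / a) * nn_integral mu (%x. ennreal (x^2) * indicator {eps..} x)"
  using \<open>0 < a\<close> by (simp add: mult.assoc[symmetric] ennreal_mult[symmetric] ennreal_numeral[symmetric] del: ennreal_numeral)
 finally show ?thesis by (simp add: mult_left_mono)
qed

lemma (in real_law) exit_overshoot_second_moment:
 fixes eps :: real
 assumes [measurable]: "S : sets borel"
  and m: "nn_integral mu (%x. ennreal (exp (- lam * x))) <= ennreal \<rho>" and r: "0 <= \<rho>" "\<rho> < 1" and "0 <= lam"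
  and int: "integrable mu (%x. x)" and mean: "a <= (\<integral>x. x \<partial>mu)" "0 < a"
  and S: "S <= {..<b}" and v: "v < b" and eps: "0 <= eps"
 shows "exit_mean mu S (%w. ennreal (w - b - eps)) v
  <= ennreal (exp lam / (1 - \<rho>) * (1 + 4 / a)) * nn_integral mu (%x. ennreal (x^2) * indicator {eps..} x)"
proof -
 have "nn_integral mu (%x. ennreal (x^2 + x) * indicator {eps..} x)
   = nn_integral mu (%x. ennreal (x^2) * indicator {eps..} x + ennreal x * indicator {eps..} x)"
  using eps by (intro nn_integral_cong) (auto simp: indicator_def)
 also have "... = nn_integral mu (%x. ennreal (x^2) * indicator {eps..} x) + nn_integral mu (%x. ennreal x * indicator {eps..} x)"
  by (intro nn_integral_add) auto
 also have "... <= (1 + ennreal (4 / a)) * nn_integral mu (%x. ennreal (x^2) * indicator {eps..} x)"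
  using truncated_mean_le[OF int mean eps] by (simp add: distrib_right add_left_mono)
 also have "1 + ennreal (4 / a) = ennreal (1 + 4 / a)" using \<open>0 < a\<close> by simp
 finally have "nn_integral mu (%x. ennreal (x^2 + x) * indicator {eps..} x) <= ... * nn_integral mu (%x. ennreal (x^2) * indicator {eps..} x)" .
 then have "exit_mean mu S (%w. ennreal (w - b - eps)) v
   <= ennreal (exp lam / (1 - \<rho>)) * (ennreal (1 + 4 / a) * nn_integral mu (%x. ennreal (x^2) * indicator {eps..} x))"
  by (intro order_trans[OF exit_overshoot_le[OF _ m r \<open>0 <= lam\<close> S v eps]] mult_left_mono) auto
 moreover have "ennreal (exp lam / (1 - \<rho>) * (1 + 4 / a)) = ennreal (exp lam / (1 - \<rho>)) * ennreal (1 + 4 / a)"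
  using r \<open>0 < a\<close> by (intro ennreal_mult) auto
 ultimately show ?thesis by (simp add: mult.assoc)
qed

lemma suminf_le_geometric_tail:
 fixes f :: "nat => ennreal"
 assumes "!!n. f n <= 1" and t: "!!n. f (n + n0) <= ennreal (c * \<rho> ^ n)" and "0 <= \<rho>" "\<rho> < 1" "0 <= c"
 shows "(\<Sum>n. f n) <= ennreal (real n0 + c / (1 - \<rho>))"
proof -
 have "(\<Sum>n. f n) = (\<Sum>n. f (n + n0)) + (SUM n<n0. f n)"
  by (rule suminf_offset) (rule summableI)
 also have "... <= (\<Sum>n. ennreal (c * \<rho> ^ n)) + (SUM n<n0. 1)"
  by (intro add_mono suminf_le summableI sum_mono t assms)
 also have "(\<Sum>n. ennreal (c * \<rho> ^ n)) = ennreal (c * (1 / (1 - \<rho>)))"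
  using assms by (intro suminf_ennreal_eq sums_mult geometric_sums) auto
 finally show ?thesis using assms by (simp add: ennreal_plus ennreal_of_nat_eq_real_of_nat add.commute)
qed

lemma (in real_law) ennreal_integral_le:
 assumes "integrable mu f" shows "ennreal (\<integral>x. f x \<partial>mu) <= nn_integral mu (%x. ennreal (f x))"
proof -
 have "ennreal (\<integral>x. f x \<partial>mu) <= ennreal (\<integral>x. max 0 (f x) \<partial>mu)"
  using assms by (intro ennreal_leI integral_mono) auto
 also have "... = nn_integral mu (%x. ennreal (max 0 (f x)))"
  using assms by (intro nn_integral_eq_integral[symmetric]) auto
 also have "... = nn_integral mu (%x. ennreal (f x))"
  by (intro nn_integral_cong) (auto simp: max_def ennreal_neg)
 finally show ?thesis .
qed

text \<open>
 The square of the position grows by at most a linear function of its size per step, so leaving a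
 neighbourhood of radius \<open>r\<close> takes a time of order \<open>r\<close>; the potential is
 quadratic.
\<close>

lemma (in real_law) exit_time_ge:
 fixes r b :: real
 assumes [measurable]: "S : sets borel" and S: "{-r<..<r} <= S" and "0 < r" "0 < b"
  and int: "integrable mu (%x. x)" "integrable mu (%x. x^2)"
  and mean: "\<bar>\<integral>x. x \<partial>mu\<bar> <= b" and sq: "(\<integral>x. x^2 \<partial>mu) <= b"
  and lim: "(%n. (kill mu S ^^ n) (%_. 1) 0) \<longlonglongrightarrow> 0"
 shows "ennreal (r^2 / (2 * r * b + b)) <= green mu S (%_. 1) 0"
proof -
 define N where "N = r^2 / (2 * r * b + b)"
 have N: "0 < N" "N * ((2 * r * b + b) / r^2) = 1"
  using \<open>0 < r\<close> \<open>0 < b\<close> add_pos_pos[of "2*r*b" b] by (auto simp: N_def)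
 define W where "W = (%v. ennreal (N * (1 - (v / r)^2)))"
 have "W 0 <= green mu S (%_. 1) 0"
 proof (rule le_green[where D=UNIV and c=N])
  fix v :: real
  show "W v <= ennreal N" using N by (auto simp: W_def intro!: ennreal_leI)
  show "W v <= 1 + kill mu S W v"
  proof (cases "\<bar>v\<bar> < r")
   case False
   then have "1 <= (v / r)^2" using \<open>0 < r\<close> by (simp add: power_divide abs_le_square_iff[symmetric])
   then have "W v = 0" unfolding W_def using N by (intro ennreal_neg) (auto simp: mult_nonneg_nonpos)
   then show ?thesis by simp
  next
   case True
   have i: "integrable mu (%x. N * (1 - ((v + x) / r)^2))"
    using int by (simp add: power_divide power2_sum add_divide_distrib)
   have eq: "(\<integral>x. N * (1 - ((v + x) / r)^2) \<partial>mu)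
    = N * (1 - (v / r)^2) - N * ((2 * v * (\<integral>x. x \<partial>mu) + (\<integral>x. x^2 \<partial>mu)) / r^2)"
    using int by (simp add: power_divide power2_sum add_divide_distrib prob_space[simplified] algebra_simps power2_eq_square[of r])
   have "v * (\<integral>x. x \<partial>mu) <= r * b"
    by (rule order_trans[OF abs_ge_self]) (use True mean \<open>0 < r\<close> in \<open>auto simp: abs_mult intro!: mult_mono\<close>)
   then have "N * ((2 * v * (\<integral>x. x \<partial>mu) + (\<integral>x. x^2 \<partial>mu)) / r^2) <= N * ((2 * r * b + b) / r^2)"
    apply (intro mult_left_mono divide_right_mono)
    subgoal using sq by linarith
    subgoal by simp
    subgoal using N by linarith
    done
   then have le: "N * (1 - (v / r)^2) <= 1 + (\<integral>x. N * (1 - ((v + x) / r)^2) \<partial>mu)"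
    using N eq by linarith
   have "ennreal (\<integral>x. N * (1 - ((v + x) / r)^2) \<partial>mu) <= nn_integral mu (%x. ennreal (N * (1 - ((v + x) / r)^2)))"
    by (rule ennreal_integral_le[OF i])
   also have "... <= kill mu S W v"
    unfolding kill_def
   proof (rule nn_integral_mono)
    fix x
    show "ennreal (N * (1 - ((v + x) / r)^2)) <= indicator S (v + x) * W (v + x)"
    proof (cases "\<bar>v + x\<bar> < r")
    case True
    then have "v + x : S" using subsetD[OF S, of "v + x"] by (simp add: abs_less_iff)
    then show ?thesis by (simp add: W_def)
    next
    case False
    then have "1 <= ((v + x) / r)^2" using \<open>0 < r\<close> by (simp add: power_divide abs_le_square_iff[symmetric])
    then have "ennreal (N * (1 - ((v + x) / r)^2)) = 0"
    using N by (intro ennreal_neg) (auto simp: mult_nonneg_nonpos)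
    then show ?thesis by simp
    qed
   qed
   finally have k: "ennreal (\<integral>x. N * (1 - ((v + x) / r)^2) \<partial>mu) <= kill mu S W v" .
   have "W v <= ennreal (1 + (\<integral>x. N * (1 - ((v + x) / r)^2) \<partial>mu))"
    unfolding W_def by (rule ennreal_leI[OF le])
   also have "... <= 1 + ennreal (\<integral>x. N * (1 - ((v + x) / r)^2) \<partial>mu)"
    by (cases "0 <= (\<integral>x. N * (1 - ((v + x) / r)^2) \<partial>mu)") (auto simp: ennreal_leI intro!: add_increasing2)
   finally show ?thesis using k by (meson add_left_mono order_trans)
  qed
 qed (use lim in \<open>auto simp: W_def\<close>)
 then show ?thesis by (simp add: W_def N_def)
qed

lemma (in real_law) exit_abs_le:
 assumes [measurable]: "S : sets borel" and int: "integrable mu (%x. x)"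
 shows "exit_mean mu S (%w. ennreal \<bar>w\<bar>) v <= ennreal \<bar>v\<bar> + ennreal (\<integral>x. \<bar>x\<bar> \<partial>mu) * green mu S (%_. 1) v"
proof (rule exit_mean_le[where D=UNIV])
 fix v
 define c where "c = ennreal (\<integral>x. \<bar>x\<bar> \<partial>mu)"
 have c: "c = nn_integral mu (%x. ennreal \<bar>x\<bar>)"
  unfolding c_def using int by (intro nn_integral_eq_integral[symmetric]) auto
 have "kill mu (- S) (%w. ennreal \<bar>w\<bar>) v + kill mu S (%v. ennreal \<bar>v\<bar> + c * green mu S (%_. 1) v) v
  = (kill mu (- S) (%w. ennreal \<bar>w\<bar>) v + kill mu S (%v. ennreal \<bar>v\<bar>) v) + c * kill mu S (green mu S (%_. 1)) v"
  by (simp add: kill_add kill_cmult add.assoc)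
 also have "kill mu (- S) (%w. ennreal \<bar>w\<bar>) v + kill mu S (%v. ennreal \<bar>v\<bar>) v = nn_integral mu (%x. ennreal \<bar>v + x\<bar>)"
  by (subst kill_compl) auto
 also have "... <= nn_integral mu (%x. ennreal \<bar>v\<bar> + ennreal \<bar>x\<bar>)"
  by (intro nn_integral_mono) (auto simp: ennreal_plus[symmetric] simp del: ennreal_plus intro!: ennreal_leI)
 also have "... = ennreal \<bar>v\<bar> + c"
  unfolding c by (subst nn_integral_add) (auto simp: emeasure_space_1[simplified])
 also have "ennreal \<bar>v\<bar> + c + c * kill mu S (green mu S (%_. 1)) v = ennreal \<bar>v\<bar> + c * green mu S (%_. 1) v"
  using green_unfold[of S "%_. 1" v] by (simp add: distrib_left add.assoc)
 finally show "kill mu (- S) (%w. ennreal \<bar>w\<bar>) v + kill mu S (%v. ennreal \<bar>v\<bar> + ennreal (\<integral>x. \<bar>x\<bar> \<partial>mu) * green mu S (%_. 1) v) v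
   <= ennreal \<bar>v\<bar> + ennreal (\<integral>x. \<bar>x\<bar> \<partial>mu) * green mu S (%_. 1) v"
  by (simp add: c_def add_right_mono)
qed auto

section \<open>Log-likelihood increments\<close>

text \<open>
 The argument of the Laplace transform, small enough for the quadratic term to be dominated by the
 drift.
\<close>

definition laplace_par :: "real => real => real" where
 "laplace_par a b = min (min (1/2) (1/a)) (a / (b + 8))"

definition laplace_rate :: "real => real => real" where
 "laplace_rate a b = 1 - laplace_par a b * a / 2"

definition overshoot_const :: "real => real => real" where
 "overshoot_const a b = exp (laplace_par a b) / (1 - laplace_rate a b) * (1 + 4 / a)"

lemma laplace_par_pos: "0 < a ==> 0 < b ==> 0 < laplace_par a b"
 by (simp add: laplace_par_def)

lemma laplace_rate_bounds:
 assumes "0 < a" "0 < b" shows "0 < laplace_rate a b" "laplace_rate a b < 1"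
proof -
 have "laplace_par a b * a <= (1 / a) * a"
  using assms by (intro mult_right_mono) (auto simp: laplace_par_def)
 then show "0 < laplace_rate a b" using assms by (simp add: laplace_rate_def)
 show "laplace_rate a b < 1" using laplace_par_pos[OF assms] assms by (simp add: laplace_rate_def)
qed

lemma overshoot_const_pos: "0 < a ==> 0 < b ==> 0 < overshoot_const a b"
 unfolding overshoot_const_def
 by (intro mult_pos_pos divide_pos_pos add_pos_pos) (auto simp: laplace_rate_bounds)

locale llr_law = real_law +
 fixes a b :: real
 assumes tilt_law: "real_law (tilt mu)"
  and a_pos: "0 < a"
  and int_inf: "integrable mu (%x. x)" and mean_inf: "a <= - (\<integral>x. x \<partial>mu)"
  and int_0: "integrable (tilt mu) (%x. x)" and mean_0: "a <= (\<integral>x. x \<partial>tilt mu)"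
  and mean_0_le: "(\<integral>x. x \<partial>tilt mu) <= b"
  and int_sq: "integrable (tilt mu) (%x. x^2)" and sq_le: "(\<integral>x. x^2 \<partial>tilt mu) <= b"
begin

sublocale t: real_law "tilt mu" by (rule tilt_law)

lemma b_pos: "0 < b" using a_pos mean_0 mean_0_le by linarith

lemma nn_integral_exp: "nn_integral mu (%x. ennreal (exp x)) = 1"
 using nn_integral_tilt[of "%_. 1"] by (simp add: t.emeasure_space_1[simplified])

lemma tilt_nn_integral_exp: "nn_integral (tilt mu) (%x. ennreal (exp (- x))) = 1"
 by (subst nn_integral_tilt) (auto simp: ennreal_mult[symmetric] exp_minus emeasure_space_1[simplified])

abbreviation "lam \<equiv> laplace_par a b"
abbreviation "rho \<equiv> laplace_rate a b"

lemma lam_pos: "0 < lam" by (simp add: laplace_par_pos a_pos b_pos)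
lemma rho_bounds: "0 <= rho" "0 < rho" "rho < 1"
 using laplace_rate_bounds[OF a_pos b_pos] by auto

lemma laplace: "nn_integral (tilt mu) (%x. ennreal (exp (- lam * x))) <= ennreal rho"
 unfolding laplace_rate_def
proof (rule t.laplace_le[where b=b])
 have "lam <= a / (b + 8)" by (simp add: laplace_par_def)
 then show "lam * (b + 8) <= a" using b_pos by (simp add: pos_le_divide_eq)
 show "lam <= 1/2" unfolding laplace_par_def by linarith
 show "nn_integral (tilt mu) (%x. ennreal (exp (- x))) <= 1" by (simp only: tilt_nn_integral_exp order_refl)
qed (use lam_pos in \<open>simp_all only: int_0 int_sq mean_0 sq_le less_imp_le\<close>)

lemma overshoot:
 assumes [measurable]: "S : sets borel" and "S <= {..<up}" "v < up" "0 <= eps"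
 shows "exit_mean (tilt mu) S (%w. ennreal (w - up - eps)) v
  <= ennreal (overshoot_const a b) * nn_integral (tilt mu) (%x. ennreal (x^2) * indicator {eps..} x)"
 unfolding overshoot_const_def
 using assms lam_pos
 by (intro t.exit_overshoot_second_moment[OF _ laplace] rho_bounds int_0 mean_0 a_pos) auto

lemma nn_sq_le:
 assumes [measurable]: "A : sets borel"
 shows "nn_integral (tilt mu) (%x. ennreal (x^2) * indicator A x) <= ennreal b"
proof -
 have "nn_integral (tilt mu) (%x. ennreal (x^2) * indicator A x) <= nn_integral (tilt mu) (%x. ennreal (x^2))"
  by (intro nn_integral_mono) (auto simp: indicator_def)
 also have "... = ennreal (\<integral>x. x^2 \<partial>tilt mu)" by (intro nn_integral_eq_integral int_sq) auto
 also have "... <= ennreal b" by (intro ennreal_leI sq_le)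
 finally show ?thesis .
qed

lemma overshoot_le:
 assumes [measurable]: "S : sets borel" and "S <= {..<up}" "v < up"
 shows "exit_mean (tilt mu) S (%w. ennreal (w - up)) v <= ennreal (overshoot_const a b * b)"
proof -
 have "exit_mean (tilt mu) S (%w. ennreal (w - up - 0)) v
   <= ennreal (overshoot_const a b) * nn_integral (tilt mu) (%x. ennreal (x^2) * indicator {0..} x)"
  using assms by (intro overshoot) auto
 also have "... <= ennreal (overshoot_const a b) * ennreal b"
  by (intro mult_left_mono nn_sq_le) auto
 finally show ?thesis using overshoot_const_pos[OF a_pos b_pos] b_pos by (simp add: ennreal_mult)
qed

text \<open>Strict convexity of the exponential: both laws are far from degenerate.\<close>

lemma half_moment: "EX \<rho>. 0 <= \<rho> & \<rho> < 1 & (nn_integral mu (%x. ennreal (exp (x / 2)))) <= ennreal \<rho>"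
proof -
 have ie: "integrable mu (%x. exp x)"
  using nn_integral_exp by (intro integrableI_nonneg) auto
 have e1: "(\<integral>x. exp x \<partial>mu) = 1"
  using nn_integral_exp by (subst (asm) nn_integral_eq_integral[OF ie]) auto
 have amgm: "exp (x / 2) <= (1 + exp x) / 2" for x :: real
  using sum_squares_ge_zero[of "exp (x/2) - 1" 0] exp_add[of "x/2" "x/2"]
  by (simp add: power2_eq_square algebra_simps)
 have ih: "integrable mu (%x. exp (x / 2))"
 proof (rule Bochner_Integration.integrable_bound)
  show "integrable mu (%x. (1 + exp x) / 2)" using ie by simp
 qed (use amgm in \<open>auto intro: order_trans\<close>)
 define g where "g = (%x::real. (1 + exp x) / 2 - exp (x / 2))"
 have ig: "integrable mu g" unfolding g_def using ie ih by simp
 have g0: "0 <= g x" for x using amgm[of x] by (simp add: g_def)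
 have "(\<integral>x. g x \<partial>mu) ~= 0"
 proof
  assume "(\<integral>x. g x \<partial>mu) = 0"
  then have "AE x in mu. g x = 0" using integral_nonneg_eq_0_iff_AE[OF ig] g0 by auto
  then have "AE x in mu. x = 0"
  proof eventually_elim
   fix x :: real assume "g x = 0"
   then have "(exp (x/2) - 1)^2 = 0"
    using exp_add[of "x/2" "x/2"] by (simp add: g_def power2_eq_square algebra_simps)
   then show "x = 0" by simp
  qed
  then have "(\<integral>x. x \<partial>mu) = (\<integral>x. 0 \<partial>mu)" by (intro integral_cong_AE) auto
  then show False using mean_inf a_pos by simp
 qed
 moreover have "0 <= (\<integral>x. g x \<partial>mu)" by (intro Bochner_Integration.integral_nonneg g0)
 moreover have "(\<integral>x. g x \<partial>mu) = 1 - (\<integral>x. exp (x / 2) \<partial>mu)"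
  unfolding g_def using ie ih e1 by (simp add: prob_space[simplified])
 ultimately have "(\<integral>x. exp (x / 2) \<partial>mu) < 1" by linarith
 moreover have "0 <= (\<integral>x. exp (x / 2) \<partial>mu)" by (intro Bochner_Integration.integral_nonneg) auto
 moreover have "nn_integral mu (%x. ennreal (exp (x / 2))) = ennreal (\<integral>x. exp (x / 2) \<partial>mu)"
  by (intro nn_integral_eq_integral ih) auto
 ultimately show ?thesis by (metis order_refl)
qed

definition half_rate :: real where
 "half_rate = (SOME \<rho>. 0 <= \<rho> & \<rho> < 1 & (nn_integral mu (%x. ennreal (exp (x / 2)))) <= ennreal \<rho>)"

lemma half_rate: "0 <= half_rate" "half_rate < 1" "nn_integral mu (%x. ennreal (exp (- (- 1/2) * x))) <= ennreal half_rate"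
 using someI_ex[OF half_moment] by (auto simp: half_rate_def[symmetric])

lemma nn_integral_min_exp_less_1: "nn_integral (tilt mu) (%x. ennreal (min 1 (exp (- x)))) < 1"
proof -
 define g where "g = (%x::real. 1 - min 1 (exp (- x)))"
 have im: "integrable (tilt mu) (%x. min 1 (exp (- x)))"
  by (rule t.integrable_const_bound[where B=1]) auto
 then have ig: "integrable (tilt mu) g" unfolding g_def by simp
 have g0: "0 <= g x" for x by (simp add: g_def)
 have "(\<integral>x. g x \<partial>tilt mu) ~= 0"
 proof
  assume "(\<integral>x. g x \<partial>tilt mu) = 0"
  then have "AE x in tilt mu. g x = 0" using integral_nonneg_eq_0_iff_AE[OF ig] g0 by auto
  then have "AE x in tilt mu. x <= 0" by eventually_elim (auto simp: g_def min_def split: if_splits)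
  then have "(\<integral>x. x \<partial>tilt mu) <= (\<integral>x. 0 \<partial>tilt mu)" using int_0 by (intro integral_mono_AE) auto
  then show False using mean_0 a_pos by simp
 qed
 moreover have "0 <= (\<integral>x. g x \<partial>tilt mu)" by (intro Bochner_Integration.integral_nonneg g0)
 moreover have "(\<integral>x. g x \<partial>tilt mu) = 1 - (\<integral>x. min 1 (exp (- x)) \<partial>tilt mu)"
  unfolding g_def using im by (simp add: t.prob_space[simplified])
 ultimately have "(\<integral>x. min 1 (exp (- x)) \<partial>tilt mu) < 1" by linarith
 moreover have "nn_integral (tilt mu) (%x. ennreal (min 1 (exp (- x)))) = ennreal (\<integral>x. min 1 (exp (- x)) \<partial>tilt mu)"
  by (intro nn_integral_eq_integral im) auto
 ultimately show ?thesis by (simp add: ennreal_less_one_iff)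
qed

lemma exit_down_le:
 assumes "- lo <= v"
 shows "exit_mean (tilt mu) {-lo<..<up} (indicator {..-lo}) v <= nn_integral (tilt mu) (%x. ennreal (min 1 (exp (- x))))"
proof -
 define S where "S = {-lo<..<up}"
 have [measurable]: "S : sets borel" by (simp add: S_def)
 define W where "W = (%w. ennreal (min 1 (exp (- (w + lo)))))"
 have [measurable]: "W : borel_measurable borel" unfolding W_def by measurable
 have step: "kill (tilt mu) (- S) (indicator {..-lo}) w + kill (tilt mu) S W w <= nn_integral (tilt mu) (%x. W (w + x))" for w
  by (subst t.kill_compl) (auto intro!: nn_integral_mono simp: W_def indicator_def min_def)
 have mono: "nn_integral (tilt mu) (%x. W (w + x)) <= W w" for w
 proof -
  have "nn_integral (tilt mu) (%x. W (w + x)) <= nn_integral (tilt mu) (%x. 1)"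
   by (intro nn_integral_mono) (auto simp: W_def ennreal_leI)
  then have 1: "nn_integral (tilt mu) (%x. W (w + x)) <= 1" by (simp add: t.emeasure_space_1[simplified])
  have "nn_integral (tilt mu) (%x. W (w + x)) <= nn_integral (tilt mu) (%x. ennreal (exp (- (w + lo))) * ennreal (exp (- x)))"
   by (intro nn_integral_mono)
    (auto simp: W_def ennreal_mult[symmetric] exp_add[symmetric] algebra_simps intro!: ennreal_leI)
  also have "... = ennreal (exp (- (w + lo)))" by (simp add: nn_integral_cmult tilt_nn_integral_exp)
  finally show ?thesis using 1 by (auto simp: W_def min_def)
 qed
 have le: "exit_mean (tilt mu) S (indicator {..-lo}) w <= W w" for w
  by (rule t.exit_mean_le[where D=UNIV]) (auto intro: order_trans[OF step mono])
 have "exit_mean (tilt mu) S (indicator {..-lo}) v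
   = kill (tilt mu) (- S) (indicator {..-lo}) v + kill (tilt mu) S (exit_mean (tilt mu) S (indicator {..-lo})) v"
  by (rule t.exit_mean_unfold) auto
 also have "... <= kill (tilt mu) (- S) (indicator {..-lo}) v + kill (tilt mu) S W v"
  by (intro add_left_mono t.kill_mono le)
 also have "... <= nn_integral (tilt mu) (%x. W (v + x))" by (rule step)
 also have "... <= nn_integral (tilt mu) (%x. ennreal (min 1 (exp (- x))))"
  using assms by (intro nn_integral_mono) (auto simp: W_def intro!: ennreal_leI min.coboundedI2)
 finally show ?thesis by (simp add: S_def)
qed

lemma tilt_pow_tendsto_0:
 assumes [measurable]: "S : sets borel" and "S <= {..<up}" "v < up"
 shows "(%n. (kill (tilt mu) S ^^ n) (%_. 1) v) \<longlonglongrightarrow> 0"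
 using assms lam_pos by (intro t.kill_pow_one_tendsto_0[OF _ laplace, where b=up] rho_bounds mult_nonneg_nonneg) auto

text \<open>
 Under the tilted law the walk leaves upwards with a probability bounded below and a bounded mean
 overshoot; changing the measure back costs the exponential of the distance.
\<close>

lemma exit_up_ge:
 obtains c where "0 < c" "!!lo up v. - lo <= v ==> v < up ==>
  ennreal (c * exp (v - up)) <= exit_mean mu {-lo<..<up} (indicator {up..}) v"
proof -
 obtain q where q: "nn_integral (tilt mu) (%x. ennreal (min 1 (exp (- x)))) = ennreal q" "0 <= q" "q < 1"
  using nn_integral_min_exp_less_1
  by (cases "nn_integral (tilt mu) (%x. ennreal (min 1 (exp (- x))))" rule: ennreal_cases)
    (auto simp: ennreal_less_one_iff)
 define A where "A = overshoot_const a b * b"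
 have A: "0 < A" using overshoot_const_pos[OF a_pos b_pos] b_pos by (simp add: A_def)
 define L where "L = 2 * A / (1 - q)"
 have L: "0 < L" "A / L = (1 - q) / 2" using A q by (auto simp: L_def)
 define p where "p = (1 - q) / 2"
 have p: "0 < p" using q by (simp add: p_def)
 show ?thesis
 proof (rule that[of "p * exp (- L)"])
  show "0 < p * exp (- L)" using p by simp
  fix lo up v :: real assume v: "- lo <= v" "v < up"
  define S where "S = {-lo<..<up}"
  have [measurable]: "S : sets borel" by (simp add: S_def)
  let ?H = "%g. exit_mean (tilt mu) S g v"
  have one: "?H (%_. 1) = 1"
   by (intro t.exit_mean_one tilt_pow_tendsto_0[where up=up]) (use v in \<open>auto simp: S_def\<close>)
  have over: "?H (indicator {up + L..}) <= ennreal p"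
  proof -
   have "?H (indicator {up + L..}) <= ?H (%w. ennreal (1 / L) * ennreal (w - up))"
   proof (rule t.exit_mean_mono)
    fix w
    show "indicator {up + L..} w <= ennreal (1 / L) * ennreal (w - up)"
    proof (cases "up + L <= w")
    case True
    then have "1 <= 1 / L * (w - up)" using L by (simp add: le_divide_eq)
    then have "ennreal 1 <= ennreal (1 / L * (w - up))" by (rule ennreal_leI)
    also have "... = ennreal (1 / L) * ennreal (w - up)" using True L by (intro ennreal_mult) auto
    finally show ?thesis using True by simp
    qed simp
   qed
   also have "... = ennreal (1 / L) * ?H (%w. ennreal (w - up))" by (rule t.exit_mean_cmult) auto
   also have "... <= ennreal (1 / L) * ennreal A"
    unfolding A_def using v by (intro mult_left_mono overshoot_le) (auto simp: S_def)
   finally show ?thesis using L A p by (simp add: ennreal_mult[symmetric] p_def)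
  qed
  have down: "?H (indicator {..-lo}) <= ennreal q"
   unfolding S_def q(1)[symmetric] by (rule exit_down_le) fact
  have "1 = ?H (%_. 1)" by (rule one[symmetric])
  also have "... <= ?H (%w. indicator {..-lo} w + (indicator {up + L..} w + indicator {up..<up+L} w))"
   by (intro t.exit_mean_mono) (auto simp: S_def indicator_def)
  also have "... = ?H (indicator {..-lo}) + (?H (indicator {up + L..}) + ?H (indicator {up..<up+L}))"
   by (subst t.exit_mean_add, simp_all)+
  also have "... <= ennreal q + (ennreal p + ?H (indicator {up..<up+L}))"
   by (intro add_mono down over order_refl)
  also have "... = ennreal (q + p) + ?H (indicator {up..<up+L})"
   using q p by (simp add: add.assoc)
  also have "1 = ennreal (q + p + p)" by (simp add: p_def)
  also have "... = ennreal (q + p) + ennreal p"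
   by (rule ennreal_plus) (use q(2) p in auto)
  finally have "ennreal (q + p) + ennreal p <= ennreal (q + p) + ?H (indicator {up..<up+L})" .
  then have mid: "ennreal p <= ?H (indicator {up..<up+L})"
   by (simp add: ennreal_add_left_cancel_le)
  also have "... = ennreal (exp (- v)) * exit_mean mu S (%w. ennreal (exp w) * indicator {up..<up+L} w) v"
   by (intro exit_mean_tilt tilt_law) auto
  also have "... <= ennreal (exp (- v)) * exit_mean mu S (%w. ennreal (exp (up + L)) * indicator {up..} w) v"
   by (intro mult_left_mono exit_mean_mono) (auto simp: indicator_def intro!: ennreal_leI)
  also have "... = ennreal (exp (up + L - v)) * exit_mean mu S (indicator {up..}) v"
   by (subst exit_mean_cmult)
    (auto simp: mult.assoc[symmetric] ennreal_mult[symmetric] exp_add[symmetric] add.commute)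
  finally have "ennreal (exp (- (up + L - v))) * ennreal p
    <= ennreal (exp (- (up + L - v))) * (ennreal (exp (up + L - v)) * exit_mean mu S (indicator {up..}) v)"
   by (rule mult_left_mono) auto
  also have "... = exit_mean mu S (indicator {up..}) v"
   by (simp add: mult.assoc[symmetric] ennreal_mult[symmetric] exp_add[symmetric])
  finally show "ennreal (p * exp (- L) * exp (v - up)) <= exit_mean mu {-lo<..<up} (indicator {up..}) v"
   using p by (simp add: ennreal_mult[symmetric] mult.assoc exp_add[symmetric] S_def)
    (simp add: mult.commute add.commute add_diff_eq diff_diff_eq)
 qed
qed

lemma rho_le_exp: "rho <= exp (- (lam * a / 2))"
 using exp_ge_add_one_self[of "- (lam * a / 2)"] by (simp add: laplace_rate_def)

text \<open>After \<open>n0\<close> steps the drift has carried the walk past the upper end, up to a geometric tail.\<close>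

lemma tilt_pow_le:
 assumes [measurable]: "S : sets borel" and "S <= {..<up}" "v < up" "up - v <= w" "2 * w / a <= real n0"
 shows "(kill (tilt mu) S ^^ (n + n0)) (%_. 1) v <= ennreal (rho ^ n)"
proof -
 have "(kill (tilt mu) S ^^ (n + n0)) (%_. 1) v <= ennreal (exp (lam * (up - v)) * rho ^ (n + n0))"
  using assms lam_pos by (intro t.kill_pow_one_exp_le[OF _ laplace] rho_bounds mult_nonneg_nonneg) auto
 also have "exp (lam * (up - v)) * rho ^ (n + n0) <= 1 * rho ^ n"
 proof -
  have "exp (lam * (up - v)) * rho ^ n0 <= exp (lam * w) * exp (- (lam * a / 2)) ^ n0"
   using assms lam_pos rho_bounds rho_le_exp by (intro mult_mono power_mono) auto
  also have "... = exp (lam * (w - a / 2 * real n0))"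
   by (simp add: exp_of_nat_mult[symmetric] exp_add[symmetric] algebra_simps)
  also have "... <= 1" using assms(5) lam_pos a_pos by (simp add: mult_nonneg_nonpos field_simps)
  finally show ?thesis using rho_bounds
   mult_right_mono[of "exp (lam * (up - v)) * rho ^ n0" 1 "rho ^ n"]
   by (simp add: power_add mult_ac)
 qed
 finally show ?thesis by (simp add: ennreal_leI)
qed

lemma sojourn_le:
 assumes [measurable]: "S : sets borel" and "S <= {..<up}" "v < up" "up - v <= w" "2 * w / a <= real n0"
 shows "green (tilt mu) S (%_. 1) v <= ennreal (real n0 + 1 / (1 - rho))"
 unfolding green_def
 using tilt_pow_le[OF assms] rho_bounds t.kill_pow_one_le
 by (intro suminf_le_geometric_tail) auto

lemma sojourn_ge:
 assumes "{-r<..<r} <= S" "0 < r" and [measurable]: "S : sets borel" and "S <= {..<up}" "0 < up"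
 shows "ennreal (r^2 / (2 * r * b + b)) <= green (tilt mu) S (%_. 1) 0"
 using assms a_pos mean_0 mean_0_le
 by (intro t.exit_time_ge int_0 int_sq sq_le b_pos tilt_pow_tendsto_0[where up=up]) auto

lemma inf_sojourn_le:
 assumes [measurable]: "S : sets borel" and "S <= {- lo..}" "- lo <= v"
 shows "green mu S (%_. 1) v <= ennreal (exp ((v + lo) / 2) / (1 - half_rate))"
proof -
 have "green mu S (%_. 1) v <= (\<Sum>n. ennreal (exp ((v + lo) / 2) * half_rate ^ n))"
  unfolding green_def
 proof (intro suminf_le summableI)
  fix n
  have "(kill mu S ^^ n) (%_. 1) v <= ennreal (exp ((- 1/2) * (- lo - v)) * half_rate ^ n)"
   using assms by (intro kill_pow_one_exp_le[OF _ half_rate(3)] half_rate) auto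
  moreover have "(- 1/2) * (- lo - v) = (v + lo) / 2" by (simp add: field_simps)
  ultimately show "(kill mu S ^^ n) (%_. 1) v <= ennreal (exp ((v + lo) / 2) * half_rate ^ n)"
   by metis
 qed
 also have "... = ennreal (exp ((v + lo) / 2) * (1 / (1 - half_rate)))"
  using half_rate by (intro suminf_ennreal_eq sums_mult geometric_sums) auto
 finally show ?thesis by simp
qed

end

text \<open>Reflecting the walk exchanges upper and lower exits.\<close>

lemma (in real_law) real_law_reflect: "real_law (distr mu borel uminus)"
proof -
 interpret d: prob_space "distr mu borel uminus" by (rule prob_space_distr) simp
 show ?thesis by unfold_locales simp
qed

lemma (in real_law) kill_reflect:
 assumes [measurable]: "S : sets borel" "f : borel_measurable borel"
 shows "kill (distr mu borel uminus) (uminus -` S) (%w. f (- w)) v = kill mu S f (- v)"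
 unfolding kill_def
 by (subst nn_integral_distr) (auto intro!: nn_integral_cong simp: indicator_def)

lemma (in real_law) exit_mean_reflect:
 assumes [measurable]: "S : sets borel" "g : borel_measurable borel"
 shows "exit_mean (distr mu borel uminus) (uminus -` S) (%w. g (- w)) v = exit_mean mu S g (- v)"
proof -
 have [measurable]: "uminus -` S : sets borel" using measurable_sets[of uminus borel borel S] by simp
 have pow: "(kill (distr mu borel uminus) (uminus -` S) ^^ n) (%w. f (- w)) v = (kill mu S ^^ n) f (- v)"
  if [measurable]: "f : borel_measurable borel" for f n v
 proof (induction n arbitrary: v)
  case (Suc n)
  then have "(kill (distr mu borel uminus) (uminus -` S) ^^ n) (%w. f (- w)) = (%v. (kill mu S ^^ n) f (- v))"
   by (intro ext)
  then show ?case by (simp add: kill_reflect)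
 qed simp
 have "kill (distr mu borel uminus) (- (uminus -` S)) (%w. g (- w)) = (%v. kill mu (- S) g (- v))"
  using kill_reflect[of "- S" g] by (auto simp: vimage_Compl)
 then show ?thesis unfolding exit_mean_def green_def by (simp add: pow)
qed

context llr_law begin

text \<open>The reflected walk has positive drift before the change.\<close>

lemma exit_down_overshoot_le:
 obtains C where "0 < C" "!!S lo v eps. S : sets borel ==> S <= {- lo<..} ==> - lo < v ==> 0 <= eps ==>
  exit_mean mu S (%w. ennreal (- w - lo - eps)) v
  <= ennreal C * nn_integral mu (%x. ennreal (x^2) * indicator {eps..} (- x))"
proof -
 define R where "R = distr mu borel (uminus :: real => real)"
 interpret r: real_law R unfolding R_def by (rule real_law_reflect)
 have m: "nn_integral R (%x. ennreal (exp (- (1/2) * x))) <= ennreal half_rate"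
 proof -
  have "nn_integral R (%x. ennreal (exp (- (1/2) * x))) = nn_integral mu (%x. ennreal (exp (- (1/2) * (- x))))"
   unfolding R_def by (rule nn_integral_distr) measurable
  then show ?thesis using half_rate(3) by (simp only: minus_mult_commute mult_minus_right mult_minus_left minus_divide_left) simp
 qed
 have int: "integrable R (%x. x)"
  unfolding R_def by (subst integrable_distr_eq) (simp_all add: int_inf)
 have "(\<integral>x. x \<partial>R) = (\<integral>x. - x \<partial>mu)" unfolding R_def by (rule integral_distr) simp_all
 then have mean: "a <= (\<integral>x. x \<partial>R)" using mean_inf by simp
 define C where "C = exp (1/2) / (1 - half_rate) * (1 + 4 / a)"
 show ?thesis
 proof (rule that[of C])
  show "0 < C" unfolding C_def using half_rate a_pos
   by (intro mult_pos_pos divide_pos_pos add_pos_pos) auto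
  fix S lo v eps assume [measurable]: "S : sets (borel :: real measure)" and S: "S <= {- lo<..}" and v: "- lo < v" and eps: "0 <= (eps::real)"
  have mS: "uminus -` S : sets borel" using measurable_sets[of uminus borel borel S] by simp
  have "exit_mean mu S (%w. ennreal (- w - lo - eps)) v = exit_mean R (uminus -` S) (%w. ennreal (w - lo - eps)) (- v)"
   unfolding R_def using exit_mean_reflect[of S "%w. ennreal (- w - lo - eps)" "- v"] by simp
  also have "... <= ennreal C * nn_integral R (%x. ennreal (x^2) * indicator {eps..} x)"
   unfolding C_def using S v eps half_rate a_pos
   by (intro r.exit_overshoot_second_moment[OF mS m] int mean) auto
  also have "nn_integral R (%x. ennreal (x^2) * indicator {eps..} x) = nn_integral mu (%x. ennreal (x^2) * indicator {eps..} (- x))"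
   unfolding R_def by (subst nn_integral_distr) auto
  finally show "exit_mean mu S (%w. ennreal (- w - lo - eps)) v
    <= ennreal C * nn_integral mu (%x. ennreal (x^2) * indicator {eps..} (- x))" .
 qed
qed

lemma inf_exit_abs_le:
 assumes [measurable]: "S : sets borel" and "S <= {- lo..}" "0 <= lo"
 shows "exit_mean mu S (%w. ennreal \<bar>w\<bar>) 0 <= ennreal ((\<integral>x. \<bar>x\<bar> \<partial>mu) * (exp (lo / 2) / (1 - half_rate)))"
proof -
 have "exit_mean mu S (%w. ennreal \<bar>w\<bar>) 0 <= ennreal \<bar>0\<bar> + ennreal (\<integral>x. \<bar>x\<bar> \<partial>mu) * green mu S (%_. 1) 0"
  by (intro exit_abs_le int_inf) fact
 also have "... <= ennreal \<bar>0\<bar> + ennreal (\<integral>x. \<bar>x\<bar> \<partial>mu) * ennreal (exp ((0 + lo) / 2) / (1 - half_rate))"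
  using assms by (intro add_left_mono mult_left_mono inf_sojourn_le) auto
 also have "... = ennreal ((\<integral>x. \<bar>x\<bar> \<partial>mu) * (exp (lo / 2) / (1 - half_rate)))"
  using half_rate by (subst ennreal_mult) auto
 finally show ?thesis .
qed

end

section \<open>Independent increments of several sensors\<close>

declare One_nat_def [simp del]

text \<open>
 The only probabilistic input: from time \<open>t0\<close> on, the vector of increments is
 independent of the past and has a product law.  It holds before the change from time zero, and
 after a change from the change-point on.
\<close>

locale filtered_walk = prob_space M for M :: "'a measure" +
 fixes F :: "nat => 'a measure" and K :: nat and law :: "nat => real measure"
  and X :: "nat => nat => 'a => real" and t0 :: nat
 assumes K_pos: "1 <= K"
  and space_F: "space (F t) = space M"
  and sets_F: "sets (F t) <= sets M"
  and F_mono: "s <= t ==> sets (F s) <= sets (F t)"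
  and X_adapted: "k : {1..K} ==> X k t : borel_measurable (F (Suc t))"
  and law: "real_law (law k)"
  and one_step: "t0 <= t ==> g : borel_measurable (F t \<Otimes>\<^sub>M PiM {1..K} (%_. borel)) ==>
   (nn_integral M (%om. g (om, \<lambda>k\<in>{1..K}. X k t om))) = nn_integral M (%om. nn_integral (PiM {1..K} law) (%x. g (om, x)))"
begin

lemma measurable_F_mono: "s <= t ==> f : measurable (F s) N ==> f : measurable (F t) N"
 using F_mono[of s t] space_F by (auto simp: measurable_def)

lemma measurable_F_M: "f : measurable (F s) N ==> f : measurable M N"
 using sets_F[of s] space_F by (auto simp: measurable_def)

lemma subalg: "subalgebra M (F t)"
 using sets_F space_F by (simp add: subalgebra_def)

lemma sets_law: "sets (law k) = sets borel"
 using law real_law.sets_law by blast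

lemma sets_PiM_law: "sets (PiM {1..K} law) = sets (PiM {1..K} (%_. borel))"
 by (intro sets_PiM_cong) (auto simp: sets_law)

lemma prob_law: "prob_space (law k)"
 using law by (simp add: real_law_def)

sublocale laws: product_prob_space law "{1..K}"
 by (simp add: product_prob_space_def product_prob_space_axioms_def prob_law
   product_sigma_finite_def prob_space_imp_sigma_finite)

lemma step_sensor:
 assumes "t0 <= t" "k : {1..K}" and [measurable]: "g : borel_measurable (F t \<Otimes>\<^sub>M borel)"
 shows "nn_integral M (%om. g (om, X k t om)) = nn_integral M (%om. nn_integral (law k) (%x. g (om, x)))"
proof -
 have [measurable]: "(%p. g (fst p, snd p k)) : borel_measurable (F t \<Otimes>\<^sub>M PiM {1..K} (%_. borel))"
  using \<open>k : {1..K}\<close> by measurable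
 have "nn_integral M (%om. g (om, X k t om)) = nn_integral M (%om. nn_integral (PiM {1..K} law) (%x. g (om, x k)))"
  using one_step[OF assms(1), of "%p. g (fst p, snd p k)"] \<open>k : {1..K}\<close> by simp
 also have "... = nn_integral M (%om. nn_integral (law k) (%x. g (om, x)))"
 proof (rule nn_integral_cong)
  fix om assume "om : space M"
  then have "om : space (F t)" by (simp add: space_F)
  then have m: "(%x. g (om, x)) : borel_measurable (law k)"
   by (subst measurable_cong_sets[OF sets_law refl]) measurable
  have "nn_integral (law k) (%x. g (om, x)) = nn_integral (distr (PiM {1..K} law) (law k) (%x. x k)) (%x. g (om, x))"
   using \<open>k : {1..K}\<close> by (subst distr_PiM_component) (auto simp: prob_law)
  also have "... = nn_integral (PiM {1..K} law) (%x. g (om, x k))"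
   using \<open>k : {1..K}\<close> m by (intro nn_integral_distr) auto
  finally show "nn_integral (PiM {1..K} law) (%x. g (om, x k)) = nn_integral (law k) (%x. g (om, x))" by simp
 qed
 finally show ?thesis .
qed

lemma step_prod:
 assumes "t0 <= t" and [measurable]: "c : borel_measurable (F t)"
  and g[measurable]: "!!k. k : {1..K} ==> g k : borel_measurable (F t \<Otimes>\<^sub>M borel)"
 shows "nn_integral M (%om. c om * (\<Prod>k=1..K. g k (om, X k t om)))
  = nn_integral M (%om. c om * (\<Prod>k=1..K. nn_integral (law k) (%x. g k (om, x))))"
proof -
 have [measurable]: "(%p. g k (fst p, snd p k)) : borel_measurable (F t \<Otimes>\<^sub>M PiM {1..K} (%_. borel))"
  if "k : {1..K}" for k
 proof (rule measurable_compose[OF _ g[OF that]])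
  show "(%p. (fst p, snd p k)) : F t \<Otimes>\<^sub>M PiM {1..K} (%_. borel) \<rightarrow>\<^sub>M F t \<Otimes>\<^sub>M borel"
   using that by measurable
 qed
 have "(%p. c (fst p) * (\<Prod>k=1..K. g k (fst p, snd p k))) : borel_measurable (F t \<Otimes>\<^sub>M PiM {1..K} (%_. borel))"
  by measurable
 from one_step[OF assms(1) this]
 have "nn_integral M (%om. c om * (\<Prod>k=1..K. g k (om, X k t om)))
   = nn_integral M (%om. nn_integral (PiM {1..K} law) (%x. c om * (\<Prod>k=1..K. g k (om, x k))))"
  by simp
 also have "... = nn_integral M (%om. c om * (\<Prod>k=1..K. nn_integral (law k) (%x. g k (om, x))))"
 proof (rule nn_integral_cong)
  fix om assume "om : space M"
  then have w: "om : space (F t)" by (simp add: space_F)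
  have m: "(%x. g k (om, x)) : borel_measurable (law k)" if "k : {1..K}" for k
   using measurable_compose[OF measurable_Pair1'[OF w] g[OF that]]
   by (subst measurable_cong_sets[OF sets_law refl])
  have mc: "(%x. g k (om, x k)) : borel_measurable (PiM {1..K} law)" if k: "k : {1..K}" for k
   using measurable_component_singleton[OF k, of law] m[OF k] by (rule measurable_compose)
  have "nn_integral (PiM {1..K} law) (%x. c om * (\<Prod>k=1..K. g k (om, x k)))
    = c om * nn_integral (PiM {1..K} law) (%x. (\<Prod>k=1..K. g k (om, x k)))"
   by (rule nn_integral_cmult, rule borel_measurable_prod_ennreal, rule mc)
  also have "nn_integral (PiM {1..K} law) (%x. (\<Prod>k=1..K. g k (om, x k))) = (\<Prod>k=1..K. nn_integral (law k) (%x. g k (om, x)))"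
   using m by (intro laws.product_nn_integral_prod) auto
  finally show "nn_integral (PiM {1..K} law) (%x. c om * (\<Prod>k=1..K. g k (om, x k)))
    = c om * (\<Prod>k=1..K. nn_integral (law k) (%x. g k (om, x)))" .
 qed
 finally show ?thesis .
qed

definition total_law :: "real measure" where
 "total_law = distr (PiM {1..K} law) borel (%x. SUM k=1..K. x k)"

lemma measurable_component_sum [measurable]:
 "(%x. SUM k=1..K. x k :: real) : borel_measurable (PiM {1..K} (%_. borel))"
 by (intro borel_measurable_sum) measurable

lemma real_law_total: "real_law total_law"
proof -
 have "prob_space total_law" unfolding total_law_def
  by (intro laws.prob_space_distr) (simp add: measurable_cong_sets[OF sets_PiM_law refl] measurable_component_sum)
 then show ?thesis by (simp add: real_law_def real_law_axioms_def total_law_def)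
qed

lemma step_sum:
 assumes "t0 <= t" and [measurable]: "g : borel_measurable (F t \<Otimes>\<^sub>M borel)"
 shows "nn_integral M (%om. g (om, SUM k=1..K. X k t om)) = nn_integral M (%om. nn_integral total_law (%x. g (om, x)))"
proof -
 have "(%p. g (fst p, SUM k=1..K. snd p k)) : borel_measurable (F t \<Otimes>\<^sub>M PiM {1..K} (%_. borel))"
  by measurable
 from one_step[OF assms(1) this]
 have "nn_integral M (%om. g (om, SUM k=1..K. X k t om)) = nn_integral M (%om. nn_integral (PiM {1..K} law) (%x. g (om, SUM k=1..K. x k)))"
  by simp
 also have "... = nn_integral M (%om. nn_integral total_law (%x. g (om, x)))"
 proof (rule nn_integral_cong)
  fix om assume "om : space M"
  then have w: "om : space (F t)" by (simp add: space_F)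
  have m: "(%x. SUM k=1..K. x k) : borel_measurable (PiM {1..K} law)"
   by (simp add: measurable_cong_sets[OF sets_PiM_law refl] measurable_component_sum)
  show "nn_integral (PiM {1..K} law) (%x. g (om, SUM k=1..K. x k)) = nn_integral total_law (%x. g (om, x))"
   unfolding total_law_def using measurable_compose[OF measurable_Pair1'[OF w] assms(2)]
   by (intro nn_integral_distr[symmetric] m) simp
 qed
 finally show ?thesis .
qed

end

section \<open>The increments of the log-likelihood ratios\<close>

context sensor_system
begin

abbreviation Omega where "Omega \<equiv> space (P \<infinity>)"

abbreviation Pre where "Pre \<equiv> P \<infinity>"

abbreviation joint :: "nat => 'a measure" where "joint t \<equiv> joint_filtration Omega K \<xi> t"

definition incr :: "nat => nat => 'a => real" where
 "incr k t om = u k (Suc t) om - u k t om"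

definition step_law :: "nat => real measure" where
 "step_law k = (if k : {1..K} then distr Pre borel (u k 1) else return borel 0)"

lemma space_P: "space (P tau) = Omega"
 by (rule sets_eq_imp_space_eq[OF sets_P])

lemma space_gen [simp]: "space (gen_filtration Omega Y t) = Omega"
 unfolding gen_filtration_def by (rule space_measure_of) auto

lemma sets_gen: "sets (gen_filtration Omega Y t) = sigma_sets Omega {Y s -` A Int Omega | s A. s <= t & A : sets borel}"
 unfolding gen_filtration_def by (rule sets_measure_of) auto

lemma space_joint [simp]: "space (joint t) = Omega"
 unfolding joint_filtration_def
 by (rule space_measure_of) (use sets.sets_into_space in fastforce)

lemma sets_joint: "sets (joint t) = sigma_sets Omega (\<Union>k\<in>{1..K}. sets (gen_filtration Omega (\<xi> k) t))"
 unfolding joint_filtration_def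
 by (rule sets_measure_of) (use sets.sets_into_space in fastforce)

lemma gen_mono: "s <= t ==> sets (gen_filtration Omega Y s) <= sets (gen_filtration Omega Y t)"
 unfolding sets_gen by (rule sigma_sets_mono') (auto intro: order_trans)

lemma joint_mono: "s <= t ==> sets (joint s) <= sets (joint t)"
 unfolding sets_joint by (rule sigma_sets_mono') (use gen_mono in blast)

lemma gen_subset_joint: "k : {1..K} ==> sets (gen_filtration Omega (\<xi> k) t) <= sets (joint t)"
 unfolding sets_joint by (intro subsetI sigma_sets.Basic) auto

lemma gen_subset_P: "k : {1..K} ==> sets (gen_filtration Omega (\<xi> k) t) <= sets Pre"
 unfolding sets_gen using measurable_sets[OF meas_xi]
 by (intro sets.sigma_sets_subset) auto

lemma joint_subset_P: "sets (joint t) <= sets (P tau)"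
proof -
 have "sets (joint t) <= sets Pre"
  unfolding sets_joint using gen_subset_P by (intro sets.sigma_sets_subset) blast
 then show ?thesis using sets_P[of tau] by simp
qed

lemma u_gen: "k : {1..K} ==> u k t : borel_measurable (gen_filtration Omega (\<xi> k) t)"
 using llr[of k t] by (simp add: is_log_density_def)

lemma measurable_larger: "f : measurable M N ==> sets M <= sets M' ==> space M = space M' ==> f : measurable M' N"
 by (auto simp: measurable_def)

lemma u_joint: "k : {1..K} ==> s <= t ==> u k s : borel_measurable (joint t)"
 by (rule measurable_larger[OF u_gen order_trans[OF gen_subset_joint joint_mono]]) simp_all

lemma u_P: "k : {1..K} ==> u k s : borel_measurable (P tau)"
 by (rule measurable_larger[OF u_joint[OF _ order_refl] joint_subset_P]) (simp_all add: space_P[of tau])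

lemma incr_gen: "k : {1..K} ==> incr k t : borel_measurable (gen_filtration Omega (\<xi> k) (Suc t))"
 unfolding incr_def[abs_def]
 by (intro borel_measurable_diff u_gen measurable_larger[OF u_gen[of k t] gen_mono]) simp_all

lemma incr_joint: "k : {1..K} ==> incr k t : borel_measurable (joint (Suc t))"
 by (rule measurable_larger[OF incr_gen gen_subset_joint]) simp_all

lemma incr_P: "k : {1..K} ==> incr k t : borel_measurable (P tau)"
 by (rule measurable_larger[OF incr_joint joint_subset_P]) (simp_all add: space_P[of tau])

lemma real_law_step: "real_law (step_law k)"
proof (cases "k : {1..K}")
 case True
 interpret prob_space "Pre" by (rule prob_P)
 have "prob_space (distr Pre borel (u k 1))"
  using u_P[OF True] by (rule prob_space_distr)
 then show ?thesis using True by (simp add: step_law_def real_law_def real_law_axioms_def)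
next
 case False
 have "prob_space (return borel (0::real))" by (rule prob_space_return) simp
 then show ?thesis using False by (auto simp: step_law_def real_law_def real_law_axioms_def)
qed

lemma incr_distr: "k : {1..K} ==> distr Pre borel (incr k t) = step_law k"
proof -
 assume k: "k : {1..K}"
 have "distr Pre borel (incr k t) = distr Pre borel (%om. u k (Suc 0) om - u k 0 om)"
  using walk[OF k, of \<infinity>] unfolding random_walk_def incr_def[abs_def] by auto
 also have "... = distr Pre borel (u k 1)"
  using u_0[OF k] by (intro distr_cong) (auto simp: One_nat_def)
 finally show ?thesis using k by (simp add: step_law_def)
qed

lemma gen_subset_path:
 "sets (gen_filtration Omega (\<xi> k) t) <= {(%om t. \<xi> k t om) -` A Int Omega | A. A : sets (PiM UNIV (%_. borel))}"
proof -
 let ?f = "%om t. \<xi> k t om"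
 let ?V = "vimage_algebra Omega ?f (PiM UNIV (%_. borel :: real measure))"
 have "sets (gen_filtration Omega (\<xi> k) t) <= sets ?V"
  unfolding sets_gen
 proof (rule sets.sigma_sets_subset[of _ ?V, simplified])
  show "{\<xi> k s -` A Int Omega |s A. s <= t & A : sets borel} <= sets ?V"
  proof safe
   fix s :: nat and A :: "real set" assume [measurable]: "A : sets borel"
   have m: "{g. g s : A} : sets (PiM UNIV (%_. borel :: real measure))"
   proof -
    have "(%g. g s) -` A Int space (PiM UNIV (%_. borel :: real measure)) : sets (PiM UNIV (%_. borel :: real measure))"
    by (rule measurable_sets[where A=borel]) auto
    then show ?thesis by (simp add: space_PiM vimage_def)
   qed
   have "\<xi> k s -` A Int Omega = ?f -` {g. g s : A} Int Omega" by auto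
   then show "\<xi> k s -` A Int Omega : sets ?V" using in_vimage_algebra[OF m] by simp
  qed
 qed
 also have "sets ?V = {?f -` A Int Omega | A. A : sets (PiM UNIV (%_. borel))}"
  by (rule sets_vimage_algebra2) (auto simp: space_PiM)
 finally show ?thesis .
qed

text \<open>
 Each sensor is a random walk relative to its own filtration only; the independence of the
 coordinate processes extends this to the joint filtration.
\<close>

lemma indep_past_increment:
 "A : sets (joint t) ==> B : sets (PiM {1..K} (%_. borel)) ==>
  measure Pre (A Int ((%om. \<lambda>k\<in>{1..K}. incr k t om) -` B Int Omega))
  = measure Pre A * measure Pre ((%om. \<lambda>k\<in>{1..K}. incr k t om) -` B Int Omega)"
 and distr_increment:
 "distr Pre (PiM {1..K} (%_. borel)) (%om. \<lambda>k\<in>{1..K}. incr k t om) = PiM {1..K} step_law"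
proof -
 interpret prob_space "Pre" by (rule prob_P)
 have ne: "{1..K} ~= {}" using K_pos by auto
 let ?V = "%k. {(%om t. \<xi> k t om) -` A Int Omega | A. A : sets (PiM UNIV (%_. borel))}"
 have V: "indep_sets ?V {1..K}"
  using indep_sensors[of \<infinity>] unfolding indep_vars_def2 by auto
 have XV: "{incr k t -` B Int Omega | B. B : sets borel} <= sets (gen_filtration Omega (\<xi> k) (Suc t))" if "k : {1..K}" for k
  using measurable_sets[OF incr_gen[OF that]] by auto
 define E where "E = (%(k, b). if b then {incr k t -` B Int Omega | B. B : sets borel} else sets (gen_filtration Omega (\<xi> k) t))"
 have E: "indep_sets E ({1..K} \<times> UNIV)"
 proof (subst indep_sets_finite)
  fix i assume i: "i : {1..K} \<times> (UNIV :: bool set)"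
  then obtain k b where k: "i = (k, b)" "k : {1..K}" by auto
  show "E i <= events"
   using XV[OF k(2)] gen_subset_P[OF k(2)] by (cases b) (auto simp: E_def k(1))
  have "Omega = incr k t -` UNIV Int Omega" by auto
  then show "Omega : E i" using sets.top[of "gen_filtration Omega (\<xi> k) t"]
   by (cases b) (auto simp: E_def k(1) intro!: exI[of _ UNIV])
 next
  show "ALL A:Pi ({1..K} \<times> UNIV) E. prob (\<Inter> (A ` ({1..K} \<times> UNIV))) = (\<Prod>j\<in>{1..K} \<times> UNIV. prob (A j))"
  proof
   fix A assume A: "A : Pi ({1..K} \<times> UNIV) E"
   have AF: "A (k, False) : sets (gen_filtration Omega (\<xi> k) t)"
    and AT: "A (k, True) : {incr k t -` B Int Omega | B. B : sets borel}" if "k : {1..K}" for k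
    using PiE[OF A, of "(k, False)"] PiE[OF A, of "(k, True)"] that by (fastforce simp: E_def)+
   have mem: "A (k, False) Int A (k, True) : ?V k" if "k : {1..K}" for k
   proof -
    have "A (k, False) : sets (gen_filtration Omega (\<xi> k) (Suc t))" using AF[OF that] gen_mono[of t "Suc t"] by auto
    moreover have "A (k, True) : sets (gen_filtration Omega (\<xi> k) (Suc t))" using AT[OF that] XV[OF that] by auto
    ultimately show ?thesis using gen_subset_path[of k "Suc t"] by (meson sets.Int subsetD)
   qed
   have ind: "prob (A (k, False) Int A (k, True)) = prob (A (k, False)) * prob (A (k, True))" if "k : {1..K}" for k
   proof (rule indep_setD)
    show "indep_set (sets (gen_filtration Omega (\<xi> k) t)) (sets (vimage_algebra Omega (%om. u k (Suc t) om - u k t om) borel))"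
    using walk[OF that, of \<infinity>] by (simp add: random_walk_def)
    show "A (k, False) : sets (gen_filtration Omega (\<xi> k) t)" by (rule AF[OF that])
    have AT': "A (k, True) : {incr k t -` B Int Omega | B. B : sets borel}" by (rule AT[OF that])
    obtain B where B: "B : sets borel" "A (k, True) = incr k t -` B Int Omega" using AT' by auto
    show "A (k, True) : sets (vimage_algebra Omega (%om. u k (Suc t) om - u k t om) borel)"
    unfolding B(2) incr_def[abs_def] by (rule in_vimage_algebra[OF B(1)])
   qed
   have "(\<Inter> (A ` ({1..K} \<times> UNIV))) = (\<Inter>k\<in>{1..K}. A (k, False) Int A (k, True))"
   proof (intro set_eqI iffI)
    fix x assume *: "x : (\<Inter>k\<in>{1..K}. A (k, False) Int A (k, True))"
    have "x : A (k, b)" if "k : {1..K}" for k b using * that by (cases b) auto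
    then show "x : (\<Inter> (A ` ({1..K} \<times> UNIV)))" by auto
   qed auto
   then have "prob (\<Inter> (A ` ({1..K} \<times> UNIV))) = (\<Prod>k=1..K. prob (A (k, False) Int A (k, True)))"
    using indep_setsD[OF V, of "{1..K}" "%k. A (k, False) Int A (k, True)"] ne mem by simp
   also have "... = (\<Prod>k=1..K. \<Prod>b\<in>UNIV. prob (A (k, b)))"
    using ind by (intro prod.cong) (auto simp: UNIV_bool)
   also have "... = (\<Prod>j\<in>{1..K} \<times> UNIV. prob (A j))"
    by (subst prod.cartesian_product) (auto simp: case_prod_beta)
   finally show "prob (\<Inter> (A ` ({1..K} \<times> UNIV))) = (\<Prod>j\<in>{1..K} \<times> UNIV. prob (A j))" .
  qed
 qed (use ne in auto)
 have collect: "indep_sets (%b. sigma_sets Omega (\<Union>i\<in>{1..K} \<times> {b}. E i)) UNIV"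
 proof (rule indep_sets_collect_sigma)
  have "(\<Union>j\<in>UNIV. {1..K} \<times> {j}) = {1..K} \<times> (UNIV :: bool set)" by auto
  then show "indep_sets E (\<Union>j\<in>UNIV. {1..K} \<times> {j})" using E by simp
  show "disjoint_family_on (%j. {1..K} \<times> {j}) UNIV" by (auto simp: disjoint_family_on_def)
  fix j :: bool and i assume "i : {1..K} \<times> {j}"
  show "Int_stable (E i)"
  proof (cases i)
   case (Pair k b)
   have "(incr k t -` B Int Omega) Int (incr k t -` B' Int Omega) = incr k t -` (B Int B') Int Omega" for B B' by auto
   then have "Int_stable {incr k t -` B Int Omega | B. B : sets borel}"
    unfolding Int_stable_def by (smt (verit) mem_Collect_eq sets.Int)
   then show ?thesis by (simp add: E_def Pair Int_stable_def)
  qed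
 qed
 have Xm: "(%om. \<lambda>k\<in>{1..K}. incr k t om) : measurable Pre (PiM {1..K} (%_. borel))"
  by (intro measurable_restrict incr_P) auto
 have sub: "{(%om. \<lambda>k\<in>{1..K}. incr k t om) -` A Int Omega | A. A : sets (PiM {1..K} (%_. borel))}
   <= sigma_sets Omega (\<Union>i\<in>{1..K} \<times> {True}. E i)"
 proof -
  let ?G = "sigma Omega (\<Union>i\<in>{1..K} \<times> {True}. E i)"
  have pow: "(\<Union>i\<in>{1..K} \<times> {True}. E i) <= Pow Omega" by (auto simp: E_def)
  have "incr k t : borel_measurable ?G" if "k : {1..K}" for k
  proof (rule measurableI)
   fix A :: "real set" assume A: "A : sets borel"
   have mem: "incr k t -` A Int Omega : E (k, True)" using A by (auto simp: E_def)
   show "incr k t -` A Int space ?G : sets ?G"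
    unfolding sets_measure_of[OF pow] space_measure_of[OF pow]
    by (rule sigma_sets.Basic, rule UN_I[where a="(k, True)"]) (use that mem in simp_all)
  qed auto
  then have "(%om. \<lambda>k\<in>{1..K}. incr k t om) : measurable ?G (PiM {1..K} (%_. borel))"
   by (intro measurable_restrict) auto
  from measurable_sets[OF this] show ?thesis
   unfolding sets_measure_of[OF pow] space_measure_of[OF pow] by blast
 qed
 have collect': "indep_sets (%b. sigma_sets Omega (\<Union>i\<in>{1..K} \<times> {~ b}. E i)) UNIV"
 proof -
  have "case_bool (sigma_sets Omega (\<Union>i\<in>{1..K} \<times> {False}. E i)) (sigma_sets Omega (\<Union>i\<in>{1..K} \<times> {True}. E i))
    = (%b. sigma_sets Omega (\<Union>i\<in>{1..K} \<times> {~ b}. E i))"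
   by (rule ext) (simp split: bool.split)
  moreover have "indep_set (sigma_sets Omega (\<Union>i\<in>{1..K} \<times> {False}. E i)) (sigma_sets Omega (\<Union>i\<in>{1..K} \<times> {True}. E i))"
  proof (rule indep_setI)
   have ev: "ALL b:UNIV. sigma_sets Omega (\<Union>i\<in>{1..K} \<times> {b}. E i) <= events"
    using collect unfolding indep_sets_def by blast
   then show "sigma_sets Omega (\<Union>i\<in>{1..K} \<times> {False}. E i) <= events"
    "sigma_sets Omega (\<Union>i\<in>{1..K} \<times> {True}. E i) <= events" by auto
   fix A B assume AB: "A : sigma_sets Omega (\<Union>i\<in>{1..K} \<times> {False}. E i)" "B : sigma_sets Omega (\<Union>i\<in>{1..K} \<times> {True}. E i)"
   show "prob (A Int B) = prob A * prob B"
    using indep_setsD[OF collect, of UNIV "case_bool B A"] AB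
    by (simp add: UNIV_bool ac_simps split: bool.split)
  qed
  ultimately show ?thesis unfolding indep_set_def by simp
 qed
 have indep: "indep_set (sets (joint t)) (sigma_sets Omega (\<Union>i\<in>{1..K} \<times> {True}. E i))"
  unfolding indep_set_def
 proof (rule indep_sets_mono_sets[OF collect'])
  fix b :: bool
  have EF: "E (k, False) = sets (gen_filtration Omega (\<xi> k) t)" for k by (simp add: E_def)
  have "(\<Union>i\<in>{1..K} \<times> {False}. E i) = (\<Union>k\<in>{1..K}. E (k, False))" by blast
  also have "... = (\<Union>k\<in>{1..K}. sets (gen_filtration Omega (\<xi> k) t))" by (simp only: EF)
  finally show "(case b of True => sets (joint t) | False => sigma_sets Omega (\<Union>i\<in>{1..K} \<times> {True}. E i))
    <= sigma_sets Omega (\<Union>i\<in>{1..K} \<times> {~ b}. E i)"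
   unfolding sets_joint by (cases b) (simp_all only: bool.case not_True_eq_False not_False_eq_True order_refl)
 qed
 show "prob (A Int ((%om. \<lambda>k\<in>{1..K}. incr k t om) -` B Int Omega))
  = prob A * prob ((%om. \<lambda>k\<in>{1..K}. incr k t om) -` B Int Omega)"
  if "A : sets (joint t)" "B : sets (PiM {1..K} (%_. borel))" for A B
  using that sub by (intro indep_setD[OF indep]) auto
 have iv: "indep_vars (%_. borel) (%k. incr k t) {1..K}"
  unfolding indep_vars_def2
 proof (intro conjI ballI incr_P)
  show "indep_sets (%k. {incr k t -` A Int Omega |A. A : sets borel}) {1..K}"
   by (rule indep_sets_mono_sets[OF V], rule order_trans[OF XV gen_subset_path])
 qed auto
 show "distr Pre (PiM {1..K} (%_. borel)) (%om. \<lambda>k\<in>{1..K}. incr k t om) = PiM {1..K} step_law"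
 proof -
  have "PiM {1..K} (%k. distr Pre borel (incr k t)) = PiM {1..K} step_law"
   by (rule PiM_cong[OF refl incr_distr])
  then show ?thesis using iffD1[OF indep_vars_iff_distr_eq_PiM'[OF ne incr_P] iv] by simp
 qed
qed

lemma one_step_inf:
 fixes g :: "'a \<times> (nat => real) => ennreal"
 assumes g: "g : borel_measurable (joint t \<Otimes>\<^sub>M PiM {1..K} (%_. borel))"
 shows "nn_integral Pre (%om. g (om, \<lambda>k\<in>{1..K}. incr k t om))
  = nn_integral Pre (%om. nn_integral (PiM {1..K} step_law) (%x. g (om, x)))"
proof -
 interpret prob_space "Pre" by (rule prob_P)
 interpret laws: product_prob_space step_law "{1..K}"
  using real_law_step
  by (simp add: product_prob_space_def product_prob_space_axioms_def real_law_def
    product_sigma_finite_def prob_space_imp_sigma_finite)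
 let ?X = "%om. \<lambda>k\<in>{1..K}. incr k t om"
 let ?N = "PiM {1..K} (%_. borel :: real measure)"
 have id: "(%om. om) : measurable Pre (joint t)"
  by (rule measurable_larger[OF measurable_ident_sets[OF refl]]) (use joint_subset_P in auto)
 have X: "?X : measurable Pre ?N"
  by (intro measurable_restrict incr_P) auto
 let ?J = "distr Pre (joint t) (%om. om)"
 have "nn_integral Pre (%om. g (om, ?X om)) = nn_integral (distr Pre (joint t \<Otimes>\<^sub>M ?N) (%om. (om, ?X om))) (%p. g p)"
  using g id X by (subst nn_integral_distr) auto
 also have "distr Pre (joint t \<Otimes>\<^sub>M ?N) (%om. (om, ?X om)) = ?J \<Otimes>\<^sub>M distr Pre ?N ?X"
 proof (rule pair_measure_eqI[symmetric])
  show "sigma_finite_measure ?J"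
   using prob_space_distr[OF id] by (simp add: prob_space_imp_sigma_finite)
  show "sigma_finite_measure (distr Pre ?N ?X)"
   using prob_space_distr[OF X] by (simp add: prob_space_imp_sigma_finite)
  show "sets (?J \<Otimes>\<^sub>M distr Pre ?N ?X) = sets (distr Pre (joint t \<Otimes>\<^sub>M ?N) (%om. (om, ?X om)))"
   by (simp cong: sets_pair_measure_cong)
  fix A B assume AB: "A : sets ?J" "B : sets (distr Pre ?N ?X)"
  then have "A <= Omega" using sets.sets_into_space[of A "joint t"] by simp
  then have "(%om. (om, ?X om)) -` (A \<times> B) Int Omega = A Int (?X -` B Int Omega)" "(%om. om) -` A Int Omega = A" by auto
  then show "emeasure ?J A * emeasure (distr Pre ?N ?X) B
    = emeasure (distr Pre (joint t \<Otimes>\<^sub>M ?N) (%om. (om, ?X om))) (A \<times> B)"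
   using AB id X indep_past_increment[of A t B]
   by (simp add: emeasure_distr emeasure_eq_measure ennreal_mult[symmetric])
 qed
 also have "distr Pre ?N ?X = PiM {1..K} step_law" by (rule distr_increment)
 also have "nn_integral (?J \<Otimes>\<^sub>M PiM {1..K} step_law) (%p. g p) = nn_integral ?J (%om. nn_integral (PiM {1..K} step_law) (%x. g (om, x)))"
 proof (rule laws.P.nn_integral_fst[symmetric])
  have "sets (PiM {1..K} step_law) = sets ?N"
   by (intro sets_PiM_cong) (auto simp: real_law.sets_law[OF real_law_step])
  then have "sets (?J \<Otimes>\<^sub>M PiM {1..K} step_law) = sets (joint t \<Otimes>\<^sub>M ?N)"
   by (intro sets_pair_measure_cong) auto
  then show "g : borel_measurable (?J \<Otimes>\<^sub>M PiM {1..K} step_law)"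
   using g by (simp cong: measurable_cong_sets)
 qed
 also have "... = nn_integral Pre (%om. nn_integral (PiM {1..K} step_law) (%x. g (om, x)))"
 proof (rule nn_integral_distr[OF id])
  have "sets (PiM {1..K} step_law) = sets ?N"
   by (intro sets_PiM_cong) (auto simp: real_law.sets_law[OF real_law_step])
  then have "sets (joint t \<Otimes>\<^sub>M PiM {1..K} step_law) = sets (joint t \<Otimes>\<^sub>M ?N)"
   by (intro sets_pair_measure_cong) auto
  then have "g : borel_measurable (joint t \<Otimes>\<^sub>M PiM {1..K} step_law)"
   using g by (simp cong: measurable_cong_sets)
  then have "(%om. nn_integral (PiM {1..K} step_law) (%x. g (om, x))) : borel_measurable (joint t)"
   by (intro laws.P.borel_measurable_nn_integral) simp
  then show "(%om. nn_integral (PiM {1..K} step_law) (%x. g (om, x))) : borel_measurable ?J"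
   by simp
 qed
 finally show "nn_integral Pre (%om. g (om, ?X om)) = nn_integral Pre (%om. nn_integral (PiM {1..K} step_law) (%x. g (om, x)))" .
qed

theorem filtered_walk_inf: "filtered_walk Pre joint K step_law incr 0"
proof (intro filtered_walk.intro filtered_walk_axioms.intro)
 show "prob_space Pre" by (rule prob_P)
 show "1 <= K" by (rule K_pos)
qed (use joint_mono joint_subset_P incr_joint real_law_step one_step_inf in auto)

text \<open>Changing the measure after the change-point tilts the law of the increments.\<close>

lemma PiM_tilt:
 fixes law :: "nat => real measure"
 assumes law: "!!k. real_law (law k)" "!!k. real_law (tilt (law k))" and fin: "finite I"
 shows "PiM I (%k. tilt (law k)) = density (PiM I law) (%x. \<Prod>k\<in>I. ennreal (exp (x k)))"
proof -
 interpret t: product_sigma_finite "%k. tilt (law k)"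
  using law(2) by (simp add: product_sigma_finite_def real_law_def prob_space_imp_sigma_finite)
 interpret l: product_sigma_finite law
  using law(1) by (simp add: product_sigma_finite_def real_law_def prob_space_imp_sigma_finite)
 have sl: "sets (law k) = sets borel" for k by (rule real_law.sets_law[OF law(1)])
 have m: "(%x. exp (x k)) : borel_measurable (PiM I law)" if "k : I" for k
  using measurable_component_singleton[OF that, of law] by (simp add: measurable_cong_sets[OF refl sl])
 have m': "(%x. \<Prod>k\<in>I. ennreal (exp (x k))) : borel_measurable (PiM I law)"
  using m by (intro borel_measurable_prod_ennreal) auto
 show ?thesis
 proof (rule t.PiM_eqI[OF fin, symmetric])
  show "sets (density (PiM I law) (%x. \<Prod>k\<in>I. ennreal (exp (x k)))) = sets (PiM I (%k. tilt (law k)))"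
   by (simp cong: sets_PiM_cong)
  fix A assume A: "!!i. i : I ==> A i : sets (tilt (law i))"
  then have A': "!!i. i : I ==> A i : sets (law i)" by simp
  then have PA: "Pi\<^sub>E I A : sets (PiM I law)" using fin by (intro sets_PiM_I_finite) auto
  have "emeasure (density (PiM I law) (%x. \<Prod>k\<in>I. ennreal (exp (x k)))) (Pi\<^sub>E I A)
    = nn_integral (PiM I law) (%x. (\<Prod>k\<in>I. ennreal (exp (x k))) * indicator (Pi\<^sub>E I A) x)"
   using PA m' by (rule emeasure_density[rotated])
  also have "... = nn_integral (PiM I law) (%x. (\<Prod>k\<in>I. ennreal (exp (x k)) * indicator (A k) (x k)))"
  proof (rule nn_integral_cong)
   fix x assume "x : space (PiM I law)"
   then have "indicator (Pi\<^sub>E I A) x = (\<Prod>k\<in>I. indicator (A k) (x k) :: ennreal)"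
    using fin by (auto simp: indicator_def PiE_iff space_PiM prod_zero_iff[OF fin])
   then show "(\<Prod>k\<in>I. ennreal (exp (x k))) * indicator (Pi\<^sub>E I A) x = (\<Prod>k\<in>I. ennreal (exp (x k)) * indicator (A k) (x k))"
    by (simp add: prod.distrib)
  qed
  also have "... = (\<Prod>k\<in>I. nn_integral (law k) (%x. ennreal (exp x) * indicator (A k) x))"
  proof (rule l.product_nn_integral_prod[OF fin])
   fix k assume "k : I"
   then have [measurable]: "A k : sets borel" using A' sl by blast
   then show "(%x. ennreal (exp x) * indicator (A k) x) : borel_measurable (law k)"
    by (subst measurable_cong_sets[OF sl refl]) measurable
  qed
  also have "... = (\<Prod>k\<in>I. emeasure (tilt (law k)) (A k))"
  proof (rule prod.cong[OF refl])
   fix k assume k: "k : I"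
   have "(%x. ennreal (exp x)) : borel_measurable (law k)"
    by (subst measurable_cong_sets[OF sl refl]) measurable
   then show "nn_integral (law k) (%x. ennreal (exp x) * indicator (A k) x) = emeasure (tilt (law k)) (A k)"
    unfolding tilt_def using A'[OF k] by (rule emeasure_density[symmetric])
  qed
  finally show "emeasure (density (PiM I law) (%x. \<Prod>k\<in>I. ennreal (exp (x k)))) (Pi\<^sub>E I A)
    = (\<Prod>k\<in>I. emeasure (tilt (law k)) (A k))" .
 qed
qed

lemma change_measure:
 assumes "tau <= t" and f: "f : borel_measurable (joint t)"
 shows "nn_integral (P (enat tau)) (%om. f om)
  = nn_integral Pre (%om. ennreal (exp ((SUM k=1..K. u k t om) - (SUM k=1..K. u k tau om))) * f om)"
proof -
 let ?v = "%om. (SUM k=1..K. u k t om) - (SUM k=1..K. u k tau om)"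
 have s1: "subalgebra (P (enat tau)) (joint t)" and s2: "subalgebra Pre (joint t)"
  using joint_subset_P space_P[of "enat tau"] by (auto simp: subalgebra_def)
 have d: "restr_to_subalg (P (enat tau)) (joint t) = density (restr_to_subalg Pre (joint t)) (%om. ennreal (exp (?v om)))"
  and v: "?v : borel_measurable (joint t)"
  using change_after[OF assms(1)] by (auto simp: is_log_density_def)
 have mc: "borel_measurable (restr_to_subalg Pre (joint t)) = borel_measurable (joint t)"
  by (rule measurable_cong_sets[OF sets_restr_to_subalg[OF s2] refl])
 have "nn_integral (P (enat tau)) (%om. f om) = nn_integral (restr_to_subalg (P (enat tau)) (joint t)) (%om. f om)"
  using f by (rule nn_integral_subalgebra2[OF s1, symmetric])
 also have "... = nn_integral (restr_to_subalg Pre (joint t)) (%om. ennreal (exp (?v om)) * f om)"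
  unfolding d using f v by (intro nn_integral_density) (simp_all add: mc)
 also have "... = nn_integral Pre (%om. ennreal (exp (?v om)) * f om)"
  using f v by (intro nn_integral_subalgebra2[OF s2] borel_measurable_times_ennreal
    measurable_compose[OF v, of "%x. ennreal (exp x)"]) simp_all
 finally show ?thesis .
qed

lemma real_law_tilt_step: "real_law (tilt (step_law k))"
proof (cases "k : {1..K}")
 case True
 interpret m: real_law "step_law k" by (rule real_law_step)
 have s1: "subalgebra (P 0) (gen_filtration Omega (\<xi> k) 1)" and s2: "subalgebra Pre (gen_filtration Omega (\<xi> k) 1)"
  using gen_subset_P[OF True] sets_P[of 0] space_P[of 0] by (auto simp: subalgebra_def)
 have uk: "u k 1 : borel_measurable (gen_filtration Omega (\<xi> k) 1)" by (rule u_gen[OF True])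
 have mc: "borel_measurable (restr_to_subalg Pre (gen_filtration Omega (\<xi> k) 1)) = borel_measurable (gen_filtration Omega (\<xi> k) 1)"
  by (rule measurable_cong_sets[OF sets_restr_to_subalg[OF s2] refl])
 have "1 = emeasure (P 0) (space (P 0))"
  using prob_space.emeasure_space_1[OF prob_P] by simp
 also have "... = nn_integral (P 0) (%om. 1)" by simp
 also have "... = nn_integral (restr_to_subalg (P 0) (gen_filtration Omega (\<xi> k) 1)) (%om. 1)"
  by (rule nn_integral_subalgebra2[OF s1, symmetric]) simp
 also have "... = nn_integral (restr_to_subalg Pre (gen_filtration Omega (\<xi> k) 1)) (%om. ennreal (exp (u k 1 om)) * 1)"
  using llr[OF True, of 1] uk unfolding is_log_density_def
  by (elim conjE, simp only:) (intro nn_integral_density, simp_all add: mc)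
 also have "... = nn_integral Pre (%om. ennreal (exp (u k 1 om)))"
  using uk by (subst nn_integral_subalgebra2[OF s2]) auto
 also have "... = nn_integral (step_law k) (%x. ennreal (exp x))"
  using True u_P[OF True] by (auto simp: step_law_def nn_integral_distr)
 finally have "emeasure (tilt (step_law k)) UNIV = 1"
  unfolding tilt_def by (subst emeasure_density) auto
 then have "prob_space (tilt (step_law k))" by (intro prob_spaceI) (simp add: tilt_def)
 then show ?thesis by (simp add: real_law_def real_law_axioms_def)
next
 case False
 interpret m: real_law "step_law k" by (rule real_law_step)
 have "nn_integral (step_law k) (%x. ennreal (exp x)) = 1"
  using False by (subst step_law_def) (auto simp: nn_integral_return)
 then have "emeasure (tilt (step_law k)) UNIV = 1"
  unfolding tilt_def by (subst emeasure_density) auto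
 then have "prob_space (tilt (step_law k))" by (intro prob_spaceI) (simp add: tilt_def)
 then show ?thesis by (simp add: real_law_def real_law_axioms_def)
qed

text \<open>
 The density of \<open>P \<tau>\<close> grows by the exponential of the increments, which tilts
 each of their laws.
\<close>

lemma one_step_post:
 fixes g :: "'a \<times> (nat => real) => ennreal"
 assumes "tau <= t" and g[measurable]: "g : borel_measurable (joint t \<Otimes>\<^sub>M PiM {1..K} (%_. borel))"
 shows "nn_integral (P (enat tau)) (%om. g (om, \<lambda>k\<in>{1..K}. incr k t om))
  = nn_integral (P (enat tau)) (%om. nn_integral (PiM {1..K} (%k. tilt (step_law k))) (%x. g (om, x)))"
proof -
 interpret w: filtered_walk "Pre" joint K step_law incr 0 by (rule filtered_walk_inf)
 let ?X = "%om. \<lambda>k\<in>{1..K}. incr k t om"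
 let ?N = "PiM {1..K} (%_. borel :: real measure)"
 let ?v = "%t om. (SUM k=1..K. u k t om) - (SUM k=1..K. u k tau om)"
 let ?e = "%x. \<Prod>k=1..K. ennreal (exp (x k))"
 have vm[measurable]: "?v t : borel_measurable (joint t)"
  using \<open>tau <= t\<close> by (intro borel_measurable_diff borel_measurable_sum u_joint) auto
 have em: "?e : borel_measurable ?N" by measurable
 have Xm: "?X : measurable (joint (Suc t)) ?N" by (intro measurable_restrict incr_joint) auto
 have idm: "(%om. om) : measurable (joint (Suc t)) (joint t)"
  by (rule measurable_larger[OF measurable_ident_sets[OF refl] joint_mono]) auto
 have gm: "(%om. g (om, ?X om)) : borel_measurable (joint (Suc t))"
  by (rule measurable_compose[OF measurable_Pair[OF idm Xm] g])
 have vs: "?v (Suc t) om = ?v t om + (SUM k=1..K. incr k t om)" for om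
  by (simp add: incr_def sum_subtractf)
 have ve: "ennreal (exp (?v (Suc t) om)) = ennreal (exp (?v t om)) * ?e (?X om)" for om
  by (simp only: vs exp_add exp_sum[OF finite_atLeastAtMost])
    (simp add: ennreal_mult prod_ennreal[symmetric] prod_nonneg)
 have g2: "(%p. ennreal (exp (?v t (fst p))) * ?e (snd p) * g p) : borel_measurable (joint t \<Otimes>\<^sub>M ?N)"
  using em by measurable
 have "nn_integral (P (enat tau)) (%om. g (om, ?X om)) = nn_integral Pre (%om. ennreal (exp (?v (Suc t) om)) * g (om, ?X om))"
  using \<open>tau <= t\<close> by (intro change_measure gm) simp
 also have "... = nn_integral Pre (%om. ennreal (exp (?v t om)) * ?e (?X om) * g (om, ?X om))"
  by (simp only: ve)
 also have "... = nn_integral Pre (%om. nn_integral (PiM {1..K} step_law) (%x. ennreal (exp (?v t om)) * ?e x * g (om, x)))"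
  using one_step_inf[OF g2] by simp
 also have "... = nn_integral Pre (%om. ennreal (exp (?v t om)) * (nn_integral (PiM {1..K} (%k. tilt (step_law k))) (%x. g (om, x))))"
 proof (rule nn_integral_cong)
  fix om assume "om : space Pre"
  then have w: "om : space (joint t)" by simp
  have gs: "(%x. g (om, x)) : borel_measurable (PiM {1..K} step_law)"
   using measurable_compose[OF measurable_Pair1'[OF w] g] by (subst measurable_cong_sets[OF w.sets_PiM_law refl])
  have es: "?e : borel_measurable (PiM {1..K} step_law)"
   using em by (subst measurable_cong_sets[OF w.sets_PiM_law refl])
  have "nn_integral (PiM {1..K} (%k. tilt (step_law k))) (%x. g (om, x)) = nn_integral (PiM {1..K} step_law) (%x. ?e x * g (om, x))"
   using gs es by (simp only: PiM_tilt[OF real_law_step real_law_tilt_step finite_atLeastAtMost]) (rule nn_integral_density)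
  then show "nn_integral (PiM {1..K} step_law) (%x. ennreal (exp (?v t om)) * ?e x * g (om, x))
    = ennreal (exp (?v t om)) * nn_integral (PiM {1..K} (%k. tilt (step_law k))) (%x. g (om, x))"
   using gs es by (simp only: mult.assoc) (intro nn_integral_cmult borel_measurable_times_ennreal)
 qed
 also have "... = nn_integral (P (enat tau)) (%om. nn_integral (PiM {1..K} (%k. tilt (step_law k))) (%x. g (om, x)))"
 proof (rule change_measure[OF \<open>tau <= t\<close>, symmetric])
  interpret tl: product_prob_space "%k. tilt (step_law k)" "{1..K}"
   using real_law_tilt_step
   by (simp add: product_prob_space_def product_prob_space_axioms_def real_law_def
    product_sigma_finite_def prob_space_imp_sigma_finite)
  have "sets (PiM {1..K} (%k. tilt (step_law k))) = sets ?N"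
   by (intro sets_PiM_cong) (auto simp: real_law.sets_law[OF real_law_step])
  then have "sets (joint t \<Otimes>\<^sub>M PiM {1..K} (%k. tilt (step_law k))) = sets (joint t \<Otimes>\<^sub>M ?N)"
   by (intro sets_pair_measure_cong) auto
  then have "g : borel_measurable (joint t \<Otimes>\<^sub>M PiM {1..K} (%k. tilt (step_law k)))"
   using g by (simp cong: measurable_cong_sets)
  then show "(%om. nn_integral (PiM {1..K} (%k. tilt (step_law k))) (%x. g (om, x))) : borel_measurable (joint t)"
   by (intro tl.P.borel_measurable_nn_integral) simp
 qed
 finally show ?thesis .
qed

theorem filtered_walk_post: "filtered_walk (P (enat tau)) joint K (%k. tilt (step_law k)) incr tau"
proof (intro filtered_walk.intro filtered_walk_axioms.intro)
 show "prob_space (P (enat tau))" by (rule prob_P)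
 show "1 <= K" by (rule K_pos)
 show "!!t. space (joint t) = space (P (enat tau))" by (simp add: space_P[of "enat tau"])
qed (use joint_mono joint_subset_P incr_joint real_law_tilt_step one_step_post in auto)

end

section \<open>Communication along a path\<close>

lemma first_time_eq_enat: "first_time Q = enat t \<longleftrightarrow> Q t & (ALL s<t. ~ Q s)"
proof
 assume *: "first_time Q = enat t"
 then have ne: "Collect Q ~= {}" by (intro notI) (simp add: first_time_def Inf_enat_def)
 then obtain x where "x : enat ` Collect Q" by blast
 then have "first_time Q : enat ` Collect Q"
  unfolding first_time_def by (rule wellorder_InfI)
 then have "Q t" using * by auto
 moreover have "~ Q s" if "s < t" for s
 proof
  assume "Q s"
  then have "first_time Q <= enat s" unfolding first_time_def by (intro Inf_lower) auto
  then show False using * that by simp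
 qed
 ultimately show "Q t & (ALL s<t. ~ Q s)" by blast
next
 assume *: "Q t & (ALL s<t. ~ Q s)"
 show "first_time Q = enat t"
  unfolding first_time_def
 proof (rule antisym)
  show "Inf (enat ` Collect Q) <= enat t" using * by (intro Inf_lower) auto
  show "enat t <= Inf (enat ` Collect Q)"
  proof (rule Inf_greatest)
   fix x assume "x : enat ` Collect Q"
   then obtain s where s: "x = enat s" "Q s" by auto
   then have "~ s < t" using * by blast
   then show "enat t <= x" using s by simp
  qed
 qed
qed

lemma less_first_time: "enat t < first_time Q \<longleftrightarrow> (ALL s<=t. ~ Q s)"
proof
 assume *: "enat t < first_time Q"
 show "ALL s<=t. ~ Q s"
 proof (intro allI impI notI)
  fix s assume "s <= t" "Q s"
  then have "first_time Q <= enat s" unfolding first_time_def by (intro Inf_lower) auto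
  also have "... <= enat t" using \<open>s <= t\<close> by simp
  finally show False using * by simp
 qed
next
 assume *: "ALL s<=t. ~ Q s"
 show "enat t < first_time Q"
 proof (cases "first_time Q")
  case (enat s)
  then have "Q s" by (simp add: first_time_eq_enat)
  then have "~ s <= t" using * by blast
  then show ?thesis using enat by simp
 qed simp
qed

text \<open>
 The part of the log-likelihood ratio accumulated since the last message, as a Markov chain driven
 by the increments.
\<close>

definition renew :: "real => real => real => real" where
 "renew lo up w = (if w : {-lo<..<up} then w else 0)"

primrec phase :: "real => real => (nat => real) => nat => real" where
 "phase lo up v 0 = 0"
| "phase lo up v (Suc t) = renew lo up (phase lo up v t + (v (Suc t) - v t))"

definition sends :: "real => real => (nat => real) => nat => bool" where
 "sends lo up v t \<longleftrightarrow> phase lo up v t + (v (Suc t) - v t) \<notin> {-lo<..<up}"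

lemma phase_bounds: "0 < lo ==> 0 < up ==> phase lo up v t : {-lo<..<up}"
 by (cases t) (auto simp: renew_def)

lemma comm_time_strict:
 assumes "comm_time lo up v (Suc n) = enat t" shows "comm_time lo up v n < enat t"
 using assms by (simp add: first_time_eq_enat del: enat_ord_simps)

lemma comm_time_mono: "comm_time lo up v n <= comm_time lo up v (Suc n)"
proof (cases "comm_time lo up v (Suc n)")
 case (enat t)
 then show ?thesis using comm_time_strict[OF enat] by (simp only: less_imp_le)
qed simp

lemma comm_time_monotone: "m <= n ==> comm_time lo up v m <= comm_time lo up v n"
 by (rule lift_Suc_mono_le[of "comm_time lo up v"]) (rule comm_time_mono)

lemma num_comm_eq:
 assumes "comm_time lo up v m <= enat t" "enat t < comm_time lo up v (Suc m)"
 shows "num_comm lo up v t = m"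
proof -
 have "{n. comm_time lo up v n <= enat t} = {..m}"
 proof (intro set_eqI iffI; simp)
  fix n assume n: "comm_time lo up v n <= enat t"
  show "n <= m"
  proof (rule ccontr)
   assume "~ n <= m"
   then have "comm_time lo up v (Suc m) <= comm_time lo up v n" by (intro comm_time_monotone) simp
   then show False using n assms(2) by (meson leD order_trans)
  qed
 next
  fix n assume "n <= m"
  then show "comm_time lo up v n <= enat t" using comm_time_monotone[of n m] assms(1) by (meson order_trans)
 qed
 then show ?thesis by (simp add: num_comm_def Max_eq_iff)
qed

text \<open>
 Relates the phase, a one-step recursion, to the communication times, which are defined by first
 passage.
\<close>

lemma phase_invariant:
 assumes v0: "v 0 = 0"
 shows "EX s. comm_time lo up v (num_comm lo up v t) = enat s & s <= t & phase lo up v t = v t - v s &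
  enat t < comm_time lo up v (Suc (num_comm lo up v t))"
proof (induction t)
 case 0
 have lt: "enat 0 < comm_time lo up v (Suc 0)"
  by (simp add: less_first_time zero_enat_def)
 have "num_comm lo up v 0 = 0"
  by (rule num_comm_eq) (use lt in \<open>simp_all add: zero_enat_def\<close>)
 then show ?case using lt by (simp add: zero_enat_def)
next
 case (Suc t)
 define m where "m = num_comm lo up v t"
 obtain s where s: "comm_time lo up v m = enat s" "s <= t" "phase lo up v t = v t - v s"
  "enat t < comm_time lo up v (Suc m)" using Suc unfolding m_def by blast
 define Q where "Q = (%r. enat s < enat r & v r - v s \<notin> {-lo<..<up})"
 have ct: "comm_time lo up v (Suc m) = first_time Q"
  by (simp add: s(1) Q_def stopped_def)
 have w: "phase lo up v t + (v (Suc t) - v t) = v (Suc t) - v s" using s(3) by simp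
 have nQ: "ALL r<=t. ~ Q r" using s(4) unfolding ct less_first_time .
 show ?case
 proof (cases "v (Suc t) - v s : {-lo<..<up}")
  case True
  then have "ALL r<=Suc t. ~ Q r" using nQ by (auto simp: Q_def le_Suc_eq)
  then have lt: "enat (Suc t) < comm_time lo up v (Suc m)" unfolding ct less_first_time .
  have "num_comm lo up v (Suc t) = m"
   by (rule num_comm_eq[OF _ lt]) (use s in simp)
  then show ?thesis using lt s True by (auto simp: renew_def w simp del: comm_time.simps)
 next
  case False
  then have "Q (Suc t)" using s(2) by (simp add: Q_def)
  then have ct': "comm_time lo up v (Suc m) = enat (Suc t)"
   unfolding ct first_time_eq_enat using nQ by auto
  have lt: "enat (Suc t) < comm_time lo up v (Suc (Suc m))"
   by (subst comm_time.simps(2), simp only: ct' less_first_time) auto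
  have "num_comm lo up v (Suc t) = Suc m"
   by (rule num_comm_eq[OF _ lt]) (simp only: ct' order_refl)
  then show ?thesis using lt ct' False by (auto simp: renew_def w simp del: comm_time.simps)
 qed
qed

lemma num_comm_0: "v 0 = 0 ==> num_comm lo up v 0 = 0"
 using num_comm_eq[of lo up v 0 0] by (simp add: less_first_time zero_enat_def)

lemma num_comm_Suc:
 assumes v0: "v 0 = 0"
 shows "num_comm lo up v (Suc t) = (if sends lo up v t then Suc (num_comm lo up v t) else num_comm lo up v t)"
  and "sends lo up v t ==> comm_time lo up v (Suc (num_comm lo up v t)) = enat (Suc t)"
  and "sends lo up v t ==> comm_incr lo up v (Suc (num_comm lo up v t)) = phase lo up v t + (v (Suc t) - v t)"
proof -
 define m where "m = num_comm lo up v t"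
 obtain s where s: "comm_time lo up v m = enat s" "s <= t" "phase lo up v t = v t - v s"
  "enat t < comm_time lo up v (Suc m)" using phase_invariant[of v lo up t, OF v0] unfolding m_def by blast
 define Q where "Q = (%r. enat s < enat r & v r - v s \<notin> {-lo<..<up})"
 have ct: "comm_time lo up v (Suc m) = first_time Q"
  by (simp add: s(1) Q_def stopped_def)
 have w: "phase lo up v t + (v (Suc t) - v t) = v (Suc t) - v s" using s(3) by simp
 have nQ: "ALL r<=t. ~ Q r" using s(4) unfolding ct less_first_time .
 have A: "comm_time lo up v (Suc m) = enat (Suc t)" if "sends lo up v t"
 proof -
  have "Q (Suc t)" using s(2) that by (simp add: Q_def sends_def w)
  then show ?thesis unfolding ct first_time_eq_enat using nQ by auto
 qed
 then show "sends lo up v t ==> comm_time lo up v (Suc (num_comm lo up v t)) = enat (Suc t)"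
  by (simp add: m_def)
 show "comm_incr lo up v (Suc (num_comm lo up v t)) = phase lo up v t + (v (Suc t) - v t)" if "sends lo up v t"
  using A[OF that] s(1) w unfolding comm_incr_def m_def by (simp add: stopped_def del: comm_time.simps)
 show "num_comm lo up v (Suc t) = (if sends lo up v t then Suc (num_comm lo up v t) else num_comm lo up v t)"
 proof (cases "sends lo up v t")
  case True
  have lt: "enat (Suc t) < comm_time lo up v (Suc (Suc m))"
   by (subst comm_time.simps(2), simp only: A[OF True] less_first_time) auto
  have "num_comm lo up v (Suc t) = Suc m"
   by (rule num_comm_eq[OF _ lt]) (simp only: A[OF True] order_refl)
  then show ?thesis using True by (simp add: m_def)
 next
  case False
  then have "ALL r<=Suc t. ~ Q r" using nQ by (auto simp: Q_def le_Suc_eq sends_def w)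
  then have lt: "enat (Suc t) < comm_time lo up v (Suc m)" unfolding ct less_first_time .
  have "num_comm lo up v (Suc t) = m"
   by (rule num_comm_eq[OF _ lt]) (use s in simp)
  then show ?thesis using False by (simp add: m_def)
 qed
qed

lemma comm_incr_first:
 assumes v0: "v 0 = 0" and "num_comm lo up v t = 0" "sends lo up v t"
 shows "comm_incr lo up v 1 = phase lo up v t + (v (Suc t) - v t)"
 using num_comm_Suc(3)[of v lo up t] assms by (simp add: One_nat_def)

lemma comm_incr_never:
 assumes v0: "v 0 = 0" and "!!t. num_comm lo up v t = 0"
 shows "comm_incr lo up v 1 = 0"
proof -
 have "enat t < comm_time lo up v (Suc 0)" for t
  using phase_invariant[of v lo up t, OF v0] assms(2)[of t] by auto
 then have "comm_time lo up v (Suc 0) = \<infinity>"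
  by (metis enat.exhaust less_irrefl)
 then show ?thesis using v0
  by (simp add: comm_incr_def stopped_def One_nat_def zero_enat_def del: comm_time.simps(2))
qed

definition message_value ::
 "'a measure => 'a measure => (nat => 'a => real) => real => real => nat => (nat => ereal) => (nat => ereal) => real => real" where
 "message_value P0 Pinf v lo up d el eu w =
   (let z = quantize lo up d el eu w; \<Lambda> = message_llr P0 Pinf v lo up d el eu in
   SUM j=1..d. \<Lambda> (int j) * of_bool (z = int j) + \<Lambda> (- int j) * of_bool (z = - int j))"

lemma quantized_llr_0: "v 0 om = 0 ==> quantized_llr P0 Pinf v lo up d el eu 0 om = 0"
 by (simp add: quantized_llr_def num_comm_0)

lemma quantized_llr_Suc:
 assumes "v 0 om = 0"
 shows "quantized_llr P0 Pinf v lo up d el eu (Suc t) om = quantized_llr P0 Pinf v lo up d el eu t om +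
  (if sends lo up (%t. v t om) t
   then message_value P0 Pinf v lo up d el eu (phase lo up (%t. v t om) t + (v (Suc t) om - v t om)) else 0)"
proof (cases "sends lo up (%t. v t om) t")
 case True
 then show ?thesis
  using num_comm_Suc[of "%t. v t om" lo up t] assms
  by (simp add: quantized_llr_def quantized_incr_def message_value_def message_def)
next
 case False
 then show ?thesis
  using num_comm_Suc(1)[of "%t. v t om" lo up t] assms by (simp add: quantized_llr_def)
qed

section \<open>Quantized log-likelihood ratios of one sensor\<close>

lemma level_bin_exists:
 assumes e: "e 0 = 0" "e d = \<infinity>" and "1 <= d" and x: "ereal D <= ereal x"
 obtains j where "1 <= j" "j <= d" "level D e j <= ereal x" "ereal x < level D e (j + 1)"
proof -
 define A where "A = {j : {1..d}. level D e j <= ereal x}"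
 have A: "finite A" "1 : A" using x \<open>1 <= d\<close> e by (auto simp: A_def level_def)
 define m where "m = Max A"
 have m: "m : A" unfolding m_def using A by (intro Max_in) auto
 have "ereal x < level D e (m + 1)"
 proof (cases "m = d")
  case True
  then show ?thesis using e by (simp add: level_def)
 next
  case False
  have "m + 1 \<notin> A"
  proof
   assume "m + 1 : A"
   then have "m + 1 <= m" unfolding m_def using A by (intro Max_ge) auto
   then show False by simp
  qed
  then show ?thesis using False m by (auto simp: A_def)
 qed
 then show thesis using m that[of m] by (auto simp: A_def)
qed

text \<open>
 The levels are strictly increasing, which makes the bins disjoint intervals that cover everything
 outside the thresholds.
\<close>

locale quantizer =
 fixes lo up :: real and d :: nat and el eu :: "nat => ereal"
 assumes lo_pos: "0 < lo" and up_pos: "0 < up" and d_pos: "1 <= d"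
  and el: "el 0 = 0" "el d = \<infinity>" and eu: "eu 0 = 0" "eu d = \<infinity>"
  and el_Suc: "!!j. j < d ==> el j < el (Suc j)" and eu_Suc: "!!j. j < d ==> eu j < eu (Suc j)"
begin

abbreviation Q :: "real => int" where "Q \<equiv> quantize lo up d el eu"
abbreviation S :: "real set" where "S \<equiv> {-lo<..<up}"

lemma e_mono: "i <= j ==> j <= d ==> el i <= el j" "i <= j ==> j <= d ==> eu i <= eu j"
proof -
 have "i <= j ==> j <= d ==> el i <= el j & eu i <= eu j"
 proof (induction j rule: dec_induct)
  case (step j)
  then show ?case using el_Suc[of j] eu_Suc[of j] by (auto intro: order_trans less_imp_le)
 qed simp
 then show "i <= j ==> j <= d ==> el i <= el j" "i <= j ==> j <= d ==> eu i <= eu j" by auto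
qed

lemma e_finite:
 assumes "j < d" shows "0 <= el j" "0 <= eu j" "\<bar>el j\<bar> ~= \<infinity>" "\<bar>eu j\<bar> ~= \<infinity>"
proof -
 show 1: "0 <= el j" "0 <= eu j" using e_mono[of 0 j] assms el eu by auto
 show "\<bar>el j\<bar> ~= \<infinity>" "\<bar>eu j\<bar> ~= \<infinity>"
  using 1 el_Suc[OF assms] eu_Suc[OF assms] by (auto simp: abs_ereal_pos)
qed

lemma level_mono: "i <= j ==> j <= d + 1 ==> level lo el i <= level lo el j"
 "i <= j ==> j <= d + 1 ==> level up eu i <= level up eu j"
 unfolding level_def by (intro add_left_mono e_mono; simp)+

lemma level_1: "level lo el 1 = ereal lo" "level up eu 1 = ereal up"
 using el eu by (auto simp: level_def)

lemma level_unique: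
 assumes "1 <= i" "i <= d" "1 <= j" "j <= d"
 shows "level up eu i <= x ==> x < level up eu (i + 1) ==> level up eu j <= x ==> x < level up eu (j + 1) ==> i = j"
  and "level lo el i <= x ==> x < level lo el (i + 1) ==> level lo el j <= x ==> x < level lo el (j + 1) ==> i = j"
 using level_mono[of "i + 1" j] level_mono[of "j + 1" i] assms
 by (metis add_le_mono1 leD le_trans less_le_trans linorder_neqE_nat Suc_eq_plus1 Suc_leI le_add1)+

lemma neg_level: "- level D e (j + 1) < ereal w & ereal w <= - level D e j
  \<longleftrightarrow> level D e j <= ereal (- w) & ereal (- w) < level D e (j + 1)"
proof -
 have "- level D e (j + 1) < ereal w \<longleftrightarrow> ereal (- w) < level D e (j + 1)"
  by (cases "level D e (j + 1)") auto
 moreover have "ereal w <= - level D e j \<longleftrightarrow> level D e j <= ereal (- w)"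
  by (cases "level D e j") auto
 ultimately show ?thesis by blast
qed

lemma quantize_up:
 assumes j: "1 <= j" "j <= d" and w: "level up eu j <= ereal w" "ereal w < level up eu (j + 1)"
 shows "Q w = int j"
proof -
 have "ereal up <= level up eu j" using level_mono(2)[of 1 j] j by (simp only: level_1)
 then have "ereal up <= ereal w" using w(1) by (rule order_trans)
 then have wu: "up <= w" by simp
 have "(SUM i=1..d. int i * of_bool (level up eu i <= ereal w & ereal w < level up eu (i + 1))) = (SUM i=1..d. if i = j then int j else 0)"
 proof (rule sum.cong[OF refl])
  fix i assume i: "i : {1..d}"
  show "int i * of_bool (level up eu i <= ereal w & ereal w < level up eu (i + 1)) = (if i = j then int j else 0)"
  proof (cases "i = j")
   case True
   then show ?thesis using w by (simp only: of_bool_eq simp_thms mult_1_right if_True)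
  next
   case False
   have "~ (level up eu i <= ereal w & ereal w < level up eu (i + 1))"
   proof
    assume *: "level up eu i <= ereal w & ereal w < level up eu (i + 1)"
    have "i = j"
    by (rule level_unique(1)[OF _ _ _ _ conjunct1[OF *] conjunct2[OF *] w]) (use i j in simp_all)
    with False show False ..
   qed
   then show ?thesis using False by (simp only: of_bool_eq simp_thms mult_zero_right if_False)
  qed
 qed
 also have "... = int j" using j by simp
 finally have 1: "(SUM i=1..d. int i * of_bool (level up eu i <= ereal w & ereal w < level up eu (i + 1))) = int j" .
 have "~ (level lo el i <= ereal (- w))" if "i : {1..d}" for i
 proof -
  have "ereal (- w) < ereal lo" using wu lo_pos up_pos by simp
  also have "... <= level lo el i" using level_mono(1)[of 1 i] that by (simp only: level_1) simp
  finally show ?thesis by (simp only: not_le)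
 qed
 then have 2: "(SUM i=1..d. int i * of_bool (- level lo el (i + 1) < ereal w & ereal w <= - level lo el i)) = 0"
  unfolding neg_level by (intro sum.neutral ballI) (simp only: simp_thms of_bool_eq mult_zero_right)
 show ?thesis unfolding quantize_def 1 2 by simp
qed

lemma quantize_down:
 assumes j: "1 <= j" "j <= d" and w: "level lo el j <= ereal (- w)" "ereal (- w) < level lo el (j + 1)"
 shows "Q w = - int j"
proof -
 have "ereal lo <= level lo el j" using level_mono(1)[of 1 j] j by (simp only: level_1)
 then have "ereal lo <= ereal (- w)" using w(1) by (rule order_trans)
 then have wu: "lo <= - w" by simp
 have "(SUM i=1..d. int i * of_bool (- level lo el (i + 1) < ereal w & ereal w <= - level lo el i)) = (SUM i=1..d. if i = j then int j else 0)"
  unfolding neg_level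
 proof (rule sum.cong[OF refl])
  fix i assume i: "i : {1..d}"
  show "int i * of_bool (level lo el i <= ereal (- w) & ereal (- w) < level lo el (i + 1)) = (if i = j then int j else 0)"
  proof (cases "i = j")
   case True
   then show ?thesis using w by (simp only: of_bool_eq simp_thms mult_1_right if_True)
  next
   case False
   have "~ (level lo el i <= ereal (- w) & ereal (- w) < level lo el (i + 1))"
   proof
    assume *: "level lo el i <= ereal (- w) & ereal (- w) < level lo el (i + 1)"
    have "i = j"
    by (rule level_unique(2)[OF _ _ _ _ conjunct1[OF *] conjunct2[OF *] w]) (use i j in simp_all)
    with False show False ..
   qed
   then show ?thesis using False by (simp only: of_bool_eq simp_thms mult_zero_right if_False)
  qed
 qed
 also have "... = int j" using j by simp
 finally have 1: "(SUM i=1..d. int i * of_bool (- level lo el (i + 1) < ereal w & ereal w <= - level lo el i)) = int j" .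
 have "~ (level up eu i <= ereal w)" if "i : {1..d}" for i
 proof -
  have "ereal w < ereal up" using wu lo_pos up_pos by simp
  also have "... <= level up eu i" using level_mono(2)[of 1 i] that by (simp only: level_1) simp
  finally show ?thesis by (simp only: not_le)
 qed
 then have 2: "(SUM i=1..d. int i * of_bool (level up eu i <= ereal w & ereal w < level up eu (i + 1))) = 0"
  by (intro sum.neutral ballI) (simp only: simp_thms of_bool_eq mult_zero_right)
 show ?thesis unfolding quantize_def 1 2 by simp
qed

lemma up_cases:
 assumes "up <= w"
 obtains j where "1 <= j" "j <= d" "level up eu j <= ereal w" "ereal w < level up eu (j + 1)" "Q w = int j"
proof -
 have "ereal up <= ereal w" using assms by simp
 from level_bin_exists[OF eu d_pos this] quantize_up show thesis using that by metis
qed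

lemma down_cases:
 assumes "w <= - lo"
 obtains j where "1 <= j" "j <= d" "level lo el j <= ereal (- w)" "ereal (- w) < level lo el (j + 1)" "Q w = - int j"
proof -
 have "ereal lo <= ereal (- w)" using assms by simp
 from level_bin_exists[OF el d_pos this] quantize_down show thesis using that by metis
qed

lemma quantize_0: "Q 0 = 0"
proof -
 have a: "ereal 0 < level up eu i" "ereal 0 < level lo el i" if "i : {1..d}" for i
  using that level_mono(1)[of 1 i] level_mono(2)[of 1 i] level_1 lo_pos up_pos
  by (auto intro: less_le_trans[of _ "ereal up"] less_le_trans[of _ "ereal lo"])
 have "~ level up eu i <= ereal 0" "~ level lo el i <= ereal (- 0)" if "i : {1..d}" for i
  using a[OF that] by (simp_all add: not_le)
 then show ?thesis unfolding quantize_def neg_level by simp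
qed

lemma bin_up:
 assumes "w \<notin> S" "Q w = int j" "1 <= j"
 shows "level up eu j <= ereal w" "ereal w < level up eu (j + 1)"
proof -
 have "up <= w"
 proof (rule ccontr)
  assume "~ up <= w"
  then have "w <= - lo" using assms(1) by auto
  then obtain i where "1 <= i" "Q w = - int i" by (rule down_cases)
  then show False using assms by simp
 qed
 then obtain i where "level up eu i <= ereal w" "ereal w < level up eu (i + 1)" "Q w = int i" by (rule up_cases)
 then show "level up eu j <= ereal w" "ereal w < level up eu (j + 1)" using assms by auto
qed

lemma bin_down:
 assumes "w \<notin> S" "Q w = - int j" "1 <= j"
 shows "level lo el j <= ereal (- w)" "ereal (- w) < level lo el (j + 1)"
proof -
 have "w <= - lo"
 proof (rule ccontr)
  assume "~ w <= - lo"
  then have "up <= w" using assms(1) by auto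
  then obtain i where "1 <= i" "Q w = int i" by (rule up_cases)
  then show False using assms by simp
 qed
 then obtain i where "level lo el i <= ereal (- w)" "ereal (- w) < level lo el (i + 1)" "Q w = - int i" by (rule down_cases)
 then show "level lo el j <= ereal (- w)" "ereal (- w) < level lo el (j + 1)" using assms by auto
qed

definition labels :: "int set" where "labels = int ` {1..d} \<union> (%j. - int j) ` {1..d}"

lemma finite_labels: "finite labels" by (simp add: labels_def)

lemma exit_label: "w \<notin> S ==> Q w : labels"
proof -
 assume "w \<notin> S"
 then consider "up <= w" | "w <= - lo" by fastforce
 then show ?thesis
 proof cases
  case 1
  then obtain j where "1 <= j" "j <= d" "Q w = int j" by (rule up_cases)
  then show ?thesis by (simp add: labels_def)
 next
  case 2
  then obtain j where "1 <= j" "j <= d" "Q w = - int j" by (rule down_cases)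
  then show ?thesis by (simp add: labels_def)
 qed
qed

lemma quantize_measurable [measurable]: "Q : measurable borel (count_space UNIV)"
proof -
 have [measurable]: "(%w. real_of_int (Q w)) : borel_measurable borel"
  unfolding quantize_def of_int_diff of_int_sum of_int_mult of_int_of_nat_eq of_bool_def if_distrib[of real_of_int]
  by measurable
 show ?thesis
 proof (subst measurable_count_space_eq_countable, simp, intro conjI ballI)
  show "Q : space borel \<rightarrow> UNIV" by simp
  fix i :: int
  have "{w : space borel. real_of_int (Q w) = real_of_int i} : sets borel" by measurable
  then show "Q -` {i} Int space borel : sets borel" by (simp add: vimage_def)
 qed
qed

lemma label_fun_measurable: "(%w. f (Q w)) : borel_measurable borel" for f :: "int => ennreal"
 by (rule measurable_compose[OF quantize_measurable]) simp

lemma label_indicator_measurable [measurable]: "(%w. indicator A (Q w) :: ennreal) : borel_measurable borel"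
 by (rule label_fun_measurable)

lemma label_interval:
 assumes "i : labels"
 obtains x y where "x < y" "{x<..<y} <= {w. w \<notin> S & Q w = i}"
proof -
 consider j where "1 <= j" "j <= d" "i = int j" | j where "1 <= j" "j <= d" "i = - int j"
  using assms by (auto simp: labels_def)
 then show thesis
 proof cases
  case 1
  then have "eu (j - 1) < eu j" using eu_Suc[of "j - 1"] by simp
  moreover have "\<bar>eu (j - 1)\<bar> ~= \<infinity>" using e_finite(4)[of "j - 1"] 1 by simp
  ultimately have "level up eu j < level up eu (j + 1)"
   by (cases "eu (j - 1)"; cases "eu j") (simp_all add: level_def)
  then obtain x where x: "level up eu j < ereal x" "ereal x < level up eu (j + 1)" using ereal_dense2 by blast
  then obtain y where y: "ereal x < ereal y" "ereal y < level up eu (j + 1)" using ereal_dense2 by blast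
  show thesis
  proof (rule that[of x y])
   show "{x<..<y} <= {w. w \<notin> S & Q w = i}"
   proof
    fix w assume "w : {x<..<y}"
    then have w: "ereal x < ereal w" "ereal w < ereal y" by auto
    have w': "level up eu j <= ereal w" "ereal w < level up eu (j + 1)"
    using less_trans[OF x(1) w(1)] less_trans[OF w(2) y(2)] by (simp_all only: less_imp_le)
    have "ereal up <= level up eu j" using level_mono(2)[of 1 j] 1 by (simp only: level_1)
    then have "ereal up <= ereal w" using w'(1) by (rule order_trans)
    then show "w : {w. w \<notin> S & Q w = i}" using quantize_up[OF 1(1,2) w'] 1(3) by simp
   qed
  qed (use y in simp)
 next
  case 2
  then have "el (j - 1) < el j" using el_Suc[of "j - 1"] by simp
  moreover have "\<bar>el (j - 1)\<bar> ~= \<infinity>" using e_finite(3)[of "j - 1"] 2 by simp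
  ultimately have "level lo el j < level lo el (j + 1)"
   by (cases "el (j - 1)"; cases "el j") (simp_all add: level_def)
  then obtain x where x: "level lo el j < ereal x" "ereal x < level lo el (j + 1)" using ereal_dense2 by blast
  then obtain y where y: "ereal x < ereal y" "ereal y < level lo el (j + 1)" using ereal_dense2 by blast
  show thesis
  proof (rule that[of "-y" "-x"])
   show "{-y<..<-x} <= {w. w \<notin> S & Q w = i}"
   proof
    fix w assume "w : {-y<..<-x}"
    then have w: "ereal x < ereal (-w)" "ereal (-w) < ereal y" by auto
    have w': "level lo el j <= ereal (-w)" "ereal (-w) < level lo el (j + 1)"
    using less_trans[OF x(1) w(1)] less_trans[OF w(2) y(2)] by (simp_all only: less_imp_le)
    have "ereal lo <= level lo el j" using level_mono(1)[of 1 j] 2 by (simp only: level_1)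
    then have "ereal lo <= ereal (-w)" using w'(1) by (rule order_trans)
    then show "w : {w. w \<notin> S & Q w = i}" using quantize_down[OF 2(1,2) w'] 2(3) by simp
   qed
  qed (use y in simp)
 qed
qed

end

text \<open>
 The full support of the increments makes all labels have positive probability, so that their
 log-likelihood ratios are meaningful.
\<close>

locale quantized_sensor = llr_law mu a b + quantizer lo up d el eu
 for mu a b lo up d el eu +
 fixes \<Lambda> :: "int => real"
 assumes full_support: "x < y ==> 0 < emeasure mu {x<..<y}"
  and llr_label: "i : labels ==> \<Lambda> i = ln (enn2real (exit_mean (tilt mu) S (%w. indicator {i} (Q w)) 0) /
    enn2real (exit_mean mu S (%w. indicator {i} (Q w)) 0))"
begin

definition q :: "real => real" where "q w = \<Lambda> (Q w)"

lemma q_measurable [measurable]: "q : borel_measurable borel"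
 unfolding q_def by (rule measurable_compose[OF quantize_measurable]) simp

lemma label_prob:
 assumes "i : labels"
 obtains p p0 where "0 < p" "0 < p0" "exit_mean mu S (%w. indicator {i} (Q w)) 0 = ennreal p"
  "exit_mean (tilt mu) S (%w. indicator {i} (Q w)) 0 = ennreal p0" "exp (\<Lambda> i) * p = p0"
  "ennreal p0 = exit_mean mu S (%w. ennreal (exp w) * indicator {i} (Q w)) 0"
proof -
 let ?f = "%w. indicator {i} (Q w) :: ennreal"
 obtain x y where xy: "x < y" "{x<..<y} <= {w. w \<notin> S & Q w = i}" using label_interval[OF assms] .
 have le1: "exit_mean mu S ?f 0 <= 1" "exit_mean (tilt mu) S ?f 0 <= 1"
  by (rule order_trans[OF exit_mean_mono[where g'="%_. 1"] exit_mean_one_le], simp_all add: indicator_def)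
    (rule order_trans[OF t.exit_mean_mono[where g'="%_. 1"] t.exit_mean_one_le], simp_all add: indicator_def)
 have "0 < emeasure mu {x<..<y}" by (rule full_support[OF xy(1)])
 also have "... = nn_integral mu (%w. indicator {x<..<y} w)" by simp
 also have "... <= kill mu (- S) ?f 0"
  unfolding kill_def using xy(2) by (intro nn_integral_mono) (auto simp: indicator_def)
 also have "... <= exit_mean mu S ?f 0" by (subst exit_mean_unfold) auto
 finally have p: "0 < exit_mean mu S ?f 0" .
 have "0 < ennreal (exp x) * emeasure mu {x<..<y}"
  using full_support[OF xy(1)] by (simp add: ennreal_zero_less_mult_iff)
 also have "... = nn_integral mu (%w. ennreal (exp x) * indicator {x<..<y} w)" by (simp add: nn_integral_cmult_indicator)
 also have "... <= kill mu (- S) (%w. ennreal (exp w) * ?f w) 0"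
  unfolding kill_def using xy(2) by (intro nn_integral_mono) (auto simp: indicator_def intro!: ennreal_leI)
 also have "... <= exit_mean mu S (%w. ennreal (exp w) * ?f w) 0" by (subst exit_mean_unfold) auto
 finally have p0: "0 < exit_mean mu S (%w. ennreal (exp w) * ?f w) 0" .
 have eq: "exit_mean (tilt mu) S ?f 0 = exit_mean mu S (%w. ennreal (exp w) * ?f w) 0"
  by (subst exit_mean_tilt[OF _ _ tilt_law]) auto
 obtain r where r: "exit_mean mu S ?f 0 = ennreal r" "0 <= r"
  using le1(1) by (cases "exit_mean mu S ?f 0" rule: ennreal_cases) (auto simp: top_unique)
 obtain r0 where r0: "exit_mean (tilt mu) S ?f 0 = ennreal r0" "0 <= r0"
  using le1(2) by (cases "exit_mean (tilt mu) S ?f 0" rule: ennreal_cases) (auto simp: top_unique)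
 have pos: "0 < r" "0 < r0" using p p0 r r0 eq by (auto simp: less_le)
 have "\<Lambda> i = ln (r0 / r)" using llr_label[OF assms] r r0 by simp
 then have "exp (\<Lambda> i) * r = r0" using pos by simp
 then show thesis using that[of r r0] pos r r0 eq by simp
qed

text \<open>
 The ratio of the probabilities of a label averages the exponential of the exit position over a bin
 above the level.
\<close>

lemma llr_ge:
 assumes i: "i : labels" and c: "!!w. w \<notin> S ==> Q w = i ==> c <= w"
 shows "c <= \<Lambda> i"
proof -
 obtain p p0 where p: "0 < p" "0 < p0" "exit_mean mu S (%w. indicator {i} (Q w)) 0 = ennreal p"
  "exit_mean (tilt mu) S (%w. indicator {i} (Q w)) 0 = ennreal p0" "exp (\<Lambda> i) * p = p0"
  "ennreal p0 = exit_mean mu S (%w. ennreal (exp w) * indicator {i} (Q w)) 0"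
  by (rule label_prob[OF i])
 have "ennreal (exp c) * ennreal p = exit_mean mu S (%w. ennreal (exp c) * indicator {i} (Q w)) 0"
  unfolding p(3)[symmetric] by (rule exit_mean_cmult[symmetric]) auto
 also have "... <= ennreal p0"
  unfolding p(6) using c by (intro exit_mean_mono) (auto simp: indicator_def)
 finally have "exp c * p <= exp (\<Lambda> i) * p" unfolding p(5) using p(1,2) by (simp add: ennreal_mult[symmetric])
 then show ?thesis using p(1) by simp
qed

lemma llr_le:
 assumes i: "i : labels" and c: "!!w. w \<notin> S ==> Q w = i ==> w <= c"
 shows "\<Lambda> i <= c"
proof -
 obtain p p0 where p: "0 < p" "0 < p0" "exit_mean mu S (%w. indicator {i} (Q w)) 0 = ennreal p"
  "exit_mean (tilt mu) S (%w. indicator {i} (Q w)) 0 = ennreal p0" "exp (\<Lambda> i) * p = p0"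
  "ennreal p0 = exit_mean mu S (%w. ennreal (exp w) * indicator {i} (Q w)) 0"
  by (rule label_prob[OF i])
 have "ennreal p0 <= exit_mean mu S (%w. ennreal (exp c) * indicator {i} (Q w)) 0"
  unfolding p(6) using c by (intro exit_mean_mono) (auto simp: indicator_def intro!: ennreal_leI)
 also have "... = ennreal (exp c) * ennreal p"
  unfolding p(3)[symmetric] by (rule exit_mean_cmult) auto
 finally have "exp (\<Lambda> i) * p <= exp c * p" unfolding p(5) using p(1,2) by (simp add: ennreal_mult[symmetric])
 then show ?thesis using p(1) by simp
qed

text \<open>
 On the event that the label is \<open>i\<close>, \<open>exp (\<Lambda> i)\<close> is the ratio of
 the two probabilities of the label.
\<close>

lemma label_change:
 fixes f :: "int => ennreal"
 shows "exit_mean mu S (%w. ennreal (exp (q w)) * f (Q w)) 0 = exit_mean (tilt mu) S (%w. f (Q w)) 0"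
proof -
 have [measurable]: "(%w. indicator {i} (Q w) :: ennreal) : borel_measurable borel" for i
  by (rule measurable_compose[OF quantize_measurable]) simp
 have dec: "(\<Sum>i\<in>labels. g i * indicator {i} (Q w)) = g (Q w)" if "w \<notin> S" for w and g :: "int => ennreal"
  using exit_label[OF that] finite_labels by (simp add: indicator_def sum.remove)
 have "exit_mean mu S (%w. ennreal (exp (q w)) * f (Q w)) 0
   = exit_mean mu S (%w. \<Sum>i\<in>labels. (ennreal (exp (\<Lambda> i)) * f i) * indicator {i} (Q w)) 0"
  using dec[of _ "%i. ennreal (exp (\<Lambda> i)) * f i"] by (intro exit_mean_cong) (simp add: q_def)
 also have "... = (\<Sum>i\<in>labels. (ennreal (exp (\<Lambda> i)) * f i) * exit_mean mu S (%w. indicator {i} (Q w)) 0)"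
  by (subst exit_mean_sum[OF _ _ finite_labels]) (auto simp: exit_mean_cmult)
 also have "... = (\<Sum>i\<in>labels. f i * exit_mean (tilt mu) S (%w. indicator {i} (Q w)) 0)"
 proof (rule sum.cong[OF refl])
  fix i assume i: "i : labels"
  obtain p p0 where p: "0 < p" "0 < p0" "exit_mean mu S (%w. indicator {i} (Q w)) 0 = ennreal p"
   "exit_mean (tilt mu) S (%w. indicator {i} (Q w)) 0 = ennreal p0" "exp (\<Lambda> i) * p = p0"
   "ennreal p0 = exit_mean mu S (%w. ennreal (exp w) * indicator {i} (Q w)) 0"
   by (rule label_prob[OF i])
  have *: "ennreal (exp (\<Lambda> i)) * ennreal p = ennreal p0"
   unfolding p(5)[symmetric] using p(1) by (simp add: ennreal_mult)
  then show "(ennreal (exp (\<Lambda> i)) * f i) * exit_mean mu S (%w. indicator {i} (Q w)) 0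
    = f i * exit_mean (tilt mu) S (%w. indicator {i} (Q w)) 0"
   unfolding p(3,4) *[symmetric] by (simp only: ac_simps)
 qed
 also have "... = exit_mean (tilt mu) S (%w. \<Sum>i\<in>labels. f i * indicator {i} (Q w)) 0"
  by (subst t.exit_mean_sum[OF _ _ finite_labels]) (auto simp: t.exit_mean_cmult)
 also have "... = exit_mean (tilt mu) S (%w. f (Q w)) 0"
  using dec[of _ f] by (intro t.exit_mean_cong) simp
 finally show ?thesis .
qed

text \<open>The mean likelihood ratio of the label of the message in progress, given the current phase.\<close>

definition h :: "real => ennreal" where "h = exit_mean mu S (%w. ennreal (exp (q w)))"

lemma h_measurable [measurable]: "h : borel_measurable borel"
 unfolding h_def by simp

lemma h_0_le: "h 0 <= 1"
 using label_change[of "%_. 1"] t.exit_mean_one_le[of S 0] by (simp add: h_def)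

lemma h_step: "h v = nn_integral mu (%x. (if v + x : S then h (v + x) else ennreal (exp (q (v + x)))))"
proof -
 have "h v = kill mu (- S) (%w. ennreal (exp (q w))) v + kill mu S h v"
  unfolding h_def by (rule exit_mean_unfold) auto
 also have "... = nn_integral mu (%x. (if v + x : S then h (v + x) else ennreal (exp (q (v + x)))))"
  by (rule kill_compl) auto
 finally show ?thesis .
qed

lemma q_up: "up <= w ==> up <= q w"
proof -
 assume "up <= w"
 then obtain j where j: "1 <= j" "j <= d" "Q w = int j" by (rule up_cases)
 show ?thesis unfolding q_def j(3)
 proof (rule llr_ge)
  show "int j : labels" using j by (simp add: labels_def)
  fix w assume "w \<notin> S" "Q w = int j"
  then have "level up eu j <= ereal w" using bin_up j by blast
  moreover have "ereal up <= level up eu j" using level_mono(2)[of 1 j] j by (simp only: level_1)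
  ultimately have "ereal up <= ereal w" by (rule order_trans[rotated])
  then show "up <= w" by simp
 qed
qed

lemma h_ge:
 assumes "!!v. - lo <= v ==> v < up ==> ennreal (c * exp (v - up)) <= exit_mean mu S (indicator {up..}) v"
  and "v : S" "0 < c"
 shows "ennreal (c * exp (- (lo + up))) <= h v"
proof -
 have "ennreal (c * exp (- (lo + up))) <= ennreal (c * exp (v - up))"
  using assms(2,3) by (intro ennreal_leI mult_left_mono) auto
 also have "... <= exit_mean mu S (indicator {up..}) v" using assms(1)[of v] assms(2) by auto
 also have "... <= h v" unfolding h_def
 proof (rule exit_mean_mono)
  fix w
  show "indicator {up..} w <= ennreal (exp (q w))"
   using q_up[of w] up_pos by (auto simp: indicator_def)
 qed
 finally show ?thesis .
qed

text \<open>The mean of a quantized positive message is at most that of the message itself.\<close>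

lemma mean_positive_llr:
 "exit_mean (tilt mu) S (%w. ennreal (\<Lambda> (Q w)) * indicator {0<..} (Q w)) 0 <= ennreal (up + overshoot_const a b * b)"
proof -
 let ?P = "%w. indicator {0<..} (Q w) :: ennreal"
 let ?H = "%f. exit_mean (tilt mu) S f 0"
 have [measurable]: "(%w. f (Q w)) : borel_measurable borel" for f :: "int => ennreal"
  by (rule measurable_compose[OF quantize_measurable]) simp
 have pw: "ennreal (\<Lambda> (Q w)) * ?P w + ?P w <= ennreal w * indicator {up..} w + ennreal (exp (q w - w)) * ?P w"
  if "w \<notin> S" for w
 proof (cases "up <= w")
  case True
  then have 0: "0 <= \<Lambda> (Q w)" "0 <= w" using q_up[OF True] up_pos by (auto simp: q_def)
  have "\<Lambda> (Q w) + 1 <= w + exp (q w - w)" using exp_ge_add_one_self[of "q w - w"] unfolding q_def by linarith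
  then have "ennreal (\<Lambda> (Q w) + 1) <= ennreal (w + exp (q w - w))" by (rule ennreal_leI)
  then have "ennreal (\<Lambda> (Q w)) + 1 <= ennreal w + ennreal (exp (q w - w))"
   using 0 by simp
  moreover obtain j where "1 <= j" "Q w = int j" using True by (rule up_cases)
  ultimately show ?thesis using True by (simp add: indicator_def)
 next
  case False
  then have "w <= - lo" using that by auto
  then obtain j where "1 <= j" "Q w = - int j" by (rule down_cases)
  then show ?thesis by (simp add: indicator_def)
 qed
 have fin: "?H ?P <= 1"
  by (rule order_trans[OF t.exit_mean_mono[where g'="%_. 1"] t.exit_mean_one_le]) (auto simp: indicator_def)
 have "?H (%w. ennreal (exp (q w - w)) * ?P w) = exit_mean mu S (%w. ennreal (exp w) * (ennreal (exp (q w - w)) * ?P w)) 0"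
  by (subst exit_mean_tilt[OF _ _ tilt_law]) auto
 also have "... = exit_mean mu S (%w. ennreal (exp (q w)) * ?P w) 0"
  by (simp add: mult.assoc[symmetric] ennreal_mult[symmetric] exp_add[symmetric])
 also have "... = ?H ?P" using label_change[of "indicator {0<..}"] .
 finally have e: "?H (%w. ennreal (exp (q w - w)) * ?P w) = ?H ?P" .
 have "?H (%w. ennreal (\<Lambda> (Q w)) * ?P w) + ?H ?P = ?H (%w. ennreal (\<Lambda> (Q w)) * ?P w + ?P w)"
  by (rule t.exit_mean_add[symmetric]) measurable
 also have "... <= ?H (%w. ennreal w * indicator {up..} w + ennreal (exp (q w - w)) * ?P w)"
  by (rule t.exit_mean_mono[OF pw])
 also have "... = ?H (%w. ennreal w * indicator {up..} w) + ?H ?P"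
  unfolding e[symmetric] by (rule t.exit_mean_add) measurable
 finally have *: "?H (%w. ennreal (\<Lambda> (Q w)) * ?P w) + ?H ?P <= ?H (%w. ennreal w * indicator {up..} w) + ?H ?P" .
 have "?H (%w. ennreal (\<Lambda> (Q w)) * ?P w) <= ?H (%w. ennreal w * indicator {up..} w)"
 proof -
  have "?H ?P ~= \<top>" using fin by (metis ennreal_one_less_top leD)
  then show ?thesis using * by (simp add: ennreal_add_left_cancel_le add.commute)
 qed
 also have "... <= ?H (%w. ennreal up * 1 + ennreal (w - up))"
  using up_pos by (intro t.exit_mean_mono) (auto simp: indicator_def ennreal_plus[symmetric] simp del: ennreal_plus)
 also have "... = ?H (%w. ennreal up * 1) + ?H (%w. ennreal (w - up))"
  by (rule t.exit_mean_add) measurable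
 also have "?H (%w. ennreal up * 1) = ennreal up * ?H (%_. 1)"
  by (rule t.exit_mean_cmult) auto
 also have "ennreal up * ?H (%_. 1) + ?H (%w. ennreal (w - up)) <= ennreal up * 1 + ennreal (overshoot_const a b * b)"
  using up_pos by (intro add_mono mult_left_mono t.exit_mean_one_le overshoot_le) auto
 also have "... = ennreal (up + overshoot_const a b * b)"
  using up_pos overshoot_const_pos[OF a_pos b_pos] b_pos by simp
 finally show ?thesis .
qed

text \<open>
 The mean of \<open>h\<close> over the age of a message in progress.
\<close>

definition age_rate :: real where "age_rate = ln (2 / (1 + half_rate))"

lemma age_rate_pos: "0 < age_rate"
 using half_rate by (simp add: age_rate_def)

text \<open>
 Old messages in progress are rare before the change, and young ones cannot have a large mean
 likelihood ratio; split according to whether the ratio exceeds the exponential of a multiple of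
 the age.
\<close>

lemma age_sum_le:
 "(\<Sum>r. (kill mu S ^^ r) h 0) <= ennreal (1 + (up + overshoot_const a b * b) / age_rate
   + exp (lo / 2) * ((1 + half_rate) / (1 - half_rate)))"
proof -
 let ?H = "%f. exit_mean mu S f 0"
 define k where "k = (2 / (1 + half_rate))"
 have k: "1 < k" "exp age_rate = k" using half_rate by (auto simp: k_def age_rate_def)
 define rr where "rr = k * half_rate"
 have rr: "0 <= rr" "rr < 1" "1 / (1 - rr) = (1 + half_rate) / (1 - half_rate)"
  using half_rate by (auto simp: rr_def k_def field_simps)
 let ?big = "%r i. if age_rate * real r <= \<Lambda> i then 1 else 0 :: ennreal"
 have [measurable]: "(%w. f (Q w)) : borel_measurable borel" for f :: "int => ennreal"
  by (rule measurable_compose[OF quantize_measurable]) simp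
 have term_le: "(kill mu S ^^ r) h 0 <= ?H (%w. ennreal (exp (q w)) * ?big r (Q w)) + ennreal (exp (lo / 2) * rr ^ r)" for r
 proof -
  have hw: "h w <= exit_mean mu S (%w. ennreal (exp (q w)) * ?big r (Q w)) w + ennreal (k ^ r) * 1" for w
  proof -
   have kr: "k ^ r = exp (age_rate * real r)" using k(2) exp_of_nat_mult[of r age_rate] by (simp add: mult.commute)
   have "h w <= exit_mean mu S (%w. ennreal (exp (q w)) * ?big r (Q w) + ennreal (k ^ r) * 1) w"
    unfolding h_def kr by (intro exit_mean_mono) (auto simp: q_def intro!: ennreal_leI)
   also have "... = exit_mean mu S (%w. ennreal (exp (q w)) * ?big r (Q w)) w + exit_mean mu S (%w. ennreal (k ^ r) * 1) w"
    by (rule exit_mean_add) measurable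
   also have "exit_mean mu S (%w. ennreal (k ^ r) * 1) w = ennreal (k ^ r) * exit_mean mu S (%_. 1) w"
    by (rule exit_mean_cmult) auto
   also have "exit_mean mu S (%w. ennreal (exp (q w)) * ?big r (Q w)) w + ennreal (k ^ r) * exit_mean mu S (%_. 1) w <= exit_mean mu S (%w. ennreal (exp (q w)) * ?big r (Q w)) w + ennreal (k ^ r) * 1"
    by (intro add_left_mono mult_left_mono exit_mean_one_le) auto
   finally show ?thesis .
  qed
  have "(kill mu S ^^ r) h 0 <= (kill mu S ^^ r) (%w. exit_mean mu S (%w. ennreal (exp (q w)) * ?big r (Q w)) w + ennreal (k ^ r) * 1) 0"
   by (rule kill_pow_mono[where D=UNIV, OF hw]) auto
  also have "... = (kill mu S ^^ r) (exit_mean mu S (%w. ennreal (exp (q w)) * ?big r (Q w))) 0 + (kill mu S ^^ r) (%w. ennreal (k ^ r) * 1) 0"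
   by (rule kill_pow_add) measurable
  also have "(kill mu S ^^ r) (%w. ennreal (k ^ r) * 1) 0 = ennreal (k ^ r) * (kill mu S ^^ r) (%_. 1) 0"
   by (rule kill_pow_cmult) auto
  also have "(kill mu S ^^ r) (exit_mean mu S (%w. ennreal (exp (q w)) * ?big r (Q w))) 0 + ennreal (k ^ r) * (kill mu S ^^ r) (%_. 1) 0 <= ?H (%w. ennreal (exp (q w)) * ?big r (Q w)) + ennreal (k ^ r) * ennreal (exp (lo / 2) * half_rate ^ r)"
  proof (intro add_mono mult_left_mono kill_pow_exit_mean_le)
   have "(kill mu S ^^ r) (%_. 1) 0 <= ennreal (exp ((- 1/2) * (- lo - 0)) * half_rate ^ r)"
    using lo_pos by (intro kill_pow_one_exp_le[OF _ half_rate(3)] half_rate) auto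
   then show "(kill mu S ^^ r) (%_. 1) 0 <= ennreal (exp (lo / 2) * half_rate ^ r)" by simp
  qed auto
  also have "ennreal (k ^ r) * ennreal (exp (lo / 2) * half_rate ^ r) = ennreal (exp (lo / 2) * rr ^ r)"
   using k half_rate by (simp add: ennreal_mult[symmetric] rr_def power_mult_distrib mult.left_commute)
  finally show ?thesis .
 qed
 have count: "(\<Sum>r. ?big r i) <= 1 + ennreal (1 / age_rate) * (ennreal (\<Lambda> i) * indicator {0<..} i)" if "i : labels" for i
 proof (cases "0 < i")
  case False
  have "\<Lambda> i <= - lo"
  proof (rule llr_le[OF that])
   fix w assume w: "w \<notin> S" "Q w = i"
   show "w <= - lo"
   proof (rule ccontr)
    assume "~ w <= - lo"
    then have "up <= w" using w by auto
    then obtain j' where "1 <= j'" "Q w = int j'" by (rule up_cases)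
    then show False using w False by simp
   qed
  qed
  then have neg: "~ age_rate * real r <= \<Lambda> i" for r
   using age_rate_pos lo_pos mult_nonneg_nonneg[of age_rate "real r"] by linarith
  show ?thesis by (simp add: neg)
 next
  case True
  define x where "x = \<Lambda> i / age_rate"
  have "?big r i = (if real r <= x then 1 else 0)" for r
   using age_rate_pos by (simp add: x_def le_divide_eq mult.commute)
  then have "(\<Sum>r. ?big r i) = (\<Sum>r. if real r <= x then 1 else 0)" by simp
  also have "... <= 1 + ennreal x"
  proof (intro suminf_le_const summableI)
   fix n
   have "(SUM r<n. if real r <= x then 1 else 0 :: ennreal) = of_nat (card {r. r < n & real r <= x})"
    by (subst sum.If_cases) (auto intro!: arg_cong[where f=card])
   also have "... = ennreal (real (card {r. r < n & real r <= x}))" by (simp add: ennreal_of_nat_eq_real_of_nat)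
   also have "... <= ennreal (max 0 x + 1)"
   proof (intro ennreal_leI)
    show "real (card {r. r < n & real r <= x}) <= max 0 x + 1"
    proof (cases "0 <= x")
    case True
    have "card {r. r < n & real r <= x} <= card {..nat \<lfloor>x\<rfloor>}"
    using True by (intro card_mono) (auto simp: le_nat_floor)
    then have "real (card {r. r < n & real r <= x}) <= real (nat \<lfloor>x\<rfloor> + 1)" by (simp only: card_atMost Suc_eq_plus1 of_nat_le_iff)
    also have "... <= x + 1" using True of_int_floor_le[of x] by simp
    finally show ?thesis by simp
    next
    case False
    then have "~ real r <= x" for r using order_trans[of 0 "real r" x] by auto
    then have e: "{r. r < n & real r <= x} = {}" by blast
    show ?thesis unfolding e by simp
    qed
   qed
   also have "... = 1 + ennreal x" by (cases "0 <= x") (auto simp: max_def ennreal_neg add.commute)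
   finally show "(SUM r<n. if real r <= x then 1 else 0 :: ennreal) <= 1 + ennreal x" .
  qed
  also have "ennreal x <= ennreal (1 / age_rate) * ennreal (\<Lambda> i)"
  proof (cases "0 <= \<Lambda> i")
   case True
   then show ?thesis using age_rate_pos by (simp add: ennreal_mult[symmetric] x_def)
  next
   case False
   then have "ennreal x = 0" using age_rate_pos by (intro ennreal_neg) (simp add: x_def divide_nonpos_pos)
   then show ?thesis by simp
  qed
  finally show ?thesis using True by (simp add: add_left_mono)
 qed
 have "(\<Sum>r. (kill mu S ^^ r) h 0) <= (\<Sum>r. ?H (%w. ennreal (exp (q w)) * ?big r (Q w)) + ennreal (exp (lo / 2) * rr ^ r))"
  by (intro suminf_le term_le summableI)
 also have "... = (\<Sum>r. ?H (%w. ennreal (exp (q w)) * ?big r (Q w))) + (\<Sum>r. ennreal (exp (lo / 2) * rr ^ r))"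
  by (intro suminf_add[symmetric] summableI)
 also have "(\<Sum>r. ennreal (exp (lo / 2) * rr ^ r)) = ennreal (exp (lo / 2) * (1 / (1 - rr)))"
  using rr by (intro suminf_ennreal_eq sums_mult geometric_sums) auto
 also have "(\<Sum>r. ?H (%w. ennreal (exp (q w)) * ?big r (Q w))) = ?H (%w. \<Sum>r. ennreal (exp (q w)) * ?big r (Q w))"
  by (rule exit_mean_suminf[symmetric]) measurable
 also have "... = ?H (%w. ennreal (exp (q w)) * (\<Sum>r. ?big r (Q w)))"
  by (simp add: ennreal_suminf_cmult)
 also have "... = exit_mean (tilt mu) S (%w. \<Sum>r. ?big r (Q w)) 0"
  by (rule label_change[of "%i. \<Sum>r. ?big r i"])
 also have "... <= exit_mean (tilt mu) S (%w. 1 + ennreal (1 / age_rate) * (ennreal (\<Lambda> (Q w)) * indicator {0<..} (Q w))) 0"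
  using count exit_label by (intro t.exit_mean_mono) blast
 also have "... = exit_mean (tilt mu) S (%_. 1) 0
   + ennreal (1 / age_rate) * exit_mean (tilt mu) S (%w. ennreal (\<Lambda> (Q w)) * indicator {0<..} (Q w)) 0"
  by (subst t.exit_mean_add) (auto simp: t.exit_mean_cmult)
 also have "... <= 1 + ennreal (1 / age_rate) * ennreal (up + overshoot_const a b * b)"
  by (intro add_mono mult_left_mono t.exit_mean_one_le mean_positive_llr) auto
 also have "... = ennreal (1 + (up + overshoot_const a b * b) / age_rate)"
  using age_rate_pos up_pos overshoot_const_pos[OF a_pos b_pos] b_pos
  by (simp add: ennreal_mult[symmetric] ennreal_1[symmetric] ennreal_plus[symmetric] del: ennreal_plus ennreal_1)
 finally have "(\<Sum>r. (kill mu S ^^ r) h 0) <= ennreal (1 + (up + overshoot_const a b * b) / age_rate)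
   + ennreal (exp (lo / 2) * (1 / (1 - rr)))" by (simp add: add_right_mono)
 also have "... = ennreal (1 + (up + overshoot_const a b * b) / age_rate + exp (lo / 2) * (1 / (1 - rr)))"
  using age_rate_pos up_pos overshoot_const_pos[OF a_pos b_pos] b_pos rr(2)
  by (intro ennreal_plus[symmetric]) simp_all
 finally show ?thesis unfolding rr(3) .
qed

text \<open>
 The loss of a lower message is weighted by its own likelihood ratio, hence by at most \<open>exp (- lo)\<close>.
\<close>

lemma negative_label_loss:
 assumes A: "!!w. w \<notin> S ==> Q w : A ==> w <= - L" and "lo <= L"
 shows "exit_mean (tilt mu) S (%w. ennreal (- \<Lambda> (Q w) - L) * indicator A (Q w)) 0
  <= ennreal (exp (- lo)) * exit_mean mu S (%w. ennreal (- w - L)) 0"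
proof -
 let ?P = "%w. indicator A (Q w) :: ennreal"
 let ?H = "%f. exit_mean mu S f 0"
 let ?F = "%w. ennreal (- \<Lambda> (Q w) - L) * ?P w"
 have [measurable]: "?F : borel_measurable borel"
  by (rule label_fun_measurable[of "%i. ennreal (- \<Lambda> i - L) * indicator A i"])
 have llr: "\<Lambda> (Q w) <= - L" if "w \<notin> S" "Q w : A" for w
 proof (rule llr_le[OF exit_label[OF that(1)]])
  fix w' assume "w' \<notin> S" "Q w' = Q w"
  then show "w' <= - L" using A[of w'] that by simp
 qed
 have "exit_mean (tilt mu) S ?F 0 = ?H (%w. ennreal (exp (q w)) * ?F w)"
  using label_change[of "%i. ennreal (- \<Lambda> i - L) * indicator A i"] by simp
 also have "... <= ?H (%w. ennreal (exp (- lo)) * ?F w)"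
 proof (rule exit_mean_mono)
  fix w assume w: "w \<notin> S"
  show "ennreal (exp (q w)) * ?F w <= ennreal (exp (- lo)) * ?F w"
  proof (cases "Q w : A")
   case True
   then have "q w <= - lo" using llr[OF w True] \<open>lo <= L\<close> by (simp add: q_def)
   then show ?thesis by (intro mult_right_mono ennreal_leI) auto
  qed simp
 qed
 also have "... = ennreal (exp (- lo)) * ?H ?F" by (rule exit_mean_cmult) auto
 also have "?H ?F <= ?H (%w. ennreal (- w - L))"
 proof -
  have pw: "?F w + ?P w <= ennreal (- w - L) + ennreal (exp (w - q w)) * ?P w" if "w \<notin> S" for w
  proof (cases "Q w : A")
   case True
   have 0: "0 <= - \<Lambda> (Q w) - L" "0 <= - w - L" using llr[OF that True] A[OF that True] by auto
   have "- \<Lambda> (Q w) - L + 1 <= - w - L + exp (w - q w)"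
    using exp_ge_add_one_self[of "w - q w"] unfolding q_def by linarith
   then have "ennreal (- \<Lambda> (Q w) - L + 1) <= ennreal (- w - L + exp (w - q w))" by (rule ennreal_leI)
   then have "ennreal (- \<Lambda> (Q w) - L) + 1 <= ennreal (- w - L) + ennreal (exp (w - q w))"
    using ennreal_plus[OF 0(1), of 1] ennreal_plus[OF 0(2), of "exp (w - q w)"] by simp
   then show ?thesis using True by simp
  qed simp
  have fin: "?H ?P <= 1"
   by (rule order_trans[OF exit_mean_mono[where g'="%_. 1"] exit_mean_one_le]) (auto simp: indicator_def)
  have "?H (%w. ennreal (exp (w - q w)) * ?P w) = ?H (%w. ennreal (exp w) * (ennreal (exp (- \<Lambda> (Q w))) * ?P w))"
   by (simp add: mult.assoc[symmetric] ennreal_mult[symmetric] exp_add[symmetric] q_def)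
  also have "... = exit_mean (tilt mu) S (%w. ennreal (exp (- \<Lambda> (Q w))) * ?P w) 0"
   by (subst exit_mean_tilt[OF _ _ tilt_law])
    (auto intro: label_fun_measurable[of "%i. ennreal (exp (- \<Lambda> i)) * indicator A i"])
  also have "... = ?H (%w. ennreal (exp (q w)) * (ennreal (exp (- \<Lambda> (Q w))) * ?P w))"
   using label_change[of "%i. ennreal (exp (- \<Lambda> i)) * indicator A i"] by simp
  also have "... = ?H ?P"
   by (simp add: mult.assoc[symmetric] ennreal_mult[symmetric] exp_add[symmetric] q_def)
  finally have e: "?H (%w. ennreal (exp (w - q w)) * ?P w) = ?H ?P" .
  have "?H ?F + ?H ?P = ?H (%w. ?F w + ?P w)"
   by (rule exit_mean_add[symmetric]) measurable
  also have "... <= ?H (%w. ennreal (- w - L) + ennreal (exp (w - q w)) * ?P w)"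
   by (rule exit_mean_mono[OF pw])
  also have "... = ?H (%w. ennreal (- w - L)) + ?H ?P"
   unfolding e[symmetric] by (rule exit_mean_add) measurable
  finally have *: "?H ?F + ?H ?P <= ?H (%w. ennreal (- w - L)) + ?H ?P" .
  have "?H ?P ~= \<top>" using fin by (metis ennreal_one_less_top leD)
  then show ?thesis using * by (simp add: ennreal_add_left_cancel_le add.commute)
 qed
 finally show ?thesis by (simp add: mult_left_mono)
qed

definition loss :: "real => ennreal" where "loss w = ennreal (w - q w)"

lemma loss_measurable [measurable]: "loss : borel_measurable borel"
 unfolding loss_def by measurable

text \<open>
 Within a bin of finite length a message loses at most that length.  In the two unbounded bins the
 loss is an overshoot beyond the last level.
\<close>

lemma mean_loss_le:
 assumes gap: "0 <= gap" "!!j. 1 <= j ==> j < d ==> eu j - eu (j - 1) <= ereal gap & el j - el (j - 1) <= ereal gap"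
  and C: "!!S lo v eps. S : sets borel ==> S <= {- lo<..} ==> - lo < v ==> 0 <= eps ==>
   exit_mean mu S (%w. ennreal (- w - lo - eps)) v
   <= ennreal C * nn_integral mu (%x. ennreal (x^2) * indicator {eps..} (- x))"
  and eps: "eu (d - 1) = ereal epsu" "el (d - 1) = ereal epsl"
 shows "exit_mean (tilt mu) S loss 0
  <= ennreal gap + ennreal (overshoot_const a b) * nn_integral (tilt mu) (%x. ennreal (x^2) * indicator {epsu..} x)
   + ennreal (exp (- lo)) * (ennreal C * nn_integral mu (%x. ennreal (x^2) * indicator {epsl..} (- x)))"
proof -
 have e0: "0 <= epsu" "0 <= epsl" using e_finite[of "d - 1"] eps d_pos by auto
 let ?N = "%w. ennreal (- \<Lambda> (Q w) - (lo + epsl)) * indicator {- int d} (Q w)"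
 have [measurable]: "?N : borel_measurable borel"
  by (rule label_fun_measurable[of "%i. ennreal (- \<Lambda> i - (lo + epsl)) * indicator {- int d} i"])
 have pw: "loss w <= ennreal gap * 1 + (ennreal (w - up - epsu) + ?N w)" if w: "w \<notin> S" for w
 proof -
  consider "up <= w" | "w <= - lo" using w by fastforce
  then show ?thesis
  proof cases
   case 1
   then obtain j where j: "1 <= j" "j <= d" "level up eu j <= ereal w" "ereal w < level up eu (j + 1)" "Q w = int j"
    by (rule up_cases)
   have lab: "int j : labels" using j by (simp add: labels_def)
   have "\<bar>eu (j - 1)\<bar> ~= \<infinity>" using e_finite(4)[of "j - 1"] j(1,2) by simp
   then obtain x where x: "eu (j - 1) = ereal x" by (cases "eu (j - 1)") auto
   have qx: "up + x <= q w" unfolding q_def j(5)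
   proof (rule llr_ge[OF lab])
    fix w' assume "w' \<notin> S" "Q w' = int j"
    from bin_up(1)[OF this j(1)] show "up + x <= w'" by (simp add: level_def x)
   qed
   show ?thesis
   proof (cases "j = d")
    case True
    then have "x = epsu" using x eps by simp
    then have "loss w <= ennreal (w - up - epsu)" unfolding loss_def using qx by (intro ennreal_leI) simp
    then show ?thesis by (simp add: add_increasing add_increasing2)
   next
    case False
    then have jd: "j < d" using j(2) by simp
    have "\<bar>eu j\<bar> ~= \<infinity>" using e_finite(4)[OF jd] .
    then obtain y where y: "eu j = ereal y" by (cases "eu j") auto
    have "y - x <= gap" using gap(2)[OF j(1) jd] by (simp add: x y)
    moreover have "w < up + y" using j(4) by (simp add: level_def y)
    ultimately have "loss w <= ennreal gap" unfolding loss_def using qx by (intro ennreal_leI) simp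
    then show ?thesis by (simp add: add_increasing2)
   qed
  next
   case 2
   then obtain j where j: "1 <= j" "j <= d" "level lo el j <= ereal (- w)" "ereal (- w) < level lo el (j + 1)" "Q w = - int j"
    by (rule down_cases)
   have lab: "- int j : labels" using j by (simp add: labels_def)
   have "\<bar>el (j - 1)\<bar> ~= \<infinity>" using e_finite(3)[of "j - 1"] j(1,2) by simp
   then obtain x where x: "el (j - 1) = ereal x" by (cases "el (j - 1)") auto
   have wx: "w <= - (lo + x)" using j(3) by (simp add: level_def x)
   show ?thesis
   proof (cases "j = d")
    case True
    then have "x = epsl" using x eps by simp
    then have "loss w <= ?N w" unfolding loss_def using wx j(5) True by (auto simp: q_def intro!: ennreal_leI)
    then show ?thesis by (simp add: add_increasing)
   next
    case False
    then have jd: "j < d" using j(2) by simp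
    have "\<bar>el j\<bar> ~= \<infinity>" using e_finite(3)[OF jd] .
    then obtain y where y: "el j = ereal y" by (cases "el j") auto
    have qy: "- (lo + y) <= q w" unfolding q_def j(5)
    proof (rule llr_ge[OF lab])
    fix w' assume "w' \<notin> S" "Q w' = - int j"
    from bin_down(2)[OF this j(1)] show "- (lo + y) <= w'" by (simp add: level_def y)
    qed
    have "y - x <= gap" using gap(2)[OF j(1) jd] by (simp add: x y)
    then have "loss w <= ennreal gap" unfolding loss_def using qy wx by (intro ennreal_leI) simp
    then show ?thesis by (simp add: add_increasing2)
   qed
  qed
 qed
 have "exit_mean (tilt mu) S loss 0 <= exit_mean (tilt mu) S (%w. ennreal gap * 1 + (ennreal (w - up - epsu) + ?N w)) 0"
  by (rule t.exit_mean_mono[OF pw])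
 also have "... = exit_mean (tilt mu) S (%w. ennreal gap * 1) 0 + (exit_mean (tilt mu) S (%w. ennreal (w - up - epsu)) 0 + exit_mean (tilt mu) S ?N 0)"
  by (subst t.exit_mean_add, measurable)+
 also have "exit_mean (tilt mu) S (%w. ennreal gap * 1) 0 = ennreal gap * exit_mean (tilt mu) S (%_. 1) 0"
  by (rule t.exit_mean_cmult) auto
 also have "... <= ennreal gap * 1" by (intro mult_left_mono t.exit_mean_one_le) auto
 also have "exit_mean (tilt mu) S (%w. ennreal (w - up - epsu)) 0
   <= ennreal (overshoot_const a b) * nn_integral (tilt mu) (%x. ennreal (x^2) * indicator {epsu..} x)"
  using up_pos e0 by (intro overshoot) auto
 also have "exit_mean (tilt mu) S ?N 0 <= ennreal (exp (- lo)) * exit_mean mu S (%w. ennreal (- w - (lo + epsl))) 0"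
 proof (rule negative_label_loss)
  fix w assume "w \<notin> S" "Q w : {- int d}"
  then have "level lo el d <= ereal (- w)" using bin_down(1)[of w d] d_pos by simp
  then show "w <= - (lo + epsl)" by (simp add: level_def eps)
 qed (use e0 in simp)
 also have "exit_mean mu S (%w. ennreal (- w - (lo + epsl))) 0
   <= ennreal C * nn_integral mu (%x. ennreal (x^2) * indicator {epsl..} (- x))"
 proof -
  have "S <= {- lo<..}" by auto
  from C[OF _ this, of 0 epsl] show ?thesis using lo_pos e0 by (simp add: diff_diff_eq)
 qed
 finally show ?thesis by (simp add: add.assoc add_mono mult_left_mono)
qed

lemma mean_loss_bounded:
 "exit_mean (tilt mu) S loss 0
  <= ennreal (overshoot_const a b * b + exp (- lo / 2) * (\<integral>x. \<bar>x\<bar> \<partial>mu) / (1 - half_rate))"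
proof -
 let ?N = "%w. ennreal (- \<Lambda> (Q w) - lo) * indicator {..<0} (Q w)"
 have [measurable]: "?N : borel_measurable borel"
  by (rule label_fun_measurable[of "%i. ennreal (- \<Lambda> i - lo) * indicator {..<0} i"])
 have neg: "w <= - lo" if "w \<notin> S" "Q w : {..<0}" for w
 proof (rule ccontr)
  assume "~ w <= - lo"
  then have "up <= w" using that by auto
  then obtain j where "1 <= j" "Q w = int j" by (rule up_cases)
  then show False using that by simp
 qed
 have pw: "loss w <= ennreal (w - up) + ?N w" if w: "w \<notin> S" for w
 proof -
  consider "up <= w" | "w <= - lo" using w by fastforce
  then show ?thesis
  proof cases
   case 1
   then have "loss w <= ennreal (w - up)" unfolding loss_def using q_up[OF 1] by (intro ennreal_leI) simp
   then show ?thesis by (simp add: add_increasing2)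
  next
   case 2
   then obtain j where j: "1 <= j" "Q w = - int j" by (rule down_cases)
   then have "loss w <= ?N w" unfolding loss_def using 2 by (auto simp: q_def intro!: ennreal_leI)
   then show ?thesis by (simp add: add_increasing)
  qed
 qed
 have "exit_mean (tilt mu) S loss 0 <= exit_mean (tilt mu) S (%w. ennreal (w - up) + ?N w) 0"
  by (rule t.exit_mean_mono[OF pw])
 also have "... = exit_mean (tilt mu) S (%w. ennreal (w - up)) 0 + exit_mean (tilt mu) S ?N 0"
  by (rule t.exit_mean_add) measurable
 also have "... <= ennreal (overshoot_const a b * b) + ennreal (exp (- lo)) * exit_mean mu S (%w. ennreal (- w - lo)) 0"
  using up_pos by (intro add_mono overshoot_le negative_label_loss neg) auto
 also have "exit_mean mu S (%w. ennreal (- w - lo)) 0 <= exit_mean mu S (%w. ennreal \<bar>w\<bar>) 0"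
  using lo_pos by (intro exit_mean_mono ennreal_leI) auto
 also have "... <= ennreal ((\<integral>x. \<bar>x\<bar> \<partial>mu) * (exp (lo / 2) / (1 - half_rate)))"
  using lo_pos by (intro inf_exit_abs_le) auto
 also have "ennreal (exp (- lo)) * ennreal ((\<integral>x. \<bar>x\<bar> \<partial>mu) * (exp (lo / 2) / (1 - half_rate)))
   = ennreal (exp (- lo / 2) * (\<integral>x. \<bar>x\<bar> \<partial>mu) / (1 - half_rate))"
 proof -
  have "exp (- lo) * exp (lo / 2) = exp (- lo / 2)" by (simp add: exp_add[symmetric])
  then have "exp (- lo) * ((\<integral>x. \<bar>x\<bar> \<partial>mu) * (exp (lo / 2) / (1 - half_rate))) = exp (- lo / 2) * (\<integral>x. \<bar>x\<bar> \<partial>mu) / (1 - half_rate)"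
   by (metis (no_types, opaque_lifting) mult.assoc mult.commute times_divide_eq_right)
  then show ?thesis using half_rate by (subst ennreal_mult[symmetric]) auto
 qed
 finally have "exit_mean (tilt mu) S loss 0
   <= ennreal (overshoot_const a b * b) + ennreal (exp (- lo / 2) * (\<integral>x. \<bar>x\<bar> \<partial>mu) / (1 - half_rate))"
  by (simp add: add_left_mono mult_left_mono)
 also have "... = ennreal (overshoot_const a b * b + exp (- lo / 2) * (\<integral>x. \<bar>x\<bar> \<partial>mu) / (1 - half_rate))"
  using half_rate overshoot_const_pos[OF a_pos b_pos] b_pos by (intro ennreal_plus[symmetric]) auto
 finally show ?thesis .
qed

end

section \<open>Alarms before the change\<close>

lemma ennreal_prod_mono:
 fixes f g :: "'b => ennreal"
 shows "(!!i. i : I ==> f i <= g i) ==> prod f I <= prod g I"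
 by (induction I rule: infinite_finite_induct) (auto intro: mult_mono)

lemma ennreal_prod_pos:
 fixes f :: "'b => ennreal"
 shows "(!!i. i : I ==> 0 < f i) ==> 0 < prod f I"
 by (induction I rule: infinite_finite_induct) (auto simp: ennreal_zero_less_mult_iff)

text \<open>The mean of \<open>h\<close> at the phase after \<open>n\<close> steps.\<close>

primrec renew_mean :: "real measure => real => real => (real => ennreal) => nat => real => ennreal" where
 "renew_mean mu lo up h 0 = h"
| "renew_mean mu lo up h (Suc n) = (%v. nn_integral mu (%x. renew_mean mu lo up h n (renew lo up (v + x))))"

lemma renew_measurable [measurable]: "renew lo up : borel_measurable borel"
 unfolding renew_def by measurable

context real_law begin

lemma renew_mean_measurable [measurable]:
 assumes [measurable]: "h : borel_measurable borel"
 shows "renew_mean mu lo up h n : borel_measurable borel"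
proof (induction n)
 case (Suc n)
 note Suc[measurable]
 have "(%v. nn_integral mu (%x. renew_mean mu lo up h n (renew lo up (v + x)))) : borel_measurable borel"
  by (rule borel_measurable_nn_integral) measurable
 then show ?case by simp
qed (simp add: assms)

text \<open>Sums over the time of the last renewal.\<close>

lemma renew_mean_le:
 assumes [measurable]: "h : borel_measurable borel"
 shows "renew_mean mu lo up h n v <= (kill mu {-lo<..<up} ^^ n) h v + (SUM r<n. (kill mu {-lo<..<up} ^^ r) h 0)"
proof (induction n arbitrary: v)
 case 0
 then show ?case by simp
next
 case (Suc n)
 let ?S = "{-lo<..<up}"
 let ?c = "SUM r<Suc n. (kill mu ?S ^^ r) h 0"
 have "renew_mean mu lo up h (Suc n) v <= nn_integral mu (%x. indicator ?S (v + x) * (kill mu ?S ^^ n) h (v + x) + ?c)"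
  unfolding renew_mean.simps
 proof (rule nn_integral_mono)
  fix x
  show "renew_mean mu lo up h n (renew lo up (v + x)) <= indicator ?S (v + x) * (kill mu ?S ^^ n) h (v + x) + ?c"
  proof (cases "v + x : ?S")
   case True
   have "renew_mean mu lo up h n (v + x) <= (kill mu ?S ^^ n) h (v + x) + (SUM r<n. (kill mu ?S ^^ r) h 0)"
    by (rule Suc.IH)
   also have "... <= (kill mu ?S ^^ n) h (v + x) + ?c" by (intro add_left_mono sum_mono2) auto
   finally show ?thesis using True by (simp add: renew_def)
  next
   case False
   have "renew_mean mu lo up h n 0 <= ?c" using Suc.IH[of 0] by (simp add: add.commute)
   then show ?thesis using False by (simp only: renew_def if_False) (simp add: add_increasing)
  qed
 qed
 also have "... = kill mu ?S ((kill mu ?S ^^ n) h) v + ?c"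
  unfolding kill_def[of _ _ "(kill mu ?S ^^ n) h"] by (subst nn_integral_add) (auto simp: emeasure_space_1[simplified])
 finally show ?case by simp
qed

lemma renew_mean_0_le:
 assumes [measurable]: "h : borel_measurable borel"
 shows "renew_mean mu lo up h n 0 <= (\<Sum>r. (kill mu {-lo<..<up} ^^ r) h 0)"
proof -
 have "renew_mean mu lo up h n 0 <= (SUM r<Suc n. (kill mu {-lo<..<up} ^^ r) h 0)"
  using renew_mean_le[OF assms, of lo up n 0] by (simp add: add.commute)
 also have "... <= (\<Sum>r. (kill mu {-lo<..<up} ^^ r) h 0)" by (intro sum_le_suminf summableI) auto
 finally show ?thesis .
qed

end

locale sensor_walk = filtered_walk M F K law X t0
 for M :: "'a measure" and F K law X t0 +
 fixes lo up :: "nat => real" and V :: "nat => nat => 'a => real"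
 assumes thr_pos: "k : {1..K} ==> 0 < lo k & 0 < up k"
  and V_adapted: "k : {1..K} ==> V k t : borel_measurable (F t)"
  and V_Suc: "k : {1..K} ==> om : space M ==> V k (Suc t) om = renew (lo k) (up k) (V k t om + X k t om)"
  and V_range: "k : {1..K} ==> om : space M ==> V k t om : {-lo k<..<up k}"
begin

abbreviation S :: "nat => real set" where "S k \<equiv> {-lo k<..<up k}"
abbreviation W :: "nat => nat => 'a => real" where "W k t om \<equiv> V k t om + X k t om"

lemma X_F: "k : {1..K} ==> Suc t <= s ==> X k t : borel_measurable (F s)"
 by (rule measurable_F_mono[OF _ X_adapted])

lemma X_M [measurable]: "k : {1..K} ==> X k t : borel_measurable M"
 by (rule measurable_F_M[OF X_adapted])

lemma V_M [measurable]: "k : {1..K} ==> V k t : borel_measurable M"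
 by (rule measurable_F_M[OF V_adapted])

lemma phase_step:
 assumes t: "t0 <= t" and k: "k : {1..K}" and c: "c : borel_measurable (F t)"
  and f[measurable]: "f : borel_measurable borel"
 shows "nn_integral M (%om. c om * f (W k t om)) = nn_integral M (%om. c om * (nn_integral (law k) (%x. f (V k t om + x))))"
proof -
 note [measurable] = c V_adapted[OF k, of t]
 have "(%p. c (fst p) * f (V k t (fst p) + snd p)) : borel_measurable (F t \<Otimes>\<^sub>M borel)" by measurable
 from step_sensor[OF t k this]
 have "nn_integral M (%om. c om * f (W k t om)) = nn_integral M (%om. nn_integral (law k) (%x. c om * f (V k t om + x)))" by simp
 also have "... = nn_integral M (%om. c om * (nn_integral (law k) (%x. f (V k t om + x))))"
  by (intro nn_integral_cong nn_integral_cmult) (simp add: measurable_cong_sets[OF sets_law refl])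
 finally show ?thesis .
qed

lemma phase_prod_step:
 assumes t: "t0 <= t" and c: "c : borel_measurable (F t)"
  and f: "!!k. k : {1..K} ==> f k : borel_measurable borel"
 shows "nn_integral M (%om. c om * (\<Prod>k=1..K. f k (W k t om)))
  = nn_integral M (%om. c om * (\<Prod>k=1..K. nn_integral (law k) (%x. f k (V k t om + x))))"
proof -
 have "(%p. f k (V k t (fst p) + snd p)) : borel_measurable (F t \<Otimes>\<^sub>M borel)" if k: "k : {1..K}" for k
 proof -
  note [measurable] = f[OF k] V_adapted[OF k, of t]
  show ?thesis by measurable
 qed
 from step_prod[OF t c this] show ?thesis by simp
qed

lemma phase_mean:
 assumes f: "!!k. k : {1..K} ==> f k : borel_measurable borel"
  and V0: "!!k om. k : {1..K} ==> om : space M ==> V k t0 om = 0"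
 shows "nn_integral M (%om. (\<Prod>k=1..K. f k (V k (t0 + n) om))) = (\<Prod>k=1..K. renew_mean (law k) (lo k) (up k) (f k) n 0)"
proof -
 have "nn_integral M (%om. (\<Prod>k=1..K. renew_mean (law k) (lo k) (up k) (f k) m (V k (t0 + n) om)))
   = (\<Prod>k=1..K. renew_mean (law k) (lo k) (up k) (f k) (m + n) 0)" for m
 proof (induction n arbitrary: m)
  case 0
  have "nn_integral M (%om. (\<Prod>k=1..K. renew_mean (law k) (lo k) (up k) (f k) m (V k (t0 + 0) om)))
    = nn_integral M (%om. (\<Prod>k=1..K. renew_mean (law k) (lo k) (up k) (f k) m 0))"
   by (intro nn_integral_cong prod.cong) (auto simp: V0)
  then show ?case by (simp add: emeasure_space_1)
 next
  case (Suc n)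
  let ?g = "%k w. renew_mean (law k) (lo k) (up k) (f k) m (renew (lo k) (up k) w)"
  have gm: "?g k : borel_measurable borel" if "k : {1..K}" for k
   using measurable_compose[OF renew_measurable real_law.renew_mean_measurable[OF law f[OF that]]] by simp
  have "nn_integral M (%om. (\<Prod>k=1..K. renew_mean (law k) (lo k) (up k) (f k) m (V k (t0 + Suc n) om)))
    = nn_integral M (%om. 1 * (\<Prod>k=1..K. ?g k (W k (t0 + n) om)))"
  proof (rule nn_integral_cong)
   fix om assume "om : space M"
   then show "(\<Prod>k=1..K. renew_mean (law k) (lo k) (up k) (f k) m (V k (t0 + Suc n) om)) = 1 * (\<Prod>k=1..K. ?g k (W k (t0 + n) om))"
    by (auto intro!: prod.cong simp: V_Suc)
  qed
  also have "... = nn_integral M (%om. 1 * (\<Prod>k=1..K. nn_integral (law k) (%x. ?g k (V k (t0 + n) om + x))))"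
   by (rule phase_prod_step) (use gm in auto)
  also have "... = nn_integral M (%om. (\<Prod>k=1..K. renew_mean (law k) (lo k) (up k) (f k) (Suc m) (V k (t0 + n) om)))" by simp
  also have "... = (\<Prod>k=1..K. renew_mean (law k) (lo k) (up k) (f k) (m + Suc n) 0)"
   by (subst Suc.IH) simp
  finally show ?case .
 qed
 from this[of 0] show ?thesis by simp
qed

text \<open>
 A change-of-measure bound of the probability of an early alarm: summed over all starting points,
 the likelihood ratios of the messages (those in progress included) form a process whose mean grows
 by at most \<open>\<Prod>D\<close> per step.
\<close>

lemma alarm_probability_le:
 fixes U :: "nat => 'a => real" and q :: "nat => real => real" and h :: "nat => real => ennreal" and D :: "nat => ennreal"
 assumes t0: "t0 = 0"
  and V0: "!!k om. k : {1..K} ==> om : space M ==> V k 0 om = 0"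
  and h: "!!k. k : {1..K} ==> h k : borel_measurable borel"
  and q: "!!k. k : {1..K} ==> q k : borel_measurable borel"
  and h0: "!!k. k : {1..K} ==> h k 0 <= 1"
  and hstep: "!!k v. k : {1..K} ==> (nn_integral (law k) (%x. (if v + x : S k then h k (v + x) else ennreal (exp (q k (v + x)))))) <= h k v"
  and hge: "!!k v. k : {1..K} ==> v : S k ==> c k <= h k v"
  and D: "!!k. k : {1..K} ==> (\<Sum>r. (kill (law k) (S k) ^^ r) (h k) 0) <= D k"
  and U: "!!t. U t : borel_measurable (F t)"
  and USuc: "!!t om. om : space M ==> U (Suc t) om = U t om + (SUM k=1..K. if W k t om : S k then 0 else q k (W k t om))"
  and A: "!!t. A t : sets (F t)" "A 0 = space M" "!!t. A (Suc t) <= A t"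
  and alarm: "!!t om. om : A t ==> om \<notin> A (Suc t) ==> EX s<=Suc t. nu <= U (Suc t) om - U s om"
 shows "ennreal (exp nu) * (\<Prod>k=1..K. c k) * emeasure M (space M - A n) <= of_nat (Suc n) * (\<Prod>k=1..K. D k)"
proof -
 let ?c = "\<Prod>k=1..K. c k" and ?D = "\<Prod>k=1..K. D k"
 define H where "H t om = (\<Prod>k=1..K. h k (V k t om))" for t om
 define R where "R t om = (SUM s<=t. ennreal (exp (U t om - U s om)))" for t om
 have HF: "H t : borel_measurable (F t)" for t
  unfolding H_def[abs_def] by (intro borel_measurable_prod_ennreal measurable_compose[OF V_adapted h])
 have UF: "s <= t ==> U s : borel_measurable (F t)" for s t by (rule measurable_F_mono[OF _ U])
 have RF: "R t : borel_measurable (F t)" for t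
 proof -
  have "(%om. ennreal (exp (U t om - U s om))) : borel_measurable (F t)" if "s <= t" for s
  proof -
   note [measurable] = UF[OF that] UF[OF order_refl, of t]
   show ?thesis by measurable
  qed
  then show ?thesis unfolding R_def[abs_def] by (intro borel_measurable_sum) auto
 qed
 have AF: "(indicator (A t) :: 'a => ennreal) : borel_measurable (F t)" for t using A(1) by simp
 note [measurable] = measurable_F_M[OF HF] measurable_F_M[OF RF] measurable_F_M[OF AF]
 have AM [measurable]: "A t : sets M" for t using A(1) sets_F by blast
 have HD: "nn_integral M (%om. H t om) <= ?D" for t
 proof -
  have "nn_integral M (%om. H t om) = (\<Prod>k=1..K. renew_mean (law k) (lo k) (up k) (h k) t 0)"
   using phase_mean[of h t] h V0 by (simp add: H_def t0)
  also have "... <= ?D"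
  proof (rule ennreal_prod_mono)
   fix k assume k: "k : {1..K}"
   show "renew_mean (law k) (lo k) (up k) (h k) t 0 <= D k"
    using real_law.renew_mean_0_le[OF law h[OF k]] D[OF k] by (rule order_trans)
  qed
  finally show ?thesis .
 qed
 define g where "g k w = (if w : S k then h k w else ennreal (exp (q k w)))" for k w
 have g: "g k : borel_measurable borel" if "k : {1..K}" for k
 proof -
  note [measurable] = h[OF that] q[OF that]
  show ?thesis unfolding g_def by measurable
 qed
 have expU: "ennreal (exp (U (Suc t) om - U t om)) * H (Suc t) om <= (\<Prod>k=1..K. g k (W k t om))" if w: "om : space M" for t om
 proof -
  have "ennreal (exp (U (Suc t) om - U t om)) = (\<Prod>k=1..K. ennreal (exp (if W k t om : S k then 0 else q k (W k t om))))"
   by (simp add: USuc[OF w] exp_sum prod_ennreal)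
  then have "ennreal (exp (U (Suc t) om - U t om)) * H (Suc t) om
    = (\<Prod>k=1..K. ennreal (exp (if W k t om : S k then 0 else q k (W k t om))) * h k (V k (Suc t) om))"
   by (simp only: H_def prod.distrib)
  also have "... <= (\<Prod>k=1..K. g k (W k t om))"
  proof (rule ennreal_prod_mono)
   fix k assume k: "k : {1..K}"
   show "ennreal (exp (if W k t om : S k then 0 else q k (W k t om))) * h k (V k (Suc t) om) <= g k (W k t om)"
   proof (cases "W k t om : S k")
    case True
    then show ?thesis by (simp only: V_Suc[OF k w] renew_def g_def if_True) simp
   next
    case False
    then show ?thesis using mult_left_mono[OF h0[OF k], of "ennreal (exp (q k (W k t om)))"]
    by (simp only: V_Suc[OF k w] renew_def g_def if_False) simp
   qed
  qed
  finally show ?thesis .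
 qed
 have step: "nn_integral M (%om. indicator (A t) om * (R (Suc t) om * H (Suc t) om)) <= nn_integral M (%om. indicator (A t) om * (R t om * H t om)) + ?D" for t
 proof -
  have cF: "(%om. indicator (A t) om * R t om) : borel_measurable (F t)"
   by (rule borel_measurable_times_ennreal[OF AF[of t] RF[of t]])
  have "nn_integral M (%om. indicator (A t) om * (R (Suc t) om * H (Suc t) om))
    <= nn_integral M (%om. (indicator (A t) om * R t om) * (\<Prod>k=1..K. g k (W k t om)) + H (Suc t) om)"
  proof (rule nn_integral_mono)
   fix om assume w: "om : space M"
   have "R (Suc t) om = (SUM s<=t. ennreal (exp (U (Suc t) om - U t om)) * ennreal (exp (U t om - U s om))) + 1"
    by (simp add: R_def ennreal_mult[symmetric] exp_add[symmetric])
   also have "... = ennreal (exp (U (Suc t) om - U t om)) * R t om + 1"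
    by (simp only: R_def sum_distrib_left)
   finally have "R (Suc t) om * H (Suc t) om = R t om * (ennreal (exp (U (Suc t) om - U t om)) * H (Suc t) om) + H (Suc t) om"
    by (simp add: algebra_simps)
   also have "... <= R t om * (\<Prod>k=1..K. g k (W k t om)) + H (Suc t) om"
    using expU[OF w, of t] by (intro add_right_mono mult_left_mono) auto
   finally show "indicator (A t) om * (R (Suc t) om * H (Suc t) om)
    <= (indicator (A t) om * R t om) * (\<Prod>k=1..K. g k (W k t om)) + H (Suc t) om"
    by (cases "om : A t") simp_all
  qed
  also have "... = nn_integral M (%om. (indicator (A t) om * R t om) * (\<Prod>k=1..K. g k (W k t om))) + nn_integral M (%om. H (Suc t) om)"
  proof (rule nn_integral_add)
   have "(%om. \<Prod>k=1..K. g k (W k t om)) : borel_measurable M"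
    by (intro borel_measurable_prod_ennreal measurable_compose[OF _ g] borel_measurable_add V_M X_M)
   then show "(%om. (indicator (A t) om * R t om) * (\<Prod>k=1..K. g k (W k t om))) : borel_measurable M" by measurable
  qed measurable
  also have "nn_integral M (%om. (indicator (A t) om * R t om) * (\<Prod>k=1..K. g k (W k t om)))
    = nn_integral M (%om. (indicator (A t) om * R t om) * (\<Prod>k=1..K. nn_integral (law k) (%x. g k (V k t om + x))))"
   by (rule phase_prod_step[OF _ cF g]) (simp add: t0)
  also have "... <= nn_integral M (%om. indicator (A t) om * (R t om * H t om))"
   unfolding mult.assoc H_def g_def
   by (intro nn_integral_mono mult_left_mono ennreal_prod_mono hstep) simp_all
  finally show ?thesis using HD[of "Suc t"] by (meson add_mono order_refl order_trans)
 qed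
 have low: "ennreal (exp nu) * ?c * indicator (A t - A (Suc t)) om + indicator (A (Suc t)) om * (R (Suc t) om * H (Suc t) om)
   <= indicator (A t) om * (R (Suc t) om * H (Suc t) om)" if w: "om : space M" for t om
 proof (cases "om : A t & om \<notin> A (Suc t)")
  case True
  then obtain s where s: "s <= Suc t" "nu <= U (Suc t) om - U s om" using alarm by blast
  have "ennreal (exp nu) <= (\<Sum>s\<in>{s}. ennreal (exp (U (Suc t) om - U s om)))"
   using s by (simp add: ennreal_leI)
  also have "... <= R (Suc t) om" unfolding R_def by (rule sum_mono2) (use s in auto)
  finally have 1: "ennreal (exp nu) <= R (Suc t) om" .
  have 2: "?c <= H (Suc t) om" unfolding H_def using w V_range by (intro ennreal_prod_mono hge) auto
  show ?thesis using True mult_mono[OF 1 2] by simp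
 next
  case False
  then show ?thesis using A(3)[of t] by (auto simp: indicator_def)
 qed
 have main: "ennreal (exp nu) * ?c * emeasure M (space M - A n) + nn_integral M (%om. indicator (A n) om * (R n om * H n om)) <= of_nat (Suc n) * ?D" for n
 proof (induction n)
  case 0
  have "nn_integral M (%om. indicator (A 0) om * (R 0 om * H 0 om)) = nn_integral M (%om. H 0 om)"
   by (intro nn_integral_cong) (simp add: A(2) R_def)
  then show ?case using HD[of 0] by (simp add: A(2))
 next
  case (Suc n)
  have "space M - A (Suc n) = (space M - A n) \<union> (A n - A (Suc n))"
   using A(3)[of n] sets.sets_into_space[OF AM[of n]] by blast
  then have "emeasure M (space M - A (Suc n)) = emeasure M (space M - A n) + emeasure M (A n - A (Suc n))"
   by (simp only:) (rule plus_emeasure[symmetric], auto)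
  then have "ennreal (exp nu) * ?c * emeasure M (space M - A (Suc n)) + nn_integral M (%om. indicator (A (Suc n)) om * (R (Suc n) om * H (Suc n) om))
    = ennreal (exp nu) * ?c * emeasure M (space M - A n) +
    ((nn_integral M (%om. ennreal (exp nu) * ?c * indicator (A n - A (Suc n)) om)) + nn_integral M (%om. indicator (A (Suc n)) om * (R (Suc n) om * H (Suc n) om)))"
   by (simp add: distrib_left add.assoc nn_integral_cmult_indicator)
  also have "nn_integral M (%om. ennreal (exp nu) * ?c * indicator (A n - A (Suc n)) om) + nn_integral M (%om. indicator (A (Suc n)) om * (R (Suc n) om * H (Suc n) om))
    = nn_integral M (%om. ennreal (exp nu) * ?c * indicator (A n - A (Suc n)) om + indicator (A (Suc n)) om * (R (Suc n) om * H (Suc n) om))"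
   by (intro nn_integral_add[symmetric]) measurable
  also have "... <= nn_integral M (%om. indicator (A n) om * (R (Suc n) om * H (Suc n) om))"
   by (intro nn_integral_mono low)
  also have "... <= nn_integral M (%om. indicator (A n) om * (R n om * H n om)) + ?D" by (rule step)
  finally have "ennreal (exp nu) * ?c * emeasure M (space M - A (Suc n)) + nn_integral M (%om. indicator (A (Suc n)) om * (R (Suc n) om * H (Suc n) om))
    <= (ennreal (exp nu) * ?c * emeasure M (space M - A n) + nn_integral M (%om. indicator (A n) om * (R n om * H n om))) + ?D"
   by (simp add: add_left_mono add.assoc)
  also have "... <= of_nat (Suc n) * ?D + ?D" using Suc.IH by (rule add_right_mono)
  also have "... = of_nat (Suc (Suc n)) * ?D" by (simp add: distrib_right add.commute)
  finally show ?case .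
 qed
 have "ennreal (exp nu) * ?c * emeasure M (space M - A n) <= ennreal (exp nu) * ?c * emeasure M (space M - A n) + nn_integral M (%om. indicator (A n) om * (R n om * H n om))"
  by simp
 also have "... <= of_nat (Suc n) * ?D" by (rule main)
 finally show ?thesis .
qed

text \<open>If a run of \<open>r\<close> increments of positive probability raises the alarm, its mean time is finite.\<close>

lemma run_sum_finite:
 assumes A: "!!t. A t : sets (F t)" "!!t. A (Suc t) <= A t"
  and J: "!!k. k : {1..K} ==> J k : sets borel" "!!k. k : {1..K} ==> 0 < emeasure (law k) (J k)"
  and "0 < r"
  and run: "!!t om. t0 <= t ==> om : space M ==> ALL i<r. ALL k:{1..K}. X k (t + i) om : J k ==> om \<notin> A (t + r)"
 shows "(\<Sum>n. emeasure M (A (t0 + n))) < \<infinity>"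
proof -
 define p where "p = (\<Prod>k=1..K. emeasure (law k) (J k))"
 have p: "0 < p" "p <= 1"
 proof -
  show "0 < p" unfolding p_def using J(2) by (rule ennreal_prod_pos)
  have "p <= (\<Prod>k=1..K. 1)" unfolding p_def
   by (rule ennreal_prod_mono) (rule prob_space.emeasure_le_1[OF prob_law])
  then show "p <= 1" by simp
 qed
 define B where "B t i = {om\<in>space M. om : A t & (ALL j<i. ALL k:{1..K}. X k (t + j) om : J k)}" for t i
 have BF: "B t i : sets (F (t + i))" for t i
 proof (induction i)
  case 0
  have "B t 0 = A t" using sets.sets_into_space[of "A t" "F t"] A(1)[of t] space_F by (auto simp: B_def)
  then show ?case using A(1) by simp
 next
  case (Suc i)
  have e: "B t (Suc i) = B t i Int (\<Inter>k\<in>{1..K}. X k (t + i) -` J k Int space (F (t + Suc i)))"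
   using K_pos by (auto simp: B_def less_Suc_eq space_F)
  have m: "X k (t + i) -` J k Int space (F (t + Suc i)) : sets (F (t + Suc i))" if "k : {1..K}" for k
   using measurable_sets[OF X_adapted[OF that, of "t + i"] J(1)[OF that]] by simp
  have "B t i : sets (F (t + Suc i))" using Suc F_mono[of "t + i" "t + Suc i"] by auto
  then show ?case unfolding e
  proof (rule sets.Int)
   show "(\<Inter>k\<in>{1..K}. X k (t + i) -` J k Int space (F (t + Suc i))) : sets (F (t + Suc i))"
    by (rule sets.finite_INT) (use K_pos m in simp_all)
  qed
 qed
 have BM: "B t i : sets M" for t i using BF sets_F by blast
 have Bp: "emeasure M (B t i) = emeasure M (A t) * p ^ i" if t: "t0 <= t" for t i
 proof (induction i)
  case 0
  have "B t 0 = A t" using sets.sets_into_space[of "A t" "F t"] A(1)[of t] space_F by (auto simp: B_def)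
  then show ?case by simp
 next
  case (Suc i)
  have "emeasure M (B t (Suc i)) = nn_integral M (%om. indicator (B t (Suc i)) om)" using BM by simp
  also have "... = nn_integral M (%om. indicator (B t i) om * (\<Prod>k=1..K. indicator (J k) (X k (t + i) om)))"
  proof (rule nn_integral_cong)
   fix om assume w: "om : space M"
   show "(indicator (B t (Suc i)) om :: ennreal) = indicator (B t i) om * (\<Prod>k=1..K. indicator (J k) (X k (t + i) om))"
   proof (cases "ALL k:{1..K}. X k (t + i) om : J k")
    case True
    then show ?thesis by (simp add: B_def indicator_def less_Suc_eq all_conj_distrib)
   next
    case False
    then have "(\<Prod>k=1..K. indicator (J k) (X k (t + i) om) :: ennreal) = 0"
    by (intro prod_zero) (auto simp: indicator_def)
    moreover have "om \<notin> B t (Suc i)" using False by (auto simp: B_def)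
    ultimately show ?thesis by simp
   qed
  qed
  also have "... = nn_integral M (%om. indicator (B t i) om * (\<Prod>k=1..K. nn_integral (law k) (%x. indicator (J k) x)))"
  proof -
   have "t0 <= t + i" using t by simp
   moreover have "(indicator (B t i) :: 'a => ennreal) : borel_measurable (F (t + i))" using BF by simp
   moreover have "(%p. indicator (J k) (snd p) :: ennreal) : borel_measurable (F (t + i) \<Otimes>\<^sub>M borel)" if "k : {1..K}" for k
    using J(1)[OF that] by measurable
   ultimately show ?thesis
    using step_prod[of "t + i" "indicator (B t i)" "%k p. indicator (J k) (snd p)"] by simp
  qed
  also have "(\<Prod>k=1..K. nn_integral (law k) (%x. indicator (J k) x)) = p"
   unfolding p_def by (intro prod.cong refl nn_integral_indicator) (simp add: sets_law J(1))
  also have "nn_integral M (%om. indicator (B t i) om * p) = emeasure M (B t i) * p"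
   using BM by (simp add: nn_integral_multc)
  finally show ?case using Suc by (simp add: ac_simps)
 qed
 define f where "f n = measure M (A (t0 + n))" for n
 obtain p' where p': "p = ennreal p'" "0 < p'" "p' <= 1"
  using p by (cases p rule: ennreal_cases) (auto simp: top_unique)
 define q where "q = 1 - p' ^ r"
 have q: "q < 1" "0 <= q" using p' by (auto simp: q_def power_le_one)
 have AM: "A t : sets M" for t using A(1) sets_F by blast
 have Adec: "A (t + i) <= A t" for t i by (induction i) (use A(2) in auto)
 have dec: "f (n + r) <= q * f n" for n
 proof -
  have "A (t0 + n + r) <= A (t0 + n) - B (t0 + n) r"
   using Adec[of "t0 + n" r] run[of "t0 + n"] by (auto simp: B_def)
  then have "f (n + r) <= measure M (A (t0 + n) - B (t0 + n) r)"
   unfolding f_def by (intro finite_measure_mono) (auto simp: AM BM add.assoc)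
  also have "... = f n - measure M (B (t0 + n) r)"
   unfolding f_def by (intro finite_measure_Diff AM BM) (auto simp: B_def)
  also have "measure M (B (t0 + n) r) = f n * p' ^ r"
   using Bp[of "t0 + n" r] p' unfolding f_def p'(1)
   by (simp add: emeasure_eq_measure ennreal_mult[symmetric] ennreal_power)
  finally show ?thesis by (simp add: q_def algebra_simps)
 qed
 have f01: "0 <= f n" "f n <= 1" for n by (auto simp: f_def)
 have part: "(SUM n<N. f n) <= real r / (1 - q)" for N
 proof -
  have "(SUM n<N. f n) <= (SUM n<N + r. f n)" by (intro sum_mono2) (auto simp: f01)
  also have "... = (SUM n<r. f n) + (SUM n<N. f (n + r))"
   by (induction N) (simp_all add: add.assoc)
  also have "... <= (SUM n<r. 1) + (SUM n<N. q * f n)" by (intro add_mono sum_mono f01 dec)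
  finally have "(1 - q) * (SUM n<N. f n) <= real r" by (simp add: sum_distrib_left[symmetric] algebra_simps)
  then show ?thesis using q by (simp add: pos_le_divide_eq mult.commute)
 qed
 have "(\<Sum>n. emeasure M (A (t0 + n))) <= ennreal (real r / (1 - q))"
 proof (intro suminf_le_const summableI)
  fix N
  have "(SUM n<N. emeasure M (A (t0 + n))) = ennreal (SUM n<N. f n)"
   by (simp add: f_def emeasure_eq_measure)
  also have "... <= ennreal (real r / (1 - q))" by (intro ennreal_leI part)
  finally show "(SUM n<N. emeasure M (A (t0 + n))) <= ennreal (real r / (1 - q))" .
 qed
 then show ?thesis by (simp add: le_less_trans[OF _ ennreal_less_top])
qed

end

section \<open>First messages\<close>

context sensor_walk begin

definition sent :: "nat => nat => 'a => bool" where
 "sent k t om \<longleftrightarrow> (EX s:{t0..<t}. W k s om \<notin> S k)"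

lemma sent_t0: "~ sent k t0 om" by (simp add: sent_def)

lemma sent_Suc: "t0 <= t ==> sent k (Suc t) om \<longleftrightarrow> sent k t om | W k t om \<notin> S k"
 by (auto simp: sent_def atLeastLessThanSuc)

lemma out_F: "k : {1..K} ==> s < t ==> {om\<in>space M. W k s om \<notin> S k} : sets (F t)"
proof -
 assume k: "k : {1..K}" and "s < t"
 note [measurable] = measurable_F_mono[OF _ V_adapted[OF k], of s t] X_F[OF k, of s t]
 have [measurable]: "V k s : borel_measurable (F t)" "X k s : borel_measurable (F t)"
  using \<open>s < t\<close> by (auto intro!: measurable_F_mono[OF _ V_adapted[OF k]] X_F[OF k])
 have "{om\<in>space (F t). W k s om \<notin> S k} : sets (F t)" by measurable
 then show ?thesis by (simp add: space_F)
qed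

lemma sent_F: "k : {1..K} ==> {om\<in>space M. sent k t om} : sets (F t)"
proof -
 assume k: "k : {1..K}"
 have "{om\<in>space M. sent k t om} = (\<Union>s\<in>{t0..<t}. {om\<in>space M. W k s om \<notin> S k})"
  by (auto simp: sent_def)
 also have "... : sets (F t)" using out_F[OF k] by (intro sets.finite_UN) auto
 finally show ?thesis .
qed

lemma unsent_F: "k : {1..K} ==> {om\<in>space M. ~ sent k t om} : sets (F t)"
 using sets.compl_sets[OF sent_F[of k t]] by (auto simp: space_F set_diff_eq cong: conj_cong)

lemma law_UNIV: "k : {1..K} ==> emeasure (law k) UNIV = 1"
 using prob_space.emeasure_space_1[OF prob_law] sets_eq_imp_space_eq[OF sets_law] by (metis space_borel)

lemma F_M: "A : sets (F t) ==> A : sets M" using sets_F by blast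

text \<open>Until its first message, a sensor is a walk killed at the exit from its interval.\<close>

lemma unsent_mean:
 assumes k: "k : {1..K}" and A: "A : sets (F t0)" and f: "f : borel_measurable borel"
 shows "nn_integral M (%om. indicator (A Int {om\<in>space M. ~ sent k (t0 + n) om}) om * f (V k (t0 + n) om))
  = nn_integral M (%om. indicator A om * (kill (law k) (S k) ^^ n) f (V k t0 om))"
 using f
proof (induction n arbitrary: f)
 case 0
 have "A Int {om\<in>space M. ~ sent k (t0 + 0) om} = A"
  using sets.sets_into_space[OF A] by (auto simp: sent_t0 space_F)
 then show ?case by simp
next
 case (Suc n)
 note [measurable] = Suc.prems
 interpret l: real_law "law k" by (rule law)
 let ?t = "t0 + n"
 have AF: "A Int {om\<in>space M. ~ sent k ?t om} : sets (F ?t)"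
  using A F_mono[of t0 ?t] unsent_F[OF k, of ?t] by (intro sets.Int) auto
 have fm: "(%w. indicator (S k) w * f w) : borel_measurable borel" by measurable
 have "nn_integral M (%om. indicator (A Int {om\<in>space M. ~ sent k (t0 + Suc n) om}) om * f (V k (t0 + Suc n) om))
   = nn_integral M (%om. indicator (A Int {om\<in>space M. ~ sent k ?t om}) om * (indicator (S k) (W k ?t om) * f (W k ?t om)))"
 proof (rule nn_integral_cong)
  fix om assume w: "om : space M"
  show "indicator (A Int {om\<in>space M. ~ sent k (t0 + Suc n) om}) om * f (V k (t0 + Suc n) om)
    = indicator (A Int {om\<in>space M. ~ sent k ?t om}) om * (indicator (S k) (W k ?t om) * f (W k ?t om))"
  proof (cases "W k ?t om : S k")
   case True
   then have "V k (Suc ?t) om = W k ?t om" by (simp only: V_Suc[OF k w] renew_def if_True)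
   then show ?thesis using True w sent_Suc[of ?t k om] by (simp add: indicator_def)
  next
   case False
   then show ?thesis using w sent_Suc[of ?t k om] by (simp add: indicator_def del: greaterThanLessThan_iff)
  qed
 qed
 also have "... = nn_integral M (%om. indicator (A Int {om\<in>space M. ~ sent k ?t om}) om * kill (law k) (S k) f (V k ?t om))"
  unfolding kill_def using AF by (intro phase_step k fm) auto
 also have "... = nn_integral M (%om. indicator A om * (kill (law k) (S k) ^^ n) (kill (law k) (S k) f) (V k t0 om))"
  by (rule Suc.IH) (rule l.kill_measurable, auto)
 finally show ?case by (simp add: funpow_swap1)
qed

lemma unsent_probability_le:
 assumes k: "k : {1..K}" and A: "A : sets (F t0)"
  and B: "!!v. v : S k ==> (kill (law k) (S k) ^^ n) (%_. 1) v <= B"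
 shows "emeasure M (A Int {om\<in>space M. ~ sent k (t0 + n) om}) <= B * emeasure M A"
proof -
 have m: "A Int {om\<in>space M. ~ sent k (t0 + n) om} : sets M"
  using A unsent_F[OF k] F_M by (intro sets.Int) blast+
 have "emeasure M (A Int {om\<in>space M. ~ sent k (t0 + n) om})
   = nn_integral M (%om. indicator (A Int {om\<in>space M. ~ sent k (t0 + n) om}) om * 1)" using m by simp
 also have "... = nn_integral M (%om. indicator A om * (kill (law k) (S k) ^^ n) (%_. 1) (V k t0 om))"
  by (rule unsent_mean[OF k A]) simp
 also have "... <= nn_integral M (%om. B * indicator A om)"
  using B V_range[OF k] by (intro nn_integral_mono) (auto simp: indicator_def)
 also have "... = B * emeasure M A" using F_M[OF A] by (simp add: nn_integral_cmult_indicator)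
 finally show ?thesis .
qed

text \<open>Starting afresh, a sensor needs a number of steps proportional to its thresholds.\<close>

lemma sent_probability_le:
 assumes k: "k : {1..K}" and V0: "!!om. om : space M ==> V k t0 om = 0"
  and int: "integrable (law k) (%x. x)" and r: "0 < r" "r <= lo k" "r <= up k"
 shows "emeasure M {om\<in>space M. sent k (t0 + n) om} <= of_nat n * ennreal ((\<integral>x. \<bar>x\<bar> \<partial>law k) / r)"
proof -
 let ?m = "\<integral>x. \<bar>x\<bar> \<partial>law k"
 interpret l: real_law "law k" by (rule law)
 define Y where "Y n om = (if sent k (t0 + n) om then 1 else ennreal (\<bar>V k (t0 + n) om\<bar> / r))" for n om
 have nn: "nn_integral (law k) (%x. ennreal (\<bar>v + x\<bar> / r)) <= ennreal (\<bar>v\<bar> / r) + ennreal (?m / r)" for v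
 proof -
  have "nn_integral (law k) (%x. ennreal (\<bar>v + x\<bar> / r)) <= nn_integral (law k) (%x. ennreal (\<bar>v\<bar> / r) + ennreal (\<bar>x\<bar> / r))"
   using r by (intro nn_integral_mono) (simp add: ennreal_plus[symmetric] add_divide_distrib[symmetric] divide_right_mono ennreal_leI del: ennreal_plus)
  also have "... = ennreal (\<bar>v\<bar> / r) + nn_integral (law k) (%x. ennreal (\<bar>x\<bar> / r))"
   by (subst nn_integral_add) (auto simp: law_UNIV[OF k])
  also have "nn_integral (law k) (%x. ennreal (\<bar>x\<bar> / r)) = ennreal (\<integral>x. \<bar>x\<bar> / r \<partial>law k)"
   using int r by (intro nn_integral_eq_integral) auto
  finally show ?thesis by simp
 qed
 have "nn_integral M (%om. Y n om) <= of_nat n * ennreal (?m / r)" for n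
 proof (induction n)
  case 0
  have "nn_integral M (%om. Y 0 om) = nn_integral M (%om. 0)"
   by (intro nn_integral_cong) (simp add: Y_def sent_t0 V0)
  then show ?case by simp
 next
  case (Suc n)
  let ?t = "t0 + n"
  let ?c = "%om. indicator {om\<in>space M. ~ sent k ?t om} om :: ennreal"
  have cF: "?c : borel_measurable (F ?t)" using unsent_F[OF k, of ?t] by simp
  note cM = measurable_F_M[OF cF]
  have sM: "{om\<in>space M. sent k ?t om} : sets M" using sent_F[OF k] F_M by blast
  have "nn_integral M (%om. Y (Suc n) om) <= nn_integral M (%om. indicator {om\<in>space M. sent k ?t om} om + ?c om * ennreal (\<bar>W k ?t om\<bar> / r))"
  proof (rule nn_integral_mono)
   fix om assume w: "om : space M"
   show "Y (Suc n) om <= indicator {om\<in>space M. sent k ?t om} om + ?c om * ennreal (\<bar>W k ?t om\<bar> / r)"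
   proof (cases "sent k ?t om")
    case True
    then show ?thesis using w sent_Suc[of ?t k om] by (simp add: Y_def)
   next
    case False
    show ?thesis
    proof (cases "W k ?t om : S k")
    case True
    then have "V k (Suc ?t) om = W k ?t om" by (simp only: V_Suc[OF k w] renew_def if_True)
    then show ?thesis using True w False sent_Suc[of ?t k om] by (simp add: Y_def)
    next
    case out: False
    then have "r <= \<bar>W k ?t om\<bar>" using r by auto
    then have "1 <= \<bar>W k ?t om\<bar> / r" using r by simp
    then have "ennreal 1 <= ennreal (\<bar>W k ?t om\<bar> / r)" by (rule ennreal_leI)
    then show ?thesis using w False out sent_Suc[of ?t k om] by (simp add: Y_def del: greaterThanLessThan_iff)
    qed
   qed
  qed
  also have "... = emeasure M {om\<in>space M. sent k ?t om} + nn_integral M (%om. ?c om * ennreal (\<bar>W k ?t om\<bar> / r))"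
  proof (subst nn_integral_add)
   note [measurable] = cM V_M[OF k, of ?t] X_M[OF k, of ?t]
   show "(%om. ?c om * ennreal (\<bar>W k ?t om\<bar> / r)) : borel_measurable M" by measurable
  qed (use sM in auto)
  also have "nn_integral M (%om. ?c om * ennreal (\<bar>W k ?t om\<bar> / r)) = nn_integral M (%om. ?c om * (nn_integral (law k) (%x. ennreal (\<bar>V k ?t om + x\<bar> / r))))"
   by (rule phase_step[OF _ k cF, of "%w. ennreal (\<bar>w\<bar> / r)"]) auto
  also have "... <= nn_integral M (%om. ?c om * (ennreal (\<bar>V k ?t om\<bar> / r)) + ennreal (?m / r))"
   using nn by (intro nn_integral_mono) (auto simp: indicator_def)
  also have "... = nn_integral M (%om. ?c om * ennreal (\<bar>V k ?t om\<bar> / r)) + ennreal (?m / r)"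
  proof (subst nn_integral_add)
   note [measurable] = cM V_M[OF k, of ?t]
   show "(%om. ?c om * ennreal (\<bar>V k ?t om\<bar> / r)) : borel_measurable M" by measurable
  qed (auto simp: emeasure_space_1)
  also have "emeasure M {om\<in>space M. sent k ?t om} + ((nn_integral M (%om. ?c om * ennreal (\<bar>V k ?t om\<bar> / r))) + ennreal (?m / r))
    = nn_integral M (%om. Y n om) + ennreal (?m / r)"
  proof -
   have "nn_integral M (%om. Y n om) = nn_integral M (%om. indicator {om\<in>space M. sent k ?t om} om + ?c om * ennreal (\<bar>V k ?t om\<bar> / r))"
    by (intro nn_integral_cong) (simp add: Y_def)
   also have "... = emeasure M {om\<in>space M. sent k ?t om} + nn_integral M (%om. ?c om * ennreal (\<bar>V k ?t om\<bar> / r))"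
   proof (subst nn_integral_add)
    note [measurable] = cM V_M[OF k, of ?t]
    show "(%om. ?c om * ennreal (\<bar>V k ?t om\<bar> / r)) : borel_measurable M" by measurable
   qed (use sM in auto)
   finally show ?thesis by (simp add: add.assoc)
  qed
  also have "... <= of_nat n * ennreal (?m / r) + ennreal (?m / r)" using Suc by (rule add_right_mono)
  also have "... = of_nat (Suc n) * ennreal (?m / r)" by (simp add: distrib_right add.commute)
  finally show ?case by this (rule add_left_mono)
 qed
 moreover have "emeasure M {om\<in>space M. sent k (t0 + n) om} <= nn_integral M (%om. Y n om)"
 proof -
  have "emeasure M {om\<in>space M. sent k (t0 + n) om} = nn_integral M (%om. indicator {om\<in>space M. sent k (t0 + n) om} om)"
   using sent_F[OF k] F_M by (subst nn_integral_indicator) blast+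
  also have "... <= nn_integral M (%om. Y n om)" by (intro nn_integral_mono) (auto simp: Y_def indicator_def)
  finally show ?thesis .
 qed
 ultimately show ?thesis using order_trans by blast
qed

section \<open>Detection delay after the change\<close>

text \<open>Losses of the messages after the first one, while the procedure is running.\<close>

definition acc_loss :: "(nat => 'a set) => (nat => real => ennreal) => nat => nat => 'a => ennreal" where
 "acc_loss A f k n om = (SUM i<n. indicator (A (t0 + i)) om *
   (if sent k (t0 + i) om & W k (t0 + i) om \<notin> S k then f k (W k (t0 + i) om) else 0))"

text \<open>
 A potential argument: \<open>psi\<close> is the mean loss of the message in progress and
 \<open>\<kappa>\<close> the ratio of the mean loss and the mean duration of a message that starts
 afresh.  The remaining duration \<open>ph\<close> enters with a negative sign, so the potential
 stays bounded by \<open>\<kappa> * \<Phi>\<close> at a renewal and grows by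
 \<open>\<kappa>\<close> per step otherwise.
\<close>

lemma acc_loss_mean_le:
 assumes k: "k : {1..K}" and A: "!!t. A t : sets (F t)" "!!t. A (Suc t) <= A t"
  and f: "f k : borel_measurable borel"
  and phi: "!!v. v : S k ==> green (law k) (S k) (%_. 1) v <= ennreal \<Phi>"
  and kap: "exit_mean (law k) (S k) (f k) 0 <= \<kappa> * green (law k) (S k) (%_. 1) 0"
 shows "nn_integral M (%om. acc_loss A f k n om) <= \<kappa> * (ennreal \<Phi> * emeasure M (A t0) + (SUM i<n. emeasure M (A (t0 + i))))"
proof -
 interpret l: real_law "law k" by (rule law)
 let ?S = "S k"
 note f [measurable]
 define psi where "psi = exit_mean (law k) ?S (f k)"
 define ph where "ph = green (law k) ?S (%_. 1)"
 define chi where "chi v = ennreal \<Phi> - ph v" for v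
 have [measurable]: "psi : borel_measurable borel" "ph : borel_measurable borel"
  unfolding psi_def ph_def by simp_all
 have [measurable]: "chi : borel_measurable borel" unfolding chi_def by measurable
 have ph: "ph v <= ennreal \<Phi>" if "v : ?S" for v using phi[OF that] by (simp add: ph_def)
 have S0: "0 : ?S" using thr_pos[OF k] by simp
 have psi_step: "nn_integral (law k) (%x. (if v + x : ?S then psi (v + x) else f k (v + x))) = psi v" for v
  using l.exit_mean_unfold[of ?S "f k" v] l.kill_compl[of ?S psi "f k" v] by (simp add: psi_def)
 have chi_step: "nn_integral (law k) (%x. (if v + x : ?S then chi (v + x) else ennreal \<Phi>)) = chi v + 1" if v: "v : ?S" for v
 proof -
  have "nn_integral (law k) (%x. (if v + x : ?S then chi (v + x) else ennreal \<Phi>)) + kill (law k) ?S ph v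
    = nn_integral (law k) (%x. (if v + x : ?S then chi (v + x) else ennreal \<Phi>) + indicator ?S (v + x) * ph (v + x))"
   unfolding kill_def by (rule nn_integral_add[symmetric]) measurable
  also have "... = nn_integral (law k) (%x. ennreal \<Phi>)"
  proof (rule nn_integral_cong)
   fix x
   show "(if v + x : ?S then chi (v + x) else ennreal \<Phi>) + indicator ?S (v + x) * ph (v + x) = ennreal \<Phi>"
    using ph[of "v + x"] by (cases "v + x : ?S") (simp_all add: chi_def diff_add_cancel_ennreal del: greaterThanLessThan_iff)
  qed
  also have "... = ennreal \<Phi>" by (simp add: law_UNIV[OF k])
  finally have *: "nn_integral (law k) (%x. (if v + x : ?S then chi (v + x) else ennreal \<Phi>)) + kill (law k) ?S ph v = ennreal \<Phi>" .
  have pv: "ph v = 1 + kill (law k) ?S ph v" unfolding ph_def by (rule l.green_unfold) auto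
  have "chi v + ph v = ennreal \<Phi>" using ph[OF v] by (simp add: chi_def diff_add_cancel_ennreal)
  then have "(chi v + 1) + kill (law k) ?S ph v = ennreal \<Phi>" using pv by (simp add: add.assoc)
  then have "nn_integral (law k) (%x. (if v + x : ?S then chi (v + x) else ennreal \<Phi>)) + kill (law k) ?S ph v = (chi v + 1) + kill (law k) ?S ph v"
   using * by simp
  moreover have "kill (law k) ?S ph v ~= \<top>" using * by (metis ennreal_add_eq_top ennreal_neq_top)
  ultimately show ?thesis by (simp add: add.commute[of _ "kill (law k) ?S ph v"] ennreal_add_left_cancel)
 qed
 have chi0: "psi 0 + \<kappa> * chi 0 <= \<kappa> * ennreal \<Phi>"
 proof -
  have "psi 0 + \<kappa> * chi 0 <= \<kappa> * ph 0 + \<kappa> * chi 0" using kap by (simp add: psi_def ph_def add_right_mono)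
  also have "... = \<kappa> * (chi 0 + ph 0)" by (simp add: distrib_left add.commute)
  also have "chi 0 + ph 0 = ennreal \<Phi>" using ph[OF S0] by (simp add: chi_def diff_add_cancel_ennreal)
  finally show ?thesis .
 qed
 define Q where "Q t om = (if sent k t om then psi (V k t om) else 0) + \<kappa> * chi (V k t om)" for t om
 define G where "G n = nn_integral M (%om. acc_loss A f k n om + indicator (A (t0 + n)) om * Q (t0 + n) om)" for n
 have AM: "A t : sets M" for t using A(1) F_M by blast
 have sM: "{om\<in>space M. sent k t om} : sets M" for t using sent_F[OF k] F_M by blast
 have VM [measurable]: "V k t : borel_measurable M" "X k t : borel_measurable M" for t by (rule V_M[OF k], rule X_M[OF k])
 have sp [measurable]: "Measurable.pred M (sent k t)" for t using sM[of t] by (simp add: pred_def)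
 have [measurable]: "A t : sets M" for t by (rule AM)
 have lossM [measurable]: "acc_loss A f k n : borel_measurable M" for n
  unfolding acc_loss_def[abs_def] by measurable
 have QM [measurable]: "Q t : borel_measurable M" for t unfolding Q_def[abs_def] by measurable
 have step: "G (Suc n) <= G n + \<kappa> * emeasure M (A (t0 + n))" for n
 proof -
  let ?t = "t0 + n"
  define c1 where "c1 om = (indicator (A ?t Int {om\<in>space M. sent k ?t om}) om :: ennreal)" for om
  define c0 where "c0 om = (indicator (A ?t) om :: ennreal)" for om
  have cF: "c1 : borel_measurable (F ?t)" "c0 : borel_measurable (F ?t)"
   unfolding c1_def[abs_def] c0_def[abs_def] using A(1)[of ?t] sent_F[OF k, of ?t] by auto
  note [measurable] = measurable_F_M[OF cF(1)] measurable_F_M[OF cF(2)]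
  let ?f1 = "%w. if w : ?S then psi w else f k w"
  let ?f0 = "%w. if w : ?S then chi w else ennreal \<Phi>"
  have pw: "acc_loss A f k (Suc n) om + indicator (A (Suc ?t)) om * Q (Suc ?t) om
    <= acc_loss A f k n om + (c1 om * ?f1 (W k ?t om) + \<kappa> * (c0 om * ?f0 (W k ?t om)))" if w: "om : space M" for om
  proof (cases "om : A ?t")
   case False
   then have "om \<notin> A (Suc ?t)" using A(2)[of ?t] by auto
   then show ?thesis using False by (simp add: acc_loss_def)
  next
   case True
   have le: "indicator (A (Suc ?t)) om * Q (Suc ?t) om <= Q (Suc ?t) om" by (simp add: indicator_def)
   show ?thesis
   proof (cases "W k ?t om : ?S")
    case inS: True
    then have "V k (Suc ?t) om = W k ?t om" by (simp only: V_Suc[OF k w] renew_def if_True)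
    moreover have "sent k (Suc ?t) om = sent k ?t om" using inS sent_Suc[of ?t k om] by simp
    ultimately have "Q (Suc ?t) om = c1 om * ?f1 (W k ?t om) + \<kappa> * (c0 om * ?f0 (W k ?t om))"
    using inS True w by (simp add: Q_def c1_def c0_def del: greaterThanLessThan_iff)
    moreover have "acc_loss A f k (Suc n) om = acc_loss A f k n om"
    using inS by (simp add: acc_loss_def del: greaterThanLessThan_iff)
    ultimately show ?thesis using le by (simp only: add_left_mono)
   next
    case out: False
    then have "V k (Suc ?t) om = 0" by (simp only: V_Suc[OF k w] renew_def if_False)
    moreover have "sent k (Suc ?t) om" using out sent_Suc[of ?t k om] by simp
    ultimately have "Q (Suc ?t) om <= \<kappa> * ennreal \<Phi>" using chi0 by (simp add: Q_def)
    moreover have "\<kappa> * (c0 om * ?f0 (W k ?t om)) = \<kappa> * ennreal \<Phi>"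
    using out True by (simp add: c0_def del: greaterThanLessThan_iff)
    moreover have "acc_loss A f k (Suc n) om = acc_loss A f k n om + c1 om * ?f1 (W k ?t om)"
    using out True w by (simp add: acc_loss_def c1_def del: greaterThanLessThan_iff)
    ultimately show ?thesis using le by (simp add: add.assoc add_left_mono order_trans)
   qed
  qed
  have "G (Suc n) <= nn_integral M (%om. acc_loss A f k n om + (c1 om * ?f1 (W k ?t om) + \<kappa> * (c0 om * ?f0 (W k ?t om))))"
   unfolding G_def add_Suc_right by (rule nn_integral_mono[OF pw])
  also have "... = nn_integral M (%om. acc_loss A f k n om) + ((nn_integral M (%om. c1 om * ?f1 (W k ?t om))) + \<kappa> * nn_integral M (%om. c0 om * ?f0 (W k ?t om)))"
  proof -
   have m1: "(%om. c1 om * ?f1 (W k ?t om)) : borel_measurable M" by measurable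
   have m0: "(%om. c0 om * ?f0 (W k ?t om)) : borel_measurable M" by measurable
   show ?thesis
    by (subst nn_integral_add[OF lossM borel_measurable_add[OF m1 borel_measurable_times_ennreal[OF borel_measurable_const m0]]],
    subst nn_integral_add[OF m1 borel_measurable_times_ennreal[OF borel_measurable_const m0]],
    subst nn_integral_cmult[OF m0]) simp
  qed
  also have "nn_integral M (%om. c1 om * ?f1 (W k ?t om)) = nn_integral M (%om. c1 om * psi (V k ?t om))"
   by (subst phase_step[OF _ k cF(1), of ?f1]) (simp_all only: psi_step, auto)
  also have "nn_integral M (%om. c0 om * ?f0 (W k ?t om)) = nn_integral M (%om. c0 om * (chi (V k ?t om) + 1))"
  proof -
   have "nn_integral M (%om. c0 om * ?f0 (W k ?t om)) = nn_integral M (%om. c0 om * (nn_integral (law k) (%x. ?f0 (V k ?t om + x))))"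
    by (rule phase_step[OF _ k cF(2), of ?f0]) auto
   also have "... = nn_integral M (%om. c0 om * (chi (V k ?t om) + 1))"
    using chi_step V_range[OF k] by (intro nn_integral_cong) (simp only:)
   finally show ?thesis .
  qed
  also have "... = nn_integral M (%om. c0 om * chi (V k ?t om)) + emeasure M (A ?t)"
  proof -
   have "nn_integral M (%om. c0 om * (chi (V k ?t om) + 1)) = nn_integral M (%om. c0 om * chi (V k ?t om) + c0 om)"
    by (simp add: distrib_left)
   also have "... = nn_integral M (%om. c0 om * chi (V k ?t om)) + nn_integral M (%om. c0 om)"
    by (rule nn_integral_add) measurable
   finally show ?thesis by (simp add: c0_def AM)
  qed
  also have "nn_integral M (%om. acc_loss A f k n om) + ((nn_integral M (%om. c1 om * psi (V k ?t om))) + \<kappa> * ((nn_integral M (%om. c0 om * chi (V k ?t om))) + emeasure M (A ?t)))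
    = G n + \<kappa> * emeasure M (A ?t)"
  proof -
   have m1: "(%om. c1 om * psi (V k ?t om)) : borel_measurable M" by measurable
   have m0: "(%om. c0 om * chi (V k ?t om)) : borel_measurable M" by measurable
   have "G n = nn_integral M (%om. acc_loss A f k n om + (c1 om * psi (V k ?t om) + \<kappa> * (c0 om * chi (V k ?t om))))"
    unfolding G_def by (intro nn_integral_cong) (simp add: Q_def c1_def c0_def indicator_def)
   also have "... = nn_integral M (%om. acc_loss A f k n om) + ((nn_integral M (%om. c1 om * psi (V k ?t om))) + \<kappa> * nn_integral M (%om. c0 om * chi (V k ?t om)))"
    by (subst nn_integral_add[OF lossM borel_measurable_add[OF m1 borel_measurable_times_ennreal[OF borel_measurable_const m0]]],
    subst nn_integral_add[OF m1 borel_measurable_times_ennreal[OF borel_measurable_const m0]],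
    subst nn_integral_cmult[OF m0]) simp
   finally show ?thesis by (simp add: distrib_left add.assoc)
  qed
  finally show ?thesis .
 qed
 have "G n <= \<kappa> * (ennreal \<Phi> * emeasure M (A t0) + (SUM i<n. emeasure M (A (t0 + i))))"
 proof (induction n)
  case 0
  have "G 0 <= nn_integral M (%om. \<kappa> * ennreal \<Phi> * indicator (A t0) om)"
   unfolding G_def
  proof (rule nn_integral_mono)
   fix om
   have "chi (V k t0 om) <= ennreal \<Phi>" by (simp add: chi_def)
   then show "acc_loss A f k 0 om + indicator (A (t0 + 0)) om * Q (t0 + 0) om <= \<kappa> * ennreal \<Phi> * indicator (A t0) om"
    by (simp add: acc_loss_def Q_def sent_t0 indicator_def mult_left_mono)
  qed
  then show ?case using AM[of t0] by (simp add: nn_integral_cmult nn_integral_cmult_indicator mult.assoc)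
 next
  case (Suc n)
  have "G (Suc n) <= G n + \<kappa> * emeasure M (A (t0 + n))" by (rule step)
  also have "... <= \<kappa> * (ennreal \<Phi> * emeasure M (A t0) + (SUM i<n. emeasure M (A (t0 + i)))) + \<kappa> * emeasure M (A (t0 + n))"
   using Suc by (rule add_right_mono)
  also have "... = \<kappa> * (ennreal \<Phi> * emeasure M (A t0) + (SUM i<Suc n. emeasure M (A (t0 + i))))"
   by (simp add: distrib_left add.assoc)
  finally show ?case .
 qed
 moreover have "nn_integral M (%om. acc_loss A f k n om) <= G n" unfolding G_def by (intro nn_integral_mono) simp
 ultimately show ?thesis using order_trans by blast
qed

end

text \<open>The mean of an increment, split at the boundary into its positive and negative parts.\<close>

lemma (in real_law) kill_balance:
 assumes [measurable]: "S : sets borel" and int: "integrable mu (%x. x)" and S: "S = {..<up}"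
  and "v < up" "0 <= (\<integral>x. x \<partial>mu)"
 shows "ennreal (up - v) + kill mu (- S) (%w. ennreal (w - up)) v = ennreal (\<integral>x. x \<partial>mu) + kill mu S (%w. ennreal (up - w)) v"
proof -
 define p where "p x = max 0 (up - v - x)" for x
 define n where "n x = max 0 (v + x - up)" for x
 have ip: "integrable mu p" "integrable mu n"
  unfolding p_def[abs_def] n_def[abs_def] using int by (auto intro!: Bochner_Integration.integrable_diff Bochner_Integration.integrable_add integrable_const integrable_max)
 have pn: "AE x in mu. 0 <= p x" "AE x in mu. 0 <= n x" by (simp_all add: p_def n_def)
 have "kill mu S (%w. ennreal (up - w)) v = nn_integral mu (%x. ennreal (p x))"
  unfolding kill_def S by (intro nn_integral_cong) (auto simp: p_def indicator_def max_def algebra_simps)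
 then have 1: "kill mu S (%w. ennreal (up - w)) v = ennreal (\<integral>x. p x \<partial>mu)"
  using nn_integral_eq_integral[OF ip(1)] pn by simp
 have "kill mu (- S) (%w. ennreal (w - up)) v = nn_integral mu (%x. ennreal (n x))"
  unfolding kill_def S by (intro nn_integral_cong) (auto simp: n_def indicator_def max_def algebra_simps)
 then have 2: "kill mu (- S) (%w. ennreal (w - up)) v = ennreal (\<integral>x. n x \<partial>mu)"
  using nn_integral_eq_integral[OF ip(2)] pn by simp
 have "(\<integral>x. p x \<partial>mu) - (\<integral>x. n x \<partial>mu) = (\<integral>x. p x - n x \<partial>mu)" using ip by simp
 also have "... = (\<integral>x. (up - v) - x \<partial>mu)" by (intro Bochner_Integration.integral_cong) (auto simp: p_def n_def)
 also have "... = (up - v) - (\<integral>x. x \<partial>mu)" using int by (simp add: prob_space[simplified])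
 finally have eq: "(\<integral>x. p x \<partial>mu) - (\<integral>x. n x \<partial>mu) = (up - v) - (\<integral>x. x \<partial>mu)" .
 have "0 <= (\<integral>x. p x \<partial>mu)" "0 <= (\<integral>x. n x \<partial>mu)" by (auto intro!: Bochner_Integration.integral_nonneg simp: p_def n_def)
 then show ?thesis unfolding 1 2 using assms(4,5) eq by (simp add: ennreal_plus[symmetric] del: ennreal_plus)
qed

text \<open>Lorden's bound of the mean time below a level: Wald's identity with the overshoot added.\<close>

lemma (in real_law) sojourn_below_le:
 assumes int: "integrable mu (%x. x)" and I: "0 <= (\<integral>x. x \<partial>mu)"
  and ov: "!!v. v < up ==> exit_mean mu {..<up} (%w. ennreal (w - up)) v <= ennreal Ov" and v: "v < up"
 shows "ennreal (\<integral>x. x \<partial>mu) * green mu {..<up} (%_. 1) v <= ennreal (up - v) + ennreal Ov"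
proof -
 let ?S = "{..<up}"
 let ?ov = "exit_mean mu ?S (%w. ennreal (w - up))"
 have "ennreal (\<integral>x. x \<partial>mu) * green mu ?S (%_. 1) v = green mu ?S (%_. ennreal (\<integral>x. x \<partial>mu)) v"
  by (subst green_cmult[symmetric]) auto
 also have "... <= ennreal (up - v) + ?ov v"
 proof (rule green_le[where D = "?S"])
  fix v assume v: "v : ?S"
  have "ennreal (\<integral>x. x \<partial>mu) + kill mu ?S (%w. ennreal (up - w) + ?ov w) v
    = (ennreal (\<integral>x. x \<partial>mu) + kill mu ?S (%w. ennreal (up - w)) v) + kill mu ?S ?ov v"
   by (subst kill_add) (auto simp: add.assoc)
  also have "... = ennreal (up - v) + (kill mu (- ?S) (%w. ennreal (w - up)) v + kill mu ?S ?ov v)"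
   using kill_balance[of ?S up v] int I v by (simp add: add.assoc)
  also have "kill mu (- ?S) (%w. ennreal (w - up)) v + kill mu ?S ?ov v = ?ov v"
   by (rule exit_mean_unfold[symmetric]) auto
  finally show "ennreal (\<integral>x. x \<partial>mu) + kill mu ?S (%w. ennreal (up - w) + ?ov w) v <= ennreal (up - v) + ?ov v" by simp
 qed (use v in auto)
 also have "... <= ennreal (up - v) + ennreal Ov" by (intro add_left_mono ov v)
 finally show ?thesis .
qed

context filtered_walk begin

definition Xs :: "nat => 'a => real" where "Xs t om = (SUM k=1..K. X k t om)"

lemma Xs_F: "t < s ==> Xs t : borel_measurable (F s)"
 unfolding Xs_def[abs_def] by (intro borel_measurable_sum measurable_F_mono[OF _ X_adapted]) auto

lemma Xs_M [measurable]: "Xs t : borel_measurable M"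
 by (rule measurable_F_M[OF Xs_F[OF lessI]])

lemma sum_step:
 assumes "t0 <= t" and [measurable]: "c : borel_measurable (F t)" "y : borel_measurable (F t)" "f : borel_measurable borel"
 shows "nn_integral M (%om. c om * f (y om + Xs t om)) = nn_integral M (%om. c om * (nn_integral total_law (%x. f (y om + x))))"
proof -
 interpret T: real_law total_law by (rule real_law_total)
 have "(%p. c (fst p) * f (y (fst p) + snd p)) : borel_measurable (F t \<Otimes>\<^sub>M borel)" by measurable
 from step_sum[OF assms(1) this]
 have "nn_integral M (%om. c om * f (y om + Xs t om)) = nn_integral M (%om. nn_integral total_law (%x. c om * f (y om + x)))" by (simp add: Xs_def)
 also have "... = nn_integral M (%om. c om * (nn_integral total_law (%x. f (y om + x))))"
  by (intro nn_integral_cong nn_integral_cmult) (simp add: measurable_cong_sets[OF T.sets_law refl])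
 finally show ?thesis .
qed

text \<open>Wald's identity for a decreasing family of events.\<close>

lemma wald:
 assumes A: "!!t. A t : sets (F t)" and fin: "(\<Sum>n. emeasure M (A (t0 + n))) < \<infinity>"
  and int: "integrable total_law (%x. x)"
 shows "integrable M (%om. \<Sum>n. indicator (A (t0 + n)) om * Xs (t0 + n) om)"
  and "(\<integral>om. (\<Sum>n. indicator (A (t0 + n)) om * Xs (t0 + n) om) \<partial>M) = (\<integral>x. x \<partial>total_law) * (\<Sum>n. measure M (A (t0 + n)))"
  and "summable (%n. measure M (A (t0 + n)))"
  and "AE om in M. EX n. om \<notin> A (t0 + n)"
proof -
 interpret T: real_law total_law by (rule real_law_total)
 have AM [measurable]: "A t : sets M" for t using A sets_F by blast
 let ?I = "%n om. indicator (A (t0 + n)) om :: ennreal"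
 have cF: "?I n : borel_measurable (F (t0 + n))" for n using A by simp
 have pr: "nn_integral M (%om. ?I n om * f (Xs (t0 + n) om)) = emeasure M (A (t0 + n)) * nn_integral total_law (%x. f x)"
  if [measurable]: "f : borel_measurable borel" for n f
  using sum_step[OF _ cF[of n], of "%_. 0" f] by (simp add: nn_integral_multc)
 let ?m = "\<integral>x. \<bar>x\<bar> \<partial>total_law"
 have absm: "nn_integral total_law (%x. ennreal \<bar>x\<bar>) = ennreal ?m"
  using int by (intro nn_integral_eq_integral) auto
 have m0: "0 <= ?m" by simp
 show sm: "summable (%n. measure M (A (t0 + n)))"
 proof (rule summable_suminf_not_top)
  show "(\<Sum>n. ennreal (measure M (A (t0 + n)))) ~= \<top>" using fin by (simp add: emeasure_eq_measure)
 qed simp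
 let ?f = "%n om. indicator (A (t0 + n)) om * Xs (t0 + n) om :: real"
 have nf: "nn_integral M (%om. ennreal (norm (?f n om))) = ennreal (?m * measure M (A (t0 + n)))" for n
 proof -
  have "nn_integral M (%om. ennreal (norm (?f n om))) = nn_integral M (%om. ?I n om * ennreal \<bar>Xs (t0 + n) om\<bar>)"
   by (intro nn_integral_cong) (auto simp: indicator_def)
  also have "... = emeasure M (A (t0 + n)) * ennreal ?m" using pr[of "%x. ennreal \<bar>x\<bar>" n] absm by simp
  also have "... = ennreal (?m * measure M (A (t0 + n)))"
   using m0 by (simp add: emeasure_eq_measure ennreal_mult[symmetric] mult.commute)
  finally show ?thesis .
 qed
 have fi: "integrable M (?f n)" for n
  by (rule integrableI_bounded) (auto simp: nf[simplified])
 have fn: "(\<integral>om. norm (?f n om) \<partial>M) = ?m * measure M (A (t0 + n))" for n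
  using integral_eq_nn_integral[of "%om. norm (?f n om)" M] nf[of n] m0 fi[of n] by simp
 have fm: "(\<integral>om. ?f n om \<partial>M) = (\<integral>x. x \<partial>total_law) * measure M (A (t0 + n))" for n
 proof -
  have p: "nn_integral total_law (%x. ennreal x) <= ennreal ?m" "nn_integral total_law (%x. ennreal (-x)) <= ennreal ?m"
   unfolding absm[symmetric] by (auto intro!: nn_integral_mono ennreal_leI)
  have "(\<integral>om. ?f n om \<partial>M) = enn2real (nn_integral M (%om. ennreal (?f n om))) - enn2real (nn_integral M (%om. ennreal (- ?f n om)))"
   by (rule real_lebesgue_integral_def[OF fi])
  also have "nn_integral M (%om. ennreal (?f n om)) = emeasure M (A (t0 + n)) * nn_integral total_law (%x. ennreal x)"
   by (subst pr[symmetric]) (auto intro!: nn_integral_cong simp: indicator_def)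
  also have "nn_integral M (%om. ennreal (- ?f n om)) = emeasure M (A (t0 + n)) * nn_integral total_law (%x. ennreal (-x))"
   by (subst pr[symmetric]) (auto intro!: nn_integral_cong simp: indicator_def)
  also have "enn2real (emeasure M (A (t0 + n)) * nn_integral total_law (%x. ennreal x)) - enn2real (emeasure M (A (t0 + n)) * nn_integral total_law (%x. ennreal (-x)))
    = (\<integral>x. x \<partial>total_law) * measure M (A (t0 + n))"
   unfolding enn2real_mult measure_def real_lebesgue_integral_def[OF int] by (simp only: algebra_simps)
  finally show ?thesis .
 qed
 show ae: "AE om in M. EX n. om \<notin> A (t0 + n)"
 proof -
  have "nn_integral M (%om. (\<Sum>n. ?I n om)) = (\<Sum>n. emeasure M (A (t0 + n)))"
   by (subst nn_integral_suminf) auto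
  then have "AE om in M. (\<Sum>n. ?I n om) ~= \<infinity>"
   using fin by (intro nn_integral_PInf_AE) auto
  then show ?thesis
  proof (rule AE_mp, intro AE_I2 impI)
   fix om assume "(\<Sum>n. ?I n om) ~= \<infinity>"
   then have "(\<Sum>n. ?I n om) < \<top>" by (simp add: top.not_eq_extremum)
   then obtain N where N: "(\<Sum>n. ?I n om) < of_nat N" using ennreal_Ex_less_of_nat by blast
   show "EX n. om \<notin> A (t0 + n)"
   proof (rule ccontr)
    assume "~ (EX n. om \<notin> A (t0 + n))"
    then have "of_nat N = (SUM n<N. ?I n om)" by simp
    also have "... <= (\<Sum>n. ?I n om)" by (rule sum_le_suminf) (auto intro: summableI)
    finally show False using N by simp
   qed
  qed
 qed
 have s2: "summable (%n. ?m * measure M (A (t0 + n)))" by (rule summable_mult[OF sm])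
 have n2: "0 <= ?m * measure M (A (t0 + n))" for n using m0 measure_nonneg by (rule mult_nonneg_nonneg)
 have aes: "AE om in M. summable (%n. norm (?f n om))"
 proof -
  have "nn_integral M (%om. (\<Sum>n. ennreal (norm (?f n om)))) = (\<Sum>n. ennreal (?m * measure M (A (t0 + n))))"
   unfolding nf[symmetric] by (rule nn_integral_suminf) measurable
  also have "... = ennreal (\<Sum>n. ?m * measure M (A (t0 + n)))"
   by (rule suminf_ennreal2[OF n2 s2])
  also have "... < \<infinity>" using ennreal_less_top by (simp only: infinity_ennreal_def)
  finally have "nn_integral M (%om. (\<Sum>n. ennreal (norm (?f n om)))) < \<infinity>" .
  then have "AE om in M. (\<Sum>n. ennreal (norm (?f n om))) ~= \<infinity>"
   by (intro nn_integral_PInf_AE) auto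
  then show ?thesis
   by (rule AE_mp) (intro AE_I2 impI summable_suminf_not_top, auto)
 qed
 have sn: "summable (%n. \<integral>om. norm (?f n om) \<partial>M)" unfolding fn by (rule summable_mult[OF sm])
 show "integrable M (%om. \<Sum>n. ?f n om)" by (rule integrable_suminf[OF fi aes sn])
 show "(\<integral>om. (\<Sum>n. ?f n om) \<partial>M) = (\<integral>x. x \<partial>total_law) * (\<Sum>n. measure M (A (t0 + n)))"
  using integral_suminf[OF fi aes sn] fm suminf_mult[OF sm] by simp
qed

end

context sensor_walk begin

definition all_sent :: "nat => 'a => bool" where
 "all_sent t om \<longleftrightarrow> (ALL k:{1..K}. sent k t om)"

definition Z :: "nat => 'a => real" where
 "Z t om = (\<Sum>s\<in>{t0..<t}. if all_sent s om then Xs s om else 0)"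

definition reached :: "real => nat => 'a => bool" where
 "reached c t om \<longleftrightarrow> (EX s:{t0..t}. c <= Z s om)"

lemma all_sent_F: "{om\<in>space M. all_sent t om} : sets (F t)"
proof -
 have "{om\<in>space M. all_sent t om} = (\<Inter>k\<in>{1..K}. {om\<in>space M. sent k t om})"
  using K_pos by (auto simp: all_sent_def)
 also have "... : sets (F t)" using K_pos sent_F by (intro sets.finite_INT) auto
 finally show ?thesis .
qed

lemma all_sent_Suc: "t0 <= t ==> all_sent t om ==> all_sent (Suc t) om"
 by (auto simp: all_sent_def sent_Suc)

lemma all_sent_mono: "t0 <= s ==> s <= t ==> all_sent s om ==> all_sent t om"
 by (rule dec_induct[of s t]) (auto intro: all_sent_Suc)

lemma Z_Suc: "t0 <= t ==> Z (Suc t) om = Z t om + (if all_sent t om then Xs t om else 0)"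
 by (simp add: Z_def atLeastLessThanSuc)

lemma Z_unsent: "t0 <= t ==> ~ all_sent t om ==> Z t om = 0 & Z (Suc t) om = 0"
proof -
 assume t: "t0 <= t" "~ all_sent t om"
 have "Z t om = (\<Sum>s\<in>{t0..<t}. 0)" unfolding Z_def
 proof (rule sum.cong)
  fix s assume "s : {t0..<t}"
  then have "~ all_sent s om" using t all_sent_mono[of s t om] by auto
  then show "(if all_sent s om then Xs s om else 0) = 0" by simp
 qed simp
 then show ?thesis using t by (simp add: Z_Suc)
qed

lemma all_sent_F': "s <= t ==> {om\<in>space M. all_sent s om} : sets (F t)"
 using all_sent_F[of s] F_mono[of s t] by blast

lemma Z_F: "Z t : borel_measurable (F t)"
 unfolding Z_def[abs_def]
proof (intro borel_measurable_sum)
 fix s assume s: "s : {t0..<t}"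
 have [measurable]: "Xs s : borel_measurable (F t)" using s by (intro Xs_F) auto
 have "Measurable.pred (F t) (all_sent s)" using all_sent_F'[of s t] s by (simp add: pred_def space_F)
 then show "(%om. if all_sent s om then Xs s om else 0) : borel_measurable (F t)" by measurable
qed

lemma reached_F: "{om\<in>space M. reached c t om} : sets (F t)"
proof -
 have "{om\<in>space M. reached c t om} = (\<Union>s\<in>{t0..t}. {om\<in>space M. c <= Z s om})"
  by (auto simp: reached_def)
 also have "... : sets (F t)"
 proof (intro sets.finite_UN)
  fix s assume "s : {t0..t}"
  then have [measurable]: "Z s : borel_measurable (F t)" by (intro measurable_F_mono[OF _ Z_F]) auto
  have "{om\<in>space (F t). c <= Z s om} : sets (F t)" by measurable
  then show "{om\<in>space M. c <= Z s om} : sets (F t)" by (simp add: space_F)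
 qed simp
 finally show ?thesis .
qed

lemma reached_Suc: "reached c (Suc t) om \<longleftrightarrow> reached c t om | (t0 <= Suc t & c <= Z (Suc t) om)"
 by (auto simp: reached_def le_Suc_eq)

lemma reached_all_sent: "0 < c ==> reached c t om ==> t0 <= t ==> all_sent t om"
proof -
 assume c: "0 < c" and "reached c t om" "t0 <= t"
 then obtain s where s: "t0 <= s" "s <= t" "c <= Z s om" by (auto simp: reached_def)
 then have "all_sent s om" using Z_unsent[of s om] c by auto
 then show "all_sent t om" using all_sent_mono s by blast
qed

text \<open>A union bound over the sensors costs the factor \<open>K\<close> only in the geometric tail.\<close>

lemma unsent_sum_le:
 assumes A: "!!t. A t : sets (F t)" "!!t. A (Suc t) <= A t"
  and B: "!!k n v. k : {1..K} ==> v : S k ==> (kill (law k) (S k) ^^ (n + n0)) (%_. 1) v <= ennreal (\<rho> ^ n)"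
  and rho: "0 <= \<rho>" "\<rho> < 1"
 shows "(SUM i<n. emeasure M (A (t0 + i) Int {om\<in>space M. ~ all_sent (t0 + i) om}))
  <= ennreal (real n0 + real K / (1 - \<rho>)) * emeasure M (A t0)"
proof -
 have AM [measurable]: "A t : sets M" for t using A(1) F_M by blast
 have dec: "A (t0 + i) <= A t0" for i by (induction i) (use A(2) in auto)
 have sM [measurable]: "{om\<in>space M. ~ sent k t om} : sets M" if "k : {1..K}" for k t using unsent_F[OF that] F_M by blast
 let ?a = "emeasure M (A t0)"
 define b where "b i = min 1 (if i < n0 then 1 else ennreal (real K * \<rho> ^ (i - n0)))" for i
 have "emeasure M (A (t0 + i) Int {om\<in>space M. ~ all_sent (t0 + i) om}) <= b i * ?a" for i
 proof -
  have 1: "emeasure M (A (t0 + i) Int {om\<in>space M. ~ all_sent (t0 + i) om}) <= 1 * ?a"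
   using dec[of i] by (simp add: emeasure_mono inf.coboundedI1)
  have 2: "emeasure M (A (t0 + i) Int {om\<in>space M. ~ all_sent (t0 + i) om}) <= ennreal (real K * \<rho> ^ (i - n0)) * ?a" if "~ i < n0"
  proof -
   have i: "i = (i - n0) + n0" using that by simp
   have "emeasure M (A (t0 + i) Int {om\<in>space M. ~ all_sent (t0 + i) om})
    <= emeasure M (\<Union>k\<in>{1..K}. A t0 Int {om\<in>space M. ~ sent k (t0 + i) om})"
    using dec[of i] by (intro emeasure_mono sets.finite_UN sets.Int) (auto simp: all_sent_def AM sM)
   also have "... <= (\<Sum>k\<in>{1..K}. emeasure M (A t0 Int {om\<in>space M. ~ sent k (t0 + i) om}))"
    by (intro emeasure_subadditive_finite) (auto intro!: sets.Int AM sM)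
   also have "... <= (\<Sum>k\<in>{1..K}. ennreal (\<rho> ^ (i - n0)) * ?a)"
   proof (rule sum_mono)
    fix k assume k: "k : {1..K}"
    show "emeasure M (A t0 Int {om\<in>space M. ~ sent k (t0 + i) om}) <= ennreal (\<rho> ^ (i - n0)) * ?a"
    using B[OF k, of _ "i - n0"] i by (intro unsent_probability_le[OF k A(1)]) simp
   qed
   also have "... = ennreal (real K * \<rho> ^ (i - n0)) * ?a"
    using rho by (simp add: ennreal_mult ennreal_of_nat_eq_real_of_nat mult.assoc)
   finally show ?thesis .
  qed
  show ?thesis using 1 2 by (auto simp: b_def min_def)
 qed
 then have "(SUM i<n. emeasure M (A (t0 + i) Int {om\<in>space M. ~ all_sent (t0 + i) om})) <= (SUM i<n. b i) * ?a"
  unfolding sum_distrib_right by (intro sum_mono) blast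
 also have "(SUM i<n. b i) <= (\<Sum>i. b i)" by (rule sum_le_suminf) (auto intro: summableI)
 also have "(\<Sum>i. b i) <= ennreal (real n0 + real K / (1 - \<rho>))"
  using rho by (intro suminf_le_geometric_tail) (auto simp: b_def)
 finally show ?thesis by (simp add: mult_right_mono)
qed

text \<open>The Green function at the current position is a potential that rests until all sensors have sent.\<close>

lemma unreached_sum_le:
 assumes A: "!!t. A t : sets (F t)" "!!t. A (Suc t) <= A t" and c: "0 < c"
 shows "(SUM i<n. emeasure M (A (t0 + i) Int {om\<in>space M. all_sent (t0 + i) om & ~ reached c (t0 + i) om}))
  <= green total_law {..<c} (%_. 1) 0 * emeasure M (A t0)"
proof -
 interpret T: real_law total_law by (rule real_law_total)
 define g where "g = green total_law {..<c} (%_. 1)"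
 have g [measurable]: "g : borel_measurable borel" unfolding g_def by simp
 have gu: "g v = 1 + kill total_law {..<c} g v" for v unfolding g_def by (rule T.green_unfold) auto
 define U where "U t = A t Int {om\<in>space M. ~ all_sent t om}" for t
 define B where "B t = A t Int {om\<in>space M. all_sent t om & ~ reached c t om}" for t
 have compl: "{om\<in>space M. ~ Q om} : sets (F t)" if "{om\<in>space M. Q om} : sets (F t)" for Q t
  using sets.compl_sets[OF that] by (auto simp: space_F set_diff_eq cong: conj_cong)
 have UF: "U t : sets (F t)" for t unfolding U_def by (intro sets.Int A compl all_sent_F)
 have BF: "B t : sets (F t)" for t
 proof -
  have "B t = A t Int ({om\<in>space M. all_sent t om} Int {om\<in>space M. ~ reached c t om})" by (auto simp: B_def)
  then show ?thesis by (simp only:) (intro sets.Int A compl all_sent_F reached_F)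
 qed
 have [measurable]: "U t : sets M" "B t : sets M" "A t : sets M" for t using UF BF A(1) F_M by blast+
 have [measurable]: "Z t : borel_measurable M" for t by (rule measurable_F_M[OF Z_F])
 define G where "G n = nn_integral M (%om. indicator (U (t0 + n)) om * g 0 + indicator (B (t0 + n)) om * g (Z (t0 + n) om))" for n
 have step: "G (Suc n) + emeasure M (B (t0 + n)) <= G n" for n
 proof -
  let ?t = "t0 + n"
  have "G (Suc n) <= nn_integral M (%om. indicator (U ?t) om * g 0 + indicator (B ?t) om * (indicator {..<c} (Z ?t om + Xs ?t om) * g (Z ?t om + Xs ?t om)))"
   unfolding G_def
  proof (rule nn_integral_mono)
   fix om assume w: "om : space M"
   show "indicator (U (t0 + Suc n)) om * g 0 + indicator (B (t0 + Suc n)) om * g (Z (t0 + Suc n) om)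
    <= indicator (U ?t) om * g 0 + indicator (B ?t) om * (indicator {..<c} (Z ?t om + Xs ?t om) * g (Z ?t om + Xs ?t om))"
   proof (cases "om : A ?t")
    case False
    then have "om \<notin> A (Suc ?t)" using A(2) by blast
    then show ?thesis by (simp add: U_def B_def)
   next
    case inA: True
    show ?thesis
    proof (cases "all_sent ?t om")
    case False
    then show ?thesis using w inA Z_unsent[of ?t om] by (auto simp: U_def B_def indicator_def)
    next
    case s: True
    then have s': "all_sent (Suc ?t) om" by (intro all_sent_Suc) auto
    have z: "Z (Suc ?t) om = Z ?t om + Xs ?t om" using s by (simp add: Z_Suc)
    show ?thesis using w inA s s' z reached_Suc[of c ?t om]
    by (auto simp: U_def B_def indicator_def)
    qed
   qed
  qed
  also have "... = nn_integral M (%om. indicator (U ?t) om * g 0) + nn_integral M (%om. indicator (B ?t) om * (indicator {..<c} (Z ?t om + Xs ?t om) * g (Z ?t om + Xs ?t om)))"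
   by (rule nn_integral_add) measurable
  also have "nn_integral M (%om. indicator (B ?t) om * (indicator {..<c} (Z ?t om + Xs ?t om) * g (Z ?t om + Xs ?t om)))
    = nn_integral M (%om. indicator (B ?t) om * kill total_law {..<c} g (Z ?t om))"
   unfolding kill_def using BF Z_F by (intro sum_step) auto
  finally have "G (Suc n) + emeasure M (B ?t) <= nn_integral M (%om. indicator (U ?t) om * g 0)
    + ((nn_integral M (%om. indicator (B ?t) om * kill total_law {..<c} g (Z ?t om))) + nn_integral M (%om. indicator (B ?t) om))"
   by (simp add: add.assoc[symmetric] add_right_mono)
  also have "nn_integral M (%om. indicator (B ?t) om * kill total_law {..<c} g (Z ?t om)) + nn_integral M (%om. indicator (B ?t) om)
    = nn_integral M (%om. indicator (B ?t) om * kill total_law {..<c} g (Z ?t om) + indicator (B ?t) om)"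
   by (rule nn_integral_add[symmetric]) (use T.kill_measurable[of "{..<c}" g] in measurable)
  also have "... = nn_integral M (%om. indicator (B ?t) om * g (Z ?t om))"
   by (intro nn_integral_cong) (subst gu, simp add: distrib_left add.commute)
  also have "nn_integral M (%om. indicator (U ?t) om * g 0) + nn_integral M (%om. indicator (B ?t) om * g (Z ?t om)) = G n"
   unfolding G_def by (rule nn_integral_add[symmetric]) measurable
  finally show ?thesis .
 qed
 have "G n + (SUM i<n. emeasure M (B (t0 + i))) <= G 0"
 proof (induction n)
  case (Suc n)
  have "G (Suc n) + (SUM i<Suc n. emeasure M (B (t0 + i))) = (G (Suc n) + emeasure M (B (t0 + n))) + (SUM i<n. emeasure M (B (t0 + i)))"
   by (simp add: ac_simps)
  also have "... <= G n + (SUM i<n. emeasure M (B (t0 + i)))" by (intro add_right_mono step)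
  also have "... <= G 0" by (rule Suc.IH)
  finally show ?case .
 qed simp
 moreover have "(SUM i<n. emeasure M (B (t0 + i))) <= G n + (SUM i<n. emeasure M (B (t0 + i)))" by simp
 ultimately have "(SUM i<n. emeasure M (B (t0 + i))) <= G 0" by (rule order_trans[rotated])
 also have "... <= nn_integral M (%om. g 0 * indicator (A t0) om)"
  unfolding G_def by (intro nn_integral_mono) (auto simp: U_def B_def Z_def indicator_def)
 also have "... = g 0 * emeasure M (A t0)" by (simp add: nn_integral_cmult_indicator)
 finally show ?thesis unfolding B_def g_def .
qed

text \<open>
 Beyond the level, only the losses of the messages keep the procedure running.  The increments are
 truncated, which makes the overshoot of the moving boundary bounded.
\<close>

lemma reached_sum_le:
 assumes A: "!!t. A t : sets (F t)" "!!t. A (Suc t) <= A t" and c: "0 < c" and c0: "0 <= c0"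
  and alive: "!!n om. om : A (t0 + n) ==> all_sent (t0 + n) om ==> ennreal (Z (t0 + n) om - c) <= L n om"
  and L: "!!n. L n : borel_measurable M" "!!n om. L n om <= L (Suc n) om"
 shows "ennreal c0 * (SUM i<n. emeasure M (A (t0 + i) Int {om\<in>space M. reached c (t0 + i) om}))
  <= nn_integral M (%om. L n om) + ennreal c0 * emeasure M (A t0)
   + nn_integral total_law (%x. ennreal (c0 - x)) * (SUM i<n. emeasure M (A (t0 + i) Int {om\<in>space M. reached c (t0 + i) om}))"
proof -
 define B where "B t = A t Int {om\<in>space M. reached c t om}" for t
 have BF: "B t : sets (F t)" for t unfolding B_def by (intro sets.Int A reached_F)
 have [measurable]: "B t : sets M" "A t : sets M" for t using BF A(1) F_M by blast+
 note L(1) [measurable]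
 define y where "y n om = (SUM i<n. indicator (B (t0 + i)) om * min c0 (Xs (t0 + i) om))" for n om
 define Y where "Y n om = (SUM i<n. indicator (B (t0 + i)) om * max 0 (c0 - Xs (t0 + i) om))" for n om
 have [measurable]: "Y n : borel_measurable M" for n unfolding Y_def[abs_def] by measurable
 have dec: "A (t0 + i) <= A t0" for i by (induction i) (use A(2) in auto)
 have inB: "y n om <= Z (t0 + n) om - c" if "om : B (t0 + n)" for n om
  using that
 proof (induction n)
  case 0
  then show ?case using c by (simp add: B_def reached_def Z_def)
 next
  case (Suc n)
  have w: "om : A (t0 + n)" "om : space M" "reached c (Suc (t0 + n)) om" using Suc.prems A(2)[of "t0 + n"] by (auto simp: B_def)
  show ?case
  proof (cases "reached c (t0 + n) om")
   case True
   then have "om : B (t0 + n)" using w by (simp add: B_def)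
   moreover have "Z (t0 + Suc n) om = Z (t0 + n) om + Xs (t0 + n) om"
    using reached_all_sent[OF c True] by (simp add: Z_Suc)
   ultimately show ?thesis using Suc.IH by (simp add: y_def)
  next
   case False
   then have "~ reached c (t0 + i) om" if "i <= n" for i using that by (auto simp: reached_def)
   then have "y (Suc n) om = (SUM i<Suc n. 0)" unfolding y_def by (intro sum.cong) (auto simp: B_def)
   then show ?thesis using False w(3) reached_Suc[of c "t0 + n" om] by simp
  qed
 qed
 have yL: "ennreal (y n om) <= L n om + ennreal c0 * indicator (A t0) om" for n om
 proof (induction n)
  case (Suc n)
  show ?case
  proof (cases "om : B (t0 + n)")
   case True
   then have w: "om : A (t0 + n)" "reached c (t0 + n) om" by (auto simp: B_def)
   have "y (Suc n) om = y n om + min c0 (Xs (t0 + n) om)" using True by (simp add: y_def)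
   also have "... <= max 0 (Z (t0 + n) om - c) + c0" using inB[OF True] by linarith
   finally have "ennreal (y (Suc n) om) <= ennreal (max 0 (Z (t0 + n) om - c) + c0)" by (rule ennreal_leI)
   also have "... = ennreal (Z (t0 + n) om - c) + ennreal c0" using c0 by (simp add: ennreal_plus ennreal_max_0)
   also have "... <= L (Suc n) om + ennreal c0"
    using alive[OF w(1) reached_all_sent[OF c w(2)]] L(2)[of n om] by (intro add_right_mono) (auto intro: order_trans)
   finally show ?thesis using w dec by (auto simp: indicator_def)
  next
   case False
   then have "y (Suc n) om = y n om" by (simp add: y_def)
   then show ?thesis using Suc L(2)[of n om] by (simp add: add_right_mono order_trans)
  qed
 qed (simp add: y_def)
 have NY: "(SUM i<n. indicator (B (t0 + i)) om * ennreal c0) <= ennreal (y n om) + (SUM i<n. indicator (B (t0 + i)) om * ennreal (c0 - Xs (t0 + i) om))" for n om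
 proof -
  have "(SUM i<n. indicator (B (t0 + i)) om * ennreal c0) = ennreal (SUM i<n. indicator (B (t0 + i)) om * c0)"
  proof -
   have e: "indicator (B (t0 + i)) om * ennreal c0 = ennreal (indicator (B (t0 + i)) om * c0)" for i
    by (simp add: indicator_def)
   show ?thesis unfolding e by (rule sum_ennreal) (simp add: c0)
  qed
  also have "(SUM i<n. indicator (B (t0 + i)) om * c0) = y n om + Y n om"
   unfolding y_def Y_def sum.distrib[symmetric] by (intro sum.cong) (auto simp: indicator_def)
  also have "ennreal (y n om + Y n om) <= ennreal (max 0 (y n om) + Y n om)" by (intro ennreal_leI) simp
  also have "... = ennreal (y n om) + ennreal (Y n om)"
   by (subst ennreal_plus) (auto simp: Y_def ennreal_max_0 intro!: sum_nonneg)
  also have "ennreal (Y n om) = (SUM i<n. indicator (B (t0 + i)) om * ennreal (c0 - Xs (t0 + i) om))"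
  proof -
   have e: "indicator (B (t0 + i)) om * ennreal (c0 - Xs (t0 + i) om) = ennreal (indicator (B (t0 + i)) om * max 0 (c0 - Xs (t0 + i) om))" for i
    by (simp add: indicator_def ennreal_max_0)
   show ?thesis unfolding Y_def e by (rule sum_ennreal[symmetric]) simp
  qed
  finally show ?thesis .
 qed
 have st: "nn_integral M (%om. indicator (B (t0 + i)) om * ennreal (c0 - Xs (t0 + i) om)) = nn_integral total_law (%x. ennreal (c0 - x)) * emeasure M (B (t0 + i))" for i
 proof -
  have "nn_integral M (%om. indicator (B (t0 + i)) om * ennreal (c0 - (0 + Xs (t0 + i) om))) = nn_integral M (%om. indicator (B (t0 + i)) om * (nn_integral total_law (%x. ennreal (c0 - (0 + x)))))"
   by (rule sum_step[where y = "%_. 0" and f = "%w. ennreal (c0 - w)"]) (use BF[of "t0 + i"] in auto)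
  then show ?thesis by (simp add: nn_integral_multc mult.commute)
 qed
 have e0: "nn_integral M (%om. indicator (B (t0 + i)) om * ennreal c0) = ennreal c0 * emeasure M (B (t0 + i))" for i
  by (subst nn_integral_multc) (auto simp: mult.commute)
 have "ennreal c0 * (SUM i<n. emeasure M (B (t0 + i))) = (SUM i<n. nn_integral M (%om. indicator (B (t0 + i)) om * ennreal c0))"
  by (simp only: e0 sum_distrib_left)
 also have "... = nn_integral M (%om. (SUM i<n. indicator (B (t0 + i)) om * ennreal c0))"
  by (rule nn_integral_sum[symmetric]) measurable
 also have "... <= nn_integral M (%om. (L n om + ennreal c0 * indicator (A t0) om) + (SUM i<n. indicator (B (t0 + i)) om * ennreal (c0 - Xs (t0 + i) om)))"
  using NY yL by (intro nn_integral_mono) (meson add_right_mono order_trans)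
 also have "... = nn_integral M (%om. L n om + ennreal c0 * indicator (A t0) om) + nn_integral M (%om. (SUM i<n. indicator (B (t0 + i)) om * ennreal (c0 - Xs (t0 + i) om)))"
  by (rule nn_integral_add) measurable
 also have "nn_integral M (%om. L n om + ennreal c0 * indicator (A t0) om) = nn_integral M (%om. L n om) + ennreal c0 * emeasure M (A t0)"
  by (subst nn_integral_add) (auto simp: nn_integral_cmult_indicator)
 also have "nn_integral M (%om. (SUM i<n. indicator (B (t0 + i)) om * ennreal (c0 - Xs (t0 + i) om))) = nn_integral total_law (%x. ennreal (c0 - x)) * (SUM i<n. emeasure M (B (t0 + i)))"
  by (subst nn_integral_sum) (auto simp: st sum_distrib_left)
 finally show ?thesis by (simp add: B_def)
qed

end

section \<open>The laws of the messages\<close>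

lemma emeasure_distr_eq:
 "f : borel_measurable M ==> A : sets borel ==> emeasure (distr M borel f) A = nn_integral M (%om. indicator A (f om))"
 using nn_integral_distr[of f M borel "indicator A"] by simp

context filtered_walk begin

lemma law_distr:
 assumes "t0 <= t" "k : {1..K}" shows "distr M borel (X k t) = law k"
proof (rule measure_eqI)
 fix A assume "A : sets (distr M borel (X k t))"
 then have A [measurable]: "A : sets borel" by simp
 have [measurable]: "X k t : borel_measurable M" by (rule measurable_F_M[OF X_adapted[OF assms(2)]])
 have "emeasure (distr M borel (X k t)) A = nn_integral M (%om. indicator A (X k t om))"
  by (rule emeasure_distr_eq) measurable
 also have "... = nn_integral M (%om. nn_integral (law k) (%x. indicator A x))"
  using step_sensor[OF assms, of "%p. indicator A (snd p)"] by simp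
 also have "... = emeasure (law k) A" by (simp add: emeasure_space_1 sets_law)
 finally show "emeasure (distr M borel (X k t)) A = emeasure (law k) A" .
qed (simp add: sets_law)

lemma total_distr:
 assumes "t0 <= t" shows "distr M borel (Xs t) = total_law"
proof (rule measure_eqI)
 interpret T: real_law total_law by (rule real_law_total)
 fix A assume "A : sets (distr M borel (Xs t))"
 then have A [measurable]: "A : sets borel" by simp
 have "emeasure (distr M borel (Xs t)) A = nn_integral M (%om. indicator A (Xs t om))"
  by (rule emeasure_distr_eq) measurable
 also have "... = nn_integral M (%om. nn_integral total_law (%x. indicator A x))"
  using step_sum[OF assms, of "%p. indicator A (snd p)"] by (simp add: Xs_def)
 also have "... = emeasure total_law A" by (simp add: emeasure_space_1 T.sets_law)
 finally show "emeasure (distr M borel (Xs t)) A = emeasure total_law A" .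
qed (simp add: real_law.sets_law[OF real_law_total])

end

context sensor_walk begin

text \<open>
 The sum has at most one nonzero term, at the step of the first message; as a series it can be
 integrated term by term.
\<close>

definition first_value :: "nat => (real => ennreal) => 'a => ennreal" where
 "first_value k f om = (\<Sum>n. if ~ sent k (t0 + n) om & W k (t0 + n) om \<notin> S k then f (W k (t0 + n) om) else 0)"

lemma first_value_eq:
 assumes "~ sent k (t0 + n) om" "W k (t0 + n) om \<notin> S k"
 shows "first_value k f om = f (W k (t0 + n) om)"
proof -
 have "(if ~ sent k (t0 + m) om & W k (t0 + m) om \<notin> S k then f (W k (t0 + m) om) else 0) = 0" if "m ~= n" for m
 proof (cases "m < n")
  case True
  then have "W k (t0 + m) om : S k" using assms(1) unfolding sent_def by (metis add_left_mono atLeastLessThan_iff le_add1 nat_add_left_cancel_less)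
  then show ?thesis by (simp only: not_True_eq_False simp_thms if_False)
 next
  case False
  then have "sent k (t0 + m) om" using that assms(2) by (auto simp: sent_def intro!: bexI[of _ "t0 + n"])
  then show ?thesis by simp
 qed
 then have "(%m. if ~ sent k (t0 + m) om & W k (t0 + m) om \<notin> S k then f (W k (t0 + m) om) else 0)
   = (%m. if m = n then f (W k (t0 + m) om) else 0)"
  using assms by (intro ext) (simp del: greaterThanLessThan_iff)
 then show ?thesis unfolding first_value_def using sums_unique[OF sums_single[of n "%m. f (W k (t0 + m) om)"]] by simp
qed

lemma first_value_none:
 assumes "!!n. ~ sent k (t0 + n) om" shows "first_value k f om = 0"
proof -
 have "W k (t0 + n) om : S k" for n
  using assms[of "Suc n"] sent_Suc[of "t0 + n" k om] unfolding add_Suc_right by (metis le_add1)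
 then show ?thesis by (simp only: first_value_def not_True_eq_False simp_thms if_False suminf_zero)
qed

lemma first_value_mean:
 assumes k: "k : {1..K}" and V0: "!!om. om : space M ==> V k t0 om = 0" and f[measurable]: "f : borel_measurable borel"
 shows "first_value k f : borel_measurable M"
  and "nn_integral M (%om. first_value k f om) = exit_mean (law k) (S k) f 0"
proof -
 interpret l: real_law "law k" by (rule law)
 have VM [measurable]: "V k t : borel_measurable M" "X k t : borel_measurable M" for t by (rule V_M[OF k], rule X_M[OF k])
 have "{om\<in>space M. sent k t om} : sets M" for t using sent_F[OF k] F_M by blast
 then have [measurable]: "Measurable.pred M (sent k t)" for t by (simp add: pred_def)
 let ?T = "%n om. if ~ sent k (t0 + n) om & W k (t0 + n) om \<notin> S k then f (W k (t0 + n) om) else 0"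
 have [measurable]: "?T n : borel_measurable M" for n by measurable
 show "first_value k f : borel_measurable M" unfolding first_value_def[abs_def] by measurable
 have "nn_integral M (%om. ?T n om) = (kill (law k) (S k) ^^ n) (kill (law k) (- S k) f) 0" for n
 proof -
  let ?c = "%om. indicator {om\<in>space M. ~ sent k (t0 + n) om} om :: ennreal"
  let ?g = "%w. indicator (- S k) w * f w"
  have g: "?g : borel_measurable borel" by measurable
  have "nn_integral M (%om. ?T n om) = nn_integral M (%om. ?c om * ?g (W k (t0 + n) om))"
   by (intro nn_integral_cong) (simp add: indicator_def del: greaterThanLessThan_iff)
  also have "... = nn_integral M (%om. ?c om * (nn_integral (law k) (%x. ?g (V k (t0 + n) om + x))))"
   by (rule phase_step[OF _ k _ g]) (use unsent_F[OF k, of "t0 + n"] in auto)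
  also have "... = nn_integral M (%om. ?c om * kill (law k) (- S k) f (V k (t0 + n) om))"
   by (simp only: kill_def)
  also have "... = nn_integral M (%om. indicator (space M Int {om\<in>space M. ~ sent k (t0 + n) om}) om * kill (law k) (- S k) f (V k (t0 + n) om))"
   by (intro nn_integral_cong) (simp add: indicator_def)
  also have "... = nn_integral M (%om. indicator (space M) om * (kill (law k) (S k) ^^ n) (kill (law k) (- S k) f) (V k t0 om))"
   using sets.top[of "F t0"] space_F[of t0] by (intro unsent_mean[OF k]) (auto intro!: l.kill_measurable)
  also have "... = nn_integral M (%om. (kill (law k) (S k) ^^ n) (kill (law k) (- S k) f) 0)"
   by (intro nn_integral_cong) (simp add: V0)
  also have "... = (kill (law k) (S k) ^^ n) (kill (law k) (- S k) f) 0" by (simp add: emeasure_space_1)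
  finally show ?thesis .
 qed
 then show "nn_integral M (%om. first_value k f om) = exit_mean (law k) (S k) f 0"
  unfolding first_value_def exit_mean_def green_def by (subst nn_integral_suminf) auto
qed

end

locale llr_system = sensor_system K P \<xi> u
 for K and P :: "enat => 'a measure" and \<xi> u +
 fixes a b :: real
 assumes a0: "0 < a"
  and sq_int: "k : {1..K} ==> integrable (P 0) (%om. (u k 1 om)^2)"
  and mean_post: "k : {1..K} ==> (\<integral>om. u k 1 om \<partial>P 0) : {a..b}"
  and mean_pre: "k : {1..K} ==> - (\<integral>om. u k 1 om \<partial>P \<infinity>) : {a..b}"
  and sq_bound: "k : {1..K} ==> (\<integral>om. (u k 1 om)^2 \<partial>P 0) <= b"
begin

lemma incr_0: "k : {1..K} ==> om : Omega ==> incr k 0 om = u k 1 om"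
 by (simp add: incr_def u_0 One_nat_def)

lemma step_law_eq: "k : {1..K} ==> step_law k = distr Pre borel (u k 1)"
 by (simp add: step_law_def)

lemma tilt_step_law_eq:
 assumes k: "k : {1..K}" shows "tilt (step_law k) = distr (P 0) borel (u k 1)"
proof -
 interpret w: filtered_walk "P (enat 0)" joint K "%k. tilt (step_law k)" incr 0 by (rule filtered_walk_post)
 have "tilt (step_law k) = distr (P (enat 0)) borel (incr k 0)" using w.law_distr[OF le0 k] by simp
 also have "... = distr (P (enat 0)) borel (u k 1)"
  using incr_0[OF k] by (intro distr_cong) (auto simp: space_P[of "enat 0"])
 finally show ?thesis by (simp add: zero_enat_def)
qed

lemma llr_law_step: assumes k: "k : {1..K}" shows "llr_law (step_law k) a b"
proof -
 have m: "u k 1 : borel_measurable Pre" "u k 1 : borel_measurable (P 0)" by (intro u_P k)+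
 have i: "integrable Pre (u k 1)" "integrable (P 0) (u k 1)" using info_0[OF k] info_inf[OF k] by auto
 note e = step_law_eq[OF k] and t = tilt_step_law_eq[OF k]
 have 1: "integrable (step_law k) (%x. x)" unfolding e using i m by (subst integrable_distr_eq) auto
 have 2: "integrable (tilt (step_law k)) (%x. x)" unfolding t using i m by (subst integrable_distr_eq) auto
 have 3: "(\<integral>x. x \<partial>step_law k) = (\<integral>om. u k 1 om \<partial>Pre)" unfolding e using m by (subst integral_distr) auto
 have 4: "(\<integral>x. x \<partial>tilt (step_law k)) = (\<integral>om. u k 1 om \<partial>P 0)" unfolding t using m by (subst integral_distr) auto
 have 5: "(\<integral>x. x^2 \<partial>tilt (step_law k)) = (\<integral>om. (u k 1 om)^2 \<partial>P 0)" unfolding t using m by (subst integral_distr) auto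
 have 6: "integrable (tilt (step_law k)) (%x. x^2)" unfolding t using sq_int[OF k] m by (subst integrable_distr_eq) auto
 show ?thesis
  using real_law_step[of k] real_law_tilt_step[of k] a0 1 2 3 4 5 6 mean_post[OF k] mean_pre[OF k] sq_bound[OF k]
  by (simp add: llr_law_def llr_law_axioms_def)
qed

lemma full_support:
 assumes k: "k : {1..K}" and "x < y" shows "0 < emeasure (step_law k) {x<..<y}"
proof -
 obtain f where f: "distributed Pre lborel (u k 1) f" "!!x. 0 < f x" using pos_density[OF k, of \<infinity>] by auto
 have fm [measurable]: "f : borel_measurable borel" using f(1) by (simp add: distributed_def)
 have [measurable]: "u k 1 : borel_measurable Pre" by (rule u_P[OF k])
 have "emeasure (step_law k) {x<..<y} = emeasure (distr Pre lborel (u k 1)) {x<..<y}"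
  unfolding step_law_eq[OF k] by (simp add: emeasure_distr)
 also have "distr Pre lborel (u k 1) = density lborel f" using f(1) by (simp add: distributed_def)
 also have "emeasure (density lborel f) {x<..<y} = nn_integral lborel (%z. f z * indicator {x<..<y} z)"
  by (rule emeasure_density) auto
 also have "... ~= 0"
 proof
  assume "nn_integral lborel (%z. f z * indicator {x<..<y} z) = 0"
  then have "AE z in lborel. f z * indicator {x<..<y} z = 0" by (subst (asm) nn_integral_0_iff_AE) auto
  then have "AE z in lborel. z \<notin> {x<..<y}" using f(2) by (auto elim!: eventually_mono simp: indicator_def less_le split: if_splits)
  then have "emeasure lborel {x<..<y} = 0" by (subst (asm) AE_iff_measurable[of "{x<..<y}"]) auto
  then show False using \<open>x < y\<close> by simp
 qed
 finally show ?thesis by (simp add: zero_less_iff_neq_zero)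
qed

definition tot :: "real measure" where "tot = distr Pre borel (%om. SUM k=1..K. u k 1 om)"

lemma sum_u_joint: "s <= t ==> (%om. SUM k=1..K. u k s om) : borel_measurable (joint t)"
 by (intro borel_measurable_sum u_joint)

lemma sum_u_P: "(%om. SUM k=1..K. u k s om) : borel_measurable (P tau)"
 by (intro borel_measurable_sum u_P)

lemma sum_incr_0: "om : Omega ==> (SUM k=1..K. incr k 0 om) = (SUM k=1..K. u k 1 om)"
 using incr_0 by (intro sum.cong) auto

lemma total_inf: "filtered_walk.total_law K step_law = tot"
proof -
 interpret w: filtered_walk "Pre" joint K step_law incr 0 by (rule filtered_walk_inf)
 show ?thesis unfolding w.total_distr[OF order_refl, symmetric] tot_def w.Xs_def[abs_def]
  using sum_incr_0 by (intro distr_cong) auto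
qed

lemma total_post_distr: "filtered_walk.total_law K (%k. tilt (step_law k)) = distr (P 0) borel (%om. SUM k=1..K. u k 1 om)"
proof -
 interpret w: filtered_walk "P (enat 0)" joint K "%k. tilt (step_law k)" incr 0 by (rule filtered_walk_post)
 have "w.total_law = distr (P (enat 0)) borel (%om. SUM k=1..K. u k 1 om)"
  unfolding w.total_distr[OF order_refl, symmetric] w.Xs_def[abs_def]
  using sum_incr_0 by (intro distr_cong) (auto simp: space_P[of "enat 0"])
 then show ?thesis by (simp add: zero_enat_def)
qed

lemma total_post: "filtered_walk.total_law K (%k. tilt (step_law k)) = tilt tot"
 unfolding total_post_distr
proof (rule measure_eqI)
 let ?s = "%om. SUM k=1..K. u k 1 om"
 have [measurable]: "?s : borel_measurable (P tau)" for tau by (rule sum_u_P)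
 have [measurable]: "?s : borel_measurable (joint 1)" by (rule sum_u_joint) simp
 fix A assume "A : sets (distr (P 0) borel ?s)"
 then have A [measurable]: "A : sets borel" by simp
 have "emeasure (distr (P 0) borel ?s) A = nn_integral (P (enat 0)) (%om. indicator A (?s om))"
  unfolding zero_enat_def[symmetric] by (rule emeasure_distr_eq) measurable
 also have "... = nn_integral Pre (%om. ennreal (exp (?s om - (SUM k=1..K. u k 0 om))) * indicator A (?s om))"
  by (rule change_measure) auto
 also have "... = nn_integral Pre (%om. ennreal (exp (?s om)) * indicator A (?s om))"
  by (intro nn_integral_cong) (simp add: u_0)
 also have "... = emeasure (tilt tot) A"
  unfolding tilt_def tot_def by (subst emeasure_density) (auto simp: nn_integral_distr)
 finally show "emeasure (distr (P 0) borel ?s) A = emeasure (tilt tot) A" .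
qed (simp add: tot_def)

text \<open>
 The sum over the sensors is itself a log-likelihood increment of the same kind, so that the
 results for one sensor apply to the centralized statistic.
\<close>

lemma llr_law_tot: "llr_law tot (real K * a) ((real K)^2 * b)"
proof -
 let ?s = "%om. SUM k=1..K. u k 1 om"
 interpret w: filtered_walk "Pre" joint K step_law incr 0 by (rule filtered_walk_inf)
 interpret v: filtered_walk "P (enat 0)" joint K "%k. tilt (step_law k)" incr 0 by (rule filtered_walk_post)
 have r: "real_law tot" "real_law (tilt tot)" using w.real_law_total v.real_law_total total_inf total_post by auto
 have m: "?s : borel_measurable Pre" "?s : borel_measurable (P 0)" by (rule sum_u_P)+
 have t: "tilt tot = distr (P 0) borel ?s" using total_post total_post_distr by simp
 have i: "integrable Pre ?s" "integrable (P 0) ?s" using info_0 info_inf by (auto intro!: Bochner_Integration.integrable_sum)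
 have le: "(?s om)^2 <= real K * (SUM k=1..K. (u k 1 om)^2)" for om
  using sum_squared_le_sum_of_squares[of "%k. u k 1 om" "{1..K}"] by (simp add: mult.commute)
 have i2: "integrable (P 0) (%om. real K * (SUM k=1..K. (u k 1 om)^2))"
  using sq_int by (intro integrable_mult_right Bochner_Integration.integrable_sum) auto
 have isq: "integrable (P 0) (%om. (?s om)^2)"
 proof (rule Bochner_Integration.integrable_bound[OF i2])
  show "(%om. (?s om)^2) : borel_measurable (P 0)" using m(2) by (rule borel_measurable_power)
  show "AE om in P 0. norm ((?s om)^2) <= norm (real K * (SUM k=1..K. (u k 1 om)^2))"
  proof (rule AE_I2)
   fix om
   have "norm ((?s om)^2) = (?s om)^2" by simp
   also note le[of om]
   also have "real K * (SUM k=1..K. (u k 1 om)^2) <= norm (real K * (SUM k=1..K. (u k 1 om)^2))" by (simp only: real_norm_def abs_ge_self)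
   finally show "norm ((?s om)^2) <= norm (real K * (SUM k=1..K. (u k 1 om)^2))" .
  qed
 qed
 have "(\<integral>om. (?s om)^2 \<partial>P 0) <= (\<integral>om. real K * (SUM k=1..K. (u k 1 om)^2) \<partial>P 0)"
  using isq i2 le by (rule integral_mono)
 also have "... = real K * (SUM k=1..K. \<integral>om. (u k 1 om)^2 \<partial>P 0)"
  using sq_int by simp
 also have "... <= real K * (SUM k=1..K. b)" using sq_bound by (intro mult_left_mono sum_mono) auto
 finally have sq: "(\<integral>om. (?s om)^2 \<partial>P 0) <= (real K)^2 * b" by (simp add: power2_eq_square)
 have m0: "(\<integral>om. ?s om \<partial>P 0) = (SUM k=1..K. \<integral>om. u k 1 om \<partial>P 0)" using info_0 by (intro Bochner_Integration.integral_sum) auto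
 have mi: "(\<integral>om. ?s om \<partial>Pre) = (SUM k=1..K. \<integral>om. u k 1 om \<partial>Pre)" using info_inf by (intro Bochner_Integration.integral_sum) auto
 have b: "a <= b" using mean_post[of 1] K_pos by auto
 have "(SUM k=1..K. a) <= (\<integral>om. ?s om \<partial>P 0)" unfolding m0 using mean_post by (intro sum_mono) auto
 then have 1: "real K * a <= (\<integral>om. ?s om \<partial>P 0)" by simp
 have "(\<integral>om. ?s om \<partial>P 0) <= (SUM k=1..K. b)" unfolding m0 using mean_post by (intro sum_mono) auto
 also have "... = real K * b * 1" by simp
 also have "... <= real K * b * real K" using K_pos a0 b by (intro mult_left_mono) auto
 finally have 2: "(\<integral>om. ?s om \<partial>P 0) <= (real K)^2 * b" by (simp add: power2_eq_square ac_simps)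
 have "(SUM k=1..K. a) <= - (\<integral>om. ?s om \<partial>Pre)" unfolding mi sum_negf[symmetric] using mean_pre by (intro sum_mono) auto
 then have 3: "real K * a <= - (\<integral>om. ?s om \<partial>Pre)" by simp
 have 4: "integrable tot (%x. x)" unfolding tot_def using i m by (subst integrable_distr_eq) auto
 have 5: "integrable (tilt tot) (%x. x)" unfolding t using i m by (subst integrable_distr_eq) auto
 have 6: "integrable (tilt tot) (%x. x^2)" unfolding t using isq m by (subst integrable_distr_eq) auto
 have 7: "(\<integral>x. x \<partial>tot) = (\<integral>om. ?s om \<partial>Pre)" unfolding tot_def using m by (subst integral_distr) auto
 have 8: "(\<integral>x. x \<partial>tilt tot) = (\<integral>om. ?s om \<partial>P 0)" unfolding t using m by (subst integral_distr) auto
 have 9: "(\<integral>x. x^2 \<partial>tilt tot) = (\<integral>om. (?s om)^2 \<partial>P 0)" unfolding t using m by (subst integral_distr) auto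
 have "0 < real K * a" using K_pos a0 by simp
 then show ?thesis using r 1 2 3 4 5 6 7 8 9 sq by (simp add: llr_law_def llr_law_axioms_def)
qed

end

locale threshold_system = llr_system K P \<xi> u a b
 for K and P :: "enat => 'a measure" and \<xi> u a b +
 fixes lo up :: "nat => real"
 assumes thr: "k : {1..K} ==> 0 < lo k & 0 < up k"
begin

definition V :: "nat => nat => 'a => real" where "V k t om = phase (lo k) (up k) (%t. u k t om) t"

lemma V_0 [simp]: "V k 0 om = 0" by (simp add: V_def)

lemma V_Suc_eq: "V k (Suc t) om = renew (lo k) (up k) (V k t om + incr k t om)" by (simp add: V_def incr_def)

lemma V_joint: "k : {1..K} ==> V k t : borel_measurable (joint t)"
proof (induction t)
 case 0
 then show ?case by (simp add: V_0[abs_def])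
next
 case (Suc t)
 have [measurable]: "V k t : borel_measurable (joint (Suc t))"
  by (rule measurable_larger[OF Suc.IH joint_mono]) (use Suc.prems in simp_all)
 have [measurable]: "incr k t : borel_measurable (joint (Suc t))" by (rule incr_joint[OF Suc.prems])
 show ?case unfolding V_Suc_eq[abs_def] by measurable
qed

lemma V_bounds: "k : {1..K} ==> V k t om : {-lo k<..<up k}"
 unfolding V_def using thr by (intro phase_bounds) auto

lemma sensor_walk_inf: "sensor_walk Pre joint K step_law incr 0 lo up V"
 by (rule sensor_walk.intro[OF filtered_walk_inf], unfold_locales) (use thr V_joint V_bounds V_Suc_eq in auto)

lemma sensor_walk_post: "sensor_walk (P (enat tau)) joint K (%k. tilt (step_law k)) incr tau lo up V"
 by (rule sensor_walk.intro[OF filtered_walk_post], unfold_locales) (use thr V_joint V_bounds V_Suc_eq in auto)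

end

text \<open>The first increment between messages is the exit position of the phase.\<close>

lemma first_value_comm_incr:
 assumes w: "sensor_walk M F K law incr 0 lo up V" and v0: "v 0 = 0"
  and V: "!!t. V k t om = phase (lo k) (up k) v t" and X: "!!t. incr k t om = v (Suc t) - v t" and f: "f 0 = 0"
 shows "sensor_walk.first_value incr 0 lo up V k f om = f (comm_incr (lo k) (up k) v 1)"
proof -
 interpret sensor_walk M F K law incr 0 lo up V by (rule w)
 have s: "sends (lo k) (up k) v t \<longleftrightarrow> W k t om \<notin> S k" for t by (simp add: sends_def V X)
 have n: "num_comm (lo k) (up k) v t = 0 \<longleftrightarrow> ~ sent k t om" for t
 proof (induction t)
  case 0
  then show ?case using v0 sent_t0 by (simp add: num_comm_0)
 next
  case (Suc t)
  then show ?case using num_comm_Suc(1)[of v "lo k" "up k" t] v0 sent_Suc[of t k om] s by simp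
 qed
 show ?thesis
 proof (cases "EX t. sent k t om")
  case False
  then have "first_value k f om = 0" by (intro first_value_none) auto
  moreover have "comm_incr (lo k) (up k) v 1 = 0" using False n by (intro comm_incr_never v0) auto
  ultimately show ?thesis using f by simp
 next
  case True
  define t where "t = (LEAST t. sent k t om)"
  have t: "sent k t om" unfolding t_def using True by (rule LeastI_ex)
  then obtain r where r: "t = Suc r" using sent_t0 by (cases t) auto
  have nr: "~ sent k r om" using not_less_Least[of r "%t. sent k t om"] r t_def by simp
  then have out: "W k r om \<notin> S k" using t r sent_Suc[of r k om] by simp
  have "first_value k f om = f (W k r om)" using first_value_eq[of k r om f] nr out by simp
  moreover have "comm_incr (lo k) (up k) v 1 = W k r om"
   using comm_incr_first[of v "lo k" "up k" r] v0 n nr s out V X by simp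
  ultimately show ?thesis by simp
 qed
qed

context threshold_system begin

lemma first_message_law:
 assumes k: "k : {1..K}" and i: "(i, law) = (0, tilt (step_law k)) | (i, law) = (\<infinity>, step_law k)"
  and B: "B : sets borel" "0 \<notin> B"
 shows "{om\<in>space (P i). comm_incr (lo k) (up k) (%t. u k t om) 1 : B} : sets (P i)"
  and "\<P>(om in P i. comm_incr (lo k) (up k) (%t. u k t om) 1 : B) = enn2real (exit_mean law {-lo k<..<up k} (indicator B) 0)"
proof -
 obtain L where L: "sensor_walk (P i) joint K L incr 0 lo up V" "L k = law"
  using i sensor_walk_inf sensor_walk_post[of 0] by (auto simp: zero_enat_def)
 interpret w: sensor_walk "P i" joint K L incr 0 lo up V by (rule L)
 let ?f = "indicator B :: real => ennreal"
 let ?E = "{om\<in>space (P i). comm_incr (lo k) (up k) (%t. u k t om) 1 : B}"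
 have f: "?f : borel_measurable borel" "?f 0 = 0" using B by auto
 have V0: "!!om. V k 0 om = 0" by simp
 have fv: "w.first_value k ?f om = ?f (comm_incr (lo k) (up k) (%t. u k t om) 1)" if "om : space (P i)" for om
  by (rule first_value_comm_incr[OF L(1)]) (use that f u_0[OF k] space_P[of i] in \<open>auto simp: V_def incr_def\<close>)
 note m [measurable] = w.first_value_mean(1)[OF k V0 f(1)]
 have "?E = {om\<in>space (P i). w.first_value k ?f om = 1}" using fv by (auto simp: indicator_def)
 also have "... : sets (P i)" by measurable
 finally show E: "?E : sets (P i)" .
 have "emeasure (P i) ?E = nn_integral (P i) (%om. indicator ?E om)" using E by simp
 also have "... = nn_integral (P i) (%om. w.first_value k ?f om)"
  by (intro nn_integral_cong) (simp add: fv indicator_def)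
 also have "... = exit_mean law {-lo k<..<up k} ?f 0" using w.first_value_mean(2)[OF k V0 f(1)] L(2) by simp
 finally show "\<P>(om in P i. comm_incr (lo k) (up k) (%t. u k t om) 1 : B) = enn2real (exit_mean law {-lo k<..<up k} (indicator B) 0)"
  by (simp add: measure_def)
qed

text \<open>
 The conditional probabilities \<open>1 - j / d\<close> are strictly decreasing in
 \<open>j\<close>.
\<close>

lemma levels_strict:
 assumes k: "k : {1..K}" and d: "1 <= d" and ql: "quantile_levels (P 0) Pre (u k) (lo k) (up k) d el eu" and j: "j < d"
 shows "el j < el (Suc j)" "eu j < eu (Suc j)"
proof -
 let ?l = "%om. comm_incr (lo k) (up k) (%t. u k t om) 1"
 have pos: "0 < lo k" "0 < up k" using thr[OF k] by auto
 have e: "el 0 = 0" "eu 0 = 0" "el d = \<infinity>" "eu d = \<infinity>" using ql by (auto simp: quantile_levels_def)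
 have e1: "0 < el i & el i < \<infinity> & 0 < eu i & eu i < \<infinity>" if "i : {1..<d}" for i
  using ql that by (auto simp: quantile_levels_def Let_def)
 have cu: "\<P>(om in P 0. eu i <= ereal (?l om - up k) \<bar> up k <= ?l om) = 1 - real i / real d"
  and cl: "\<P>(om in Pre. ereal (?l om + lo k) <= - el i \<bar> ?l om <= - lo k) = 1 - real i / real d" if "i : {1..<d}" for i
  using ql that by (auto simp: quantile_levels_def Let_def)
 interpret p0: prob_space "P 0" by (rule prob_P)
 interpret pi: prob_space "Pre" by (rule prob_P)
 have "el j < el (Suc j) & eu j < eu (Suc j)"
 proof (cases "1 <= j & Suc j < d")
  case False
  then have "j = 0 | Suc j = d" using j by auto
  then show ?thesis using e e1[of j] e1[of "Suc j"] j by (cases "j = 0"; cases "Suc j = d") auto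
 next
  case True
  have mu: "{om\<in>space (P 0). eu i <= ereal (?l om - up k) & up k <= ?l om} : sets (P 0)" for i
   using first_message_law(1)[OF k, of 0 "tilt (step_law k)" "{w. eu i <= ereal (w - up k) & up k <= w}"] pos by auto
  have ml: "{om\<in>space Pre. ereal (?l om + lo k) <= - el i & ?l om <= - lo k} : sets Pre" for i
   using first_message_law(1)[OF k, of \<infinity> "step_law k" "{w. ereal (w + lo k) <= - el i & w <= - lo k}"] pos by auto
  have lt: "1 - real (Suc j) / real d < 1 - real j / real d" using d by (simp add: divide_strict_right_mono)
  have "eu j < eu (Suc j)"
  proof (rule ccontr)
   assume "~ eu j < eu (Suc j)"
   then have "\<P>(om in P 0. eu j <= ereal (?l om - up k) \<bar> up k <= ?l om) <= \<P>(om in P 0. eu (Suc j) <= ereal (?l om - up k) \<bar> up k <= ?l om)"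
    unfolding cond_prob_def by (intro divide_right_mono p0.finite_measure_mono mu) auto
   then show False using cu[of j] cu[of "Suc j"] lt True by auto
  qed
  moreover have "el j < el (Suc j)"
  proof (rule ccontr)
   assume "~ el j < el (Suc j)"
   then have "- el j <= - el (Suc j)" by (simp add: not_less)
   then have "\<P>(om in Pre. ereal (?l om + lo k) <= - el j \<bar> ?l om <= - lo k) <= \<P>(om in Pre. ereal (?l om + lo k) <= - el (Suc j) \<bar> ?l om <= - lo k)"
    unfolding cond_prob_def by (intro divide_right_mono pi.finite_measure_mono ml) (auto intro: order_trans)
   then show False using cl[of j] cl[of "Suc j"] lt True by auto
  qed
  ultimately show ?thesis by simp
 qed
 then show "el j < el (Suc j)" "eu j < eu (Suc j)" by auto
qed

lemma quantized_sensor_message: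
 assumes k: "k : {1..K}" and d: "1 <= d" and ql: "quantile_levels (P 0) Pre (u k) (lo k) (up k) d el eu"
 shows "quantized_sensor (step_law k) a b (lo k) (up k) d el eu (message_llr (P 0) Pre (u k) (lo k) (up k) d el eu)"
proof -
 have qz: "quantizer (lo k) (up k) d el eu"
  by unfold_locales (use thr[OF k] d levels_strict[OF k d ql] ql in \<open>auto simp: quantile_levels_def\<close>)
 interpret z: quantizer "lo k" "up k" d el eu by (rule qz)
 interpret l: llr_law "step_law k" a b by (rule llr_law_step[OF k])
 have lab: "message_llr (P 0) Pre (u k) (lo k) (up k) d el eu i =
   ln (enn2real (exit_mean (tilt (step_law k)) {-lo k<..<up k} (%w. indicator {i} (z.Q w)) 0) /
    enn2real (exit_mean (step_law k) {-lo k<..<up k} (%w. indicator {i} (z.Q w)) 0))" if "i : z.labels" for i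
 proof -
  have i0: "i ~= 0" using that by (auto simp: z.labels_def)
  have B: "z.Q -` {i} : sets borel" "0 \<notin> z.Q -` {i}"
   using measurable_sets[OF z.quantize_measurable, of "{i}"] i0 z.quantize_0 by auto
  have ind: "(%w. indicator {i} (z.Q w)) = (indicator (z.Q -` {i}) :: real => ennreal)" by (auto simp: indicator_def fun_eq_iff)
  show ?thesis
   using first_message_law(2)[OF k _ B, of 0 "tilt (step_law k)"] first_message_law(2)[OF k _ B, of \<infinity> "step_law k"]
   by (simp add: message_llr_def message_def ind)
 qed
 show ?thesis
  by (intro quantized_sensor.intro quantized_sensor_axioms.intro llr_law_step[OF k] qz full_support[OF k] lab)
qed

end

lemma (in quantizer) message_value_eq:
 assumes "w \<notin> S"
 shows "message_value P0 Pinf v lo up d el eu w = message_llr P0 Pinf v lo up d el eu (Q w)"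
proof -
 define L where "L = message_llr P0 Pinf v lo up d el eu"
 have "Q w : labels" by (rule exit_label[OF assms])
 then obtain i where i: "i : {1..d}" "Q w = int i | Q w = - int i" by (auto simp: labels_def)
 have "(SUM j=1..d. L (int j) * of_bool (Q w = int j) + L (- int j) * of_bool (Q w = - int j)) = (SUM j=1..d. if j = i then L (Q w) else 0)"
  using i by (intro sum.cong) auto
 also have "... = L (Q w)" using i by simp
 finally show ?thesis by (simp add: message_value_def L_def Let_def)
qed

section \<open>Stopped walks and conditional expectations\<close>

text \<open>
 Otherwise the conditional expectation exceeds \<open>C\<close> on an event of the sub-algebra of
 positive probability.
\<close>

lemma (in prob_space) esssup_cond_exp_le:
 assumes sub: "subalgebra M F" and f: "integrable M f"
  and le: "!!B. B : sets F ==> (\<integral>om. indicator B om * f om \<partial>M) <= C * measure M B"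
 shows "esssup M (%om. ereal (real_cond_exp M F f om)) <= ereal C"
proof -
 interpret s: finite_measure_subalgebra M F by unfold_locales (rule sub)
 let ?g = "real_cond_exp M F f"
 define B where "B = {om\<in>space F. C < ?g om}"
 have B: "B : sets F" unfolding B_def by measurable
 then have BM [measurable]: "B : sets M" using sub by (auto simp: subalgebra_def)
 have g: "integrable M ?g" by (rule s.real_cond_exp_int(1)[OF f])
 have ig: "integrable M (%om. indicator B om * ?g om)" "integrable M (%om. indicator B om * C)"
  using integrable_mult_indicator[OF BM g] integrable_mult_indicator[OF BM integrable_const[of C]] by simp_all
 have "(\<integral>om. indicator B om * ?g om \<partial>M) <= C * measure M B"
  using s.real_cond_exp_intA[OF f B] le[OF B] by (simp add: set_lebesgue_integral_def)
 then have "(\<integral>om. indicator B om * (?g om - C) \<partial>M) <= 0"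
  using ig by (simp add: right_diff_distrib mult.commute)
 moreover have nn: "0 <= indicator B om * (?g om - C)" for om by (simp add: indicator_def B_def)
 ultimately have "(\<integral>om. indicator B om * (?g om - C) \<partial>M) = 0"
  using Bochner_Integration.integral_nonneg[of M "%om. indicator B om * (?g om - C)"] by fastforce
 moreover have "integrable M (%om. indicator B om * (?g om - C))" using ig by (simp add: right_diff_distrib)
 ultimately have z: "AE om in M. indicator B om * (?g om - C) = 0"
  using nn by (subst (asm) integral_nonneg_eq_0_iff_AE) auto
 have sp: "space F = space M" using sub by (simp add: subalgebra_def)
 have "AE om in M. ereal (?g om) <= ereal C"
  using z by (rule AE_mp) (rule AE_I2, auto simp: B_def sp indicator_def split: if_splits)
 then show ?thesis by (intro esssup_I) measurable
qed

lemma (in prob_space) mean_le_esssup: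
 assumes g: "integrable M g" shows "ereal (\<integral>om. g om \<partial>M) <= esssup M (%om. ereal (g om))"
proof (rule ereal_le_real)
 fix z assume z: "esssup M (%om. ereal (g om)) <= ereal z"
 have "AE om in M. ereal (g om) <= esssup M (%om. ereal (g om))" by (rule esssup_AE)
 then have "AE om in M. g om <= z" by (rule AE_mp) (intro AE_I2 impI, use z in \<open>auto dest: order_trans\<close>)
 then have "(\<integral>om. g om \<partial>M) <= (\<integral>om. z \<partial>M)" by (intro integral_mono_AE g) auto
 then show "ereal (\<integral>om. g om \<partial>M) <= ereal z" by (simp add: prob_space)
qed

context filtered_walk begin

text \<open>The increments before \<open>T\<close> sum up to the displacement.\<close>

lemma wald_stopped:
 assumes U: "!!t om. t0 <= t ==> om : space M ==> U (Suc t) om = U t om + Xs t om" and Um: "U t0 : borel_measurable M"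
  and T: "!!t. {om\<in>space M. enat t < T om} : sets (F t)" and B: "B : sets (F t0)"
  and fin: "(\<Sum>n. emeasure M {om\<in>space M. enat (t0 + n) < T om}) < \<infinity>" and int: "integrable total_law (%x. x)"
 shows "integrable M (%om. indicator B om * ((stopped (%t. U t om) (T om) - U t0 om) * of_bool (enat t0 < T om)))" (is "integrable M ?f")
  and "(\<integral>om. indicator B om * ((stopped (%t. U t om) (T om) - U t0 om) * of_bool (enat t0 < T om)) \<partial>M)
   = (\<integral>x. x \<partial>total_law) * (\<Sum>n. measure M ({om\<in>space M. enat (t0 + n) < T om} Int B))"
  and "summable (%n. measure M ({om\<in>space M. enat (t0 + n) < T om} Int B))"
proof -
 define A where "A t = (if t < t0 then space M else {om\<in>space M. enat t < T om} Int B)" for t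
 have A: "A t : sets (F t)" for t
 proof (cases "t < t0")
  case True
  then show ?thesis using sets.top[of "F t"] by (simp add: A_def space_F)
 next
  case False
  then have "B : sets (F t)" using B F_mono[of t0 t] by auto
  then show ?thesis using False T[of t] by (simp add: A_def sets.Int)
 qed
 have An: "A (t0 + n) = {om\<in>space M. enat (t0 + n) < T om} Int B" for n by (simp add: A_def)
 have AM [measurable]: "A t : sets M" for t using A sets_F by blast
 have TM: "{om\<in>space M. enat t < T om} : sets M" for t using T sets_F by blast
 have finA: "(\<Sum>n. emeasure M (A (t0 + n))) < \<infinity>"
 proof (rule le_less_trans[OF _ fin])
  show "(\<Sum>n. emeasure M (A (t0 + n))) <= (\<Sum>n. emeasure M {om\<in>space M. enat (t0 + n) < T om})"
   unfolding An by (intro suminf_le summableI emeasure_mono TM) auto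
 qed
 note w = wald[OF A finA int]
 let ?s = "%om. \<Sum>n. indicator (A (t0 + n)) om * Xs (t0 + n) om"
 have eq: "?s om = ?f om" if w: "om : space M" and n: "EX n. om \<notin> A (t0 + n)" for om
 proof (cases "om : B")
  case False
  then show ?thesis by (simp add: An)
 next
  case True
  then obtain n where "~ enat (t0 + n) < T om" using n w by (auto simp: An)
  then obtain t where t: "T om = enat t" by (cases "T om") auto
  have "?s om = (\<Sum>n\<in>{..<t - t0}. indicator (A (t0 + n)) om * Xs (t0 + n) om)"
   by (rule suminf_finite) (use t in \<open>auto simp: An indicator_def\<close>)
  also have "... = (SUM n<t - t0. U (t0 + Suc n) om - U (t0 + n) om)"
   using True t w U[of "t0 + _" om] by (intro sum.cong) (auto simp: An)
  also have "... = U (t0 + (t - t0)) om - U t0 om"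
   using sum_lessThan_telescope[of "%n. U (t0 + n) om" "t - t0"] by simp
  also have "... = ?f om" using True t by (cases "t0 < t") (auto simp: stopped_def)
  finally show ?thesis .
 qed
 have sm: "?s : borel_measurable M" using w(1) by (rule borel_measurable_integrable)
 have fm: "?f : borel_measurable M"
 proof -
  have "?f om = (if ALL n. om : A (t0 + n) then - U t0 om else ?s om)" if "om : space M" for om
  proof (cases "ALL n. om : A (t0 + n)")
   case True
   then have b: "om : B" "enat (t0 + n) < T om" for n by (auto simp: An)
   have "T om = \<infinity>"
   proof (cases "T om")
    case (enat t)
    then show ?thesis using b(2)[of t] by simp
   qed
   then show ?thesis using True b by (simp add: stopped_def)
  next
   case False
   then show ?thesis using eq[OF that] by auto
  qed
  moreover have "(%om. if ALL n. om : A (t0 + n) then - U t0 om else ?s om) : borel_measurable M"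
   using sm Um by measurable
  ultimately show ?thesis by (subst measurable_cong) auto
 qed
 have ae: "AE om in M. ?s om = ?f om" using w(4) by (rule AE_mp) (use eq in \<open>auto intro!: AE_I2\<close>)
 show "integrable M ?f" using w(1) integrable_cong_AE[OF sm fm ae] by blast
 show "(\<integral>om. ?f om \<partial>M) = (\<integral>x. x \<partial>total_law) * (\<Sum>n. measure M ({om\<in>space M. enat (t0 + n) < T om} Int B))"
  using w(2) integral_cong_AE[OF sm fm ae] by (simp add: An)
 show "summable (%n. measure M ({om\<in>space M. enat (t0 + n) < T om} Int B))" using w(3) by (simp add: An)
qed

end

text \<open>
 No increase by \<open>\<nu>\<close> has occurred up to time \<open>t\<close>; both procedures stop
 at the first time at which this fails.
\<close>

definition running :: "(nat => real) => real => nat => bool" where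
 "running v nu t \<longleftrightarrow> (ALL s<=t. ALL r<=s. v s - v r < nu)"

lemma Min_image_atMost_diff: "v t - Min (v ` {..t::nat}) < nu \<longleftrightarrow> (ALL r<=t. v t - (v r :: real) < nu)"
 using Min_gr_iff[of "v ` {..t}" "v t - nu"] by (auto simp: algebra_simps)

lemma Min_image_lessThan_diff: "0 < t ==> v t - Min (v ` {..<t::nat}) < nu \<longleftrightarrow> (ALL r<t. v t - (v r :: real) < nu)"
 using Min_gr_iff[of "v ` {..<t}" "v t - nu"] by (auto simp: algebra_simps)

lemma less_dcusum:
 "enat t < dcusum K P u lo up d el eu nu om \<longleftrightarrow>
   running (sensor_sum K (%k. quantized_llr (P 0) (P \<infinity>) (u k) (lo k) (up k) d (el k) (eu k)) om) nu t"
 unfolding dcusum_def less_first_time dcusum_stat_def not_le Min_image_atMost_diff running_def ..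

lemma less_cusum:
 assumes "0 < nu" shows "enat t < cusum K u nu om \<longleftrightarrow> running (sensor_sum K u om) nu t"
proof -
 let ?v = "sensor_sum K u om"
 have "cusum_stat ?v s < nu \<longleftrightarrow> (ALL r<=s. ?v s - ?v r < nu)" for s
 proof (cases "s = 0")
  case True
  then show ?thesis using assms by (simp add: cusum_stat_def)
 next
  case False
  have "(ALL r<=s. ?v s - ?v r < nu) \<longleftrightarrow> (ALL r<s. ?v s - ?v r < nu)" using assms by (auto simp: le_less)
  then show ?thesis using False Min_image_lessThan_diff[of s ?v nu] by (simp add: cusum_stat_def)
 qed
 then show ?thesis unfolding cusum_def less_first_time running_def not_le by simp
qed

lemma running_Suc: "running v nu (Suc t) ==> running v nu t"
 by (simp add: running_def)

lemma sum_weak_bound: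
 fixes I y G r :: real
 assumes "0 <= y" "y <= 1/2" "(1 - y) * (I * N) <= G" "0 <= G"
 shows "I * N <= (1 + 2 * y) * G"
proof -
 have "1 - y ~= 0" "0 < 1 - y" using assms by auto
 then have "I * N <= G / (1 - y)" using assms(3) by (simp add: pos_le_divide_eq mult.commute)
 also have "G / (1 - y) <= (1 + 2 * y) * G"
 proof -
  have "1 <= (1 + 2 * y) * (1 - y)" using assms(1,2) mult_left_mono[of y "1/2" y] by (simp add: algebra_simps)
  then have "G * 1 <= G * ((1 + 2 * y) * (1 - y))" using assms(4) by (rule mult_left_mono)
  then show ?thesis using \<open>0 < 1 - y\<close> by (simp add: pos_divide_le_eq ac_simps)
 qed
 finally show ?thesis .
qed

section \<open>The detection delay of D-CUSUM\<close>

locale dcusum_system = threshold_system K P \<xi> u a b lo up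
 for K and P :: "enat => 'a measure" and \<xi> u a b lo up +
 fixes d :: nat and el eu :: "nat => nat => ereal"
 assumes d: "1 <= d"
  and ql: "k : {1..K} ==> quantile_levels (P 0) (P \<infinity>) (u k) (lo k) (up k) d (el k) (eu k)"
begin

definition qk :: "nat => real => real" where
 "qk k w = message_llr (P 0) Pre (u k) (lo k) (up k) d (el k) (eu k) (quantize (lo k) (up k) d (el k) (eu k) w)"

definition lossk :: "nat => real => ennreal" where "lossk k w = ennreal (w - qk k w)"

definition ut :: "nat => 'a => real" where
 "ut t om = sensor_sum K (%k. quantized_llr (P 0) Pre (u k) (lo k) (up k) d (el k) (eu k)) om t"

lemma sensor: "k : {1..K} ==> quantized_sensor (step_law k) a b (lo k) (up k) d (el k) (eu k)
  (message_llr (P 0) Pre (u k) (lo k) (up k) d (el k) (eu k))"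
 by (rule quantized_sensor_message[OF _ d ql])

lemma quantizer_k: "k : {1..K} ==> quantizer (lo k) (up k) d (el k) (eu k)"
 using sensor by (simp add: quantized_sensor_def)

lemma q_eq: "k : {1..K} ==> quantized_sensor.q (lo k) (up k) d (el k) (eu k)
  (message_llr (P 0) Pre (u k) (lo k) (up k) d (el k) (eu k)) = qk k"
 by (intro ext) (simp add: quantized_sensor.q_def[OF sensor] qk_def)

lemma loss_eq: "k : {1..K} ==> quantized_sensor.loss (lo k) (up k) d (el k) (eu k)
  (message_llr (P 0) Pre (u k) (lo k) (up k) d (el k) (eu k)) = lossk k"
 by (intro ext) (simp add: quantized_sensor.loss_def[OF sensor] lossk_def q_eq)

lemma qk_measurable: "k : {1..K} ==> qk k : borel_measurable borel"
 using quantized_sensor.q_measurable[OF sensor, of k] q_eq[of k] by simp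

lemma lossk_measurable: "k : {1..K} ==> lossk k : borel_measurable borel"
 using quantized_sensor.loss_measurable[OF sensor, of k] loss_eq[of k] by simp

abbreviation W :: "nat => nat => 'a => real" where "W k t om \<equiv> V k t om + incr k t om"

lemma ut_0: "om : Omega ==> ut 0 om = 0"
 by (simp add: ut_def sensor_sum_def quantized_llr_0 u_0)

lemma ut_Suc: "om : Omega ==> ut (Suc t) om = ut t om + (SUM k=1..K. if W k t om : {-lo k<..<up k} then 0 else qk k (W k t om))"
proof -
 assume w: "om : Omega"
 have "quantized_llr (P 0) Pre (u k) (lo k) (up k) d (el k) (eu k) (Suc t) om
   = quantized_llr (P 0) Pre (u k) (lo k) (up k) d (el k) (eu k) t om + (if W k t om : {-lo k<..<up k} then 0 else qk k (W k t om))"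
  if k: "k : {1..K}" for k
 proof (cases "W k t om : {-lo k<..<up k}")
  case True
  then have "~ sends (lo k) (up k) (%t. u k t om) t" by (simp only: sends_def V_def[symmetric] incr_def[symmetric]) simp
  then show ?thesis using True by (simp only: quantized_llr_Suc[of "u k" om, OF u_0[OF k w]] if_True if_False)
 next
  case False
  then have "sends (lo k) (up k) (%t. u k t om) t" by (simp only: sends_def V_def[symmetric] incr_def[symmetric]) simp
  moreover note quantizer.message_value_eq[OF quantizer_k[OF k] False, of "P 0" "Pre" "u k"]
  ultimately show ?thesis using False
   by (simp only: quantized_llr_Suc[of "u k" om, OF u_0[OF k w]] if_True if_False qk_def V_def[symmetric] incr_def[symmetric])
 qed
 then show ?thesis by (simp only: ut_def sensor_sum_def sum.distrib[symmetric] cong: sum.cong)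
qed

lemma ut_joint: "ut t : borel_measurable (joint t)"
proof (induction t)
 case 0
 have "ut 0 : borel_measurable (joint 0) \<longleftrightarrow> (%_. 0 :: real) : borel_measurable (joint 0)"
  by (rule measurable_cong) (simp add: ut_0)
 then show ?case by simp
next
 case (Suc t)
 let ?r = "%om. ut t om + (SUM k=1..K. if W k t om : {-lo k<..<up k} then 0 else qk k (W k t om))"
 have "?r : borel_measurable (joint (Suc t))"
 proof (intro borel_measurable_add borel_measurable_sum)
  show "ut t : borel_measurable (joint (Suc t))" by (rule measurable_larger[OF Suc.IH joint_mono]) auto
  fix k assume k: "k : {1..K}"
  have [measurable]: "V k t : borel_measurable (joint (Suc t))" by (rule measurable_larger[OF V_joint[OF k] joint_mono]) auto
  note [measurable] = incr_joint[OF k, of t] qk_measurable[OF k]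
  show "(%om. if W k t om : {-lo k<..<up k} then 0 else qk k (W k t om)) : borel_measurable (joint (Suc t))" by measurable
 qed
 moreover have "ut (Suc t) : borel_measurable (joint (Suc t)) \<longleftrightarrow> ?r : borel_measurable (joint (Suc t))"
  by (rule measurable_cong) (simp only: ut_Suc space_joint)
 ultimately show ?case by simp
qed

end

context sensor_system begin

lemma running_joint:
 assumes "!!t. v t : borel_measurable (joint t)"
 shows "{om\<in>Omega. running (%t. v t om) nu t} : sets (joint t)"
proof -
 have [measurable]: "v s : borel_measurable (joint t)" if "s <= t" for s
  using that by (intro measurable_larger[OF assms joint_mono]) auto
 have e: "{om\<in>Omega. running (%t. v t om) nu t} = (\<Inter>s\<in>{..t}. \<Inter>r\<in>{..s}. {om\<in>space (joint t). v s om - v r om < nu})"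
  by (auto simp: running_def)
 have "{om\<in>space (joint t). v s om - v r om < nu} : sets (joint t)" if "s <= t" "r <= s" for s r
 proof -
  have [measurable]: "v s : borel_measurable (joint t)" "v r : borel_measurable (joint t)"
   using that by (auto intro!: measurable_larger[OF assms joint_mono])
  show ?thesis by measurable
 qed
 then show ?thesis unfolding e by (intro sets.finite_INT) auto
qed

end

context dcusum_system begin

text \<open>
 On a running path, the log-likelihood ratio since a common message time exceeds the threshold
 only by the current phases and the losses of the messages.
\<close>

lemma path_loss:
 assumes w: "om : Omega" and A: "!!t. A (Suc t) <= A t"
  and run: "!!t. tau <= t ==> om : A t ==> running (%t. ut t om) nu t"
  and A0: "om : A (tau + n)"
  and S: "sensor_walk M F K law incr tau lo up V" and wM: "om : space M"
 shows "ennreal (sensor_walk.Z K incr tau lo up V (tau + n) om - (nu + (SUM k=1..K. lo k + up k)))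
  <= (SUM k=1..K. sensor_walk.acc_loss incr tau lo up V A lossk k n om)"
proof -
 interpret s: sensor_walk M F K law incr tau lo up V by (rule S)
 define D where "D t = ut t om + (SUM k=1..K. V k t om)" for t
 define L where "L n = (SUM k=1..K. s.acc_loss A lossk k n om)" for n
 define l where "l t = (SUM k=1..K. if W k t om \<notin> s.S k then lossk k (W k t om) else 0)" for t
 have step: "ennreal (Z' + s.Xs t om - (D (Suc t) - c)) <= ennreal (Z' - (D t - c)) + l t" for Z' c t
 proof -
  define m where "m = (SUM k=1..K. if W k t om \<notin> s.S k then max 0 (W k t om - qk k (W k t om)) else 0)"
  have m0: "0 <= m" unfolding m_def by (intro sum_nonneg) auto
  have e: "(if W k t om \<notin> s.S k then lossk k (W k t om) else 0)
    = ennreal (if W k t om \<notin> s.S k then max 0 (W k t om - qk k (W k t om)) else 0)" for k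
   by (cases "W k t om : s.S k") (simp_all add: lossk_def ennreal_max_0 del: greaterThanLessThan_iff)
  have lm: "l t = ennreal m" unfolding l_def m_def e by (rule sum_ennreal) simp
  have "D (Suc t) - D t = (SUM k=1..K. (if W k t om : s.S k then 0 else qk k (W k t om)) + (V k (Suc t) om - V k t om))"
   unfolding D_def ut_Suc[OF w] sum.distrib sum_subtractf by simp
  also have "... \<ge> (SUM k=1..K. incr k t om - (if W k t om \<notin> s.S k then max 0 (W k t om - qk k (W k t om)) else 0))"
  proof (rule sum_mono)
   fix k assume "k : {1..K}"
   show "incr k t om - (if W k t om \<notin> s.S k then max 0 (W k t om - qk k (W k t om)) else 0)
    <= (if W k t om : s.S k then 0 else qk k (W k t om)) + (V k (Suc t) om - V k t om)"
   proof (cases "W k t om : s.S k")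
    case True
    then have "V k (Suc t) om = W k t om" by (simp only: V_Suc_eq renew_def if_True)
    then show ?thesis using True by (simp only: not_True_eq_False if_True if_False)
   next
    case False
    then have "V k (Suc t) om = 0" by (simp only: V_Suc_eq renew_def if_False)
    then show ?thesis using False max.cobounded2[of "W k t om - qk k (W k t om)" 0]
    by (simp only: not_False_eq_True if_True if_False)
   qed
  qed
  finally have "s.Xs t om - m <= D (Suc t) - D t" unfolding s.Xs_def m_def sum_subtractf by simp
  then have "ennreal (Z' + s.Xs t om - (D (Suc t) - c)) <= ennreal (max 0 (Z' - (D t - c)) + m)"
   by (intro ennreal_leI) linarith
  then show ?thesis using m0 by (simp add: lm ennreal_plus ennreal_max_0)
 qed
 have Adec: "A (tau + Suc n) <= A (tau + n)" for n using A[of "tau + n"] by simp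
 have "EX r<=tau + n. ennreal (s.Z (tau + n) om - (D (tau + n) - D r)) <= L n"
  using A0
 proof (induction n)
  case 0
  show ?case by (intro exI[of _ "tau"]) (simp add: s.Z_def)
 next
  case (Suc n)
  have a: "om : A (tau + n)" using Suc.prems Adec by blast
  show ?case
  proof (cases "s.all_sent (tau + n) om")
   case False
   then show ?thesis using s.Z_unsent[of "tau + n" om] by (intro exI[of _ "tau + Suc n"]) simp
  next
   case True
   obtain r where r: "r <= tau + n" "ennreal (s.Z (tau + n) om - (D (tau + n) - D r)) <= L n" using Suc.IH a by blast
   have "L (Suc n) = L n + l (tau + n)"
    unfolding L_def l_def sum.distrib[symmetric] using a True
    by (intro sum.cong) (simp_all add: s.acc_loss_def s.all_sent_def del: greaterThanLessThan_iff)
   moreover have "s.Z (tau + Suc n) om = s.Z (tau + n) om + s.Xs (tau + n) om" using True by (simp add: s.Z_Suc)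
   ultimately have "ennreal (s.Z (tau + Suc n) om - (D (tau + Suc n) - D r)) <= L (Suc n)"
    using step[of "s.Z (tau + n) om" "tau + n" "D r"] r(2) by (simp add: add_right_mono order_trans)
   then show ?thesis using r(1) by (intro exI[of _ r]) simp
  qed
 qed
 then obtain r where r: "r <= tau + n" "ennreal (s.Z (tau + n) om - (D (tau + n) - D r)) <= L n" by blast
 have u: "ut (tau + n) om - ut r om < nu" using run[OF _ A0] r(1) by (auto simp: running_def)
 have "(SUM k=1..K. V k (tau + n) om) - (SUM k=1..K. V k r om) <= (SUM k=1..K. lo k + up k)"
  unfolding sum_subtractf[symmetric]
 proof (rule sum_mono)
  fix k assume k: "k : {1..K}"
  show "V k (tau + n) om - V k r om <= lo k + up k" using V_bounds[OF k, of "tau + n" om] V_bounds[OF k, of r om] by simp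
 qed
 then have "ennreal (s.Z (tau + n) om - (nu + (SUM k=1..K. lo k + up k))) <= ennreal (s.Z (tau + n) om - (D (tau + n) - D r))"
  using u unfolding D_def by (intro ennreal_leI) linarith
 then show ?thesis using r(2) unfolding L_def by (rule order_trans)
qed

definition info :: real where "info = (\<integral>x. x \<partial>tilt tot)"

definition tot_overshoot :: real where
 "tot_overshoot = overshoot_const (real K * a) ((real K)^2 * b) * ((real K)^2 * b)"

definition steps :: "real => real" where "steps w = real (nat \<lceil>2 * w / a\<rceil>)"

definition rest :: "real => real => real => real => real" where
 "rest w g0 \<delta> c0 = real K * w + tot_overshoot + info * (steps w + real K / (1 - laplace_rate a b))
   + 2 * (real K * (\<delta> / g0) * (steps w + 1 / (1 - laplace_rate a b)) + c0)"

abbreviation R :: "real => nat => 'a set" where "R nu t \<equiv> {om\<in>Omega. running (%t. ut t om) nu t}"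

lemma R_joint: "R nu t : sets (joint t)" by (rule running_joint[OF ut_joint])

text \<open>
 The three parts of the running time are \<open>r1\<close>, \<open>r2\<close> and
 \<open>r3\<close>.  The bound of \<open>r3\<close> contains the total running time again, with the
 small factor \<open>2 * \<delta> / (a * g0)\<close>, and is solved for it.
\<close>

lemma delay_sum_le:
 fixes w g0 \<delta> c0 nu :: real
 assumes nu: "0 < nu" and w: "0 <= w" "!!k. k : {1..K} ==> lo k + up k <= w"
  and g0: "0 < g0" "!!k. k : {1..K} ==> ennreal g0 <= green (tilt (step_law k)) {-lo k<..<up k} (%_. 1) 0"
  and \<delta>: "0 <= \<delta>" "!!k. k : {1..K} ==> exit_mean (tilt (step_law k)) {-lo k<..<up k} (lossk k) 0 <= ennreal \<delta>"
  and half: "4 * \<delta> <= a * g0"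
  and c0: "0 < c0" "info / 2 <= c0" "nn_integral (tilt tot) (%x. ennreal (c0 - x)) <= ennreal (c0 - info / 2)"
  and B: "B : sets (joint tau)"
 shows "info * (SUM i<n. measure (P (enat tau)) (R nu (tau + i) Int B))
  <= (1 + 2 * (2 * \<delta> / (a * g0))) * ((nu + rest w g0 \<delta> c0) * measure (P (enat tau)) (R nu tau Int B))"
proof -
 let ?M = "P (enat tau)"
 interpret s: sensor_walk ?M joint K "%k. tilt (step_law k)" incr tau lo up V by (rule sensor_walk_post)
 interpret T: llr_law tot "real K * a" "(real K)^2 * b" by (rule llr_law_tot)
 let ?\<rho> = "laplace_rate a b"
 let ?n0 = "nat \<lceil>2 * w / a\<rceil>"
 let ?T1 = "steps w + real K / (1 - ?\<rho>)" and ?\<Phi> = "steps w + 1 / (1 - ?\<rho>)"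
 have tl: "s.total_law = tilt tot" by (rule total_post)
 have b0: "0 < b" using llr_law.b_pos[OF llr_law_step[of 1]] K_pos by simp
 have rho: "0 <= ?\<rho>" "?\<rho> < 1" using laplace_rate_bounds[OF a0 b0] by auto
 have n0: "2 * w / a <= real ?n0" by (rule real_nat_ceiling_ge)
 have st0: "0 <= steps w" by (simp add: steps_def)
 define c where "c = nu + (SUM k=1..K. lo k + up k)"
 have sK: "0 <= (SUM k=1..K. lo k + up k)" using thr by (intro sum_nonneg) (auto simp: less_imp_le add_nonneg_nonneg)
 have c: "0 < c" "c <= nu + real K * w"
 proof -
  show "0 < c" using nu sK by (simp add: c_def)
  have "(SUM k=1..K. lo k + up k) <= (SUM k=1..K. w)" by (intro sum_mono w)
  then show "c <= nu + real K * w" by (simp add: c_def)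
 qed
 define A where "A t = (if t < tau then Omega else R nu t Int B)" for t
 have BO: "B <= Omega" using sets.sets_into_space[OF B] by simp
 have A: "A t : sets (joint t)" for t
 proof (cases "t < tau")
  case True
  then show ?thesis using sets.top[of "joint t"] by (simp add: A_def)
 next
  case False
  then have "B : sets (joint t)" using B joint_mono[of tau t] by auto
  then show ?thesis using False R_joint[of nu t] by (simp add: A_def sets.Int)
 qed
 have Adec: "A (Suc t) <= A t" for t
  using running_Suc by (auto simp: A_def)
 have AM [measurable]: "A t : sets ?M" for t using A joint_subset_P by blast
 have compl: "{om\<in>space ?M. ~ Q om} : sets ?M" if "{om\<in>space ?M. Q om} : sets ?M" for Q
  using sets.compl_sets[OF that] by (auto simp: set_diff_eq cong: conj_cong)
 have aM: "{om\<in>space ?M. s.all_sent t om} : sets ?M" and rM: "{om\<in>space ?M. s.reached c t om} : sets ?M" for t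
  using s.all_sent_F s.reached_F s.F_M by blast+
 define B1 where "B1 i = A (tau + i) Int {om\<in>space ?M. ~ s.all_sent (tau + i) om}" for i
 define B2 where "B2 i = A (tau + i) Int {om\<in>space ?M. s.all_sent (tau + i) om & ~ s.reached c (tau + i) om}" for i
 define B3 where "B3 i = A (tau + i) Int {om\<in>space ?M. s.reached c (tau + i) om}" for i
 have BM: "B1 i : sets ?M" "B2 i : sets ?M" "B3 i : sets ?M" for i
 proof -
  show "B1 i : sets ?M" "B3 i : sets ?M" unfolding B1_def B3_def by (intro sets.Int AM compl aM rM)+
  have "B2 i = A (tau + i) Int ({om\<in>space ?M. s.all_sent (tau + i) om} Int {om\<in>space ?M. ~ s.reached c (tau + i) om})"
   by (auto simp: B2_def)
  then show "B2 i : sets ?M" by (simp only:) (intro sets.Int AM compl aM rM)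
 qed
 define r where "r i = measure ?M (A (tau + i))" for i
 define r1 where "r1 = (SUM i<n. measure ?M (B1 i))"
 define r2 where "r2 = (SUM i<n. measure ?M (B2 i))"
 define r3 where "r3 = (SUM i<n. measure ?M (B3 i))"
 define N where "N = (SUM i<n. r i)"
 have nn: "0 <= r i" "0 <= r1" "0 <= r2" "0 <= r3" "0 <= N" for i
  by (auto simp: r_def r1_def r2_def r3_def N_def intro!: sum_nonneg)
 have split: "N <= r1 + r2 + r3"
  unfolding N_def r1_def r2_def r3_def sum.distrib[symmetric]
 proof (rule sum_mono)
  fix i
  have "r i <= measure ?M ((B1 i \<union> B2 i) \<union> B3 i)"
   unfolding r_def using sets.sets_into_space[OF AM[of "tau + i"]]
   by (intro s.finite_measure_mono sets.Un BM) (auto simp: B1_def B2_def B3_def)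
  also have "... <= measure ?M (B1 i \<union> B2 i) + measure ?M (B3 i)" by (intro measure_Un_le sets.Un BM)
  also have "... <= measure ?M (B1 i) + measure ?M (B2 i) + measure ?M (B3 i)"
   by (intro add_right_mono measure_Un_le BM)
  finally show "r i <= measure ?M (B1 i) + measure ?M (B2 i) + measure ?M (B3 i)" .
 qed
 have I: "real K * a <= info" using T.mean_0 by (simp add: info_def)
 have Ka: "0 < real K * a" by (rule T.a_pos)
 have I0: "0 < info" using I Ka by linarith
 have 1: "r1 <= ?T1 * r 0"
 proof -
  have "(kill (tilt (step_law k)) (s.S k) ^^ (m + ?n0)) (%_. 1) v <= ennreal (?\<rho> ^ m)" if k: "k : {1..K}" and v: "v : s.S k" for k m v
   using w(2)[OF k] v n0 by (intro llr_law.tilt_pow_le[OF llr_law_step[OF k], of _ "up k" _ w]) auto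
  from s.unsent_sum_le[OF A Adec this rho, where n = n]
  have "ennreal r1 <= ennreal ?T1 * ennreal (r 0)"
   by (simp add: r1_def r_def B1_def s.emeasure_eq_measure steps_def)
  moreover have "0 <= ?T1" using st0 rho by (intro add_nonneg_nonneg divide_nonneg_nonneg) auto
  ultimately show ?thesis using nn by (simp add: ennreal_mult[symmetric] del: ennreal_plus)
 qed
 have ov: "0 <= tot_overshoot"
  unfolding tot_overshoot_def
  by (intro mult_nonneg_nonneg less_imp_le[OF overshoot_const_pos[OF T.a_pos T.b_pos]] less_imp_le[OF T.b_pos])
 have 2: "info * r2 <= (c + tot_overshoot) * r 0"
 proof -
  have "ennreal info * green (tilt tot) {..<c} (%_. 1) 0 <= ennreal (c - 0) + ennreal tot_overshoot"
   unfolding info_def tot_overshoot_def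
  proof (rule T.t.sojourn_below_le[OF T.int_0])
   show "0 <= (\<integral>x. x \<partial>tilt tot)" using I0 unfolding info_def by (rule less_imp_le)
   show "exit_mean (tilt tot) {..<c} (%w. ennreal (w - c)) v
    <= ennreal (overshoot_const (real K * a) ((real K)^2 * b) * ((real K)^2 * b))" if "v < c" for v
    using T.overshoot_le[of "{..<c}" c v] that by simp
  qed (rule c(1))
  moreover have "ennreal info * ennreal r2 <= ennreal info * (green (tilt tot) {..<c} (%_. 1) 0 * ennreal (r 0))"
   using s.unreached_sum_le[OF A Adec c(1), where n = n] unfolding tl
   by (intro mult_left_mono) (simp_all add: r2_def r_def B2_def s.emeasure_eq_measure)
  ultimately have "ennreal info * ennreal r2 <= (ennreal (c - 0) + ennreal tot_overshoot) * ennreal (r 0)"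
   unfolding mult.assoc[symmetric] by (meson mult_right_mono order_trans zero_le)
  then show ?thesis using nn I0 c ov by (simp add: ennreal_mult[symmetric] ennreal_plus[symmetric] del: ennreal_plus)
 qed
 define L where "L m om = (SUM k=1..K. s.acc_loss A lossk k m om)" for m om
 have alM: "s.acc_loss A lossk k m : borel_measurable ?M" if k: "k : {1..K}" for k m
 proof -
  have "{om\<in>space ?M. s.sent k t om} : sets ?M" for t using s.sent_F[OF k] s.F_M by blast
  then have [measurable]: "Measurable.pred ?M (s.sent k t)" for t by (simp add: pred_def)
  note [measurable] = s.V_M[OF k] s.X_M[OF k] lossk_measurable[OF k]
  show ?thesis unfolding s.acc_loss_def[abs_def] by measurable
 qed
 have LM: "L m : borel_measurable ?M" for m unfolding L_def[abs_def] by (intro borel_measurable_sum alM)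
 have EL: "nn_integral ?M (%om. L n om) <= ennreal (real K * (\<delta> / g0) * (?\<Phi> * r 0 + N))"
 proof -
  have "nn_integral ?M (%om. L n om) = (SUM k=1..K. nn_integral ?M (%om. s.acc_loss A lossk k n om))"
   unfolding L_def by (rule nn_integral_sum) (rule alM)
  also have "... <= (SUM k=1..K. ennreal (\<delta> / g0) * (ennreal ?\<Phi> * emeasure ?M (A tau) + (SUM i<n. emeasure ?M (A (tau + i)))))"
  proof (rule sum_mono)
   fix k assume k: "k : {1..K}"
   show "nn_integral ?M (%om. s.acc_loss A lossk k n om) <= ennreal (\<delta> / g0) * (ennreal ?\<Phi> * emeasure ?M (A tau) + (SUM i<n. emeasure ?M (A (tau + i))))"
   proof (rule s.acc_loss_mean_le[where A = A and f = lossk, OF k A Adec lossk_measurable[OF k]])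
    show "green (tilt (step_law k)) (s.S k) (%_. 1) v <= ennreal ?\<Phi>" if "v : s.S k" for v
    unfolding steps_def using w(2)[OF k] that n0 by (intro llr_law.sojourn_le[OF llr_law_step[OF k], of _ "up k" _ w]) auto
    have "exit_mean (tilt (step_law k)) (s.S k) (lossk k) 0 <= ennreal (\<delta> / g0) * ennreal g0"
    using \<delta>(2)[OF k] \<delta>(1) g0(1) by (simp add: ennreal_mult[symmetric])
    also have "... <= ennreal (\<delta> / g0) * green (tilt (step_law k)) (s.S k) (%_. 1) 0" by (intro mult_left_mono g0(2) k) simp
    finally show "exit_mean (tilt (step_law k)) (s.S k) (lossk k) 0 <= ennreal (\<delta> / g0) * green (tilt (step_law k)) (s.S k) (%_. 1) 0" .
   qed
  qed
  also have "ennreal ?\<Phi> * emeasure ?M (A tau) + (SUM i<n. emeasure ?M (A (tau + i))) = ennreal (?\<Phi> * r 0 + N)"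
  proof -
   have "0 <= ?\<Phi>" using st0 rho by simp
   then have "ennreal ?\<Phi> * emeasure ?M (A tau) = ennreal (?\<Phi> * r 0)" by (simp add: r_def s.emeasure_eq_measure ennreal_mult)
   moreover have "(SUM i<n. emeasure ?M (A (tau + i))) = ennreal N" by (simp add: N_def r_def s.emeasure_eq_measure)
   ultimately show ?thesis using \<open>0 <= ?\<Phi>\<close> nn by simp
  qed
  also have "(SUM k=1..K. ennreal (\<delta> / g0) * ennreal (?\<Phi> * r 0 + N)) = ennreal (real K * (\<delta> / g0) * (?\<Phi> * r 0 + N))"
  proof -
   have "0 <= ?\<Phi> * r 0 + N" using st0 rho nn by (intro add_nonneg_nonneg mult_nonneg_nonneg) auto
   then show ?thesis using \<delta>(1) g0(1)
    by (simp add: ennreal_mult[symmetric] ennreal_of_nat_eq_real_of_nat mult.assoc del: ennreal_plus times_divide_eq_left times_divide_eq_right)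
  qed
  finally show ?thesis .
 qed
 have 3: "c0 * r3 <= real K * (\<delta> / g0) * (?\<Phi> * r 0 + N) + c0 * r 0 + (c0 - info / 2) * r3"
 proof -
  have alive: "ennreal (s.Z (tau + m) om - c) <= L m om" if "om : A (tau + m)" "s.all_sent (tau + m) om" for m om
  proof -
   have w: "om : Omega" using that(1) AM[of "tau + m", THEN sets.sets_into_space] space_P[of "enat tau"] by blast
   show ?thesis unfolding c_def L_def
    by (rule path_loss[OF w Adec _ that(1) s.sensor_walk_axioms]) (use w space_P[of "enat tau"] in \<open>auto simp: A_def\<close>)
  qed
  have mono: "L m om <= L (Suc m) om" for m om unfolding L_def by (intro sum_mono) (simp add: s.acc_loss_def)
  have "ennreal c0 * ennreal r3 <= nn_integral ?M (%om. L n om) + ennreal c0 * ennreal (r 0) + nn_integral (tilt tot) (%x. ennreal (c0 - x)) * ennreal r3"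
   using s.reached_sum_le[where A = A and c = c and ?c0.0 = c0 and L = L and n = n, OF A Adec c(1) less_imp_le[OF c0(1)] alive LM mono]
   unfolding tl by (simp add: r3_def r_def B3_def s.emeasure_eq_measure)
  also have "... <= ennreal (real K * (\<delta> / g0) * (?\<Phi> * r 0 + N)) + ennreal c0 * ennreal (r 0) + ennreal (c0 - info / 2) * ennreal r3"
   using EL c0(3) by (intro add_mono mult_right_mono) auto
  also have "... = ennreal (real K * (\<delta> / g0) * (?\<Phi> * r 0 + N) + c0 * r 0 + (c0 - info / 2) * r3)"
  proof -
   have "0 <= real K * (\<delta> / g0) * (?\<Phi> * r 0 + N)" using st0 rho nn \<delta>(1) g0(1) by (intro add_nonneg_nonneg mult_nonneg_nonneg) auto
   then show ?thesis using nn c0 by (simp add: ennreal_mult ennreal_plus)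
  qed
  finally have "ennreal (c0 * r3) <= ennreal (real K * (\<delta> / g0) * (?\<Phi> * r 0 + N) + c0 * r 0 + (c0 - info / 2) * r3)"
   using nn c0 by (simp add: ennreal_mult)
  moreover have "0 <= real K * (\<delta> / g0) * (?\<Phi> * r 0 + N) + c0 * r 0 + (c0 - info / 2) * r3"
   using st0 rho nn \<delta>(1) g0(1) c0 by (intro add_nonneg_nonneg mult_nonneg_nonneg) auto
  ultimately show ?thesis by (simp add: ennreal_le_iff)
 qed
 let ?y = "2 * \<delta> / (a * g0)"
 have y: "0 <= ?y" "?y <= 1/2" using \<delta>(1) g0(1) a0 half by (auto simp: pos_divide_le_eq)
 have yI: "2 * (real K * (\<delta> / g0)) <= ?y * info"
 proof -
  have "2 * (real K * (\<delta> / g0)) = ?y * (real K * a)" using a0 g0 by (simp add: field_simps)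
  also have "... <= ?y * info" using I y by (intro mult_left_mono)
  finally show ?thesis .
 qed
 define G where "G = (nu + rest w g0 \<delta> c0) * r 0"
 have "info * N <= info * (r1 + r2 + r3)" using split I0 by simp
 also have "... <= info * (?T1 * r 0) + (c + tot_overshoot) * r 0 + 2 * (real K * (\<delta> / g0) * (?\<Phi> * r 0 + N) + c0 * r 0)"
 proof -
  have "info * r1 <= info * (?T1 * r 0)" using 1 I0 by (intro mult_left_mono) auto
  moreover have "info * r3 <= 2 * (real K * (\<delta> / g0) * (?\<Phi> * r 0 + N) + c0 * r 0)" using 3 by (simp add: left_diff_distrib)
  ultimately show ?thesis using 2 by (simp add: distrib_left)
 qed
 also have "... <= G + 2 * (real K * (\<delta> / g0)) * N"
 proof -
  have "c * r 0 <= (nu + real K * w) * r 0" using c nn by (intro mult_right_mono)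
  then show ?thesis unfolding G_def rest_def by (simp add: algebra_simps)
 qed
 also have "... <= G + ?y * info * N" using yI nn by (intro add_left_mono mult_right_mono)
 finally have "(1 - ?y) * (info * N) <= G" by (simp add: algebra_simps)
 moreover have "0 <= G"
  unfolding G_def rest_def using nu w ov I0 st0 rho \<delta>(1) g0(1) c0 nn
  by (intro mult_nonneg_nonneg add_nonneg_nonneg) auto
 ultimately have "info * N <= (1 + 2 * ?y) * G" using y by (intro sum_weak_bound)
 then show ?thesis by (simp add: N_def r_def G_def A_def)
qed

lemma detection_delay_le:
 assumes C: "0 <= C" and bound: "!!tau B n. B : sets (joint tau) ==>
   info * (SUM i<n. measure (P (enat tau)) (R nu (tau + i) Int B)) <= C * measure (P (enat tau)) (R nu tau Int B)"
 shows "detection_delay K P \<xi> u (dcusum K P u lo up d el eu nu) <= ereal C"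
 unfolding detection_delay_def
proof (rule SUP_least)
 fix tau :: nat
 let ?M = "P (enat tau)" and ?T = "dcusum K P u lo up d el eu nu"
 let ?f = "%om. (stopped (sensor_sum K u om) (?T om) - sensor_sum K u om tau) * of_bool (enat tau < ?T om)"
 interpret s: sensor_walk ?M joint K "%k. tilt (step_law k)" incr tau lo up V by (rule sensor_walk_post)
 interpret T: llr_law tot "real K * a" "(real K)^2 * b" by (rule llr_law_tot)
 have tl: "s.total_law = tilt tot" by (rule total_post)
 have I0: "0 < info" using T.mean_0 T.a_pos by (simp add: info_def)
 have sp: "space ?M = Omega" by (rule space_P)
 have RT: "{om\<in>space ?M. enat t < ?T om} = R nu t" for t
  unfolding sp less_dcusum ut_def[abs_def] by simp
 have part: "(SUM i<n. measure ?M (R nu (tau + i) Int B)) <= C * measure ?M B / info" if B: "B : sets (joint tau)" for n B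
 proof -
  have BM: "B : sets ?M" using B joint_subset_P by blast
  have "info * (SUM i<n. measure ?M (R nu (tau + i) Int B)) <= C * measure ?M (R nu tau Int B)" by (rule bound[OF B])
  also have "... <= C * measure ?M B" by (intro mult_left_mono s.finite_measure_mono C BM) auto
  finally show ?thesis using I0 by (simp add: pos_le_divide_eq mult.commute)
 qed
 have top: "Omega : sets (joint tau)" using sets.top[of "joint tau"] by simp
 have fin: "(\<Sum>n. emeasure ?M {om\<in>space ?M. enat (tau + n) < ?T om}) < \<infinity>"
 proof -
  have e: "emeasure ?M {om\<in>space ?M. enat (tau + n) < ?T om} = ennreal (measure ?M (R nu (tau + n) Int Omega))" for n
   unfolding RT s.emeasure_eq_measure by (simp add: Int_absorb2)
  have "(\<Sum>n. emeasure ?M {om\<in>space ?M. enat (tau + n) < ?T om}) <= ennreal (C * measure ?M Omega / info)"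
   unfolding e
  proof (intro suminf_le_const summableI)
   fix n
   show "(SUM i<n. ennreal (measure ?M (R nu (tau + i) Int Omega))) <= ennreal (C * measure ?M Omega / info)"
    using part[OF top, of n] by (subst sum_ennreal) (auto intro!: ennreal_leI)
  qed
  also have "... < \<infinity>" using ennreal_less_top by (simp only: infinity_ennreal_def)
  finally show ?thesis .
 qed
 have U: "sensor_sum K u om (Suc t) = sensor_sum K u om t + s.Xs t om" for t om
  unfolding sensor_sum_def s.Xs_def incr_def sum_subtractf by simp
 have Um: "(%om. sensor_sum K u om tau) : borel_measurable ?M" unfolding sensor_sum_def by (rule sum_u_P)
 have TF: "{om\<in>space ?M. enat t < ?T om} : sets (joint t)" for t unfolding RT by (rule R_joint)
 note w = s.wald_stopped[where U = "%t om. sensor_sum K u om t" and T = ?T, OF U Um TF _ fin, unfolded tl, OF _ T.int_0, unfolded RT]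
 define g where "g = ?f"
 have ig: "integrable ?M (%om. indicator B om * g om)"
  and eg: "(\<integral>om. indicator B om * g om \<partial>?M) = info * (\<Sum>n. measure ?M (R nu (tau + n) Int B))"
  if "B : sets (joint tau)" for B
  unfolding g_def info_def by (rule w(1)[OF that], rule w(2)[OF that])
 have "integrable ?M (%om. indicator Omega om * g om) = integrable ?M g"
 proof (rule Bochner_Integration.integrable_cong[OF refl])
  fix om assume "om : space ?M"
  then have "om : Omega" unfolding sp .
  then show "indicator Omega om * g om = g om" by (simp only: indicator_simps mult_1)
 qed
 then have "integrable ?M g" using ig[OF top] by blast
 then have "esssup ?M (%om. ereal (real_cond_exp ?M (joint tau) g om)) <= ereal C"
 proof (rule s.esssup_cond_exp_le[OF s.subalg])
  fix B assume B: "B : sets (joint tau)"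
  have "(\<integral>om. indicator B om * g om \<partial>?M) = info * (\<Sum>n. measure ?M (R nu (tau + n) Int B))" by (rule eg[OF B])
  also have "... <= info * (C * measure ?M B / info)"
   using I0 by (intro mult_left_mono suminf_le_const w(3)[OF B] part[OF B]) simp
  finally show "(\<integral>om. indicator B om * g om \<partial>?M) <= C * measure ?M B" using I0 by simp
 qed
 then show "esssup ?M (%om. ereal (real_cond_exp ?M (joint tau) ?f om)) <= ereal C" unfolding g_def .
qed

end

section \<open>The centralized procedure\<close>

context llr_system begin

lemma sum_Suc: "sensor_sum K u om (Suc t) = sensor_sum K u om t + (SUM k=1..K. incr k t om)"
 unfolding sensor_sum_def incr_def sum_subtractf by simp

lemma sum_0: "om : Omega ==> sensor_sum K u om 0 = 0"
 by (simp add: sensor_sum_def u_0)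

lemma sum_joint: "(%om. sensor_sum K u om t) : borel_measurable (joint t)"
 unfolding sensor_sum_def by (rule sum_u_joint) simp

abbreviation A :: "real => nat => 'a set" where "A nu t \<equiv> {om\<in>Omega. running (sensor_sum K u om) nu t}"

lemma A_joint: "A nu t : sets (joint t)"
 using running_joint[of "%t om. sensor_sum K u om t", OF sum_joint] by simp

text \<open>
 The phase of a single walk with the thresholds \<open>1\<close> and \<open>nu\<close> renews at
 its lower exits, and an upper exit raises an alarm.  The potential adds the mean time in a cycle
 to the mean total time \<open>w0\<close> after a renewal.
\<close>

lemma cusum_sum_le:
 obtains c where "0 < c" "!!nu. 0 < nu ==> (\<Sum>n. emeasure Pre (A nu n)) <= ennreal (c * exp nu)"
proof -
 interpret w: filtered_walk "Pre" joint K step_law incr 0 by (rule filtered_walk_inf)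
 interpret T: llr_law tot "real K * a" "(real K)^2 * b" by (rule llr_law_tot)
 obtain c where c: "0 < c" "!!lo up v. - lo <= v ==> v < up ==>
   ennreal (c * exp (v - up)) <= exit_mean tot {-lo<..<up} (indicator {up..}) v"
  by (rule T.exit_up_ge) blast
 define K0 where "K0 = exp ((0 + 1) / 2) / (1 - T.half_rate)"
 have K0: "0 < K0" using T.half_rate by (simp add: K0_def)
 have "(\<Sum>n. emeasure Pre (A nu n)) <= ennreal (K0 / c * exp nu)" if nu: "0 < nu" for nu
 proof -
  let ?S = "{-1<..<nu}"
  define w0 where "w0 = K0 / c * exp nu"
  have w0: "0 < w0" using K0 c by (simp add: w0_def)
  define G where "G = green tot ?S (%_. 1)"
  define h where "h = exit_mean tot ?S (indicator {..-1})"
  define g where "g v = G v + ennreal w0 * h v" for v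
  define f where "f w = (if w : ?S then g w else ennreal w0 * indicator {..-1} w)" for w
  have [measurable]: "G : borel_measurable borel" "h : borel_measurable borel" unfolding G_def h_def by simp_all
  have gm [measurable]: "g : borel_measurable borel" unfolding g_def by measurable
  have fm [measurable]: "f : borel_measurable borel" unfolding f_def by measurable
  have f_mean: "nn_integral tot (%x. f (v + x)) + 1 = g v" for v
  proof -
   have "nn_integral tot (%x. f (v + x)) = kill tot (- ?S) (%w. ennreal w0 * indicator {..-1} w) v + kill tot ?S g v"
    unfolding f_def by (rule T.kill_compl[symmetric]) auto
   also have "kill tot (- ?S) (%w. ennreal w0 * indicator {..-1} w) v = ennreal w0 * kill tot (- ?S) (indicator {..-1}) v"
    by (rule T.kill_cmult) auto
   also have "kill tot ?S g v = kill tot ?S G v + ennreal w0 * kill tot ?S h v"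
    unfolding g_def by (subst T.kill_add) (auto simp: T.kill_cmult)
   finally have "nn_integral tot (%x. f (v + x)) + 1 = (1 + kill tot ?S G v) + ennreal w0 * (kill tot (- ?S) (indicator {..-1}) v + kill tot ?S h v)"
    by (simp add: distrib_left ac_simps)
   also have "1 + kill tot ?S G v = G v" unfolding G_def by (rule T.green_unfold[symmetric]) auto
   also have "kill tot (- ?S) (indicator {..-1}) v + kill tot ?S h v = h v"
    unfolding h_def by (rule T.exit_mean_unfold[symmetric]) auto
   finally show ?thesis by (simp add: g_def)
  qed
  have g0: "g 0 <= ennreal w0"
  proof -
   have 1: "G 0 <= ennreal K0"
    unfolding G_def K0_def by (rule T.inf_sojourn_le) auto
   have "h 0 + exit_mean tot ?S (indicator {nu..}) 0 = exit_mean tot ?S (%w. indicator {..-1} w + indicator {nu..} w) 0"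
    unfolding h_def by (rule T.exit_mean_add[symmetric]) auto
   also have "... <= exit_mean tot ?S (%_. 1) 0"
    using nu by (intro T.exit_mean_mono) (auto simp: indicator_def)
   also have "... <= 1" by (rule T.exit_mean_one_le) auto
   finally have "h 0 + ennreal (c * exp (0 - nu)) <= 1"
    using c(2)[of 1 0 nu] nu by (meson add_left_mono order_trans le_minus_one_simps(1) zero_less_one less_imp_le neg_le_0_iff_le)
   then have "ennreal w0 * (h 0 + ennreal (c * exp (0 - nu))) <= ennreal w0 * 1" by (rule mult_left_mono) simp
   moreover have "ennreal w0 * ennreal (c * exp (0 - nu)) = ennreal K0"
   proof -
    have "w0 * (c * exp (0 - nu)) = K0" using c(1) by (simp add: w0_def exp_minus field_simps)
    then show ?thesis using w0 c(1) by (simp add: ennreal_mult[symmetric])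
   qed
   ultimately have "ennreal w0 * h 0 + ennreal K0 <= ennreal w0" by (simp add: distrib_left)
   then show ?thesis using 1 unfolding g_def by (metis add.commute add_left_mono order_trans)
  qed
  define V where "V t om = phase 1 nu (sensor_sum K u om) t" for t om
  have VS: "V (Suc t) om = renew 1 nu (V t om + w.Xs t om)" for t om
   by (simp add: V_def sum_Suc w.Xs_def)
  have VF: "V t : borel_measurable (joint t)" for t
  proof (induction t)
   case 0
   show ?case by (simp add: V_def[abs_def])
  next
   case (Suc t)
   have [measurable]: "V t : borel_measurable (joint (Suc t))" "w.Xs t : borel_measurable (joint (Suc t))"
    by (rule w.measurable_F_mono[OF _ Suc], simp) (rule w.Xs_F[OF lessI])
   show ?case unfolding VS[abs_def] by measurable
  qed
  have Vinv: "EX s<=t. V t om = sensor_sum K u om t - sensor_sum K u om s" for t om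
  proof (induction t)
   case (Suc t)
   then obtain s where s: "s <= t" "V t om = sensor_sum K u om t - sensor_sum K u om s" by blast
   show ?case
   proof (cases "V t om + w.Xs t om : ?S")
    case True
    then have "V (Suc t) om = V t om + w.Xs t om" by (simp only: VS renew_def if_True)
    then show ?thesis using s by (intro exI[of _ s]) (simp add: sum_Suc w.Xs_def)
   next
    case False
    then have "V (Suc t) om = 0" by (simp only: VS renew_def if_False)
    then show ?thesis by (intro exI[of _ "Suc t"]) simp
   qed
  qed (simp add: V_def)
  have AM [measurable]: "A nu t : sets Pre" for t using A_joint joint_subset_P by blast
  have VM [measurable]: "V t : borel_measurable Pre" "w.Xs t : borel_measurable Pre" for t
   by (rule w.measurable_F_M[OF VF]) (rule w.Xs_M)
  define Y where "Y n = nn_integral Pre (%om. indicator (A nu n) om * g (V n om))" for n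
  have step: "Y (Suc n) + emeasure Pre (A nu n) <= Y n" for n
  proof -
   have "Y (Suc n) <= nn_integral Pre (%om. indicator (A nu n) om * f (V n om + w.Xs n om))"
    unfolding Y_def
   proof (rule nn_integral_mono)
    fix om
    show "indicator (A nu (Suc n)) om * g (V (Suc n) om) <= indicator (A nu n) om * f (V n om + w.Xs n om)"
    proof (cases "om : A nu (Suc n)")
    case False
    then show ?thesis by simp
    next
    case in1: True
    then have in0: "om : A nu n" using running_Suc by blast
    have "g (V (Suc n) om) <= f (V n om + w.Xs n om)"
    proof (cases "V n om + w.Xs n om : ?S")
    case True
    then show ?thesis by (simp only: VS renew_def f_def if_True)
    next
    case False
    obtain s where s: "s <= n" "V n om = sensor_sum K u om n - sensor_sum K u om s" using Vinv by blast
    have "sensor_sum K u om (Suc n) - sensor_sum K u om s < nu" using in1 s(1) by (simp add: running_def)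
    then have "V n om + w.Xs n om < nu" using s(2) by (simp add: sum_Suc w.Xs_def)
    then have "V n om + w.Xs n om : {..-1}" using False by auto
    then have "f (V n om + w.Xs n om) = ennreal w0" using False by (simp only: f_def if_False indicator_simps mult_1_right)
    moreover have "V (Suc n) om = 0" using False by (simp only: VS renew_def if_False)
    ultimately show ?thesis using g0 by simp
    qed
    then show ?thesis using in0 in1 by simp
    qed
   qed
   also have "... = nn_integral Pre (%om. indicator (A nu n) om * (nn_integral tot (%x. f (V n om + x))))"
    unfolding total_inf[symmetric] by (rule w.sum_step) (use A_joint VF in auto)
   finally have "Y (Suc n) + emeasure Pre (A nu n) <= nn_integral Pre (%om. indicator (A nu n) om * (nn_integral tot (%x. f (V n om + x)))) + nn_integral Pre (%om. indicator (A nu n) om)"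
    by (simp add: add_right_mono)
   also have "... = nn_integral Pre (%om. indicator (A nu n) om * (nn_integral tot (%x. f (V n om + x))) + indicator (A nu n) om)"
   proof (rule nn_integral_add[symmetric])
    have "(%v. nn_integral tot (%x. f (v + x))) : borel_measurable borel"
    by (rule sigma_finite_measure.borel_measurable_nn_integral[OF T.sigma_finite_measure_axioms]) (simp add: measurable_cong_sets[OF sets_pair_measure_cong[OF refl T.sets_law] refl], measurable)
    from measurable_compose[OF VM(1) this]
    have [measurable]: "(%om. nn_integral tot (%x. f (V n om + x))) : borel_measurable Pre" .
    show "(%om. indicator (A nu n) om * nn_integral tot (%x. f (V n om + x))) : borel_measurable Pre" by measurable
   qed measurable
   also have "... = Y n" unfolding Y_def by (intro nn_integral_cong) (simp add: f_mean[symmetric] distrib_left)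
   finally show ?thesis .
  qed
  have part: "Y n + (SUM i<n. emeasure Pre (A nu i)) <= Y 0" for n
  proof (induction n)
   case (Suc n)
   have "Y (Suc n) + (SUM i<Suc n. emeasure Pre (A nu i)) = (Y (Suc n) + emeasure Pre (A nu n)) + (SUM i<n. emeasure Pre (A nu i))"
    by (simp add: ac_simps)
   also have "... <= Y n + (SUM i<n. emeasure Pre (A nu i))" by (intro add_right_mono step)
   also have "... <= Y 0" by (rule Suc.IH)
   finally show ?case .
  qed simp
  have "Y 0 <= nn_integral Pre (%om. ennreal w0)"
   unfolding Y_def using g0 by (intro nn_integral_mono) (simp add: V_def indicator_def)
  then have Y0: "Y 0 <= ennreal w0" by (simp add: w.emeasure_space_1)
  show ?thesis unfolding w0_def[symmetric]
  proof (intro suminf_le_const summableI)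
   fix n
   have "(SUM i<n. emeasure Pre (A nu i)) <= Y n + (SUM i<n. emeasure Pre (A nu i))" by simp
   also note part
   also note Y0
   finally show "(SUM i<n. emeasure Pre (A nu i)) <= ennreal w0" .
  qed
 qed
 then show thesis using K0 c(1) that[of "K0 / c"] by simp
qed

lemma info_inf_ge: "a <= - (\<integral>x. x \<partial>tot)"
proof -
 interpret T: llr_law tot "real K * a" "(real K)^2 * b" by (rule llr_law_tot)
 have "1 * a <= real K * a" using K_pos a0 by (intro mult_right_mono) auto
 then show ?thesis using T.mean_inf by linarith
qed

text \<open>Wald's identity for a stopping time of finite mean, before the change.\<close>

lemma mean_stopped_inf:
 assumes T: "!!t. {om\<in>Omega. enat t < T om} = R t" "!!t. R t : sets (joint t)" and fin: "(\<Sum>n. emeasure Pre (R n)) < \<infinity>"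
 shows "(\<integral>om. - stopped (sensor_sum K u om) (T om) \<partial>Pre) = - (\<integral>x. x \<partial>tot) * (\<Sum>n. measure Pre (R n))"
  and "summable (%n. measure Pre (R n))"
proof -
 interpret w: filtered_walk "Pre" joint K step_law incr 0 by (rule filtered_walk_inf)
 interpret T: llr_law tot "real K * a" "(real K)^2 * b" by (rule llr_law_tot)
 have U: "sensor_sum K u om (Suc t) = sensor_sum K u om t + w.Xs t om" for t om by (simp add: sum_Suc w.Xs_def)
 have Um: "(%om. sensor_sum K u om 0) : borel_measurable Pre" by (rule w.measurable_F_M[OF sum_joint])
 have TF: "{om\<in>Omega. enat t < T om} : sets (joint t)" for t using T by simp
 have fin': "(\<Sum>n. emeasure Pre {om\<in>Omega. enat (0 + n) < T om}) < \<infinity>" using fin T(1) by simp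
 have int: "integrable w.total_law (%x. x)" using T.int_inf total_inf by simp
 have top: "Omega : sets (joint 0)" using sets.top[of "joint 0"] by simp
 have RO: "R n Int Omega = R n" for n using T(1)[of n] by auto
 note ws = w.wald_stopped[where U = "%t om. sensor_sum K u om t" and T = T, OF U Um TF top fin' int, unfolded T(1) total_inf, simplified add_0 RO]
 show "summable (%n. measure Pre (R n))" by (rule ws(3))
 have e: "- stopped (sensor_sum K u om) (T om) = - (indicator Omega om * ((stopped (%t. sensor_sum K u om t) (T om) - sensor_sum K u om 0) * of_bool (enat 0 < T om)))"
  if "om : Omega" for om
 proof (cases "enat 0 < T om")
  case True
  then show ?thesis using that by (simp add: sum_0)
 next
  case False
  then have "T om = enat 0" by (simp add: zero_enat_def[symmetric])
  then show ?thesis using that by (simp add: stopped_def sum_0)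
 qed
 have "(\<integral>om. - stopped (sensor_sum K u om) (T om) \<partial>Pre)
   = (\<integral>om. - (indicator Omega om * ((stopped (%t. sensor_sum K u om t) (T om) - sensor_sum K u om 0) * of_bool (enat 0 < T om))) \<partial>Pre)"
  by (rule Bochner_Integration.integral_cong[OF refl e])
 also have "... = - (\<integral>om. indicator Omega om * ((stopped (%t. sensor_sum K u om t) (T om) - sensor_sum K u om 0) * of_bool (enat 0 < T om)) \<partial>Pre)"
  by (rule Bochner_Integration.integral_minus)
 also note ws(2)
 finally show "(\<integral>om. - stopped (sensor_sum K u om) (T om) \<partial>Pre) = - (\<integral>x. x \<partial>tot) * (\<Sum>n. measure Pre (R n))" by simp
qed

lemma threshold_pos:
 assumes g: "(\<integral>om. - stopped (sensor_sum K u om) (T om) \<partial>Pre) = gam" "0 < gam" shows "EX om:Omega. T om ~= enat 0"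
proof (rule ccontr)
 assume "~ ?thesis"
 then have "(\<integral>om. - stopped (sensor_sum K u om) (T om) \<partial>Pre) = (\<integral>om. 0 \<partial>Pre)"
  by (intro Bochner_Integration.integral_cong) (auto simp: stopped_def sum_0)
 then show False using g by simp
qed

lemma cusum_threshold_ge:
 obtains c where "!!nu gam. (\<integral>om. - stopped (sensor_sum K u om) (cusum K u nu om) \<partial>Pre) = gam ==> 0 < gam ==> 0 < nu & ln gam <= nu + c"
proof -
 interpret T: llr_law tot "real K * a" "(real K)^2 * b" by (rule llr_law_tot)
 interpret p: prob_space "Pre" by (rule prob_P)
 obtain c where c: "0 < c" "!!nu. 0 < nu ==> (\<Sum>n. emeasure Pre (A nu n)) <= ennreal (c * exp nu)"
  by (rule cusum_sum_le) blast
 define I where "I = - (\<integral>x. x \<partial>tot)"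
 have I: "0 < I" using T.mean_inf T.a_pos unfolding I_def by linarith
 show thesis
 proof (rule that)
  fix nu gam :: real
  assume g: "(\<integral>om. - stopped (sensor_sum K u om) (cusum K u nu om) \<partial>Pre) = gam" "0 < gam"
  have nu: "0 < nu"
  proof (rule ccontr)
   assume "~ 0 < nu"
   then have "cusum K u nu om = enat 0" for om
    unfolding cusum_def first_time_eq_enat by (simp add: cusum_stat_def)
   then show False using threshold_pos[OF g] by auto
  qed
  have R: "{om\<in>Omega. enat t < cusum K u nu om} = A nu t" for t unfolding less_cusum[OF nu] by (rule refl)
  have fin: "(\<Sum>n. emeasure Pre (A nu n)) < \<infinity>"
   using c(2)[OF nu] by (rule le_less_trans) simp
  note m = mean_stopped_inf[OF R A_joint fin]
  have "(\<Sum>n. ennreal (measure Pre (A nu n))) = ennreal (\<Sum>n. measure Pre (A nu n))"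
   by (rule suminf_ennreal2[OF measure_nonneg m(2)])
  then have "ennreal (\<Sum>n. measure Pre (A nu n)) <= ennreal (c * exp nu)"
   using c(2)[OF nu] by (simp add: p.emeasure_eq_measure)
  then have "(\<Sum>n. measure Pre (A nu n)) <= c * exp nu" using c(1) by (simp add: ennreal_le_iff)
  then have le: "I * (\<Sum>n. measure Pre (A nu n)) <= I * (c * exp nu)" using I by (intro mult_left_mono) simp_all
  have "gam = I * (\<Sum>n. measure Pre (A nu n))" using g(1) m(1) unfolding I_def by (rule trans[OF sym])
  also note le
  finally have "gam <= I * (c * exp nu)" .
  then have "ln gam <= ln (I * c * exp nu)" using g(2) by (simp add: mult.assoc)
  also have "... = nu + ln (I * c)" using I c(1) ln_mult_pos[of "I * c" "exp nu"] by simp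
  finally show "0 < nu & ln gam <= nu + ln (I * c)" using nu by simp
 qed
qed

text \<open>After an immediate change, the alarm is at least \<open>\<nu>\<close> above the minimum of the walk.\<close>

lemma cusum_delay_ge:
 obtains c where "!!nu. 0 < nu ==> ereal (nu - c) <= detection_delay K P \<xi> u (cusum K u nu)"
proof -
 let ?M = "P (enat 0)"
 interpret w: filtered_walk ?M joint K "%k. tilt (step_law k)" incr 0 by (rule filtered_walk_post)
 interpret T: llr_law tot "real K * a" "(real K)^2 * b" by (rule llr_law_tot)
 have tl: "w.total_law = tilt tot" by (rule total_post)
 let ?U = "%t om. sensor_sum K u om t"
 define l where "l = T.lam"
 define r where "r = T.rho"
 have l: "0 < l" using T.lam_pos by (simp add: l_def)
 have r: "0 <= r" "r < 1" using T.rho_bounds by (simp_all add: r_def)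
 have sp: "space ?M = Omega" by (rule space_P)
 have US: "?U (Suc t) om = ?U t om + w.Xs t om" for t om by (simp add: sum_Suc w.Xs_def)
 have UM: "?U t : borel_measurable ?M" for t by (rule w.measurable_F_M[OF sum_joint])
 note [measurable] = UM
 have lap: "nn_integral ?M (%om. ennreal (exp (- l * ?U n om))) <= ennreal (r ^ n)" for n
 proof (induction n)
  case 0
  have "nn_integral ?M (%om. ennreal (exp (- l * ?U 0 om))) = nn_integral ?M (%om. 1)"
   by (intro nn_integral_cong) (simp add: sp sum_0)
  then show ?case by (simp add: w.emeasure_space_1)
 next
  case (Suc n)
  have "nn_integral ?M (%om. ennreal (exp (- l * ?U (Suc n) om))) = nn_integral ?M (%om. 1 * ennreal (exp (- l * (?U n om + w.Xs n om))))"
   by (simp only: US mult_1)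
  also have "... = nn_integral ?M (%om. 1 * (nn_integral w.total_law (%x. ennreal (exp (- l * (?U n om + x))))))"
   by (rule w.sum_step[where f = "%z. ennreal (exp (- l * z))"]) (use sum_joint in auto)
  also have "... <= nn_integral ?M (%om. ennreal (exp (- l * ?U n om)) * ennreal r)"
  proof (rule nn_integral_mono)
   fix om
   have "nn_integral (tilt tot) (%x. ennreal (exp (- l * (?U n om + x)))) = nn_integral (tilt tot) (%x. ennreal (exp (- l * ?U n om)) * ennreal (exp (- l * x)))"
    by (intro nn_integral_cong) (simp add: ennreal_mult[symmetric] exp_add[symmetric] distrib_left)
   also have "... = ennreal (exp (- l * ?U n om)) * nn_integral (tilt tot) (%x. ennreal (exp (- l * x)))"
    by (rule nn_integral_cmult) simp
   also have "... <= ennreal (exp (- l * ?U n om)) * ennreal r"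
    unfolding l_def r_def by (intro mult_left_mono T.laplace) simp
   finally show "1 * nn_integral w.total_law (%x. ennreal (exp (- l * (?U n om + x)))) <= ennreal (exp (- l * ?U n om)) * ennreal r"
    by (simp add: tl)
  qed
  also have "... = nn_integral ?M (%om. ennreal (exp (- l * ?U n om))) * ennreal r" by (rule nn_integral_multc) measurable
  also have "... <= ennreal (r ^ n) * ennreal r" using Suc by (rule mult_right_mono) simp
  finally show ?case using r by (simp add: ennreal_mult[symmetric] mult.commute)
 qed
 have geo: "(\<Sum>n. ennreal (c * r ^ n)) = ennreal (c / (1 - r))" if "0 <= c" for c
 proof -
  have "(%n. c * r ^ n) sums (c * (1 / (1 - r)))" using r by (intro sums_mult geometric_sums) auto
  then show ?thesis using r that by (subst suminf_ennreal_eq[of "%n. c * r ^ n"]) auto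
 qed
 define C where "C = 1 / l / (1 - r)"
 have gm: "nn_integral ?M (%om. (\<Sum>n. ennreal (exp (- l * ?U n om) / l))) <= ennreal C"
 proof -
  have "nn_integral ?M (%om. (\<Sum>n. ennreal (exp (- l * ?U n om) / l))) = (\<Sum>n. nn_integral ?M (%om. ennreal (exp (- l * ?U n om) / l)))"
   by (rule nn_integral_suminf) measurable
  also have "... <= (\<Sum>n. ennreal (1 / l * r ^ n))"
  proof (intro suminf_le summableI)
   fix n
   have "nn_integral ?M (%om. ennreal (exp (- l * ?U n om) / l)) = nn_integral ?M (%om. ennreal (1 / l) * ennreal (exp (- l * ?U n om)))"
    using l by (intro nn_integral_cong) (simp add: ennreal_mult[symmetric])
   also have "... = ennreal (1 / l) * nn_integral ?M (%om. ennreal (exp (- l * ?U n om)))" by (rule nn_integral_cmult) measurable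
   also have "... <= ennreal (1 / l) * ennreal (r ^ n)" by (intro mult_left_mono lap) simp
   finally show "nn_integral ?M (%om. ennreal (exp (- l * ?U n om) / l)) <= ennreal (1 / l * r ^ n)" using l r by (simp add: ennreal_mult[symmetric])
  qed
  also have "... = ennreal C" unfolding C_def by (rule geo) (use l in simp)
  finally show ?thesis .
 qed
 show thesis
 proof (rule that)
  fix nu :: real assume nu: "0 < nu"
  let ?T = "cusum K u nu"
  have R: "{om\<in>space ?M. enat t < ?T om} = A nu t" for t unfolding sp less_cusum[OF nu] by (rule refl)
  have AM: "A nu t : sets ?M" for t using A_joint joint_subset_P by blast
  have fin: "(\<Sum>n. emeasure ?M {om\<in>space ?M. enat (0 + n) < ?T om}) < \<infinity>"
  proof -
   have em: "emeasure ?M (A nu n) <= ennreal (exp (l * nu) * r ^ n)" for n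
   proof -
    have "emeasure ?M (A nu n) = nn_integral ?M (%om. indicator (A nu n) om)" using AM by simp
    also have "... <= nn_integral ?M (%om. ennreal (exp (l * nu)) * ennreal (exp (- l * ?U n om)))"
    proof (rule nn_integral_mono)
    fix om
    show "indicator (A nu n) om <= ennreal (exp (l * nu)) * ennreal (exp (- l * ?U n om))"
    proof (cases "om : A nu n")
    case True
    then have "running (sensor_sum K u om) nu n" "?U 0 om = 0" using sum_0 by auto
    then have "?U n om - ?U 0 om < nu" unfolding running_def by blast
    then have "?U n om < nu" using \<open>?U 0 om = 0\<close> by simp
    then have "l * ?U n om <= l * nu" using l by simp
    then have "ennreal 1 <= ennreal (exp (l * nu + - l * ?U n om))" by (intro ennreal_leI) simp
    then show ?thesis using True by (simp only: exp_add ennreal_mult[OF exp_ge_zero exp_ge_zero] indicator_simps ennreal_1)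
    qed simp
    qed
    also have "... = ennreal (exp (l * nu)) * nn_integral ?M (%om. ennreal (exp (- l * ?U n om)))" by (rule nn_integral_cmult) measurable
    also have "... <= ennreal (exp (l * nu)) * ennreal (r ^ n)" by (intro mult_left_mono lap) simp
    finally show ?thesis using r by (simp add: ennreal_mult[symmetric])
   qed
   have "(\<Sum>n. emeasure ?M (A nu n)) <= (\<Sum>n. ennreal (exp (l * nu) * r ^ n))" by (intro suminf_le summableI em)
   also have "... < \<infinity>" by (simp add: geo)
   finally show ?thesis unfolding R by simp
  qed
  define f where "f om = (stopped (sensor_sum K u om) (?T om) - sensor_sum K u om 0) * of_bool (enat 0 < ?T om)" for om
  have TF: "{om\<in>space ?M. enat t < ?T om} : sets (joint t)" for t unfolding R by (rule A_joint)
  have int: "integrable w.total_law (%x. x)" using T.int_0 tl by simp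
  have top: "Omega : sets (joint 0)" using sets.top[of "joint 0"] by simp
  have ig: "integrable ?M (%om. indicator Omega om * f om)"
   unfolding f_def by (rule w.wald_stopped(1)[where U = "%t om. sensor_sum K u om t" and T = ?T, OF US UM TF top fin int])
  have "integrable ?M (%om. indicator Omega om * f om) = integrable ?M f"
  proof (rule Bochner_Integration.integrable_cong[OF refl])
   fix om assume "om : space ?M"
   then have "om : Omega" unfolding sp .
   then show "indicator Omega om * f om = f om" by (simp only: indicator_simps mult_1)
  qed
  then have fi: "integrable ?M f" using ig by blast
  have ae: "AE om in ?M. EX n. om \<notin> {om\<in>space ?M. enat (0 + n) < ?T om}"
   by (rule w.wald(4)[where A = "%t. {om\<in>space ?M. enat t < ?T om}", OF TF fin int])
  have low: "AE om in ?M. ennreal (nu - f om) <= (\<Sum>n. ennreal (exp (- l * ?U n om) / l))"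
   using ae
  proof (rule AE_mp, intro AE_I2 impI)
   fix om assume w: "om : space ?M" "EX n. om \<notin> {om\<in>space ?M. enat (0 + n) < ?T om}"
   then obtain n where "~ enat n < ?T om" by auto
   then obtain t where t: "?T om = enat t" by (cases "?T om") auto
   have U0: "?U 0 om = 0" using w(1) sum_0 unfolding sp by blast
   have run: "enat s < ?T om \<longleftrightarrow> running (sensor_sum K u om) nu s" for s by (rule less_cusum[OF nu])
   have "running (sensor_sum K u om) nu 0" using nu by (simp add: running_def)
   then have t0: "0 < t" using run[of 0] t by simp
   have "~ running (sensor_sum K u om) nu t" "running (sensor_sum K u om) nu (t - 1)" using run[of t] run[of "t - 1"] t t0 by auto
   then obtain s r' where s: "s <= t" "r' <= s" "~ ?U s om - ?U r' om < nu" unfolding running_def by blast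
   have "s = t"
   proof (rule ccontr)
    assume "s ~= t"
    then have "s <= t - 1" using s(1) by simp
    then show False using s(2,3) \<open>running (sensor_sum K u om) nu (t - 1)\<close> unfolding running_def by blast
   qed
   then have u: "nu <= ?U t om - ?U r' om" using s(3) by simp
   have "f om = ?U t om" using t t0 U0 by (simp add: f_def stopped_def)
   then have "nu - f om <= - ?U r' om" using u by simp
   also have "... <= exp (- l * ?U r' om) / l"
    using l exp_ge_add_one_self[of "- l * ?U r' om"] by (simp add: pos_le_divide_eq mult.commute)
   finally have "ennreal (nu - f om) <= (\<Sum>n\<in>{r'}. ennreal (exp (- l * ?U n om) / l))" by (simp add: ennreal_leI)
   also have "... <= (\<Sum>n. ennreal (exp (- l * ?U n om) / l))" by (rule sum_le_suminf) (auto intro: summableI)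
   finally show "ennreal (nu - f om) <= (\<Sum>n. ennreal (exp (- l * ?U n om) / l))" .
  qed
  have fn: "integrable ?M (%om. nu - f om)" using fi by (intro Bochner_Integration.integrable_diff w.integrable_const)
  have "(\<integral>om. nu - f om \<partial>?M) <= C"
  proof (rule integral_real_bounded)
   show "0 <= C" using l r by (simp add: C_def)
   have "nn_integral ?M (%om. ennreal (nu - f om)) <= nn_integral ?M (%om. (\<Sum>n. ennreal (exp (- l * ?U n om) / l)))" by (rule nn_integral_mono_AE[OF low])
   also note gm
   finally show "nn_integral ?M (%om. ennreal (nu - f om)) <= ennreal C" .
  qed
  moreover have "(\<integral>om. nu - f om \<partial>?M) = (\<integral>om. nu \<partial>?M) - (\<integral>om. f om \<partial>?M)"
   by (rule Bochner_Integration.integral_diff[OF w.integrable_const fi])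
  moreover have "(\<integral>om. nu \<partial>?M) = nu" by (simp add: w.prob_space)
  ultimately have "nu - C <= (\<integral>om. f om \<partial>?M)" by linarith
  also have "(\<integral>om. f om \<partial>?M) = (\<integral>om. real_cond_exp ?M (joint 0) f om \<partial>?M)"
  proof -
   interpret s: finite_measure_subalgebra ?M "joint 0" by unfold_locales (rule w.subalg)
   show ?thesis using s.real_cond_exp_int(2)[OF fi] by simp
  qed
  finally have "ereal (nu - C) <= ereal (\<integral>om. real_cond_exp ?M (joint 0) f om \<partial>?M)" by simp
  also have "... <= esssup ?M (%om. ereal (real_cond_exp ?M (joint 0) f om))"
  proof -
   interpret s: finite_measure_subalgebra ?M "joint 0" by unfold_locales (rule w.subalg)
   show ?thesis by (rule w.mean_le_esssup[OF s.real_cond_exp_int(1)[OF fi]])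
  qed
  also have "... <= detection_delay K P \<xi> u ?T"
   unfolding detection_delay_def f_def by (rule SUP_upper2[of 0]) auto
  finally show "ereal (nu - C) <= detection_delay K P \<xi> u ?T" .
 qed
qed

end

section \<open>False alarms of D-CUSUM\<close>

text \<open>
 The survival probabilities are at least one half up to a time of order \<open>1 / Z\<close>.
\<close>

lemma sum_ge_of_linear_bound:
 fixes p :: "nat => real"
 assumes p: "!!n. 0 <= p n" "summable p" "!!n. 1 - real (Suc n) * Z <= p n" and Z: "0 < Z"
 shows "1 / Z <= 4 * (\<Sum>n. p n) + 2"
proof -
 define m where "m = nat \<lfloor>1 / (2 * Z)\<rfloor>"
 have z: "0 <= 1 / (2 * Z)" using Z by simp
 have m: "real m <= 1 / (2 * Z)" "1 / (2 * Z) < real m + 1"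
  using z unfolding m_def by linarith+
 have mZ: "real m * Z <= 1/2" using m(1) Z by (simp add: field_simps)
 have "(SUM n<m. 1/2) <= (SUM n<m. p n)"
 proof (rule sum_mono)
  fix n assume "n : {..<m}"
  then have "real (Suc n) * Z <= real m * Z" using Z by (intro mult_right_mono) auto
  then show "1/2 <= p n" using p(3)[of n] mZ by linarith
 qed
 also have "... <= (\<Sum>n. p n)" using p by (intro sum_le_suminf) auto
 finally have "real m / 2 <= (\<Sum>n. p n)" by simp
 then have "2 * (1 / (2 * Z)) <= 4 * (\<Sum>n. p n) + 2" using m(2) by linarith
 then show ?thesis by simp
qed

context dcusum_system begin

text \<open>
 Sufficiently many consecutive steps in which all sensors send positive messages raise an alarm.
\<close>

lemma inf_run_finite:
 assumes nu: "0 < nu" shows "(\<Sum>n. emeasure Pre (R nu n)) < \<infinity>"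
proof -
 interpret s: sensor_walk "Pre" joint K step_law incr 0 lo up V by (rule sensor_walk_inf)
 define r where "r = nat \<lceil>nu / up 1\<rceil> + 1"
 have k1: "1 : {1..K}" using K_pos by simp
 have up1: "0 < up 1" using thr[OF k1] by simp
 have "nu / up 1 <= real r" unfolding r_def by linarith
 then have r: "nu <= real r * up 1" using up1 by (simp add: pos_divide_le_eq)
 let ?J = "%k. {lo k + up k<..<lo k + up k + 1}"
 have "(\<Sum>n. emeasure Pre (R nu (0 + n))) < \<infinity>"
 proof (rule s.run_sum_finite[where J = ?J and r = r])
  show "R nu (Suc t) <= R nu t" for t using running_Suc by blast
  show "0 < emeasure (step_law k) (?J k)" if "k : {1..K}" for k by (rule full_support[OF that]) simp
  show "om \<notin> R nu (t + r)" if w: "om : space Pre" and J: "ALL i<r. ALL k:{1..K}. incr k (t + i) om : ?J k" for t om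
  proof
   have "ut t om + real i * up 1 <= ut (t + i) om" if "i <= r" for i
    using that
   proof (induction i)
    case (Suc i)
    have k: "W k (t + i) om \<notin> {-lo k<..<up k} & up k <= qk k (W k (t + i) om)" if k: "k : {1..K}" for k
    proof -
    have "incr k (t + i) om > lo k + up k" using J Suc.prems k by auto
    moreover have "V k (t + i) om > - lo k" using V_bounds[OF k, of "t + i" om] by simp
    ultimately have "up k <= W k (t + i) om" by linarith
    then show ?thesis using quantized_sensor.q_up[OF sensor[OF k]] q_eq[OF k] by auto
    qed
    have "up 1 <= (SUM k=1..K. up k)" by (rule member_le_sum[OF k1]) (use thr in \<open>auto simp: less_imp_le\<close>)
    also have "... <= (SUM k=1..K. if W k (t + i) om : {-lo k<..<up k} then 0 else qk k (W k (t + i) om))"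
    proof (rule sum_mono)
    fix k' assume "k' : {1..K}"
    then show "up k' <= (if W k' (t + i) om : {-lo k'<..<up k'} then 0 else qk k' (W k' (t + i) om))" using k by (simp only: if_False)
    qed
    finally have "ut (t + i) om + up 1 <= ut (t + Suc i) om" using ut_Suc[OF w, of "t + i"] by simp
    then show ?case using Suc by (simp add: algebra_simps)
   qed simp
   from this[of r] have "nu <= ut (t + r) om - ut t om" using r by simp
   moreover assume "om : R nu (t + r)"
   then have "ut (t + r) om - ut t om < nu" by (simp add: running_def)
   ultimately show False by simp
  qed
 qed (use R_joint in \<open>auto simp: r_def\<close>)
 then show ?thesis by simp
qed

abbreviation S' :: "real => 'a => enat" where "S' nu \<equiv> dcusum K P u lo up d el eu nu"

lemma dcusum_threshold_pos:
 assumes g: "(\<integral>om. - stopped (sensor_sum K u om) (S' nu om) \<partial>Pre) = gam" "0 < gam" shows "0 < nu"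
proof (rule ccontr)
 assume nu: "~ 0 < nu"
 have "S' nu om = enat 0" for om
 proof -
  have "~ enat 0 < S' nu om" using nu by (simp only: less_dcusum running_def) auto
  then show ?thesis by (simp add: zero_enat_def[symmetric])
 qed
 then show False using threshold_pos[OF g] by auto
qed

lemma dcusum_mean:
 assumes nu: "0 < nu" and g: "(\<integral>om. - stopped (sensor_sum K u om) (S' nu om) \<partial>Pre) = gam"
 shows "gam = - (\<integral>x. x \<partial>tot) * (\<Sum>n. measure Pre (R nu n))" "summable (%n. measure Pre (R nu n))"
proof -
 have RT: "{om\<in>Omega. enat t < S' nu om} = R nu t" for t unfolding less_dcusum ut_def[abs_def] by simp
 note m = mean_stopped_inf[OF RT R_joint inf_run_finite[OF nu]]
 show "gam = - (\<integral>x. x \<partial>tot) * (\<Sum>n. measure Pre (R nu n))" using m(1) g by simp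
 show "summable (%n. measure Pre (R nu n))" by (rule m(2))
qed

lemma dcusum_threshold_le:
 assumes nu: "0 < nu" and g: "(\<integral>om. - stopped (sensor_sum K u om) (S' nu om) \<partial>Pre) = gam" "1 <= gam"
  and D: "0 < D" "!!k. k : {1..K} ==> (\<Sum>r. (kill (step_law k) {-lo k<..<up k} ^^ r) (quantized_sensor.h (step_law k) (lo k) (up k) d (el k) (eu k)
    (message_llr (P 0) Pre (u k) (lo k) (up k) d (el k) (eu k))) 0) <= ennreal D"
  and c: "0 < c" "!!k v. k : {1..K} ==> v : {-lo k<..<up k} ==> ennreal c <= quantized_sensor.h (step_law k) (lo k) (up k) d (el k) (eu k)
    (message_llr (P 0) Pre (u k) (lo k) (up k) d (el k) (eu k)) v"
 shows "nu <= ln gam + real K * ln (D / c) + ln (4 / a + 2)"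
proof -
 interpret s: sensor_walk "Pre" joint K step_law incr 0 lo up V by (rule sensor_walk_inf)
 interpret T: llr_law tot "real K * a" "(real K)^2 * b" by (rule llr_law_tot)
 let ?h = "%k. quantized_sensor.h (step_law k) (lo k) (up k) d (el k) (eu k)
    (message_llr (P 0) Pre (u k) (lo k) (up k) d (el k) (eu k))"
 define Z where "Z = (D / c) ^ K / exp nu"
 have Z: "0 < Z" using D(1) c(1) by (simp add: Z_def)
 have RM: "R nu n : sets Pre" for n using R_joint joint_subset_P by blast
 have "1 - real (Suc n) * Z <= measure Pre (R nu n)" for n
 proof -
  have "ennreal (exp nu) * (\<Prod>k=1..K. ennreal c) * emeasure Pre (space Pre - R nu n) <= of_nat (Suc n) * (\<Prod>k=1..K. ennreal D)"
  proof (rule s.alarm_probability_le[where U = ut and q = qk and h = ?h])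
   fix k assume k: "k : {1..K}"
   show "?h k : borel_measurable borel" by (rule quantized_sensor.h_measurable[OF sensor[OF k]])
   show "qk k : borel_measurable borel" by (rule qk_measurable[OF k])
   show "?h k 0 <= 1" by (rule quantized_sensor.h_0_le[OF sensor[OF k]])
   show "nn_integral (step_law k) (%x. (if v + x : s.S k then ?h k (v + x) else ennreal (exp (qk k (v + x))))) <= ?h k v" for v
    using quantized_sensor.h_step[OF sensor[OF k], of v] unfolding q_eq[OF k] by simp
   show "ennreal c <= ?h k v" if "v : s.S k" for v by (rule c(2)[OF k that])
   show "(\<Sum>r. (kill (step_law k) (s.S k) ^^ r) (?h k) 0) <= ennreal D" by (rule D(2)[OF k])
  next
   show "ut (Suc t) om = ut t om + (SUM k=1..K. if W k t om : s.S k then 0 else qk k (W k t om))" if "om : space Pre" for t om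
    by (rule ut_Suc[OF that])
   show "R nu 0 = space Pre" using nu by (auto simp: running_def)
   show "R nu (Suc t) <= R nu t" for t using running_Suc by blast
   show "EX s<=Suc t. nu <= ut (Suc t) om - ut s om" if "om : R nu t" "om \<notin> R nu (Suc t)" for t om
    using that by (auto simp: running_def le_Suc_eq not_less)
  qed (use V_0 ut_joint R_joint in auto)
  then have "ennreal (exp nu * c ^ K * measure Pre (space Pre - R nu n)) <= ennreal (real (Suc n) * D ^ K)"
   using c(1) D(1) by (simp add: s.emeasure_eq_measure ennreal_mult ennreal_power ennreal_of_nat_eq_real_of_nat[symmetric] del: of_nat_Suc)
  then have "exp nu * c ^ K * measure Pre (space Pre - R nu n) <= real (Suc n) * D ^ K"
   using D(1) by (subst (asm) ennreal_le_iff) auto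
  moreover have "exp nu * c ^ K * (real (Suc n) * Z) = real (Suc n) * D ^ K"
   using c(1) by (simp add: Z_def power_divide)
  ultimately have "exp nu * c ^ K * measure Pre (space Pre - R nu n) <= exp nu * c ^ K * (real (Suc n) * Z)" by (rule ord_le_eq_trans[OF _ sym])
  then have "measure Pre (space Pre - R nu n) <= real (Suc n) * Z"
   using c(1) by (subst (asm) mult_le_cancel_left_pos) auto
  then show ?thesis using s.prob_compl[OF RM[of n]] by simp
 qed
 from sum_ge_of_linear_bound[OF measure_nonneg dcusum_mean(2)[OF nu g(1)] this Z]
 have 1: "1 / Z <= 4 * (\<Sum>n. measure Pre (R nu n)) + 2" .
 define I where "I = - (\<integral>x. x \<partial>tot)"
 have I: "a <= I" unfolding I_def by (rule info_inf_ge)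
 have "(\<Sum>n. measure Pre (R nu n)) = gam / I" using dcusum_mean(1)[OF nu g(1)] I a0 by (simp add: I_def)
 also have "... <= gam / a" using I a0 g(2) by (intro divide_left_mono) auto
 finally have "(\<Sum>n. measure Pre (R nu n)) <= gam / a" .
 moreover have "gam * (4 / a + 2) = 4 * (gam / a) + 2 * gam" by (simp add: distrib_left)
 ultimately have "1 / Z <= gam * (4 / a + 2)" using 1 g(2) by linarith
 then have "ln (1 / Z) <= ln (gam * (4 / a + 2))" using Z by (intro ln_mono) auto
 also have "... = ln gam + ln (4 / a + 2)" using g(2) a0 by (intro ln_mult_pos) (auto intro: add_pos_pos)
 also have "ln (1 / Z) = nu - real K * ln (D / c)" using c(1) D(1) by (simp add: Z_def ln_div ln_realpow)
 finally show ?thesis by simp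
qed

text \<open>
 No alarm is raised before the first message, which takes a time of the order of the thresholds; so
 \<open>\<gamma>\<close> is not small and \<open>ln gam\<close> is positive.
\<close>

lemma dcusum_mean_ge:
 assumes nu: "0 < nu" and g: "(\<integral>om. - stopped (sensor_sum K u om) (S' nu om) \<partial>Pre) = gam"
  and r: "0 < r" "!!k. k : {1..K} ==> r <= lo k & r <= up k"
  and small: "real (nat \<lceil>4 / a\<rceil>) * (SUM k=1..K. \<integral>x. \<bar>x\<bar> \<partial>step_law k) <= r / 2"
 shows "2 <= gam"
proof -
 interpret s: sensor_walk "Pre" joint K step_law incr 0 lo up V by (rule sensor_walk_inf)
 interpret T: llr_law tot "real K * a" "(real K)^2 * b" by (rule llr_law_tot)
 define N where "N = nat \<lceil>4 / a\<rceil>"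
 define m where "m k = (\<integral>x. \<bar>x\<bar> \<partial>step_law k)" for k
 have m: "0 <= m k" for k by (simp add: m_def)
 have RM: "R nu n : sets Pre" for n using R_joint joint_subset_P by blast
 have half: "1/2 <= measure Pre (R nu n)" if n: "n : {..<N}" for n
 proof -
  have sM: "{om\<in>space Pre. s.sent k n om} : sets Pre" if "k : {1..K}" for k using s.sent_F[OF that] s.F_M by blast
  have "space Pre - R nu n <= (\<Union>k\<in>{1..K}. {om\<in>space Pre. s.sent k n om})"
  proof
   fix om assume w: "om : space Pre - R nu n"
   show "om : (\<Union>k\<in>{1..K}. {om\<in>space Pre. s.sent k n om})"
   proof (rule ccontr)
    assume *: "~ ?thesis"
    have "ut t om = 0" if "t <= n" for t
    using that
    proof (induction t)
    case 0
    then show ?case using w ut_0 by simp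
    next
    case (Suc t)
    have "W k t om : s.S k" if "k : {1..K}" for k
    proof -
    have "~ s.sent k n om" using * that w by blast
    then show ?thesis unfolding s.sent_def using Suc.prems by (meson Suc_le_lessD atLeastLessThan_iff le0)
    qed
    then have "(SUM k=1..K. if W k t om : s.S k then 0 else qk k (W k t om)) = (SUM k=1..K. 0)" by (intro sum.cong) (simp_all only: if_True)
    then show ?case using Suc w ut_Suc[of om t] by simp
    qed
    then have "om : R nu n" using w nu by (simp add: running_def)
    then show False using w by simp
   qed
  qed
  then have "measure Pre (space Pre - R nu n) <= measure Pre (\<Union>k\<in>{1..K}. {om\<in>space Pre. s.sent k n om})"
   using sM by (intro s.finite_measure_mono sets.finite_UN) auto
  also have "... <= (SUM k=1..K. measure Pre {om\<in>space Pre. s.sent k n om})"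
   using sM by (intro measure_UNION_le) auto
  also have "... <= (SUM k=1..K. real N * (m k / r))"
  proof (rule sum_mono)
   fix k assume k: "k : {1..K}"
   interpret l: llr_law "step_law k" a b by (rule llr_law_step[OF k])
   have "emeasure Pre {om\<in>space Pre. s.sent k (0 + n) om} <= of_nat n * ennreal (m k / r)"
    unfolding m_def using r(2)[OF k] by (intro s.sent_probability_le[OF k _ l.int_inf r(1)]) auto
   then have "measure Pre {om\<in>space Pre. s.sent k n om} <= real n * (m k / r)"
    using m[of k] r(1) by (simp add: s.emeasure_eq_measure ennreal_of_nat_eq_real_of_nat ennreal_mult[symmetric] del: times_divide_eq_right)
   also have "... <= real N * (m k / r)" using n m[of k] r(1) by (intro mult_right_mono) auto
   finally show "measure Pre {om\<in>space Pre. s.sent k n om} <= real N * (m k / r)" .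
  qed
  also have "... = real N * (SUM k=1..K. m k) / r" by (simp add: sum_distrib_left sum_divide_distrib)
  also have "... <= 1/2" using small r(1) by (simp add: N_def m_def pos_divide_le_eq)
  finally show ?thesis using s.prob_compl[OF RM[of n]] by simp
 qed
 have N: "4 / a <= real N" unfolding N_def by (rule real_nat_ceiling_ge)
 define I where "I = - (\<integral>x. x \<partial>tot)"
 have I: "a <= I" unfolding I_def by (rule info_inf_ge)
 have "2 / a <= real N / 2" using N by simp
 also have "... = (SUM n<N. 1/2)" by simp
 also have "... <= (SUM n<N. measure Pre (R nu n))" by (intro sum_mono half)
 also have "... <= (\<Sum>n. measure Pre (R nu n))" using dcusum_mean(2)[OF nu g] by (intro sum_le_suminf) auto
 finally have s: "2 / a <= (\<Sum>n. measure Pre (R nu n))" .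
 have "2 = a * (2 / a)" using a0 by simp
 also have "... <= I * (\<Sum>n. measure Pre (R nu n))" using I a0 s by (intro mult_mono) auto
 also have "... = gam" using dcusum_mean(1)[OF nu g] by (simp add: I_def)
 finally show ?thesis .
qed

end

section \<open>Large thresholds\<close>

text \<open>
 What large thresholds give for a single sensor, uniformly in the number of labels and in the
 levels.
\<close>

definition (in llr_law) sensor_bounds :: "real => real => real => bool" where
 "sensor_bounds c C De \<longleftrightarrow> (ALL lo up d el eu \<Lambda>. quantized_sensor mu a b lo up d el eu \<Lambda> -->
   c * De <= lo --> lo <= C * De --> c * De <= up --> up <= C * De -->
   (\<Sum>r. (kill mu {-lo<..<up} ^^ r) (quantized_sensor.h mu lo up d el eu \<Lambda>) 0) <= ennreal (exp (C * De)) &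
   (ALL v:{-lo<..<up}. ennreal (exp (- 3 * (C * De))) <= quantized_sensor.h mu lo up d el eu \<Lambda> v) &
   exit_mean (tilt mu) {-lo<..<up} (quantized_sensor.loss lo up d el eu \<Lambda>) 0 <= ennreal (overshoot_const a b * b + 1) &
   (ALL gap epsu epsl. 0 <= gap --> (ALL j. 1 <= j --> j < d --> eu j - eu (j - 1) <= ereal gap & el j - el (j - 1) <= ereal gap) -->
    eu (d - 1) = ereal epsu --> el (d - 1) = ereal epsl -->
    exit_mean (tilt mu) {-lo<..<up} (quantized_sensor.loss lo up d el eu \<Lambda>) 0
    <= ennreal gap + ennreal (overshoot_const a b) * nn_integral (tilt mu) (%x. ennreal (x^2) * indicator {epsu..} x)
    + nn_integral mu (%x. ennreal (x^2) * indicator {epsl..} (- x))))"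

lemma (in llr_law) eventually_sensor_bounds:
 fixes c C :: real
 assumes c: "0 < c" "c <= C"
 shows "\<forall>\<^sub>F De in at_top. sensor_bounds c C De"
proof -
 obtain c1 where c1: "0 < c1" "!!lo up v. - lo <= v ==> v < up ==>
   ennreal (c1 * exp (v - up)) <= exit_mean mu {-lo<..<up} (indicator {up..}) v"
  by (rule exit_up_ge) blast
 obtain C1 where C1: "0 < C1" "!!S lo v eps. S : sets borel ==> S <= {- lo<..} ==> - lo < v ==> 0 <= eps ==>
   exit_mean mu S (%w. ennreal (- w - lo - eps)) v
   <= ennreal C1 * nn_integral mu (%x. ennreal (x^2) * indicator {eps..} (- x))"
  by (rule exit_down_overshoot_le) blast
 define oc where "oc = overshoot_const a b"
 define rate where "rate = ln (2 / (1 + half_rate))"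
 define q0 where "q0 = (1 + half_rate) / (1 - half_rate)"
 define Q where "Q = 1 + 2 / rate + oc * b / rate + q0"
 define m where "m = (\<integral>x. \<bar>x\<bar> \<partial>mu) / (1 - half_rate)"
 have oc: "0 < oc" unfolding oc_def by (rule overshoot_const_pos[OF a_pos b_pos])
 have rate: "0 < rate" using half_rate by (simp add: rate_def)
 have q0: "0 <= q0" using half_rate by (simp add: q0_def)
 have m: "0 <= m" using half_rate by (simp add: m_def)
 have C: "0 < C" using c by simp
 have expx: "exp (- x) <= 1 / x" if "0 < x" for x :: real
 proof -
  have "x <= exp x" using exp_ge_add_one_self[of x] by linarith
  then show ?thesis using that by (simp add: exp_minus field_simps)
 qed
 have inv1: "1 / x * x = 1" if "0 < x" for x :: real using that by simp
 have "\<forall>\<^sub>F De::real in at_top. 0 < De & 2 * Q / C <= De & 1 / (C * c1) <= De & 2 * m / c <= De & C1 / c <= De"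
  by (intro eventually_conj eventually_ge_at_top eventually_gt_at_top)
 then show ?thesis
 proof (rule eventually_mono, unfold sensor_bounds_def, intro allI impI)
  fix De lo up :: real and d el eu \<Lambda>
  assume D: "0 < De & 2 * Q / C <= De & 1 / (C * c1) <= De & 2 * m / c <= De & C1 / c <= De"
   and qs: "quantized_sensor mu a b lo up d el eu \<Lambda>" and th: "c * De <= lo" "lo <= C * De" "c * De <= up" "up <= C * De"
  interpret q: quantized_sensor mu a b lo up d el eu \<Lambda> by (rule qs)
  have D1: "Q <= C * De / 2" using D C by (simp add: pos_divide_le_eq mult.commute)
  have D2: "1 <= C * De * c1" using D C c1(1) by (simp add: pos_divide_le_eq ac_simps)
  have D3: "m <= c * De / 2" using D c by (simp add: pos_divide_le_eq mult.commute)
  have D4: "C1 <= c * De" using D c by (simp add: pos_divide_le_eq mult.commute)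
  have cD: "0 < c * De" using c D by simp
  let ?h = "quantized_sensor.h mu lo up d el eu \<Lambda>" and ?loss = "quantized_sensor.loss lo up d el eu \<Lambda>"
  let ?e = "exp (C * De / 2)"
  have e: "1 <= ?e" "C * De / 2 <= ?e" 
  proof -
   show "1 <= ?e" using C D by simp
   show "C * De / 2 <= ?e" using exp_ge_add_one_self[of "C * De / 2"] by linarith
  qed
  have ageb: "1 + (up + oc * b) / q.age_rate + exp (lo / 2) * ((1 + half_rate) / (1 - half_rate)) <= exp (C * De)"
  proof -
   have "up + oc * b <= 2 * ?e + oc * b * ?e"
   proof -
    have "0 <= oc * b" using oc b_pos by simp
    then have "oc * b * 1 <= oc * b * ?e" using e(1) by (intro mult_left_mono)
    then show ?thesis using th(4) e(2) by linarith
   qed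
   then have "(up + oc * b) / rate <= (2 * ?e + oc * b * ?e) / rate" using rate by (intro divide_right_mono) simp_all
   moreover have "exp (lo / 2) * q0 <= ?e * q0" using th(2) q0 by (intro mult_right_mono) simp_all
   ultimately have "1 + (up + oc * b) / rate + exp (lo / 2) * q0 <= ?e + (2 * ?e + oc * b * ?e) / rate + ?e * q0"
    using e(1) by linarith
   also have "... = Q * ?e" using rate by (simp add: Q_def field_simps)
   also have "... <= ?e * ?e" using D1 e(2) by (intro mult_right_mono) auto
   also have "... = exp (C * De)" by (simp add: exp_add[symmetric])
   finally show ?thesis unfolding rate_def q0_def q.age_rate_def .
  qed
  have 1: "(\<Sum>r. (kill mu {-lo<..<up} ^^ r) ?h 0) <= ennreal (exp (C * De))"
   using q.age_sum_le ennreal_leI[OF ageb] unfolding oc_def by (rule order_trans)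
  have 2: "ennreal (exp (- 3 * (C * De))) <= ?h v" if v: "v : {-lo<..<up}" for v
  proof -
   have "exp (- (C * De)) <= 1 / (C * De)" using C D by (intro expx) simp
   also have "... <= c1" using D2 C D by (simp add: pos_divide_le_eq mult.commute)
   finally have "exp (- (C * De)) <= c1" .
   then have "exp (- (C * De)) * exp (- (2 * (C * De))) <= c1 * exp (- (lo + up))"
    using th c1(1) by (intro mult_mono) auto
   moreover have "exp (- 3 * (C * De)) = exp (- (C * De)) * exp (- (2 * (C * De)))"
    unfolding exp_add[symmetric] by simp
   ultimately have "ennreal (exp (- 3 * (C * De))) <= ennreal (c1 * exp (- (lo + up)))" by (intro ennreal_leI) simp
   also have "... <= ?h v" by (rule q.h_ge[OF c1(2) v c1(1)])
   finally show ?thesis .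
  qed
  have 3: "exit_mean (tilt mu) {-lo<..<up} ?loss 0 <= ennreal (oc * b + 1)"
  proof -
   have "exp (- lo / 2) * m <= exp (- (c * De / 2)) * m" using th(1) m by (intro mult_right_mono) auto
   also have "... <= 1 / (c * De / 2) * (c * De / 2)" using expx[of "c * De / 2"] cD m D3 by (intro mult_mono) auto
   also have "... = 1" by (rule inv1) (use cD in simp)
   finally have "overshoot_const a b * b + exp (- lo / 2) * (\<integral>x. \<bar>x\<bar> \<partial>mu) / (1 - half_rate) <= oc * b + 1"
    by (simp add: m_def oc_def)
   from ennreal_leI[OF this] show ?thesis by (rule order_trans[OF q.mean_loss_bounded])
  qed
  have 4: "exit_mean (tilt mu) {-lo<..<up} ?loss 0
    <= ennreal gap + ennreal oc * nn_integral (tilt mu) (%x. ennreal (x^2) * indicator {epsu..} x)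
    + nn_integral mu (%x. ennreal (x^2) * indicator {epsl..} (- x))"
   if g: "0 <= gap" "ALL j. 1 <= j --> j < d --> eu j - eu (j - 1) <= ereal gap & el j - el (j - 1) <= ereal gap"
    "eu (d - 1) = ereal epsu" "el (d - 1) = ereal epsl" for gap epsu epsl
  proof -
   let ?T = "nn_integral mu (%x. ennreal (x^2) * indicator {epsl..} (- x))"
   have "exp (- lo) * C1 <= exp (- (c * De)) * C1" using th(1) C1(1) by (intro mult_right_mono) auto
   also have "... <= 1 / (c * De) * (c * De)" using expx[OF cD] cD C1(1) D4 by (intro mult_mono) auto
   also have "... = 1" by (rule inv1) (use cD in simp)
   finally have "ennreal (exp (- lo) * C1) <= ennreal 1" by (rule ennreal_leI)
   then have "ennreal (exp (- lo) * C1) * ?T <= 1 * ?T" by (intro mult_right_mono) simp_all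
   then have t: "ennreal (exp (- lo)) * (ennreal C1 * ?T) <= ?T" using C1(1) by (simp add: ennreal_mult mult.assoc)
   have "exit_mean (tilt mu) {-lo<..<up} ?loss 0
    <= ennreal gap + ennreal (overshoot_const a b) * nn_integral (tilt mu) (%x. ennreal (x^2) * indicator {epsu..} x)
    + ennreal (exp (- lo)) * (ennreal C1 * ?T)"
    by (rule q.mean_loss_le[OF g(1) _ C1(2) g(3,4)]) (use g(2) in auto)
   also have "... <= ennreal gap + ennreal oc * nn_integral (tilt mu) (%x. ennreal (x^2) * indicator {epsu..} x) + ?T"
    unfolding oc_def by (intro add_left_mono t)
   finally show ?thesis .
  qed
  show "(\<Sum>r. (kill mu {-lo<..<up} ^^ r) ?h 0) <= ennreal (exp (C * De)) &
   (ALL v:{-lo<..<up}. ennreal (exp (- 3 * (C * De))) <= ?h v) &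
   exit_mean (tilt mu) {-lo<..<up} ?loss 0 <= ennreal (overshoot_const a b * b + 1) &
   (ALL gap epsu epsl. 0 <= gap --> (ALL j. 1 <= j --> j < d --> eu j - eu (j - 1) <= ereal gap & el j - el (j - 1) <= ereal gap) -->
    eu (d - 1) = ereal epsu --> el (d - 1) = ereal epsl -->
    exit_mean (tilt mu) {-lo<..<up} ?loss 0
    <= ennreal gap + ennreal (overshoot_const a b) * nn_integral (tilt mu) (%x. ennreal (x^2) * indicator {epsu..} x)
    + nn_integral mu (%x. ennreal (x^2) * indicator {epsl..} (- x)))"
   using 1 2 3 4 unfolding oc_def by blast
 qed
qed

lemma (in llr_system) info_le: "(\<integral>x. x \<partial>tilt tot) <= real K * b"
proof -
 have "(\<integral>x. x \<partial>tilt tot) = (\<integral>om. (SUM k=1..K. u k 1 om) \<partial>P 0)"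
  unfolding total_post[symmetric] total_post_distr by (rule integral_distr[OF sum_u_P]) simp
 also have "... = (SUM k=1..K. \<integral>om. u k 1 om \<partial>P 0)" using info_0 by (intro Bochner_Integration.integral_sum) auto
 also have "... <= (SUM k=1..K. b)" using mean_post by (intro sum_mono) auto
 finally show ?thesis by simp
qed

text \<open>
 The part of the mean above the truncation level is at most the second moment divided by the level.
\<close>

lemma (in llr_law) truncated_deficit_le:
 assumes c0: "0 < c0" and sq: "b / c0 <= (\<integral>x. x \<partial>tilt mu) / 2"
 shows "nn_integral (tilt mu) (%x. ennreal (c0 - x)) <= ennreal (c0 - (\<integral>x. x \<partial>tilt mu) / 2)"
proof -
 have i: "integrable (tilt mu) (%x. (c0 - x) + x^2 / c0)"
  using int_0 int_sq by (intro Bochner_Integration.integrable_add Bochner_Integration.integrable_diff t.integrable_const) auto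
 have nn: "max 0 (c0 - x) <= (c0 - x) + x^2 / c0" for x
 proof -
  have "0 <= (x - c0 / 2)^2 + 3 * c0^2 / 4" by simp
  also have "... = c0 * ((c0 - x) + x^2 / c0)" using c0 by (simp add: field_simps power2_eq_square)
  finally have "0 <= (c0 - x) + x^2 / c0" using c0 by (simp add: zero_le_mult_iff)
  moreover have "0 <= x^2 / c0" using c0 by simp
  ultimately show ?thesis by (simp add: max_def)
 qed
 have "nn_integral (tilt mu) (%x. ennreal (c0 - x)) <= nn_integral (tilt mu) (%x. ennreal ((c0 - x) + x^2 / c0))"
  by (intro nn_integral_mono ennreal_leI order_trans[OF max.cobounded2 nn])
 also have "... = ennreal (\<integral>x. (c0 - x) + x^2 / c0 \<partial>tilt mu)"
  by (intro nn_integral_eq_integral[OF i] AE_I2 order_trans[OF max.cobounded1 nn])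
 also have "(\<integral>x. (c0 - x) + x^2 / c0 \<partial>tilt mu) = c0 - (\<integral>x. x \<partial>tilt mu) + (\<integral>x. x^2 \<partial>tilt mu) / c0"
  using int_0 int_sq by (simp add: t.prob_space[simplified])
 also have "ennreal ... <= ennreal (c0 - (\<integral>x. x \<partial>tilt mu) / 2)"
  using sq divide_right_mono[OF sq_le less_imp_le[OF c0]] by (intro ennreal_leI) linarith
 finally show ?thesis .
qed

text \<open>The largest gap is finite, so that the error is a sum in the extended nonnegative reals.\<close>

lemma (in dcusum_system) quantization_error_eq:
 assumes k: "k : {1..K}"
 obtains gap epsu epsl where "0 <= gap"
  "ALL j. 1 <= j --> j < d --> eu k j - eu k (j - 1) <= ereal gap & el k j - el k (j - 1) <= ereal gap"
  "eu k (d - 1) = ereal epsu" "el k (d - 1) = ereal epsl"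
  "quantization_error (P 0) Pre (u k 1) 1 1 d (el k) (eu k) = enn2ereal (ennreal gap
    + nn_integral (tilt (step_law k)) (%x. ennreal (x^2) * indicator {epsu..} x)
    + nn_integral (step_law k) (%x. ennreal (x^2) * indicator {epsl..} (- x)))"
proof -
 interpret z: quantizer "lo k" "up k" d "el k" "eu k" by (rule quantizer_k[OF k])
 have fin: "\<bar>eu k j\<bar> ~= \<infinity>" "\<bar>el k j\<bar> ~= \<infinity>" if "j < d" for j using z.e_finite[OF that] by auto
 define G where "G = (\<Union>j\<in>{1..d-1}. {eu k j - eu k (j - 1), el k j - el k (j - 1)})"
 have G: "finite G" by (simp add: G_def)
 have Gfin: "0 <= x & \<bar>x\<bar> ~= \<infinity>" if "x : G" for x
 proof -
  from that obtain j where j: "1 <= j" "j <= d - 1" "x = eu k j - eu k (j - 1) | x = el k j - el k (j - 1)"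
   by (auto simp: G_def)
  then have lt: "j < d" "j - 1 < d" "Suc (j - 1) = j" using d by auto
  have "eu k (j - 1) < eu k j" "el k (j - 1) < el k j" using z.eu_Suc[OF lt(2)] z.el_Suc[OF lt(2)] lt(3) by auto
  then show ?thesis using j(3) fin[OF lt(1)] fin[OF lt(2)]
   by (cases "eu k j"; cases "eu k (j - 1)"; cases "el k j"; cases "el k (j - 1)") auto
 qed
 have mg: "max_gap d (el k) (eu k) = (if d = 1 then 0 else Max G)" by (simp add: max_gap_def G_def)
 have mfin: "0 <= max_gap d (el k) (eu k) & \<bar>max_gap d (el k) (eu k)\<bar> ~= \<infinity>"
 proof (cases "d = 1")
  case False
  then have "1 : {1..d-1}" using d by auto
  then have "G ~= {}" unfolding G_def by blast
  then have "Max G : G" using G by (intro Max_in)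
  from Gfin[OF this] False show ?thesis by (simp only: mg if_False simp_thms)
 next
  case True
  then have "max_gap d (el k) (eu k) = 0" by (simp add: max_gap_def)
  then show ?thesis by simp
 qed
 then obtain gap where gap: "max_gap d (el k) (eu k) = ereal gap" "0 <= gap" by (cases "max_gap d (el k) (eu k)") auto
 have le: "eu k j - eu k (j - 1) <= ereal gap & el k j - el k (j - 1) <= ereal gap" if "1 <= j" "j < d" for j
 proof -
  have "d ~= 1" "j : {1..d-1}" using that by auto
  then have "eu k j - eu k (j - 1) : G" "el k j - el k (j - 1) : G" "Max G = ereal gap" using gap mg unfolding G_def by auto
  then show ?thesis using G by (metis Max_ge)
 qed
 have d1: "d - 1 < d" using d by simp
 obtain epsu epsl where eps: "eu k (d - 1) = ereal epsu" "el k (d - 1) = ereal epsl"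
  using fin[OF d1] by (cases "eu k (d - 1)"; cases "el k (d - 1)") auto
 have m: "u k 1 : borel_measurable (P 0)" "u k 1 : borel_measurable Pre" by (rule u_P[OF k])+
 have "nn_integral (tilt (step_law k)) (%x. ennreal (x^2) * indicator {epsu..} x) = nn_integral (P 0) (%om. ennreal ((u k 1 om)^2) * of_bool (eu k (d - 1) <= ereal (u k 1 om)))"
  unfolding tilt_step_law_eq[OF k] eps using m by (subst nn_integral_distr) (auto simp: indicator_def intro!: nn_integral_cong)
 moreover have "nn_integral (step_law k) (%x. ennreal (x^2) * indicator {epsl..} (- x)) = nn_integral Pre (%om. ennreal ((u k 1 om)^2) * of_bool (el k (d - 1) <= ereal (- u k 1 om)))"
  unfolding step_law_eq[OF k] eps using m by (subst nn_integral_distr) (auto simp: indicator_def intro!: nn_integral_cong)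
 ultimately have "quantization_error (P 0) Pre (u k 1) 1 1 d (el k) (eu k) = enn2ereal (ennreal gap
    + nn_integral (tilt (step_law k)) (%x. ennreal (x^2) * indicator {epsu..} x)
    + nn_integral (step_law k) (%x. ennreal (x^2) * indicator {epsl..} (- x)))"
  using gap by (simp add: quantization_error_def plus_ennreal.rep_eq enn2ereal_ennreal one_ereal_def[symmetric])
 then show thesis using that[OF gap(2) _ eps] le by blast
qed

text \<open>
 The factor of \<open>\<Delta>\<close> in the denominator of the first term; \<open>16 * b\<close>
 collects the constants of the mean duration of a message and of the solved inequality for the
 running time.
\<close>

definition delay_slope :: "real => real => real => real" where
 "delay_slope a b c = min 1 (a * c / (16 * b * (1 + overshoot_const a b)))"

text \<open>
 Twice the sum of the contributions of the threshold, the first messages, the phases, the losses of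
 the messages in progress and the truncation, plus one for the terms that depend on the system.
\<close>

definition delay_offset :: "real => real => real => real" where
 "delay_offset a b C = 2 * (4 * C + 1 + (2 * C + 1 + b * (4 * C / a + 2) + 2 * (a / 4 * (4 * C / a + 2) + 1))) + 1"

lemma (in llr_system) eventually_delay_difference:
 fixes c C :: real
 assumes c: "0 < c" "c <= C"
 shows "\<forall>\<^sub>F De in at_top. ALL lo up d el eu gam nu nu'.
  (ALL k:{1..K}. c * De <= lo k & lo k <= C * De & c * De <= up k & up k <= C * De) -->
  dcusum_system K P \<xi> u a b lo up d el eu --> 0 < gam -->
  (\<integral>om. - stopped (sensor_sum K u om) (cusum K u nu om) \<partial>Pre) = gam -->
  (\<integral>om. - stopped (sensor_sum K u om) (dcusum K P u lo up d el eu nu' om) \<partial>Pre) = gam -->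
  detection_delay K P \<xi> u (dcusum K P u lo up d el eu nu') - detection_delay K P \<xi> u (cusum K u nu)
   <= Max ((%k. quantization_error (P 0) Pre (u k 1) 1 1 d (el k) (eu k)) ` {1..K}) / ereal (delay_slope a b c * De) * ereal (ln gam)
    + ereal (real K * (delay_offset a b C * De))"
proof -
 interpret T: llr_law tot "real K * a" "(real K)^2 * b" by (rule llr_law_tot)
 obtain c1 where c1: "!!nu gam. (\<integral>om. - stopped (sensor_sum K u om) (cusum K u nu om) \<partial>Pre) = gam ==> 0 < gam ==> 0 < nu & ln gam <= nu + c1"
  by (rule cusum_threshold_ge) blast
 obtain c2 where c2: "!!nu. 0 < nu ==> ereal (nu - c2) <= detection_delay K P \<xi> u (cusum K u nu)"
  by (rule cusum_delay_ge) blast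
 have b0: "0 < b" using llr_law.b_pos[OF llr_law_step[of 1]] K_pos by simp
 have C: "0 < C" using c by simp
 have K1: "1 <= real K" using K_pos by simp
 define oc where "oc = overshoot_const a b"
 have oc: "0 < oc" unfolding oc_def by (rule overshoot_const_pos[OF a0 b0])
 define \<rho> where "\<rho> = laplace_rate a b"
 have rho: "\<rho> < 1" using laplace_rate_bounds[OF a0 b0] by (simp add: \<rho>_def)
 define I where "I = (\<integral>x. x \<partial>tilt tot)"
 have I: "real K * a <= I" "I <= real K * b" using T.mean_0 info_le by (simp_all add: I_def)
 define tov where "tov = overshoot_const (real K * a) ((real K)^2 * b) * ((real K)^2 * b)"
 define mm where "mm = (SUM k=1..K. \<integral>x. \<bar>x\<bar> \<partial>step_law k)"
 define dm where "dm = oc * b + 1"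
 have dm: "0 < dm" using oc b0 by (simp add: dm_def add_pos_pos)
 have evB: "\<forall>\<^sub>F De in at_top. ALL k:{1..K}. llr_law.sensor_bounds (step_law k) a b c C De"
  by (intro eventually_ball_finite ballI llr_law.eventually_sensor_bounds[OF llr_law_step c]) auto
 have evD: "\<forall>\<^sub>F De::real in at_top. 1 <= De & 1 / (2 * c) <= De & 16 * b * dm / (a * c) <= De & tov <= De & real K / (1 - \<rho>) <= De
   & 2 * b / a <= De & b <= De & ln (4 / a + 2) <= De & c1 + c2 <= De & 2 * real (nat \<lceil>4 / a\<rceil>) * mm / c <= De"
  by (intro eventually_conj eventually_ge_at_top)
 from evB evD show ?thesis
 proof (rule eventually_elim2, intro allI impI)
  fix De :: real and lo up :: "nat => real" and d :: nat and el eu :: "nat => nat => ereal" and gam nu nu' :: real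
  assume B: "ALL k:{1..K}. llr_law.sensor_bounds (step_law k) a b c C De"
   and Dc: "1 <= De & 1 / (2 * c) <= De & 16 * b * dm / (a * c) <= De & tov <= De & real K / (1 - \<rho>) <= De
   & 2 * b / a <= De & b <= De & ln (4 / a + 2) <= De & c1 + c2 <= De & 2 * real (nat \<lceil>4 / a\<rceil>) * mm / c <= De"
   and th: "ALL k:{1..K}. c * De <= lo k & lo k <= C * De & c * De <= up k & up k <= C * De"
   and ds: "dcusum_system K P \<xi> u a b lo up d el eu" and g: "0 < gam"
   and gS: "(\<integral>om. - stopped (sensor_sum K u om) (cusum K u nu om) \<partial>Pre) = gam"
   and gS': "(\<integral>om. - stopped (sensor_sum K u om) (dcusum K P u lo up d el eu nu' om) \<partial>Pre) = gam"
  interpret z: dcusum_system K P \<xi> u a b lo up d el eu by (rule ds)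
  have D: "1 <= De" "1 / (2 * c) <= De" "16 * b * dm / (a * c) <= De" "tov <= De" "real K / (1 - \<rho>) <= De"
   "2 * b / a <= De" "b <= De" "ln (4 / a + 2) <= De" "c1 + c2 <= De" "2 * real (nat \<lceil>4 / a\<rceil>) * mm / c <= De"
   using Dc by auto
  let ?J' = "detection_delay K P \<xi> u (dcusum K P u lo up d el eu nu')" and ?J = "detection_delay K P \<xi> u (cusum K u nu)"
  let ?q = "%k. quantization_error (P 0) Pre (u k 1) 1 1 d (el k) (eu k)"
  define \<theta> where "\<theta> = Max (?q ` {1..K})"
  have D0: "1 <= De" "0 < De" using D by auto
  have cD: "0 < c * De" "1/2 <= c * De" using D c by (auto simp: field_simps)
  have th': "c * De <= lo k" "lo k <= C * De" "c * De <= up k" "up k <= C * De" if "k : {1..K}" for k using th that by auto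
  have Bk1: "(\<Sum>r. (kill (step_law k) {-lo k<..<up k} ^^ r) (quantized_sensor.h (step_law k) (lo k) (up k) d (el k) (eu k)
    (message_llr (P 0) Pre (u k) (lo k) (up k) d (el k) (eu k))) 0) <= ennreal (exp (C * De))" if k: "k : {1..K}" for k
   using B[rule_format, OF k, unfolded llr_law.sensor_bounds_def[OF llr_law_step[OF k]], rule_format, OF z.sensor[OF k] th'[OF k]] by blast
  have Bk2: "ennreal (exp (- 3 * (C * De))) <= quantized_sensor.h (step_law k) (lo k) (up k) d (el k) (eu k)
    (message_llr (P 0) Pre (u k) (lo k) (up k) d (el k) (eu k)) v" if k: "k : {1..K}" and v: "v : {-lo k<..<up k}" for k v
   using B[rule_format, OF k, unfolded llr_law.sensor_bounds_def[OF llr_law_step[OF k]], rule_format, OF z.sensor[OF k] th'[OF k]] v by blast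
  have nu': "0 < nu'" by (rule z.dcusum_threshold_pos[OF gS' g])
  have small: "real (nat \<lceil>4 / a\<rceil>) * mm <= c * De / 2" using D c by (simp add: pos_divide_le_eq mult.commute)
  have g2: "2 <= gam" by (rule z.dcusum_mean_ge[OF nu' gS' cD(1) _ small[unfolded mm_def]]) (use th in auto)
  have lg: "0 < ln gam" using g2 by simp
  have nu'le: "nu' <= ln gam + real K * (4 * (C * De)) + De"
  proof -
   have "nu' <= ln gam + real K * ln (exp (C * De) / exp (- 3 * (C * De))) + ln (4 / a + 2)"
    by (rule z.dcusum_threshold_le[OF nu' gS' _ _ Bk1 _ Bk2]) (use g2 in auto)
   also have "ln (exp (C * De) / exp (- 3 * (C * De))) = 4 * (C * De)" unfolding exp_diff[symmetric] ln_exp by simp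
   finally show ?thesis using D(8) by linarith
  qed
  have delay_S: "ereal (ln gam - De) <= ?J"
  proof -
   have "0 < nu" "ln gam <= nu + c1" using c1[OF gS g] by auto
   then have "ereal (ln gam - De) <= ereal (nu - c2)" using D(9) by simp
   also have "... <= ?J" by (rule c2) fact
   finally show ?thesis .
  qed
  have err: "EX E. ?q k = enn2ereal E & exit_mean (tilt (step_law k)) {-lo k<..<up k} (z.lossk k) 0 <= ennreal (1 + oc) * E"
   if k: "k : {1..K}" for k
  proof -
   obtain gap epsu epsl where e: "0 <= gap"
    "ALL j. 1 <= j --> j < d --> eu k j - eu k (j - 1) <= ereal gap & el k j - el k (j - 1) <= ereal gap"
    "eu k (d - 1) = ereal epsu" "el k (d - 1) = ereal epsl"
    "?q k = enn2ereal (ennreal gap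
    + nn_integral (tilt (step_law k)) (%x. ennreal (x^2) * indicator {epsu..} x)
    + nn_integral (step_law k) (%x. ennreal (x^2) * indicator {epsl..} (- x)))"
    by (rule z.quantization_error_eq[OF k])
   let ?T0 = "nn_integral (tilt (step_law k)) (%x. ennreal (x^2) * indicator {epsu..} x)"
    and ?T1 = "nn_integral (step_law k) (%x. ennreal (x^2) * indicator {epsl..} (- x))"
   have "exit_mean (tilt (step_law k)) {-lo k<..<up k} (z.lossk k) 0 <= ennreal gap + ennreal oc * ?T0 + ?T1"
    unfolding oc_def z.loss_eq[OF k, symmetric]
    by (rule B[rule_format, OF k, unfolded llr_law.sensor_bounds_def[OF llr_law_step[OF k]], rule_format, OF z.sensor[OF k] th'[OF k], THEN conjunct2, THEN conjunct2, THEN conjunct2, rule_format, OF e(1) _ e(3,4)]) (use e(2) in auto)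
   also have "... <= ennreal (1 + oc) * ennreal gap + ennreal (1 + oc) * ?T0 + ennreal (1 + oc) * ?T1"
   proof -
    have 1: "1 * x <= ennreal (1 + oc) * x" for x :: ennreal using oc by (intro mult_right_mono) simp_all
    have "ennreal oc * ?T0 <= ennreal (1 + oc) * ?T0" by (intro mult_right_mono ennreal_leI) simp_all
    then show ?thesis using 1[of "ennreal gap"] 1[of ?T1] by (intro add_mono) simp_all
   qed
   finally have "exit_mean (tilt (step_law k)) {-lo k<..<up k} (z.lossk k) 0 <= ennreal (1 + oc) * (ennreal gap + ?T0 + ?T1)"
    by (simp only: distrib_left)
   then show ?thesis using e(5) by blast
  qed
  have qle: "?q k <= \<theta>" if "k : {1..K}" for k unfolding \<theta>_def using that by (intro Max_ge) auto
  have th0: "0 <= \<theta>"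
  proof -
   have k1: "1 : {1..K}" using K_pos by simp
   obtain E where "?q 1 = enn2ereal E" using err[OF k1] by blast
   then have "0 <= ?q 1" by simp
   then show ?thesis using qle[OF k1] by (rule order_trans)
  qed
  define M where "M = delay_offset a b C"
  define s where "s = delay_slope a b c"
  have s: "0 < s" using a0 b0 c oc by (simp add: s_def delay_slope_def oc_def)
  show "?J' - ?J
   <= Max (?q ` {1..K}) / ereal (delay_slope a b c * De) * ereal (ln gam) + ereal (real K * (delay_offset a b C * De))"
   unfolding \<theta>_def[symmetric] M_def[symmetric] s_def[symmetric]
  proof (cases "\<theta>")
   case PInf
   have "\<theta> / ereal (s * De) = \<infinity>" using PInf s D0 by (simp add: divide_ereal_def)
   then show "?J' - ?J
    <= \<theta> / ereal (s * De) * ereal (ln gam) + ereal (real K * (M * De))" using lg by simp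
  next
   case MInf
   then show "?J' - ?J
    <= \<theta> / ereal (s * De) * ereal (ln gam) + ereal (real K * (M * De))" using th0 by simp
  next
   case (real t)
   have t: "0 <= t" using th0 real by simp
   define \<delta> where "\<delta> = min dm ((1 + oc) * t)"
   have \<delta>: "0 <= \<delta>" "\<delta> <= dm" "\<delta> <= (1 + oc) * t" using dm oc t by (auto simp: \<delta>_def)
   have loss: "exit_mean (tilt (step_law k)) {-lo k<..<up k} (z.lossk k) 0 <= ennreal \<delta>" if k: "k : {1..K}" for k
   proof -
    have 1: "exit_mean (tilt (step_law k)) {-lo k<..<up k} (z.lossk k) 0 <= ennreal dm"
    unfolding dm_def oc_def z.loss_eq[OF k, symmetric] using B[rule_format, OF k, unfolded llr_law.sensor_bounds_def[OF llr_law_step[OF k]], rule_format, OF z.sensor[OF k] th'[OF k]] by blast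
    obtain E where E: "?q k = enn2ereal E" "exit_mean (tilt (step_law k)) {-lo k<..<up k} (z.lossk k) 0 <= ennreal (1 + oc) * E"
    using err[OF k] by blast
    have "enn2ereal E <= enn2ereal (ennreal t)" using qle[OF k] E(1) real t by (simp add: enn2ereal_ennreal)
    then have "E <= ennreal t" by (simp add: less_eq_ennreal.rep_eq)
    then have "ennreal (1 + oc) * E <= ennreal (1 + oc) * ennreal t" by (rule mult_left_mono) simp
    also have "... = ennreal ((1 + oc) * t)" using oc t by (intro ennreal_mult[symmetric]) auto
    finally have "exit_mean (tilt (step_law k)) {-lo k<..<up k} (z.lossk k) 0 <= ennreal ((1 + oc) * t)" by (rule order_trans[OF E(2)])
    then show ?thesis using 1 unfolding \<delta>_def min_def by simp
   qed
   define g0 where "g0 = c * De / (4 * b)"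
   have g0: "0 < g0" using cD b0 by (simp add: g0_def)
   have green: "ennreal g0 <= green (tilt (step_law k)) {-lo k<..<up k} (%_. 1) 0" if k: "k : {1..K}" for k
   proof -
    interpret l: llr_law "step_law k" a b by (rule llr_law_step[OF k])
    let ?r = "c * De"
    have "g0 <= ?r^2 / (2 * ?r * b + b)"
    proof -
    have "2 * ?r * b + b <= 4 * ?r * b" using mult_right_mono[OF cD(2) less_imp_le[OF b0]] by linarith
    then have "?r^2 / (4 * ?r * b) <= ?r^2 / (2 * ?r * b + b)" using cD b0 c D0 by (intro divide_left_mono mult_pos_pos add_pos_pos) auto
    moreover have "?r^2 / (4 * ?r * b) = g0" using c D0 b0 by (simp add: g0_def power2_eq_square field_simps)
    ultimately show ?thesis by simp
    qed
    then have "ennreal g0 <= ennreal (?r^2 / (2 * ?r * b + b))" by (rule ennreal_leI)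
    also have "... <= green (tilt (step_law k)) {-lo k<..<up k} (%_. 1) 0"
    using th'[OF k] cD by (intro l.sojourn_ge[where up = "up k"]) auto
    finally show ?thesis .
   qed
   have acD: "16 * b * dm <= a * c * De" using D a0 c by (simp add: pos_divide_le_eq mult.commute)
   have half: "4 * \<delta> <= a * g0"
   proof -
    have "16 * b * \<delta> <= 16 * b * dm" using \<delta>(2) b0 by (intro mult_left_mono) auto
    moreover have "a * g0 * (4 * b) = a * c * De" using b0 by (simp add: g0_def)
    moreover have "(4 * \<delta>) * (4 * b) = 16 * b * \<delta>" by simp
    ultimately have "(4 * \<delta>) * (4 * b) <= (a * g0) * (4 * b)" using acD by linarith
    then show ?thesis by (rule mult_right_le_imp_le) (use b0 in simp)
   qed
   define c0 where "c0 = real K * De"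
   have c0: "0 < c0" using K1 D0 by (simp add: c0_def)
   have zi: "z.info = I" by (simp add: z.info_def I_def)
   have c0b: "I / 2 <= c0"
   proof -
    have "real K * b <= real K * De" using D by (intro mult_left_mono) auto
    then show ?thesis using I(2) c0 unfolding c0_def by linarith
   qed
   have def: "nn_integral (tilt tot) (%x. ennreal (c0 - x)) <= ennreal (c0 - I / 2)"
    unfolding I_def
   proof (rule T.truncated_deficit_le[OF c0])
    have "2 * b <= a * De" using D a0 by (simp add: pos_divide_le_eq mult.commute)
    then have "b / De <= a / 2" using D0 by (simp add: field_simps)
    then have "real K * (b / De) <= real K * (a / 2)" by (intro mult_left_mono) auto
    moreover have "(real K)^2 * b / c0 = real K * (b / De)" using K1 D0 by (simp add: c0_def power2_eq_square field_simps)
    ultimately show "(real K)^2 * b / c0 <= (\<integral>x. x \<partial>tilt tot) / 2" using I(1) unfolding I_def by simp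
   qed
   define y where "y = 2 * \<delta> / (a * g0)"
   define w where "w = 2 * (C * De)"
   define X where "X = (1 + 2 * y) * (nu' + z.rest w g0 \<delta> c0)"
   have y: "0 <= y" "y <= 1/2" using \<delta>(1) g0 a0 half by (auto simp: y_def pos_divide_le_eq)
   have w0: "0 <= w" using C D0 by (simp add: w_def)
   define q1 where "q1 = 4 * C / a + 2"
   have q1: "0 <= q1" using C a0 by (simp add: q1_def)
   have st: "0 <= z.steps w" "z.steps w <= 4 * (C * De) / a + 1"
   proof -
    show "0 <= z.steps w" by (simp add: z.steps_def)
    have "0 <= 2 * w / a" using w0 a0 by simp
    then have "z.steps w <= 2 * w / a + 1" unfolding z.steps_def by linarith
    then show "z.steps w <= 4 * (C * De) / a + 1" by (simp add: w_def)
   qed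
   have st1: "z.steps w + real K / (1 - \<rho>) <= q1 * De" "z.steps w + 1 / (1 - \<rho>) <= q1 * De"
   proof -
    have "4 * (C * De) / a + 1 + De <= q1 * De" using D0 by (simp add: q1_def distrib_right mult.assoc)
    moreover have "1 / (1 - \<rho>) <= real K / (1 - \<rho>)" using K1 rho by (intro divide_right_mono) auto
    ultimately show "z.steps w + real K / (1 - \<rho>) <= q1 * De" "z.steps w + 1 / (1 - \<rho>) <= q1 * De"
    using st(2) D(5) by linarith+
   qed
   have dg: "0 <= \<delta> / g0" "\<delta> / g0 <= a / 4" using \<delta>(1) g0 half by (auto simp: pos_divide_le_eq)
   have KD: "De <= real K * De" using K1 D0 by simp
   have tz: "z.tot_overshoot = tov" by (simp add: z.tot_overshoot_def tov_def)
   have rest0: "0 <= z.rest w g0 \<delta> c0"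
   proof -
    have "0 <= tov" unfolding tov_def
    by (intro mult_nonneg_nonneg less_imp_le[OF overshoot_const_pos[OF T.a_pos T.b_pos]] less_imp_le[OF T.b_pos])
    moreover have "0 <= I" using I(1) T.a_pos by linarith
    ultimately show ?thesis unfolding z.rest_def tz zi \<rho>_def[symmetric]
    using w0 st(1) \<delta>(1) g0 c0 rho by (intro add_nonneg_nonneg mult_nonneg_nonneg divide_nonneg_nonneg) auto
   qed
   have rest: "z.rest w g0 \<delta> c0 <= (2 * C + 1 + b * q1 + 2 * (a / 4 * q1 + 1)) * (real K * De)"
   proof -
    have 1: "I * (z.steps w + real K / (1 - \<rho>)) <= (real K * b) * (q1 * De)"
    using I K1 b0 rho st st1 by (intro mult_mono add_nonneg_nonneg divide_nonneg_nonneg) auto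
    have 2: "real K * (\<delta> / g0) * (z.steps w + 1 / (1 - \<rho>)) <= (real K * (a / 4)) * (q1 * De)"
    using dg \<delta>(1) g0 K1 a0 rho st st1 by (intro mult_mono add_nonneg_nonneg divide_nonneg_nonneg) auto
    have 3: "tov <= real K * De" using D(4) KD by linarith
    have "z.rest w g0 \<delta> c0 = real K * w + tov + I * (z.steps w + real K / (1 - \<rho>)) + 2 * (real K * (\<delta> / g0) * (z.steps w + 1 / (1 - \<rho>)) + c0)"
    by (simp add: z.rest_def tz zi \<rho>_def)
    also have "... <= real K * w + real K * De + (real K * b) * (q1 * De) + 2 * ((real K * (a / 4)) * (q1 * De) + c0)"
    by (intro add_mono order_refl 1 2 3 mult_left_mono) simp
    also have "... = (2 * C + 1 + b * q1 + 2 * (a / 4 * q1 + 1)) * (real K * De)" by (simp add: w_def c0_def algebra_simps)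
    finally show ?thesis .
   qed
   define A4 where "A4 = 4 * C + 1 + (2 * C + 1 + b * q1 + 2 * (a / 4 * q1 + 1))"
   have A4: "0 <= A4" "M = 2 * A4 + 1" 
   proof -
    show "0 <= A4" unfolding A4_def using C b0 a0 q1 by (intro add_nonneg_nonneg mult_nonneg_nonneg) auto
    show "M = 2 * A4 + 1" by (simp only: M_def delay_offset_def A4_def q1_def)
   qed
   have wk: "lo k + up k <= w" if "k : {1..K}" for k using th'[OF that] by (simp add: w_def)
   have delay_S': "?J' <= ereal X"
   proof (rule z.detection_delay_le)
    show "0 <= X" unfolding X_def using y nu' rest0 by (intro mult_nonneg_nonneg add_nonneg_nonneg) auto
    fix tau n and Bs assume "Bs : sets (joint tau)"
    from z.delay_sum_le[OF nu' w0 wk g0 green \<delta>(1) loss half c0 c0b[folded zi] def[folded zi] this, of n]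
    show "z.info * (SUM i<n. measure (P (enat tau)) (z.R nu' (tau + i) Int Bs)) <= X * measure (P (enat tau)) (z.R nu' tau Int Bs)"
    by (simp only: X_def y_def mult.assoc)
   qed
   have "X <= (1 + 2 * y) * (ln gam + A4 * (real K * De))"
    unfolding X_def
   proof (rule mult_left_mono)
    have "nu' + z.rest w g0 \<delta> c0 <= ln gam + real K * (4 * (C * De)) + real K * De + (2 * C + 1 + b * q1 + 2 * (a / 4 * q1 + 1)) * (real K * De)"
    using nu'le rest KD by linarith
    then show "nu' + z.rest w g0 \<delta> c0 <= ln gam + A4 * (real K * De)" by (simp add: A4_def algebra_simps)
   qed (use y in simp)
   also have "... = ln gam + 2 * y * ln gam + (1 + 2 * y) * (A4 * (real K * De))" by (simp add: algebra_simps)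
   also have "... <= ln gam + t / (s * De) * ln gam + 2 * (A4 * (real K * De))"
   proof -
    have o1: "0 < 1 + oc" using oc by simp
    define v where "v = a * c / (16 * b * (1 + oc))"
    have v: "0 < v" using a0 c b0 o1 by (simp add: v_def)
    have sv: "s <= v" by (simp add: s_def delay_slope_def oc_def v_def)
    have "2 * y = 16 * b * \<delta> / (a * c * De)" using b0 a0 cD c D0 by (simp add: y_def g0_def field_simps)
    also have "... <= 16 * b * ((1 + oc) * t) / (a * c * De)" using b0 \<delta>(3) a0 c D0 by (intro divide_right_mono mult_left_mono) auto
    also have "... = t / (v * De)" using b0 o1 a0 c D0 by (simp add: v_def field_simps)
    also have "... <= t / (s * De)"
    using t s v D0 sv by (intro divide_left_mono mult_right_mono mult_pos_pos) auto
    finally have "2 * y * ln gam <= t / (s * De) * ln gam" using lg by (intro mult_right_mono) auto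
    moreover have "(1 + 2 * y) * (A4 * (real K * De)) <= 2 * (A4 * (real K * De))"
    using y A4 K1 D0 by (intro mult_right_mono mult_nonneg_nonneg) auto
    ultimately show ?thesis by linarith
   qed
   finally have X: "X <= ln gam + t / (s * De) * ln gam + 2 * (A4 * (real K * De))" .
   have KM: "real K * (M * De) = 2 * (A4 * (real K * De)) + real K * De" by (simp add: A4(2) algebra_simps)
   have "?J' - ?J <= ereal X - ereal (ln gam - De)"
    by (rule ereal_minus_mono[OF delay_S' delay_S])
   also have "... = ereal (X - (ln gam - De))" by simp
   also have "... <= ereal (t / (s * De) * ln gam + real K * (M * De))" using X KM KD by simp
   also have "... = \<theta> / ereal (s * De) * ereal (ln gam) + ereal (real K * (M * De))" using real s D0 by simp
   finally show "?J' - ?J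
    <= \<theta> / ereal (s * De) * ereal (ln gam) + ereal (real K * (M * De))" .
  qed
 qed
qed

theorem theorem2:
  fixes a b c C :: real
  assumes "0 < a" and "a \<le> b" and "0 < c" and "c \<le> C"
  shows "\<exists>m M. 0 < m \<and> m \<le> M \<and>
    (\<forall>(K::nat) (P :: enat \<Rightarrow> 'a measure) (\<xi> :: nat \<Rightarrow> nat \<Rightarrow> 'a \<Rightarrow> real) (u :: nat \<Rightarrow> nat \<Rightarrow> 'a \<Rightarrow> real)
        (lo :: nat \<Rightarrow> real \<Rightarrow> real) (up :: nat \<Rightarrow> real \<Rightarrow> real).
      sensor_system K P \<xi> u \<longrightarrow>
      (\<forall>k\<in>{1..K}. integrable (P 0) (\<lambda>\<omega>. (u k 1 \<omega>)\<^sup>2)) \<longrightarrow>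
      (\<forall>k\<in>{1..K}. (\<integral>\<omega>. u k 1 \<omega> \<partial>P 0) \<in> {a..b} \<and> - (\<integral>\<omega>. u k 1 \<omega> \<partial>P \<infinity>) \<in> {a..b} \<and>
                   (\<integral>\<omega>. (u k 1 \<omega>)\<^sup>2 \<partial>P 0) \<le> b) \<longrightarrow>
      (\<forall>k\<in>{1..K}. (\<forall>\<Delta>>0. 0 < lo k \<Delta> \<and> 0 < up k \<Delta>) \<and>
                   exact_order c C (lo k) (\<lambda>\<Delta>. \<Delta>) \<and> exact_order c C (up k) (\<lambda>\<Delta>. \<Delta>)) \<longrightarrow>
      (\<exists>(g1 :: real \<Rightarrow> real) (g2 :: real \<Rightarrow> real) (\<alpha> :: nat \<Rightarrow> real \<Rightarrow> real) (\<beta> :: nat \<Rightarrow> real \<Rightarrow> real).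
        exact_order m M g1 (\<lambda>\<Delta>. \<Delta>) \<and> exact_order m M g2 (\<lambda>\<Delta>. \<Delta>) \<and>
        (\<forall>k\<in>{1..K}. exact_order m M (\<alpha> k) (\<lambda>_. 1) \<and> exact_order m M (\<beta> k) (\<lambda>_. 1)) \<and>
        (\<forall>\<^sub>F \<Delta> in at_top.
          \<forall>(d::nat) (el :: nat \<Rightarrow> nat \<Rightarrow> ereal) (eu :: nat \<Rightarrow> nat \<Rightarrow> ereal) (\<gamma>::real) (\<nu>::real) (\<nu>'::real).
            let S = cusum K u \<nu>;
                S' = dcusum K P u (\<lambda>k. lo k \<Delta>) (\<lambda>k. up k \<Delta>) d el eu \<nu>';
                \<theta> = Max ((\<lambda>k. quantization_error (P 0) (P \<infinity>) (u k 1) (\<alpha> k \<Delta>) (\<beta> k \<Delta>) d (el k) (eu k)) ` {1..K})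
            in
              1 \<le> d \<longrightarrow>
              (\<forall>k\<in>{1..K}. quantile_levels (P 0) (P \<infinity>) (u k) (lo k \<Delta>) (up k \<Delta>) d (el k) (eu k)) \<longrightarrow>
              0 < \<gamma> \<longrightarrow>
              (\<integral>\<omega>. - stopped (sensor_sum K u \<omega>) (S \<omega>) \<partial>P \<infinity>) = \<gamma> \<longrightarrow>
              (\<integral>\<omega>. - stopped (sensor_sum K u \<omega>) (S' \<omega>) \<partial>P \<infinity>) = \<gamma> \<longrightarrow>
              detection_delay K P \<xi> u S' - detection_delay K P \<xi> u S
                \<le> \<theta> / ereal (g1 \<Delta>) * ereal (ln \<gamma>) + ereal (real K * g2 \<Delta>))))"
proof -
 have b: "0 < b" and C: "0 < C" using assms by linarith+
 have oc: "0 < overshoot_const a b" using assms b by (intro overshoot_const_pos)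
 define m where "m = delay_slope a b c"
 define M where "M = delay_offset a b C"
 have m: "0 < m" "m <= 1" using assms b oc by (auto simp: m_def delay_slope_def)
 have M: "1 <= M"
 proof -
  have "0 <= 2 * (4 * C + 1 + (2 * C + 1 + b * (4 * C / a + 2) + 2 * (a / 4 * (4 * C / a + 2) + 1)))"
   using assms b C by (intro mult_nonneg_nonneg add_nonneg_nonneg divide_nonneg_nonneg) auto
  then show ?thesis unfolding M_def delay_offset_def by linarith
 qed
 have lin: "exact_order m M (%De. r * De) (%De. De)" if "m <= r" "r <= M" for r
  unfolding exact_order_def using eventually_ge_at_top[of "0::real"]
  by (rule eventually_mono) (use that in \<open>auto intro!: mult_right_mono\<close>)
 have one: "exact_order m M (%_. 1) (%_. 1)" unfolding exact_order_def using m M by simp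
 show ?thesis
 proof (rule exI[of _ m], rule exI[of _ M], intro conjI allI impI, goal_cases)
  case (3 K P \<xi> u lo up)
  interpret L: llr_system K P \<xi> u a b
   by (intro llr_system.intro 3(1) llr_system_axioms.intro) (use 3(2,3) assms in auto)
  have ev: "\<forall>\<^sub>F De in at_top. ALL k:{1..K}. c * De <= lo k De & lo k De <= C * De & c * De <= up k De & up k De <= C * De"
  proof (intro eventually_ball_finite ballI)
   fix k assume "k : {1..K}"
   then have "exact_order c C (lo k) (%De. De)" "exact_order c C (up k) (%De. De)" using 3(4) by auto
   then show "\<forall>\<^sub>F De in at_top. c * De <= lo k De & lo k De <= C * De & c * De <= up k De & up k De <= C * De"
    unfolding exact_order_def by (rule eventually_elim2) auto
  qed simp
  have main: "\<forall>\<^sub>F De in at_top. ALL (d::nat) (el :: nat => nat => ereal) (eu :: nat => nat => ereal) (gam::real) (nu::real) (nu'::real).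
   let S = cusum K u nu; S' = dcusum K P u (%k. lo k De) (%k. up k De) d el eu nu';
    \<theta> = Max ((%k. quantization_error (P 0) (P \<infinity>) (u k 1) 1 1 d (el k) (eu k)) ` {1..K})
   in 1 <= d --> (ALL k:{1..K}. quantile_levels (P 0) (P \<infinity>) (u k) (lo k De) (up k De) d (el k) (eu k)) --> 0 < gam -->
    (\<integral>om. - stopped (sensor_sum K u om) (S om) \<partial>P \<infinity>) = gam --> (\<integral>om. - stopped (sensor_sum K u om) (S' om) \<partial>P \<infinity>) = gam -->
    detection_delay K P \<xi> u S' - detection_delay K P \<xi> u S <= \<theta> / ereal (m * De) * ereal (ln gam) + ereal (real K * (M * De))"
  proof (rule eventually_elim2[OF L.eventually_delay_difference[OF assms(3,4)] eventually_conj[OF ev eventually_gt_at_top[of "0::real"]]], unfold Let_def, intro allI impI, goal_cases)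
   case (1 De d el eu gam nu nu')
   have "dcusum_system K P \<xi> u a b (%k. lo k De) (%k. up k De) d el eu"
    by (intro dcusum_system.intro threshold_system.intro dcusum_system_axioms.intro threshold_system_axioms.intro L.llr_system_axioms)
    (use 3(4) 1 in auto)
   from 1(1)[rule_format, OF _ this 1(5-7)] 1(2) show ?case unfolding m_def M_def by blast
  qed
  show ?case
   by (rule exI[of _ "%De. m * De"], rule exI[of _ "%De. M * De"], rule exI[of _ "%_ _. 1"], rule exI[of _ "%_ _. 1"])
    (intro conjI ballI one lin main, use m M in auto)
 qed (use m M in auto)
qed

end
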